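(* Consider the learning problem $F_\lambda=(\mathcal X_\lambda,\mathcal Y_\lambda,\mathcal D_\lambda,\mathcal H_\lambda)$ defined in the context. There is an efficient (polynomial-time) learner, with sample complexity $0$, that outputs a model with no parameter and $\mathrm{negl}(\lambda)$-robustly learns $F_\lambda$ against computationally bounded (polynomial-time) adversaries of budget $(1-\sqrt R)n$ in Hamming distance over $\mathbb F_{2^\ell}$. Here $\mathrm{negl}(\lambda)$ denotes a negligible function of $\lambda$.
   Context: **Learning.** A family of learning problems is $\{F_\lambda=(\mathcal X_\lambda,\mathcal Y_\lambda,\mathcal D_\lambda,\mathcal H_\lambda)\}_{\lambda\in\mathbb N}$, where $\mathcal H_\lambda$ is a set of functions $\mathcal X_\lambda\to\mathcal Y_\lambda$ and $\mathcal D_\lambda$ is a set of distributions supported on $\mathcal X_\lambda$; elements of $\mathcal X_\lambda,\mathcal Y_\lambda$ are represented with $\mathrm{poly}(\lambda)$ bits. A learner $L$ takes a labeled set $\mathcal S^h=\{(x,h(x)):x\in\mathcal S\}$ and $\lambda$, and outputs a function $f$ (not necessarily in $\mathcal H_\lambda$). For a metric $d$, budget $r$ and an oracle-aided adversary $A_\lambda$ (with access to a sampler for $D$), let $$\mathrm{Risk}_{d,r,A_\lambda}(h,D,f)=\Pr_{x\leftarrow D,\ x'\leftarrow A_\lambda^{D}(x,h(x),f)}\big[f(x')\neq h(x)\ \text{and}\ d(x,x')\le r\big].$$ $L$ $\varepsilon$-robustly learns the family against polynomial-time adversaries of budget $r$ with respect to $d$ if for any family $\{A_\lambda^{(\cdot)}\}_{\lambda\in\mathbb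 N}$ of $\mathrm{poly}(\lambda)$-time oracle-aided adversaries, for all $\lambda\in\mathbb N$, $D_\lambda\in\mathcal D_\lambda$, $h\in\mathcal H_\lambda$ and sample sizes $N\in\mathbb N$, $$\mathbf E_{\mathcal S\leftarrow D_\lambda^N,\ f\leftarrow L(\mathcal S^h,\lambda)}[\mathrm{Risk}_{d,r,A_\lambda}(h,D_\lambda,f)]\le\varepsilon(\lambda,N).$$ $L$ outputs models with at most $p(\cdot)$ bits of parameters if the set of possible outputs of $L(\cdot,\lambda)$ has size at most $2^{p(\lambda)}$ for all $\lambda$. $L$ runs in polynomial time (is efficient) if there is a polynomial $\mathrm{poly}$ such that for all $\lambda$ and all labeled sets $\mathcal S$ the running time of $L(\mathcal S,\lambda)$ is at most $\mathrm{poly}(|\mathcal S|\cdot\lambda)$. A function of $\lambda$ is negligible if for every polynomial $p$ it is smaller than $1/p(\lambda)$ for all sufficiently large $\lambda$. **Building blocks.** The parameters $n<\lambda<\alpha$ are given, with $n,\alpha$ polynomial in $\lambda$. The min-entropy of $X$ is $H_\infty(X)=-\log_2\max_\omega\Pr[X=\omega]$. $U_r$ is the uniform distribution on $\{0,1\}^r$. For a vector $x$ and a set $\mathcal S$ of coordinates, $x|_{\mathcal S}$ is the restriction of $x$ to $\mathcal S$. - $(\mathsf{Gen},\mathsf{Sign},\mathsf{Verify})$ is a signature scheme: the randomized algorithm $\mathsf{Gen}(1^\lambda)$ outputs a verification key and a signing key $(\mathsf{vk},\mathsf{sk})$; $\mathsf{Sign}(\mathsf{sk},m)$ outputs a signature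 $\sigma$; $\mathsf{Verify}(\mathsf{vk},m,\sigma)$ outputs a bit ($1$ meaning accept). Correctness: for every message $m$, $\Pr[\mathsf{Verify}(\mathsf{vk},m,\sigma)=1]=1$ for $(\mathsf{vk},\mathsf{sk})\leftarrow\mathsf{Gen}(1^\lambda)$, $\sigma=\mathsf{Sign}(\mathsf{sk},m)$. Weak unforgeability: for any probabilistic polynomial-time algorithm $B$ and message $m$, the probability that $m'\ne m$ and $\mathsf{Verify}(\mathsf{vk},m',\sigma')=1$, for $(\mathsf{vk},\mathsf{sk})\leftarrow\mathsf{Gen}(1^\lambda)$, $\sigma=\mathsf{Sign}(\mathsf{sk},m)$, $(m',\sigma')\leftarrow B(\mathsf{vk},m,\sigma)$, is negligible in $\lambda$. - $\mathrm{LEnc}:\mathbb F_{2^\ell}^k\to\mathbb F_{2^\ell}^n$ is the Reed–Solomon (RS) encoding over $\mathbb F_{2^\ell}$, for some $\ell=\Theta(\log\lambda)$: the message gives the coefficients of a polynomial of degree at most $k-1$, and the codeword is its list of values at $n$ fixed distinct field elements. The rate $R=k/n$ is any constant $<1/4$, and $k$ is determined by $R$ and $n$. - Sampler fact: for any $0<\kappa_1,\kappa_2<1$ and $M,t\in\mathbb N$ there is a deterministic sampler $\mathsf{samp}:\{0,1\}^r\to\binom{\{1,\dots,M\}}{t}$ (values are subsets of size $t$) with $r=\Theta(M^{\kappa_2})$ such that, if $X$ is a random variable over $\{0,1\}^M$ with min-entropy $\ge\mu M$, there is a random variable $Y$ over $\{0,1\}^t$ with min-entropy $\ge(\mu-\kappa_1)t$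 such that the statistical distance between $(U_r,X|_{\mathsf{samp}(U_r)})$ and $(U_r,Y)$ is at most $\exp(-\Theta(M\kappa_1))+\exp(-M^{\kappa_2})$ (the two $U_r$ in the first pair are the same sample). Let $\mathsf{samp}:\{0,1\}^r\to\binom{\{1,\dots,\alpha\}}{n}$ be a sampler given by this fact with sufficiently small $\kappa_1$ and $\kappa_2$ (for instance, $\kappa_1=\Theta(1/\log\lambda)$ and $\kappa_2$ any small constant suffices). - For a binary string $v$, $[v]$ is an arbitrary error-correcting encoding of $v$ over $\mathbb F_{2^\ell}$ that can correct more than $(1-\sqrt R)n$ errors (e.g. an RS encoding of suitable rate). **The learning problem.** $\mathcal Y_\lambda=\{0,1\}$. $\mathcal D_\lambda=\{D_s:s\in\{0,1\}^\alpha\}$, where $D_s$ is the distribution of $$x=\big([u],\,[v],\,[\mathsf{vk}],\,\mathrm{LEnc}(b,\mathsf{Sign}(\mathsf{sk},b)),\,[\,b+\langle v,s|_{\mathsf{samp}(u)}\rangle\,]\big)$$ with $u$, $v$, $b$ sampled uniformly from $\{0,1\}^r$, $\{0,1\}^n$, $\{0,1\}$ respectively and $(\mathsf{vk},\mathsf{sk})\leftarrow\mathsf{Gen}(1^\lambda)$ (fresh for every instance); $(b,\mathsf{Sign}(\mathsf{sk},b))$ is interpreted as a vector in $\mathbb F_{2^\ell}^k$ in the natural way, and $b+\langle v,s|_{\mathsf{samp}(u)}\rangle$ is computed over $\mathbb F_2$. $\mathcal X_\lambda$ is the set of binary strings of the length implicitly defined by $\mathcal D_\lambda$. $\mathcal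 H_\lambda$ consists of the single function $h$ which, on input $x$, decodes $\mathrm{LEnc}(b,\mathsf{Sign}(\mathsf{sk},b))$ and outputs $b$. Adversary: the entire input $x$ is interpreted as a vector over $\mathbb F_{2^\ell}$, and the adversary may perturb at most $(1-\sqrt R)n$ symbols; that is, $d$ is Hamming distance over $\mathbb F_{2^\ell}$ and the budget is $(1-\sqrt R)n$.
   Formalization: The negligible bound may depend on the adversary family (one bound for all families would cover unbounded forgers and fails), and weak unforgeability is assumed against non-uniform polynomial-size forgers, matching the adversary families. *)

theory Defs
  imports
    "HOL-Probability.Probability"
    "HOL-Algebra.Ring"
    "HOL-Computational_Algebra.Polynomial"
    "HOL-Library.Landau_Symbols"
begin

section \<open>Machine model\<close>

text \<open>
  Time is measured on Jones's WHILE language over binary trees, extended by a coin flip and by a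
  command that draws one fresh sample from an oracle distribution. Every executed command costs one
  step. Trees can only be built and taken apart one constructor at a time and tested against the
  atom, so they can be represented by pointers and step counts agree with Turing machine time up to
  a polynomial. The size of an expression is not charged at run time: it is part of the size of the
  program, which is constant for a single algorithm and has to be polynomial for a family.
\<close>

datatype data = Atom | Pair data data

primrec data_size :: "data \<Rightarrow> nat" where
  "data_size Atom = 1"
| "data_size (Pair a b) = Suc (data_size a + data_size b)"

fun data_fst :: "data \<Rightarrow> data" where
  "data_fst Atom = Atom"
| "data_fst (Pair a b) = a"

fun data_snd :: "data \<Rightarrow> data" where
  "data_snd Atom = Atom"
| "data_snd (Pair a b) = b"

datatype expr = Var nat | Quote data | Fst expr | Snd expr | Mk expr expr

datatype com =
    Assign nat expr
  | Flip nat
  | Sample nat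
  | Seq com com
  | Cond expr com com
  | While expr com

type_synonym store = "nat \<Rightarrow> data"

primrec eval_expr :: "expr \<Rightarrow> store \<Rightarrow> data" where
  "eval_expr (Var i) s = s i"
| "eval_expr (Quote a) s = a"
| "eval_expr (Fst e) s = data_fst (eval_expr e s)"
| "eval_expr (Snd e) s = data_snd (eval_expr e s)"
| "eval_expr (Mk e e') s = Pair (eval_expr e s) (eval_expr e' s)"

primrec expr_size :: "expr \<Rightarrow> nat" where
  "expr_size (Var i) = 1"
| "expr_size (Quote a) = Suc (data_size a)"
| "expr_size (Fst e) = Suc (expr_size e)"
| "expr_size (Snd e) = Suc (expr_size e)"
| "expr_size (Mk e e') = Suc (expr_size e + expr_size e')"

primrec com_size :: "com \<Rightarrow> nat" where
  "com_size (Assign i e) = Suc (expr_size e)"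
| "com_size (Flip i) = 1"
| "com_size (Sample i) = 1"
| "com_size (Seq c c') = Suc (com_size c + com_size c')"
| "com_size (Cond e c c') = Suc (expr_size e + com_size c + com_size c')"
| "com_size (While e c) = Suc (expr_size e + com_size c)"

fun enc_bool :: "bool \<Rightarrow> data" where
  "enc_bool False = Atom"
| "enc_bool True = Pair Atom Atom"

text \<open>
  A configuration is the list of commands still to be executed, together with a store. The atom
  plays the role of the truth value false.
\<close>

fun step :: "data pmf \<Rightarrow> com list \<times> store \<Rightarrow> (com list \<times> store) pmf" where
  "step orc ([], s) = return_pmf ([], s)"
| "step orc (Assign i e # cs, s) = return_pmf (cs, s(i := eval_expr e s))"
| "step orc (Flip i # cs, s) = map_pmf (\<lambda>b. (cs, s(i := enc_bool b))) (bernoulli_pmf (1/2))"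
| "step orc (Sample i # cs, s) = map_pmf (\<lambda>a. (cs, s(i := a))) orc"
| "step orc (Seq c c' # cs, s) = return_pmf (c # c' # cs, s)"
| "step orc (Cond e c c' # cs, s) =
     return_pmf ((if eval_expr e s = Atom then c' else c) # cs, s)"
| "step orc (While e c # cs, s) =
     return_pmf (if eval_expr e s = Atom then cs else c # While e c # cs, s)"

primrec steps :: "data pmf \<Rightarrow> nat \<Rightarrow> com list \<times> store \<Rightarrow> (com list \<times> store) pmf" where
  "steps orc 0 cf = return_pmf cf"
| "steps orc (Suc t) cf = bind_pmf (step orc cf) (steps orc t)"

definition start :: "com \<Rightarrow> data \<Rightarrow> com list \<times> store" where
  "start c a = ([c], (\<lambda>_. Atom)(0 := a))"

text \<open>Worst-case running time at most \<open>t\<close>, over all coins and oracle answers.\<close>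

definition halts_in :: "data pmf \<Rightarrow> com \<Rightarrow> data \<Rightarrow> nat \<Rightarrow> bool" where
  "halts_in orc c a t \<longleftrightarrow> (\<forall>cf \<in> set_pmf (steps orc t (start c a)). fst cf = [])"

text \<open>The output distribution; meaningful for computations that halt in bounded time.\<close>

definition outcome :: "data pmf \<Rightarrow> com \<Rightarrow> data \<Rightarrow> data pmf" where
  "outcome orc c a =
     map_pmf (\<lambda>cf. snd cf 0) (steps orc (LEAST t. halts_in orc c a t) (start c a))"

definition no_oracle :: "data pmf" where
  "no_oracle = return_pmf Atom"

subsection \<open>Data representation\<close>

definition enc_list :: "('a \<Rightarrow> data) \<Rightarrow> 'a list \<Rightarrow> data" where
  "enc_list f xs = foldr (\<lambda>x a. Pair (f x) a) xs Atom"

abbreviation enc_bits :: "bool list \<Rightarrow> data" where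
  "enc_bits \<equiv> enc_list enc_bool"

text \<open>Numbers are written in unary; \<open>enc_nat lam\<close> is the usual input \<open>1\<close> to the power \<open>lam\<close>.\<close>

definition enc_nat :: "nat \<Rightarrow> data" where
  "enc_nat m = enc_bits (replicate m True)"

text \<open>Total, so that the output of an arbitrary adversary can be read as a bit string.\<close>

primrec dec_bits :: "data \<Rightarrow> bool list" where
  "dec_bits Atom = []"
| "dec_bits (Pair a b) = (a \<noteq> Atom) # dec_bits b"

lemma dec_enc_bits: "dec_bits (enc_bits w) = w"
proof (induction w)
  case (Cons b w)
  then show ?case by (cases b) (simp_all add: enc_list_def)
qed (simp add: enc_list_def)

subsection \<open>Polynomial time\<close>

text \<open>
  One randomized algorithm that, on the input encoding \<open>inp i\<close> with \<open>i \<in> I\<close>, has output distribution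
  \<open>F i\<close> and runs in time polynomial in the length of its input.
\<close>

definition ppt_computable :: "'i set \<Rightarrow> ('i \<Rightarrow> data) \<Rightarrow> ('i \<Rightarrow> data pmf) \<Rightarrow> bool" where
  "ppt_computable I inp F \<longleftrightarrow>
     (\<exists>c. \<exists>p :: nat poly. \<forall>i\<in>I.
        halts_in no_oracle c (inp i) (poly p (data_size (inp i))) \<and>
        outcome no_oracle c (inp i) = F i)"

definition poly_time_computable :: "'i set \<Rightarrow> ('i \<Rightarrow> data) \<Rightarrow> ('i \<Rightarrow> data) \<Rightarrow> bool" where
  "poly_time_computable I inp f \<longleftrightarrow> ppt_computable I inp (\<lambda>i. return_pmf (f i))"

text \<open>
  A family of programs, one for each value of the security parameter, of polynomial size and
  running time. \<open>I lam\<close> is the set of pairs of an oracle and an input on which the program with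
  index \<open>lam\<close> may be run. Without the bound on the size the members of such a family could contain
  lookup tables of superpolynomial size.
\<close>

definition poly_time_family :: "(nat \<Rightarrow> (data pmf \<times> data) set) \<Rightarrow> (nat \<Rightarrow> com) \<Rightarrow> bool" where
  "poly_time_family I A \<longleftrightarrow>
     (\<exists>p :: nat poly. \<forall>lam. com_size (A lam) \<le> poly p lam \<and>
        (\<forall>(orc, a) \<in> I lam. halts_in orc (A lam) a (poly p lam)))"

definition negligible :: "(nat \<Rightarrow> real) \<Rightarrow> bool" where
  "negligible \<nu> \<longleftrightarrow>
     (\<forall>p :: real poly. (\<forall>\<^sub>F lam in sequentially. 0 < poly p (real lam)) \<longrightarrow>
        (\<forall>\<^sub>F lam in sequentially. \<nu> lam < 1 / poly p (real lam)))"

section \<open>Robust learning\<close>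

text \<open>Instances are bit strings; labels have type \<^typ>\<open>bool\<close>, that is, the label set is \<open>{0,1}\<close>.\<close>

record learning_problem =
  instances :: "nat \<Rightarrow> bool list set"
  dists :: "nat \<Rightarrow> bool list pmf set"
  concepts :: "nat \<Rightarrow> (bool list \<Rightarrow> bool) set"

text \<open>
  The training algorithm outputs (the parameters of) a model, which is a piece of data;
  \<open>model_fun L lam \<theta>\<close> is the function that the output \<open>\<theta>\<close> stands for.
\<close>

record learner =
  train :: com
  model_fun :: "nat \<Rightarrow> data \<Rightarrow> bool list \<Rightarrow> bool"

definition labeled :: "(bool list \<Rightarrow> bool) \<Rightarrow> bool list list \<Rightarrow> (bool list \<times> bool) list" where
  "labeled h xs = map (\<lambda>x. (x, h x)) xs"

definition train_input :: "(bool list \<times> bool) list \<Rightarrow> nat \<Rightarrow> data" where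
  "train_input S lam = Pair (enc_list (\<lambda>(x, y). Pair (enc_bits x) (enc_bool y)) S) (enc_nat lam)"

definition train_out :: "learner \<Rightarrow> (bool list \<times> bool) list \<Rightarrow> nat \<Rightarrow> data pmf" where
  "train_out L S lam = outcome no_oracle (train L) (train_input S lam)"

definition labeled_sets :: "learning_problem \<Rightarrow> nat \<Rightarrow> (bool list \<times> bool) list set" where
  "labeled_sets F lam = {S. fst ` set S \<subseteq> instances F lam}"

definition possible_outputs :: "learning_problem \<Rightarrow> learner \<Rightarrow> nat \<Rightarrow> data set" where
  "possible_outputs F L lam = (\<Union>S \<in> labeled_sets F lam. set_pmf (train_out L S lam))"

definition outputs_models_with_params ::
  "learning_problem \<Rightarrow> learner \<Rightarrow> (nat \<Rightarrow> nat) \<Rightarrow> bool" where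
  "outputs_models_with_params F L p \<longleftrightarrow>
     (\<forall>lam. finite (possible_outputs F L lam) \<and> card (possible_outputs F L lam) \<le> 2 ^ p lam)"

text \<open>
  Training time is polynomial in the number of samples times \<open>lam\<close>. The second conjunct says that
  the output data really represent functions: one polynomial-time algorithm evaluates all of them.
\<close>

definition efficient_learner :: "learning_problem \<Rightarrow> learner \<Rightarrow> bool" where
  "efficient_learner F L \<longleftrightarrow>
     (\<exists>p :: nat poly. \<forall>lam. \<forall>S \<in> labeled_sets F lam.
        halts_in no_oracle (train L) (train_input S lam) (poly p (length S * lam))) \<and>
     poly_time_computable
       {(lam, \<theta>, x). \<theta> \<in> possible_outputs F L lam \<and> x \<in> instances F lam}
       (\<lambda>(lam, \<theta>, x). Pair (enc_nat lam) (Pair \<theta> (enc_bits x)))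
       (\<lambda>(lam, \<theta>, x). enc_bool (model_fun L lam \<theta> x))"

definition adversary_input :: "bool list \<Rightarrow> bool \<Rightarrow> data \<Rightarrow> data" where
  "adversary_input x y \<theta> = Pair (enc_bits x) (Pair (enc_bool y) \<theta>)"

definition sampling_oracle :: "bool list pmf \<Rightarrow> data pmf" where
  "sampling_oracle D = map_pmf enc_bits D"

definition adversary_family :: "learning_problem \<Rightarrow> learner \<Rightarrow> (nat \<Rightarrow> com) \<Rightarrow> bool" where
  "adversary_family F L A \<longleftrightarrow>
     poly_time_family
       (\<lambda>lam. {(sampling_oracle D, adversary_input x y \<theta>) | D x y \<theta>.
          D \<in> dists F lam \<and> x \<in> instances F lam \<and> \<theta> \<in> possible_outputs F L lam}) A"

definition risk ::
  "learning_problem \<Rightarrow> learner \<Rightarrow> (nat \<Rightarrow> bool list \<Rightarrow> bool list \<Rightarrow> real) \<Rightarrow> (nat \<Rightarrow> real) \<Rightarrow>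
   (nat \<Rightarrow> com) \<Rightarrow> nat \<Rightarrow> (bool list \<Rightarrow> bool) \<Rightarrow> bool list pmf \<Rightarrow> data \<Rightarrow> real" where
  "risk F L d r A lam h D \<theta> =
     measure_pmf.prob
       (do {
          x \<leftarrow> D;
          out \<leftarrow> outcome (sampling_oracle D) (A lam) (adversary_input x (h x) \<theta>);
          return_pmf (x, dec_bits out)
        })
       {(x, x'). x' \<in> instances F lam \<and> model_fun L lam \<theta> x' \<noteq> h x \<and> d lam x x' \<le> r lam}"

definition robust_against ::
  "learning_problem \<Rightarrow> learner \<Rightarrow> (nat \<Rightarrow> bool list \<Rightarrow> bool list \<Rightarrow> real) \<Rightarrow> (nat \<Rightarrow> real) \<Rightarrow>
   (nat \<Rightarrow> com) \<Rightarrow> (nat \<Rightarrow> nat \<Rightarrow> real) \<Rightarrow> bool" where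
  "robust_against F L d r A \<epsilon> \<longleftrightarrow>
     (\<forall>lam. \<forall>D \<in> dists F lam. \<forall>h \<in> concepts F lam. \<forall>N.
        measure_pmf.expectation
          (bind_pmf (replicate_pmf N D) (\<lambda>xs. train_out L (labeled h xs) lam))
          (\<lambda>\<theta>. risk F L d r A lam h D \<theta>)
        \<le> \<epsilon> lam N)"

text \<open>
  The error is independent of the sample size \<open>N\<close>, so the bound holds in particular for \<open>N = 0\<close>. As
  usual for asymptotic security, the negligible function may depend on the adversary family (but on
  nothing else): a bound common to all families would be a bound against unbounded adversaries,
  since every program is the member with index \<open>lam\<close> of some polynomial-time family.
\<close>

definition negl_robustly_learns_without_samples ::
  "learning_problem \<Rightarrow> learner \<Rightarrow> (nat \<Rightarrow> bool list \<Rightarrow> bool list \<Rightarrow> real) \<Rightarrow> (nat \<Rightarrow> real) \<Rightarrow> bool" where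
  "negl_robustly_learns_without_samples F L d r \<longleftrightarrow>
     (\<forall>A. adversary_family F L A \<longrightarrow>
        (\<exists>\<nu>. negligible \<nu> \<and> robust_against F L d r A (\<lambda>lam N. \<nu> lam)))"

section \<open>Building blocks\<close>

subsection \<open>Signatures\<close>

text \<open>Polynomial-time algorithms with perfect correctness; messages are arbitrary bit strings.\<close>

definition signature_scheme ::
  "(nat \<Rightarrow> (bool list \<times> bool list) pmf) \<Rightarrow> (bool list \<Rightarrow> bool list \<Rightarrow> bool list) \<Rightarrow>
   (bool list \<Rightarrow> bool list \<Rightarrow> bool list \<Rightarrow> bool) \<Rightarrow> bool" where
  "signature_scheme gen sig verify \<longleftrightarrow>
     ppt_computable UNIV enc_nat
       (\<lambda>lam. map_pmf (\<lambda>(vk, sk). Pair (enc_bits vk) (enc_bits sk)) (gen lam)) \<and>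
     poly_time_computable UNIV
       (\<lambda>(sk, m). Pair (enc_bits sk) (enc_bits m)) (\<lambda>(sk, m). enc_bits (sig sk m)) \<and>
     poly_time_computable UNIV
       (\<lambda>(vk, m, \<sigma>). Pair (enc_bits vk) (Pair (enc_bits m) (enc_bits \<sigma>)))
       (\<lambda>(vk, m, \<sigma>). enc_bool (verify vk m \<sigma>)) \<and>
     (\<forall>lam m. measure_pmf.prob (gen lam) {(vk, sk). verify vk m (sig sk m)} = 1)"

definition forger_input :: "bool list \<Rightarrow> bool list \<Rightarrow> bool list \<Rightarrow> data" where
  "forger_input vk m \<sigma> = Pair (enc_bits vk) (Pair (enc_bits m) (enc_bits \<sigma>))"

text \<open>
  Forgers are families of polynomial-time programs, exactly like the adversaries against a learner.
  Security against a single uniform program would not match those: a family of adversaries, and the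
  oracle for a distribution with an arbitrary secret, both carry advice that depends on \<open>lam\<close>.
\<close>

definition weakly_unforgeable ::
  "(nat \<Rightarrow> (bool list \<times> bool list) pmf) \<Rightarrow> (bool list \<Rightarrow> bool list \<Rightarrow> bool list) \<Rightarrow>
   (bool list \<Rightarrow> bool list \<Rightarrow> bool list \<Rightarrow> bool) \<Rightarrow> bool" where
  "weakly_unforgeable gen sig verify \<longleftrightarrow>
     (\<forall>B m.
        poly_time_family
          (\<lambda>lam. {(no_oracle, forger_input vk m (sig sk m)) | vk sk. (vk, sk) \<in> set_pmf (gen lam)}) B
        \<longrightarrow> negligible (\<lambda>lam.
          measure_pmf.prob
            (do {
               (vk, sk) \<leftarrow> gen lam;
               out \<leftarrow> outcome no_oracle (B lam) (forger_input vk m (sig sk m));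
               return_pmf (vk, dec_bits (data_fst out), dec_bits (data_snd out))
             })
            {(vk, m', \<sigma>'). m' \<noteq> m \<and> verify vk m' \<sigma>'}))"

subsection \<open>Bit strings and the averaging sampler\<close>

definition bitstrings :: "nat \<Rightarrow> bool list set" where
  "bitstrings m = {w. length w = m}"

definition uniform_bits :: "nat \<Rightarrow> bool list pmf" where
  "uniform_bits m = pmf_of_set (bitstrings m)"

text \<open>Coordinates are numbered from 1.\<close>

definition restrict_bits :: "bool list \<Rightarrow> nat set \<Rightarrow> bool list" where
  "restrict_bits x T = nths x {i. Suc i \<in> T}"

definition inner_F2 :: "bool list \<Rightarrow> bool list \<Rightarrow> bool" where
  "inner_F2 v w \<longleftrightarrow> odd (card {i. i < min (length v) (length w) \<and> v ! i \<and> w ! i})"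

definition min_entropy :: "'a pmf \<Rightarrow> real" where
  "min_entropy X = - log 2 (SUP \<omega>. pmf X \<omega>)"

definition stat_dist :: "'a pmf \<Rightarrow> 'a pmf \<Rightarrow> real" where
  "stat_dist X Y = (SUP E. \<bar>measure_pmf.prob X E - measure_pmf.prob Y E\<bar>)"

text \<open>
  The sampler property for a family of functions from \<open>{0,1}^(r lam)\<close> to subsets of
  \<open>{1..M lam}\<close> of size \<open>t lam\<close>. The constant \<open>C\<close> is the one hidden in the first exponent.
\<close>

definition sampler_family ::
  "nat \<Rightarrow> (nat \<Rightarrow> nat) \<Rightarrow> (nat \<Rightarrow> nat) \<Rightarrow> (nat \<Rightarrow> nat) \<Rightarrow> (nat \<Rightarrow> real) \<Rightarrow> real \<Rightarrow>
   (nat \<Rightarrow> bool list \<Rightarrow> nat set) \<Rightarrow> bool" where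
  "sampler_family lam0 M t r \<kappa>1 \<kappa>2 samp \<longleftrightarrow>
     (\<forall>lam\<ge>lam0. \<forall>u \<in> bitstrings (r lam). samp lam u \<subseteq> {1..M lam} \<and> card (samp lam u) = t lam) \<and>
     (\<lambda>lam. real (r lam)) \<in> \<Theta>(\<lambda>lam. real (M lam) powr \<kappa>2) \<and>
     (\<exists>C>0. \<forall>lam\<ge>lam0. \<forall>\<mu> X. set_pmf X \<subseteq> bitstrings (M lam) \<and> min_entropy X \<ge> \<mu> * M lam \<longrightarrow>
        (\<exists>Y. set_pmf Y \<subseteq> bitstrings (t lam) \<and> min_entropy Y \<ge> (\<mu> - \<kappa>1 lam) * t lam \<and>
           stat_dist
             (do { u \<leftarrow> uniform_bits (r lam); x \<leftarrow> X; return_pmf (u, restrict_bits x (samp lam u)) })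
             (pair_pmf (uniform_bits (r lam)) Y)
           \<le> exp (- C * M lam * \<kappa>1 lam) + exp (- (M lam powr \<kappa>2))))"

subsection \<open>Vectors over the field with \<open>2^l\<close> elements\<close>

text \<open>A field element is a string of \<open>l\<close> bits, and a vector over the field is a list of such strings.\<close>

definition hamming :: "'a list \<Rightarrow> 'a list \<Rightarrow> nat" where
  "hamming xs ys = card {i. i < length xs \<and> xs ! i \<noteq> ys ! i}"

definition symbols :: "nat \<Rightarrow> bool list \<Rightarrow> bool list list" where
  "symbols l x = map (\<lambda>i. take l (drop (i * l) x)) [0..<length x div l]"

lemma set_symbols: "set (symbols l x) \<subseteq> bitstrings l"
proof
  fix a assume "a \<in> set (symbols l x)"
  then obtain i where i: "i < length x div l" and a: "a = take l (drop (i * l) x)"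
    by (auto simp: symbols_def)
  have "Suc i * l \<le> length x div l * l" using i by (intro mult_le_mono1) simp
  also have "\<dots> \<le> length x" by simp
  finally show "a \<in> bitstrings l" by (simp add: a bitstrings_def)
qed

text \<open>A bit string read as a vector of \<open>k\<close> field elements, padded with zeros.\<close>

definition bits_to_vec :: "nat \<Rightarrow> nat \<Rightarrow> bool list \<Rightarrow> bool list list" where
  "bits_to_vec l k w = symbols l (w @ replicate (k * l - length w) False)"

text \<open>Reed--Solomon encoding of the coefficient vector \<open>cs\<close> with evaluation points \<open>as\<close>.\<close>

definition rs_encode ::
  "bool list ring \<Rightarrow> bool list list \<Rightarrow> bool list list \<Rightarrow> bool list list" where
  "rs_encode K as cs =
     map (\<lambda>a. \<Oplus>\<^bsub>K\<^esub>j\<in>{..<length cs}. cs ! j \<otimes>\<^bsub>K\<^esub> (a [^]\<^bsub>K\<^esub> j)) as"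

text \<open>
  An efficient error-correcting encoding \<open>enc lam v\<close> of arbitrary bit strings \<open>v\<close> over the alphabet
  of \<open>l lam\<close>-bit symbols, with code length depending only on the length of \<open>v\<close>, which corrects more
  than \<open>\<rho> lam\<close> errors.
\<close>

definition error_correcting ::
  "nat \<Rightarrow> (nat \<Rightarrow> nat) \<Rightarrow> (nat \<Rightarrow> real) \<Rightarrow> (nat \<Rightarrow> bool list \<Rightarrow> bool list list) \<Rightarrow> bool" where
  "error_correcting lam0 l \<rho> enc \<longleftrightarrow>
     (\<forall>lam\<ge>lam0. \<forall>v. set (enc lam v) \<subseteq> bitstrings (l lam)) \<and>
     (\<forall>lam v w. length v = length w \<longrightarrow> length (enc lam v) = length (enc lam w)) \<and>
     poly_time_computable {(lam, v). lam \<ge> lam0}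
       (\<lambda>(lam, v). Pair (enc_nat lam) (enc_bits v))
       (\<lambda>(lam, v). enc_list enc_bits (enc lam v)) \<and>
     (\<exists>(dec :: nat \<Rightarrow> nat \<Rightarrow> bool list list \<Rightarrow> bool list) (e :: nat \<Rightarrow> nat).
        (\<forall>lam\<ge>lam0. real (e lam) > \<rho> lam) \<and>
        (\<forall>lam\<ge>lam0. \<forall>v y. length y = length (enc lam v) \<and> set y \<subseteq> bitstrings (l lam) \<and>
           hamming (enc lam v) y \<le> e lam \<longrightarrow> dec lam (length v) y = v) \<and>
        poly_time_computable
          {(lam, m, y). lam \<ge> lam0 \<and> length y = length (enc lam (replicate m False)) \<and>
             set y \<subseteq> bitstrings (l lam)}
          (\<lambda>(lam, m, y). Pair (enc_nat lam) (Pair (enc_nat m) (enc_list enc_bits y)))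
          (\<lambda>(lam, m, y). enc_bits (dec lam m y)))"

section \<open>The learning problem\<close>

record setting =
  code_len :: "nat \<Rightarrow> nat"                                  \<comment> \<open>\<open>n\<close>\<close>
  code_dim :: "nat \<Rightarrow> nat"                                  \<comment> \<open>\<open>k\<close>\<close>
  secret_len :: "nat \<Rightarrow> nat"                                \<comment> \<open>\<open>\<alpha>\<close>\<close>
  seed_len :: "nat \<Rightarrow> nat"                                  \<comment> \<open>\<open>r\<close>\<close>
  sym_bits :: "nat \<Rightarrow> nat"                                  \<comment> \<open>\<open>l\<close>\<close>
  vk_len :: "nat \<Rightarrow> nat"
  sig_len :: "nat \<Rightarrow> nat"
  fld :: "nat \<Rightarrow> bool list ring"                            \<comment> \<open>the field with \<open>2^l\<close> elements\<close>
  eval_pts :: "nat \<Rightarrow> bool list list"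
  gen_of :: "nat \<Rightarrow> (bool list \<times> bool list) pmf"
  sign_of :: "bool list \<Rightarrow> bool list \<Rightarrow> bool list"
  verify_of :: "bool list \<Rightarrow> bool list \<Rightarrow> bool list \<Rightarrow> bool"
  samp_of :: "nat \<Rightarrow> bool list \<Rightarrow> nat set"
  ecc_of :: "nat \<Rightarrow> bool list \<Rightarrow> bool list list"           \<comment> \<open>\<open>[v]\<close>\<close>

text \<open>
  The constraints \<open>n < lam < \<alpha>\<close> and \<open>1 \<le> k = R n\<close> cannot hold for small \<open>lam\<close>, so all of them are
  required from some \<open>lam0\<close> on. Keys and signatures of bits have a fixed length, so that the instances
  have one, and the bit together with its signature fits into \<open>k\<close> symbols. Lengths, field operations
  and evaluation points are computable in time polynomial in \<open>lam\<close>.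
\<close>

definition valid_parameters :: "setting \<Rightarrow> real \<Rightarrow> nat \<Rightarrow> bool" where
  "valid_parameters P R lam0 \<longleftrightarrow>
     (\<forall>lam\<ge>lam0. code_len P lam < lam \<and> lam < secret_len P lam) \<and>
     (\<exists>p :: nat poly. \<forall>lam. code_len P lam \<le> poly p lam \<and> secret_len P lam \<le> poly p lam) \<and>
     (\<forall>lam\<ge>lam0. real (code_dim P lam) = R * real (code_len P lam)) \<and>
     (\<lambda>lam. real (sym_bits P lam)) \<in> \<Theta>(\<lambda>lam. ln (real lam)) \<and>
     (\<forall>lam\<ge>lam0. \<forall>(vk, sk) \<in> set_pmf (gen_of P lam). length vk = vk_len P lam \<and>
        (\<forall>b. length (sign_of P sk [b]) = sig_len P lam)) \<and>
     (\<forall>lam\<ge>lam0. 1 + sig_len P lam \<le> code_dim P lam * sym_bits P lam) \<and>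
     (\<forall>g \<in> {code_len P, code_dim P, seed_len P, sym_bits P, vk_len P, sig_len P}.
        poly_time_computable UNIV enc_nat (\<lambda>lam. enc_nat (g lam)))"

definition valid_field :: "setting \<Rightarrow> nat \<Rightarrow> bool" where
  "valid_field P lam0 \<longleftrightarrow>
     (\<forall>lam\<ge>lam0. field (fld P lam) \<and> carrier (fld P lam) = bitstrings (sym_bits P lam)) \<and>
     (\<forall>lam\<ge>lam0. distinct (eval_pts P lam) \<and> length (eval_pts P lam) = code_len P lam \<and>
        set (eval_pts P lam) \<subseteq> carrier (fld P lam)) \<and>
     poly_time_computable {lam. lam \<ge> lam0} enc_nat (\<lambda>lam. enc_list enc_bits (eval_pts P lam)) \<and>
     (\<forall>f \<in> {\<lambda>K x y. x \<oplus>\<^bsub>K\<^esub> y, \<lambda>K x y. x \<otimes>\<^bsub>K\<^esub> y}.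
        poly_time_computable
          {(lam, a, b). lam \<ge> lam0 \<and> a \<in> carrier (fld P lam) \<and> b \<in> carrier (fld P lam)}
          (\<lambda>(lam, a, b). Pair (enc_nat lam) (Pair (enc_bits a) (enc_bits b)))
          (\<lambda>(lam, a, b). enc_bits (f (fld P lam) a b)))"

definition LEnc :: "setting \<Rightarrow> nat \<Rightarrow> bool \<Rightarrow> bool list \<Rightarrow> bool list list" where
  "LEnc P lam b \<sigma> =
     rs_encode (fld P lam) (eval_pts P lam) (bits_to_vec (sym_bits P lam) (code_dim P lam) (b # \<sigma>))"

definition instance_dist :: "setting \<Rightarrow> nat \<Rightarrow> bool list \<Rightarrow> bool list pmf" where
  "instance_dist P lam s =
     do {
       u \<leftarrow> uniform_bits (seed_len P lam);
       v \<leftarrow> uniform_bits (code_len P lam);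
       b \<leftarrow> pmf_of_set (UNIV :: bool set);
       (vk, sk) \<leftarrow> gen_of P lam;
       return_pmf (concat
         (ecc_of P lam u @ ecc_of P lam v @ ecc_of P lam vk @
          LEnc P lam b (sign_of P sk [b]) @
          ecc_of P lam [b \<noteq> inner_F2 v (restrict_bits s (samp_of P lam u))]))
     }"

definition ecc_len :: "setting \<Rightarrow> nat \<Rightarrow> nat \<Rightarrow> nat" where
  "ecc_len P lam m = length (ecc_of P lam (replicate m False))"

definition instance_len :: "setting \<Rightarrow> nat \<Rightarrow> nat" where
  "instance_len P lam =
     sym_bits P lam *
       (ecc_len P lam (seed_len P lam) + ecc_len P lam (code_len P lam) +
        ecc_len P lam (vk_len P lam) + code_len P lam + ecc_len P lam 1)"

definition LEnc_part :: "setting \<Rightarrow> nat \<Rightarrow> bool list \<Rightarrow> bool list list" where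
  "LEnc_part P lam x =
     take (code_len P lam)
       (drop (ecc_len P lam (seed_len P lam) + ecc_len P lam (code_len P lam) +
              ecc_len P lam (vk_len P lam))
         (symbols (sym_bits P lam) x))"

text \<open>The encoded bit is unique because \<open>k \<le> n\<close>; \<open>SOME\<close> only matters outside the support of the instances.\<close>

definition true_label :: "setting \<Rightarrow> nat \<Rightarrow> bool list \<Rightarrow> bool" where
  "true_label P lam x =
     (SOME b. \<exists>\<sigma>. length \<sigma> = sig_len P lam \<and> LEnc_part P lam x = LEnc P lam b \<sigma>)"

definition the_problem :: "setting \<Rightarrow> learning_problem" where
  "the_problem P = \<lparr>
     instances = (\<lambda>lam. bitstrings (instance_len P lam)),
     dists = (\<lambda>lam. instance_dist P lam ` bitstrings (secret_len P lam)),
     concepts = (\<lambda>lam. {true_label P lam}) \<rparr>"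

text \<open>The distributions are indeed supported on the instances.\<close>

lemma instance_dist_supported:
  assumes "valid_parameters P R lam0" "valid_field P lam0"
    and "error_correcting lam0 (sym_bits P) \<rho> (ecc_of P)" and lam: "lam \<ge> lam0"
  shows "set_pmf (instance_dist P lam s) \<subseteq> instances (the_problem P) lam"
proof
  fix x assume "x \<in> set_pmf (instance_dist P lam s)"
  moreover have "finite (bitstrings m)" "bitstrings m \<noteq> {}" for m
    using finite_lists_length_eq[of "UNIV :: bool set" m] Ex_list_of_length[of m]
    by (auto simp: bitstrings_def)
  ultimately obtain u v b vk sk c where
    len: "length u = seed_len P lam" "length v = code_len P lam" and
    key: "(vk, sk) \<in> set_pmf (gen_of P lam)" and
    x: "x = concat (ecc_of P lam u @ ecc_of P lam v @ ecc_of P lam vk @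
          LEnc P lam b (sign_of P sk [b]) @ ecc_of P lam [c])"
    by (auto simp: instance_dist_def uniform_bits_def bitstrings_def)
  let ?K = "fld P lam"
  interpret K: field ?K using assms(2) lam by (auto simp: valid_field_def)
  have carr: "carrier ?K = bitstrings (sym_bits P lam)"
    using assms(2) lam by (auto simp: valid_field_def)
  have "\<forall>(vk, sk) \<in> set_pmf (gen_of P lam). length vk = vk_len P lam"
    and fits: "1 + sig_len P lam \<le> code_dim P lam * sym_bits P lam"
    using assms(1) lam by (auto simp: valid_parameters_def split_beta)
  then have vk: "length vk = vk_len P lam" using key by auto
  let ?cs = "bits_to_vec (sym_bits P lam) (code_dim P lam) (b # sign_of P sk [b])"
  have cs: "set ?cs \<subseteq> carrier ?K"
    unfolding bits_to_vec_def carr by (rule set_symbols)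
  have pts: "set (eval_pts P lam) \<subseteq> carrier ?K" "length (eval_pts P lam) = code_len P lam"
    using assms(2) lam by (auto simp: valid_field_def)
  have LE: "set (LEnc P lam b (sign_of P sk [b])) \<subseteq> bitstrings (sym_bits P lam)"
  proof -
    have "?cs ! j \<in> carrier ?K" if "j < length ?cs" for j
      using cs that nth_mem by blast
    then show ?thesis
      using pts unfolding LEnc_def rs_encode_def carr[symmetric]
      by (auto intro!: K.finsum_closed)
  qed
  have LE_len: "length (LEnc P lam b (sign_of P sk [b])) = code_len P lam"
    using pts by (simp add: LEnc_def rs_encode_def)
  have E: "set (ecc_of P lam w) \<subseteq> bitstrings (sym_bits P lam)" for w
    using assms(3) lam by (auto simp: error_correcting_def)
  have "length (ecc_of P lam w) = length (ecc_of P lam w')" if "length w = length w'" for w w'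
    using assms(3) that unfolding error_correcting_def by blast
  then have E_len: "length (ecc_of P lam w) = ecc_len P lam (length w)" for w
    unfolding ecc_len_def by (metis length_replicate)
  have concat_len: "length (concat ws) = l * length ws" if "set ws \<subseteq> bitstrings l" for ws l
    using that by (induction ws) (auto simp: bitstrings_def)
  have "length x = instance_len P lam"
    unfolding x by (subst concat_len[of _ "sym_bits P lam"])
      (use LE E in \<open>auto simp: LE_len E_len len vk instance_len_def\<close>)
  then show "x \<in> instances (the_problem P) lam"
    by (simp add: the_problem_def bitstrings_def)
qed

definition symbol_distance :: "setting \<Rightarrow> nat \<Rightarrow> bool list \<Rightarrow> bool list \<Rightarrow> real" where
  "symbol_distance P lam x x' =
     real (hamming (symbols (sym_bits P lam) x) (symbols (sym_bits P lam) x'))"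

definition budget :: "setting \<Rightarrow> real \<Rightarrow> nat \<Rightarrow> real" where
  "budget P R lam = (1 - sqrt R) * real (code_len P lam)"

end

theory Submission
  imports Defs "HOL-Algebra.Algebraic_Closure_Type" "HOL-Algebra.Multiplicative_Group" "HOL-Library.Z2"
begin

text \<open>
  The model decodes the verification key, list-decodes the Reed--Solomon part with the algorithm of
  Guruswami and Sudan, and outputs the first bit of a candidate that is a correctly signed bit. Within
  the budget the key is decoded correctly, and at least \<open>\<surd>(k n)\<close> symbols of the codeword survive, which
  is the list-decoding radius; so the original bit and its signature are among the candidates, and
  a wrong output contains a signature of the other bit. An adversary that causes wrong outputs
  is therefore turned into a forger, which plants the key and the signature that it is given in an
  instance. The forger cannot sample instances itself, since the secret and the sampler need not be
  computable; the answers of the sampling oracle and the random choices other than the key are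
  hard-coded in it, with the values that maximize its success.
\<close>

text \<open>The budget guarantees an agreement t with t^2 \<ge> k n and nothing more, so the
  interpolation must be tuned: with multiplicity k at every point, the count of monomials against
  constraints reduces to t (t + 1) against k n. Root finding is deterministic: since l is
  logarithmic in \<open>lam\<close>, the field has polynomially many elements, and a
  Roth-Ruckenstein search can try all of them at each level.

  Running time is the second obstacle. The machine shares subtrees, so a time bound does not bound
  sizes, and iterating a polynomial-time body is safe only with a size invariant for the
  accumulator. For the decoder such invariants are mathematical facts (a nonzero interpolant, at
  most t + 1 live branches), so its cost analysis rests on its correctness proof.

  Finally, unforgeability fixes the signed message before the key is drawn. There are therefore two
  forgers, one for each label, and the error is the sum of their success probabilities; for
  \<open>lam\<close> below \<open>lam0\<close>, where the parameters are unconstrained, the error is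
  set to 1.\<close>

hide_const (open) Module.smult Coset.order UnivPoly.up_ring.coeff UnivPoly.up_ring.monom Polynomials.degree

section \<open>Executions\<close>

lemma steps_halted [simp]: "steps orc t ([], s) = return_pmf ([], s)"
  by (induction t) (simp_all add: bind_return_pmf)

definition halted :: "(com list \<times> store) pmf \<Rightarrow> bool" where
  "halted M \<longleftrightarrow> (\<forall>cf\<in>set_pmf M. fst cf = [])"

lemma halted_bind: "halted (bind_pmf M f) \<longleftrightarrow> (\<forall>x\<in>set_pmf M. halted (f x))"
  by (auto simp: halted_def)

lemma halted_return [simp]: "halted (return_pmf cf) \<longleftrightarrow> fst cf = []"
  by (simp add: halted_def)

lemma steps_add: "steps orc (t + t') cf = bind_pmf (steps orc t cf) (steps orc t')"
  by (induction t arbitrary: cf) (simp_all add: bind_return_pmf bind_assoc_pmf cong: bind_pmf_cong)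

lemma steps_stable:
  assumes "halted (steps orc t cf)" "t \<le> t'"
  shows "steps orc t' cf = steps orc t cf"
proof -
  have "steps orc (t + (t' - t)) cf = bind_pmf (steps orc t cf) return_pmf"
    unfolding steps_add
    by (rule bind_pmf_cong[OF refl]) (use assms(1) in \<open>auto simp: halted_def prod_eq_iff\<close>)
  then show ?thesis using assms(2) by (simp add: bind_return_pmf')
qed

lemma step_append:
  "step orc (c # cs @ cs', s) = map_pmf (\<lambda>(r, s). (r @ cs', s)) (step orc (c # cs, s))"
  by (cases c) (auto simp: pmf.map_comp o_def)

text \<open>The bound t is a worst case, and different coin flips finish \<open>cs\<close> at
  different times. The second program must be halted after t' steps from every reachable store, so
  that a branch that finishes early can idle through its remaining steps.\<close>

lemma steps_append:
  assumes "halted (steps orc t (cs, s))"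
    and "\<And>s'. ([], s') \<in> set_pmf (steps orc t (cs, s)) \<Longrightarrow> halted (steps orc t' (cs', s'))"
  shows "steps orc (t + t') (cs @ cs', s) = bind_pmf (steps orc t (cs, s)) (\<lambda>cf. steps orc t' (cs', snd cf))"
  using assms
proof (induction t arbitrary: cs s)
  case 0
  then show ?case by (simp add: bind_return_pmf)
next
  case (Suc t)
  show ?case
  proof (cases cs)
    case Nil
    \<comment> \<open>The first program has ended ahead of its bound; the unspent steps are absorbed
      because the second one is already halted after t' steps.\<close>
    have "steps orc (Suc t + t') (cs', s) = steps orc t' (cs', s)"
      by (rule steps_stable) (use Suc.prems(2)[of s] Nil in \<open>auto simp: bind_return_pmf\<close>)
    then show ?thesis by (simp add: Nil bind_return_pmf)
  next
    case (Cons c cs1)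
    have "steps orc (Suc t + t') (cs @ cs', s) =
        bind_pmf (step orc (c # cs1, s)) (\<lambda>cf. steps orc (t + t') (fst cf @ cs', snd cf))"
      by (simp add: Cons step_append bind_map_pmf split_beta)
    also have "\<dots> = bind_pmf (step orc (c # cs1, s))
        (\<lambda>cf. bind_pmf (steps orc t cf) (\<lambda>cf. steps orc t' (cs', snd cf)))"
    proof (rule bind_pmf_cong[OF refl])
      fix cf assume cf: "cf \<in> set_pmf (step orc (c # cs1, s))"
      have "halted (steps orc t (fst cf, snd cf))"
        using Suc.prems(1) cf by (simp add: Cons halted_bind)
      moreover have "halted (steps orc t' (cs', s'))"
        if "([], s') \<in> set_pmf (steps orc t (fst cf, snd cf))" for s'
        using Suc.prems(2)[of s'] cf that by (auto simp: Cons)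
      ultimately show "steps orc (t + t') (fst cf @ cs', snd cf) =
          bind_pmf (steps orc t cf) (\<lambda>cf. steps orc t' (cs', snd cf))"
        using Suc.IH[of "fst cf" "snd cf"] by simp
    qed
    finally show ?thesis by (simp add: Cons bind_assoc_pmf)
  qed
qed

subsection \<open>Total correctness\<close>

text \<open>Total correctness over the support. Probabilities are dropped because the programs
  verified in this way compute functions; only the adversary itself is treated through its
  distribution.\<close>

definition tot :: "com list \<Rightarrow> store \<Rightarrow> nat \<Rightarrow> (store \<Rightarrow> bool) \<Rightarrow> bool" where
  "tot cs s t Q \<longleftrightarrow> (\<forall>cf\<in>set_pmf (steps no_oracle t (cs, s)). fst cf = [] \<and> Q (snd cf))"

lemma tot_halted: "tot cs s t Q \<Longrightarrow> halted (steps no_oracle t (cs, s))"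
  by (auto simp: tot_def halted_def)

lemma tot_weaken:
  assumes "tot cs s t Q" "t \<le> t'" "\<And>s'. Q s' \<Longrightarrow> Q' s'"
  shows "tot cs s t' Q'"
  using assms steps_stable[OF tot_halted[OF assms(1)] assms(2)] by (auto simp: tot_def)

lemma tot_append:
  assumes "tot cs s t R" "\<And>s'. R s' \<Longrightarrow> tot cs' s' t' Q"
  shows "tot (cs @ cs') s (t + t') Q"
proof -
  have R: "R s'" if "([], s') \<in> set_pmf (steps no_oracle t (cs, s))" for s'
    using that assms(1) by (auto simp: tot_def)
  have "steps no_oracle (t + t') (cs @ cs', s) =
      bind_pmf (steps no_oracle t (cs, s)) (\<lambda>cf. steps no_oracle t' (cs', snd cf))"
    using steps_append[OF tot_halted[OF assms(1)]] tot_halted[OF assms(2)] R by blast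
  then show ?thesis
    using assms by (auto simp: tot_def)
qed

lemma tot_Cons:
  assumes "tot [c] s t R" "\<And>s'. R s' \<Longrightarrow> tot cs s' t' Q"
  shows "tot (c # cs) s (t + t') Q"
  using tot_append[of "[c]"] assms by simp

lemma tot_Assign: "Q (s(i := eval_expr e s)) \<Longrightarrow> tot [Assign i e] s 1 Q"
  by (simp add: tot_def bind_return_pmf)

lemma tot_Seq: "tot (c # c' # cs) s t Q \<Longrightarrow> tot (Seq c c' # cs) s (Suc t) Q"
  by (simp add: tot_def bind_return_pmf)

lemma tot_Cond:
  assumes "eval_expr e s \<noteq> Atom \<Longrightarrow> tot (c # cs) s t Q" "eval_expr e s = Atom \<Longrightarrow> tot (c' # cs) s t Q"
  shows "tot (Cond e c c' # cs) s (Suc t) Q"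
  using assms by (auto simp: tot_def bind_return_pmf)

lemma tot_While_done: "eval_expr e s = Atom \<Longrightarrow> Q s \<Longrightarrow> tot [While e c] s 1 Q"
  by (simp add: tot_def bind_return_pmf)

lemma tot_While_step:
  "eval_expr e s \<noteq> Atom \<Longrightarrow> tot (c # While e c # cs) s t Q \<Longrightarrow> tot (While e c # cs) s (Suc t) Q"
  by (simp add: tot_def bind_return_pmf)

lemma tot_Seq2:
  assumes "tot [c] s t R" "\<And>s'. R s' \<Longrightarrow> tot [c'] s' t' Q"
  shows "tot [Seq c c'] s (Suc (t + t')) Q"
  by (rule tot_Seq, rule tot_Cons[OF assms])

subsection \<open>Frame\<close>

text \<open>Only written variables count. Registers from this bound on survive a run, which gives a
  caller places to save its own data.\<close>

primrec var_bound :: "com \<Rightarrow> nat" where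
  "var_bound (Assign i e) = Suc i"
| "var_bound (Flip i) = Suc i"
| "var_bound (Sample i) = Suc i"
| "var_bound (Seq c c') = max (var_bound c) (var_bound c')"
| "var_bound (Cond e c c') = max (var_bound c) (var_bound c')"
| "var_bound (While e c) = var_bound c"

lemma step_frame:
  assumes "cf \<in> set_pmf (step orc (cs, s))" "\<forall>c\<in>set cs. var_bound c \<le> v"
  shows "snd cf v = s v \<and> (\<forall>c\<in>set (fst cf). var_bound c \<le> v)"
proof (cases cs)
  case (Cons c cs')
  then show ?thesis using assms by (cases c) auto
qed (use assms in auto)

lemma steps_frame:
  assumes "cf \<in> set_pmf (steps orc t cf0)" "\<forall>c\<in>set (fst cf0). var_bound c \<le> v"
  shows "snd cf v = snd cf0 v"
  using assms
proof (induction t arbitrary: cf0)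
  case (Suc t)
  then obtain cf1 where 1: "cf1 \<in> set_pmf (step orc (fst cf0, snd cf0))"
    and "cf \<in> set_pmf (steps orc t cf1)" by auto
  then show ?case using step_frame[OF 1 Suc.prems(2)] Suc.IH[of cf1] by auto
qed auto

lemma tot_frame:
  assumes "tot [c] s t Q"
  shows "tot [c] s t (\<lambda>s'. Q s' \<and> (\<forall>v\<ge>var_bound c. s' v = s v))"
  using assms steps_frame[where ?cf0.0 = "([c], s)"] unfolding tot_def by fastforce

section \<open>Polynomial-time functions\<close>

lemma tot_time: "tot cs s t Q \<Longrightarrow> t \<le> t' \<Longrightarrow> tot cs s t' Q"
  by (rule tot_weaken)

text \<open>The name abbreviates "polynomially bounded"; the yardstick is the size of the encoded
  input, not the index.\<close>

definition pbd :: "'i set \<Rightarrow> ('i \<Rightarrow> data) \<Rightarrow> ('i \<Rightarrow> nat) \<Rightarrow> bool" where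
  "pbd I x N \<longleftrightarrow> (\<exists>p. \<forall>i\<in>I. N i \<le> poly p (data_size (x i)))"

lemma poly_nat_mono: "a \<le> b \<Longrightarrow> poly p a \<le> poly p b" for p :: "nat poly"
  by (induction p) (auto intro!: add_mono mult_mono)

lemma pbd_size: "pbd I x (\<lambda>i. data_size (x i))"
  unfolding pbd_def by (rule exI[of _ "[:0, 1:]"]) simp

lemma pbd_const: "pbd I x (\<lambda>_. n)"
  unfolding pbd_def by (rule exI[of _ "[:n:]"]) simp

lemma pbd_le: "pbd I x N \<Longrightarrow> (\<And>i. i \<in> I \<Longrightarrow> M i \<le> N i) \<Longrightarrow> pbd I x M"
  unfolding pbd_def by (meson order_trans)

lemma pbd_add:
  assumes "pbd I x M" "pbd I x N"
  shows "pbd I x (\<lambda>i. M i + N i)"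
proof -
  obtain p q where "\<forall>i\<in>I. M i \<le> poly p (data_size (x i))" "\<forall>i\<in>I. N i \<le> poly q (data_size (x i))"
    using assms unfolding pbd_def by blast
  then show ?thesis
    unfolding pbd_def by (intro exI[of _ "p + q"]) (auto intro: add_mono)
qed

lemma pbd_Suc: "pbd I x M \<Longrightarrow> pbd I x (\<lambda>i. Suc (M i))"
  using pbd_add[OF pbd_const[of _ _ 1]] by simp

lemma pbd_mult:
  assumes "pbd I x M" "pbd I x N"
  shows "pbd I x (\<lambda>i. M i * N i)"
proof -
  obtain p q where "\<forall>i\<in>I. M i \<le> poly p (data_size (x i))" "\<forall>i\<in>I. N i \<le> poly q (data_size (x i))"
    using assms unfolding pbd_def by blast
  then show ?thesis
    unfolding pbd_def by (intro exI[of _ "p * q"]) (auto intro: mult_mono)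
qed

lemma pbd_poly:
  assumes "pbd I x N"
  shows "pbd I x (\<lambda>i. poly p (N i))"
proof -
  obtain q where q: "\<forall>i\<in>I. N i \<le> poly q (data_size (x i))"
    using assms unfolding pbd_def by blast
  have "poly p (N i) \<le> poly (pcompose p q) (data_size (x i))" if "i \<in> I" for i
    using q that by (simp add: poly_pcompose poly_nat_mono)
  then show ?thesis unfolding pbd_def by blast
qed

lemma pbd_comp:
  assumes N: "pbd J z N" and size: "pbd I x (\<lambda>i. data_size (y i))"
    and ji: "\<And>i. i \<in> I \<Longrightarrow> j i \<in> J \<and> z (j i) = y i"
  shows "pbd I x (\<lambda>i. N (j i))"
proof -
  obtain p where p: "\<forall>i\<in>J. N i \<le> poly p (data_size (z i))"
    using N unfolding pbd_def by blast
  show ?thesis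
    by (rule pbd_le[OF pbd_poly[OF size, of p]], use p ji in metis)
qed

lemma pbd_subset: "pbd I x N \<Longrightarrow> J \<subseteq> I \<Longrightarrow> pbd J x N"
  unfolding pbd_def by blast

text \<open>
  The store on which the program is started is arbitrary apart from the input, so that
  the program can be used inside a loop.
\<close>

definition pt :: "'i set \<Rightarrow> ('i \<Rightarrow> data) \<Rightarrow> ('i \<Rightarrow> data) \<Rightarrow> bool" where
  "pt I x f \<longleftrightarrow> pbd I x (\<lambda>i. data_size (f i)) \<and>
     (\<exists>c T. pbd I x T \<and>
       (\<forall>i\<in>I. \<forall>s. s 0 = x i \<longrightarrow> tot [c] s (T i) (\<lambda>s'. s' 0 = f i)))"

lemma ptI:
  assumes "pbd I x (\<lambda>i. data_size (f i))" "pbd I x T"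
    and "\<And>i s. i \<in> I \<Longrightarrow> s 0 = x i \<Longrightarrow> tot [c] s (T i) (\<lambda>s'. s' 0 = f i)"
  shows "pt I x f"
  using assms unfolding pt_def by blast

lemma ptE:
  assumes "pt I x f"
  obtains c T where "pbd I x (\<lambda>i. data_size (f i))" "pbd I x T"
    "\<And>i s. i \<in> I \<Longrightarrow> s 0 = x i \<Longrightarrow> tot [c] s (T i) (\<lambda>s'. s' 0 = f i \<and> (\<forall>v\<ge>var_bound c. s' v = s v))"
proof -
  obtain c T where c: "pbd I x (\<lambda>i. data_size (f i))" "pbd I x T"
    "\<And>i s. i \<in> I \<Longrightarrow> s 0 = x i \<Longrightarrow> tot [c] s (T i) (\<lambda>s'. s' 0 = f i)"
    using assms unfolding pt_def by blast
  show thesis by (rule that[OF c(1,2)]) (rule tot_frame[OF c(3)])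
qed

lemma pt_pbd: "pt I x f \<Longrightarrow> pbd I x (\<lambda>i. data_size (f i))"
  by (simp add: pt_def)

lemma pt_cong:
  assumes "pt I x f" "\<And>i. i \<in> I \<Longrightarrow> f i = g i"
  shows "pt I x g"
  using assms by (auto simp: pt_def pbd_def)

lemma pt_subset: "pt I x f \<Longrightarrow> J \<subseteq> I \<Longrightarrow> pt J x f"
  unfolding pt_def using pbd_subset by blast

text \<open>The time of the second program is polynomial in its own input y. That y is polynomial in
  x does not follow from the time of the first program, since trees share subtrees; this is why
  \<open>pt\<close> also bounds the output size.\<close>

lemma pt_comp:
  assumes "pt I x y" "pt J z f" "\<And>i. i \<in> I \<Longrightarrow> j i \<in> J \<and> z (j i) = y i"
  shows "pt I x (\<lambda>i. f (j i))"
proof -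
  obtain c T where c: "pbd I x (\<lambda>i. data_size (y i))" "pbd I x T"
    "\<And>i s. i \<in> I \<Longrightarrow> s 0 = x i \<Longrightarrow> tot [c] s (T i) (\<lambda>s'. s' 0 = y i \<and> (\<forall>v\<ge>var_bound c. s' v = s v))"
    by (rule ptE[OF assms(1)]) (rule that)
  obtain c' T' where c': "pbd J z (\<lambda>i. data_size (f i))" "pbd J z T'"
    "\<And>i s. i \<in> J \<Longrightarrow> s 0 = z i \<Longrightarrow> tot [c'] s (T' i) (\<lambda>s'. s' 0 = f i \<and> (\<forall>v\<ge>var_bound c'. s' v = s v))"
    by (rule ptE[OF assms(2)]) (rule that)
  show ?thesis
  proof (rule ptI[of _ _ _ "\<lambda>i. Suc (T i + T' (j i))" "Seq c c'"])
    show "pbd I x (\<lambda>i. data_size (f (j i)))"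
      by (rule pbd_comp[OF c'(1) c(1) assms(3)])
    show "pbd I x (\<lambda>i. Suc (T i + T' (j i)))"
      by (intro pbd_Suc pbd_add c pbd_comp[OF c'(2) c(1) assms(3)])
    fix i and s :: store assume i: "i \<in> I" "s 0 = x i"
    show "tot [Seq c c'] s (Suc (T i + T' (j i))) (\<lambda>s'. s' 0 = f (j i))"
    proof (rule tot_Seq2[OF c(3)[OF i(1), of s, OF i(2)]])
      fix s' assume "s' 0 = y i \<and> (\<forall>v\<ge>var_bound c. s' v = s v)"
      then show "tot [c'] s' (T' (j i)) (\<lambda>s'. s' 0 = f (j i))"
        using assms(3)[OF i(1)] by (intro tot_weaken[OF c'(3)[of "j i" s']]) auto
    qed
  qed
qed

lemma pt_expr:
  assumes "pbd I x (\<lambda>i. data_size (f i))" "\<And>i s. i \<in> I \<Longrightarrow> s 0 = x i \<Longrightarrow> eval_expr e s = f i"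
  shows "pt I x f"
  by (rule ptI[OF assms(1) pbd_const[where n = 1], where c = "Assign 0 e"], rule tot_Assign) (use assms(2) in auto)

lemma pt_id: "pt I x x"
  by (rule pt_expr[OF pbd_size, of _ _ "Var 0"]) simp

lemma pt_const: "pt I x (\<lambda>_. d)"
  by (rule pt_expr[OF pbd_const, of _ _ "Quote d"]) simp

lemma data_size_fst: "data_size (data_fst d) \<le> data_size d"
  by (cases d) auto

lemma data_size_snd: "data_size (data_snd d) \<le> data_size d"
  by (cases d) auto

lemma pt_fst: "pt I x f \<Longrightarrow> pt I x (\<lambda>i. data_fst (f i))"
  by (rule pt_comp[of I x f UNIV "\<lambda>d. d" data_fst])
    (auto intro!: pt_expr[of _ _ _ "Fst (Var 0)"] pbd_le[OF pbd_size] data_size_fst)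

lemma pt_snd: "pt I x f \<Longrightarrow> pt I x (\<lambda>i. data_snd (f i))"
  by (rule pt_comp[of I x f UNIV "\<lambda>d. d" data_snd])
    (auto intro!: pt_expr[of _ _ _ "Snd (Var 0)"] pbd_le[OF pbd_size] data_size_snd)

lemma pt_Pair:
  assumes "pt I x f" "pt I x g"
  shows "pt I x (\<lambda>i. Pair (f i) (g i))"
proof -
  obtain c T where c: "pbd I x (\<lambda>i. data_size (f i))" "pbd I x T"
    "\<And>i s. i \<in> I \<Longrightarrow> s 0 = x i \<Longrightarrow> tot [c] s (T i) (\<lambda>s'. s' 0 = f i \<and> (\<forall>v\<ge>var_bound c. s' v = s v))"
    by (rule ptE[OF assms(1)]) (rule that)
  obtain c' T' where c': "pbd I x (\<lambda>i. data_size (g i))" "pbd I x T'"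
    "\<And>i s. i \<in> I \<Longrightarrow> s 0 = x i \<Longrightarrow> tot [c'] s (T' i) (\<lambda>s'. s' 0 = g i \<and> (\<forall>v\<ge>var_bound c'. s' v = s v))"
    by (rule ptE[OF assms(2)]) (rule that)
  \<comment> \<open>Neither program writes at or beyond K, so the input can wait in K and the first
    result in K + 1. The successor keeps K away from register 0.\<close>
  define K where "K = Suc (max (var_bound c) (var_bound c'))"
  show ?thesis
  proof (rule ptI)
    show "pbd I x (\<lambda>i. data_size (Pair (f i) (g i)))"
      using c(1) c'(1) by (simp add: pbd_Suc pbd_add)
    show "pbd I x (\<lambda>i. 1 + Suc (T i + Suc (2 + Suc (T' i + 1))) + 2)"
      by (intro pbd_Suc pbd_add pbd_const c c')
    fix i and s :: store assume i: "i \<in> I" "s 0 = x i"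
    show "tot [Seq (Assign K (Var 0)) (Seq c (Seq (Assign (Suc K) (Var 0)) (Seq (Assign 0 (Var K))
       (Seq c' (Assign 0 (Mk (Var (Suc K)) (Var 0)))))))] s
       (1 + Suc (T i + Suc (2 + Suc (T' i + 1))) + 2) (\<lambda>s'. s' 0 = Pair (f i) (g i))"
      apply (rule tot_time)
        apply (rule tot_Seq2[where R = "\<lambda>s'. s' = s(K := x i)"])
         apply (rule tot_Assign) using i apply simp
        apply (rule tot_Seq2[where R = "\<lambda>s'. s' 0 = f i \<and> s' K = x i"])
         apply (rule tot_weaken[OF c(3)[OF i(1)] order_refl])
          apply (use i in \<open>simp add: K_def\<close>)
         apply (clarsimp simp: K_def)
        apply (rule tot_Seq2[where R = "\<lambda>s'. s' (Suc K) = f i \<and> s' K = x i"])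
         apply (rule tot_Assign) apply simp
        apply (rule tot_Seq2[where R = "\<lambda>s'. s' (Suc K) = f i \<and> s' 0 = x i"])
         apply (rule tot_Assign) apply simp
        apply (rule tot_Seq2[where R = "\<lambda>s'. s' (Suc K) = f i \<and> s' 0 = g i"])
         apply (rule tot_weaken[OF c'(3)[OF i(1)] order_refl])
          apply simp
         apply (simp add: K_def)
        apply (rule tot_Assign) apply simp
       apply simp
      done
  qed
qed

text \<open>Each branch has to be efficient only where it is taken. In this way partial operations
  such as \<open>hd\<close>, indexing and field arithmetic, which are computable under a promise on
  the input, enter total programs.\<close>

lemma pt_If:
  assumes "pt I x b" "pt {i\<in>I. b i \<noteq> Atom} x f" "pt {i\<in>I. b i = Atom} x g"
  shows "pt I x (\<lambda>i. if b i = Atom then g i else f i)"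
proof -
  obtain c T where c: "pbd I x (\<lambda>i. data_size (b i))" "pbd I x T"
    "\<And>i s. i \<in> I \<Longrightarrow> s 0 = x i \<Longrightarrow> tot [c] s (T i) (\<lambda>s'. s' 0 = b i \<and> (\<forall>v\<ge>var_bound c. s' v = s v))"
    by (rule ptE[OF assms(1)]) (rule that)
  obtain c1 T1 where c1: "pbd {i\<in>I. b i \<noteq> Atom} x (\<lambda>i. data_size (f i))" "pbd {i\<in>I. b i \<noteq> Atom} x T1"
    "\<And>i s. i \<in> {i\<in>I. b i \<noteq> Atom} \<Longrightarrow> s 0 = x i \<Longrightarrow> tot [c1] s (T1 i) (\<lambda>s'. s' 0 = f i \<and> (\<forall>v\<ge>var_bound c1. s' v = s v))"
    by (rule ptE[OF assms(2)]) (rule that)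
  obtain c2 T2 where c2: "pbd {i\<in>I. b i = Atom} x (\<lambda>i. data_size (g i))" "pbd {i\<in>I. b i = Atom} x T2"
    "\<And>i s. i \<in> {i\<in>I. b i = Atom} \<Longrightarrow> s 0 = x i \<Longrightarrow> tot [c2] s (T2 i) (\<lambda>s'. s' 0 = g i \<and> (\<forall>v\<ge>var_bound c2. s' v = s v))"
    by (rule ptE[OF assms(3)]) (rule that)
  have pbd_If: "pbd I x (\<lambda>i. if b i = Atom then M i else N i)"
    if M: "pbd {i\<in>I. b i = Atom} x M" and N: "pbd {i\<in>I. b i \<noteq> Atom} x N" for M N
  proof -
    obtain p q where p: "\<And>i. i \<in> I \<Longrightarrow> b i = Atom \<Longrightarrow> M i \<le> poly p (data_size (x i))"
      and q: "\<And>i. i \<in> I \<Longrightarrow> b i \<noteq> Atom \<Longrightarrow> N i \<le> poly q (data_size (x i))"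
      using M N unfolding pbd_def by blast
    show ?thesis unfolding pbd_def
      by (rule exI[of _ "p + q"]) (use p q in \<open>auto intro: trans_le_add1 trans_le_add2\<close>)
  qed
  define K where "K = Suc (var_bound c)"
  show ?thesis
  proof (rule ptI)
    show "pbd I x (\<lambda>i. data_size (if b i = Atom then g i else f i))"
      using pbd_If[OF c2(1) c1(1)] by (simp add: if_distrib)
    show "pbd I x (\<lambda>i. 5 + T i + 2 + Suc (if b i = Atom then T2 i else T1 i))"
      by (intro pbd_Suc pbd_add pbd_const c pbd_If[OF c2(2) c1(2)])
    fix i and s :: store assume i: "i \<in> I" "s 0 = x i"
    show "tot [Seq (Assign K (Var 0)) (Seq c (Seq (Assign (Suc K) (Var 0)) (Seq (Assign 0 (Var K))
       (Cond (Var (Suc K)) c1 c2))))] s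
       (5 + T i + 2 + Suc (if b i = Atom then T2 i else T1 i)) (\<lambda>s'. s' 0 = (if b i = Atom then g i else f i))"
      apply (rule tot_time)
        apply (rule tot_Seq2[where R = "\<lambda>s'. s' = s(K := x i)"])
         apply (rule tot_Assign) using i apply simp
        apply (rule tot_Seq2[where R = "\<lambda>s'. s' 0 = b i \<and> s' K = x i"])
         apply (rule tot_weaken[OF c(3)[OF i(1)] order_refl])
          apply (use i in \<open>simp add: K_def\<close>)
         apply (clarsimp simp: K_def)
        apply (rule tot_Seq2[where R = "\<lambda>s'. s' (Suc K) = b i \<and> s' K = x i"])
         apply (rule tot_Assign) apply simp
        apply (rule tot_Seq2[where R = "\<lambda>s'. s' (Suc K) = b i \<and> s' 0 = x i"])
         apply (rule tot_Assign) apply simp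
        apply (rule tot_Cond[where t = "if b i = Atom then T2 i else T1 i"])
         apply (rule tot_weaken[OF c1(3)[of i]], use i in simp, simp, simp, use i in simp)
        apply (rule tot_weaken[OF c2(3)[of i]], use i in simp, simp, simp, use i in simp)
       apply simp
      done
  qed
qed

subsection \<open>Loops\<close>

lemma enc_list_simps [simp]:
  "enc_list E [] = Atom" "enc_list E (a # as) = Pair (E a) (enc_list E as)"
  by (simp_all add: enc_list_def)

lemma enc_list_eq_Atom [simp]: "enc_list E as = Atom \<longleftrightarrow> as = []"
  by (cases as) auto

lemma length_le_data_size: "length xs \<le> data_size (enc_list E xs)"
  by (induction xs) auto

lemma data_size_mem: "y \<in> set xs \<Longrightarrow> data_size (E y) \<le> data_size (enc_list E xs)"
  by (induction xs) auto

text \<open>Register K holds the input, K + 1 the unprocessed list, and K + 2 the accumulator; the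
  body receives the input, the current element and the accumulator as one tree in register 0. The
  invariant V depends on the number of elements already processed, and each round costs 8 steps
  besides the body.\<close>

lemma tot_fold_loop:
  assumes step: "\<And>n a s. n < length xs \<Longrightarrow> V n a \<Longrightarrow> s 0 = Pair d (Pair (E (xs ! n)) (A a)) \<Longrightarrow>
      tot [c] s T (\<lambda>s'. s' 0 = A (g (xs ! n) a) \<and> (\<forall>v\<ge>K. s' v = s v))"
    and V: "\<And>n a. n < length xs \<Longrightarrow> V n a \<Longrightarrow> V (Suc n) (g (xs ! n) a)"
    and K: "K > 0"
  shows "m \<le> length xs \<Longrightarrow> V m a \<Longrightarrow> s K = d \<Longrightarrow> s (Suc K) = enc_list E (drop m xs) \<Longrightarrow> s (Suc (Suc K)) = A a \<Longrightarrow>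
    tot [While (Var (Suc K)) (Seq (Assign 0 (Mk (Var K) (Mk (Fst (Var (Suc K))) (Var (Suc (Suc K))))))
       (Seq c (Seq (Assign (Suc (Suc K)) (Var 0)) (Assign (Suc K) (Snd (Var (Suc K)))))))] s
      (Suc ((length xs - m) * (T + 8))) (\<lambda>s'. s' (Suc (Suc K)) = A (foldl (\<lambda>a y. g y a) a (drop m xs)))"
proof (induction "length xs - m" arbitrary: m a s)
  case 0
  show ?case
    by (rule tot_weaken[OF tot_While_done[where Q = "\<lambda>s'. s' = s"]]) (use 0 in auto)
next
  case (Suc k)
  have m: "m < length xs" using Suc.hyps(2) by simp
  have dr: "drop m xs = xs ! m # drop (Suc m) xs" using m by (simp add: Cons_nth_drop_Suc)
  let ?w = "While (Var (Suc K)) (Seq (Assign 0 (Mk (Var K) (Mk (Fst (Var (Suc K))) (Var (Suc (Suc K))))))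
       (Seq c (Seq (Assign (Suc (Suc K)) (Var 0)) (Assign (Suc K) (Snd (Var (Suc K)))))))"
  have k: "length xs - m = Suc (length xs - Suc m)" using m by simp
  show ?case
    apply (rule tot_time[where t = "Suc ((T + 7) + Suc ((length xs - Suc m) * (T + 8)))"])
      apply (rule tot_While_step)
       apply (use Suc.prems dr in simp)
      apply (rule tot_Cons[where R = "\<lambda>s'. s' K = d \<and> s' (Suc K) = enc_list E (drop (Suc m) xs) \<and> s' (Suc (Suc K)) = A (g (xs ! m) a)"])
       apply (rule tot_time[where t = "Suc (1 + Suc (T + Suc (1 + 1)))"])
         apply (rule tot_Seq2[where R = "\<lambda>s'. s' 0 = Pair d (Pair (E (xs ! m)) (A a)) \<and> s' K = d \<and> s' (Suc K) = enc_list E (drop m xs)"])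
          apply (rule tot_Assign) apply (use Suc.prems dr K in simp)
         apply (rule tot_Seq2[where R = "\<lambda>s'. s' 0 = A (g (xs ! m) a) \<and> s' K = d \<and> s' (Suc K) = enc_list E (drop m xs)"])
          apply (rule tot_weaken[OF step[OF m Suc.prems(2)] order_refl])
           apply simp
          apply simp
         apply (rule tot_Seq2[where R = "\<lambda>s'. s' (Suc (Suc K)) = A (g (xs ! m) a) \<and> s' K = d \<and> s' (Suc K) = enc_list E (drop m xs)"])
          apply (rule tot_Assign) apply (use K in simp)
         apply (rule tot_Assign) apply (use K dr in simp)
        apply simp
      apply (rule tot_weaken[OF Suc.hyps(1)[of "Suc m" "g (xs ! m) a"]])
             apply (use Suc.hyps(2) in simp)
            apply (use m in simp)
           apply (rule V[OF m Suc.prems(2)])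
          apply simp
         apply simp
        apply simp
       apply simp
      apply (simp add: dr)
    apply (simp add: k)
    done
qed

text \<open>Iterating a polynomial-time body can square the size of the accumulator in every round,
  so the bound B on all intermediate accumulators is essential. The invariant V supplies this bound
  and at the same time the promise J under which the body is efficient.\<close>

lemma pt_foldl_raw:
  assumes xs: "pt I x (\<lambda>i. enc_list E (xs i))" and a0: "pt I x (\<lambda>i. A (a0 i))"
    and step: "pt J (\<lambda>j. Pair (x (fst j)) (Pair (E (fst (snd j))) (A (snd (snd j)))))
       (\<lambda>j. A (g (fst j) (fst (snd j)) (snd (snd j))))"
    and V0: "\<And>i. i \<in> I \<Longrightarrow> V i 0 (a0 i)"
    and VS: "\<And>i n a. i \<in> I \<Longrightarrow> n < length (xs i) \<Longrightarrow> V i n a \<Longrightarrow> V i (Suc n) (g i (xs i ! n) a)"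
    and B: "pbd I x B" "\<And>i n a. i \<in> I \<Longrightarrow> n \<le> length (xs i) \<Longrightarrow> V i n a \<Longrightarrow> data_size (A a) \<le> B i"
    and J: "\<And>i n a. i \<in> I \<Longrightarrow> n < length (xs i) \<Longrightarrow> V i n a \<Longrightarrow> (i, xs i ! n, a) \<in> J"
  shows "pt I x (\<lambda>i. A (foldl (\<lambda>a y. g i y a) (a0 i) (xs i)))"
proof -
  obtain c1 T1 where c1: "pbd I x (\<lambda>i. data_size (enc_list E (xs i)))" "pbd I x T1"
    "\<And>i s. i \<in> I \<Longrightarrow> s 0 = x i \<Longrightarrow> tot [c1] s (T1 i) (\<lambda>s'. s' 0 = enc_list E (xs i) \<and> (\<forall>v\<ge>var_bound c1. s' v = s v))"
    by (rule ptE[OF xs]) (rule that)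
  obtain c2 T2 where c2: "pbd I x (\<lambda>i. data_size (A (a0 i)))" "pbd I x T2"
    "\<And>i s. i \<in> I \<Longrightarrow> s 0 = x i \<Longrightarrow> tot [c2] s (T2 i) (\<lambda>s'. s' 0 = A (a0 i) \<and> (\<forall>v\<ge>var_bound c2. s' v = s v))"
    by (rule ptE[OF a0]) (rule that)
  obtain c T where T: "pbd J (\<lambda>j. Pair (x (fst j)) (Pair (E (fst (snd j))) (A (snd (snd j))))) T"
    and c: "\<And>j s. j \<in> J \<Longrightarrow> s 0 = Pair (x (fst j)) (Pair (E (fst (snd j))) (A (snd (snd j)))) \<Longrightarrow>
      tot [c] s (T j) (\<lambda>s'. s' 0 = A (g (fst j) (fst (snd j)) (snd (snd j))) \<and> (\<forall>v\<ge>var_bound c. s' v = s v))"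
    by (rule ptE[OF step]) (rule that)
  obtain p where p: "\<And>j. j \<in> J \<Longrightarrow> T j \<le> poly p (data_size (Pair (x (fst j)) (Pair (E (fst (snd j))) (A (snd (snd j))))))"
    using T unfolding pbd_def by blast
  \<comment> \<open>One bound for all rounds: the input of the body consists of the original input,
    one list element and the accumulator, with 2 for the two \<open>Pair\<close> nodes.\<close>
  define Tm where "Tm i = poly p (data_size (x i) + (data_size (enc_list E (xs i)) + B i + 2))" for i
  have Tm: "pbd I x Tm"
    unfolding Tm_def by (intro pbd_poly pbd_add pbd_size pbd_const c1 B)
  define K where "K = Suc (max (var_bound c1) (max (var_bound c2) (var_bound c)))"
  have fold_inv: "V i (length (take m (xs i))) (foldl (\<lambda>a y. g i y a) (a0 i) (take m (xs i)))" if "i \<in> I" for i m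
  proof (induction m)
    case (Suc m)
    then show ?case using VS[OF that, of m "foldl (\<lambda>a y. g i y a) (a0 i) (take m (xs i))"]
      by (cases "m < length (xs i)") (auto simp: take_Suc_conv_app_nth min_def)
  qed (use V0 that in simp)
  have body: "tot [c] s (Tm i) (\<lambda>s'. s' 0 = A (g i (xs i ! n) a) \<and> (\<forall>v\<ge>K. s' v = s v))"
    if "i \<in> I" "n < length (xs i)" "V i n a" "s 0 = Pair (x i) (Pair (E (xs i ! n)) (A a))" for i n a s
  proof (rule tot_weaken[OF c[of "(i, xs i ! n, a)" s]])
    show "T (i, xs i ! n, a) \<le> Tm i"
      unfolding Tm_def
      by (rule order_trans[OF p[OF J] poly_nat_mono])
        (use that data_size_mem[OF nth_mem, of n "xs i" E] B(2)[of i n a] in auto)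
  qed (use that J in \<open>auto simp: K_def\<close>)
  show ?thesis
  proof (rule ptI)
    show "pbd I x (\<lambda>i. data_size (A (foldl (\<lambda>a y. g i y a) (a0 i) (xs i))))"
      by (rule pbd_le[OF B(1)], rule B(2)[OF _ le_refl], assumption) (use fold_inv in \<open>metis order_refl take_all\<close>)
    show "pbd I x (\<lambda>i. T1 i + T2 i + 20 + data_size (enc_list E (xs i)) * (Tm i + 8))"
      by (intro pbd_add pbd_mult pbd_const c1 c2 Tm)
    fix i and s :: store assume i: "i \<in> I" "s 0 = x i"
    let ?w = "While (Var (Suc K)) (Seq (Assign 0 (Mk (Var K) (Mk (Fst (Var (Suc K))) (Var (Suc (Suc K))))))
       (Seq c (Seq (Assign (Suc (Suc K)) (Var 0)) (Assign (Suc K) (Snd (Var (Suc K)))))))"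
    show "tot [Seq (Assign K (Var 0)) (Seq c1 (Seq (Assign (Suc K) (Var 0)) (Seq (Assign 0 (Var K))
       (Seq c2 (Seq (Assign (Suc (Suc K)) (Var 0)) (Seq ?w (Assign 0 (Var (Suc (Suc K))))))))))] s
       (T1 i + T2 i + 20 + data_size (enc_list E (xs i)) * (Tm i + 8))
       (\<lambda>s'. s' 0 = A (foldl (\<lambda>a y. g i y a) (a0 i) (xs i)))"
      apply (rule tot_time)
        apply (rule tot_Seq2[where R = "\<lambda>s'. s' = s(K := x i)"])
         apply (rule tot_Assign) using i apply simp
        apply (rule tot_Seq2[where R = "\<lambda>s'. s' 0 = enc_list E (xs i) \<and> s' K = x i"])
         apply (rule tot_weaken[OF c1(3)[OF i(1)] order_refl])
          apply (use i in \<open>simp add: K_def\<close>)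
         apply (clarsimp simp: K_def)
        apply (rule tot_Seq2[where R = "\<lambda>s'. s' (Suc K) = enc_list E (xs i) \<and> s' K = x i"])
         apply (rule tot_Assign) apply simp
        apply (rule tot_Seq2[where R = "\<lambda>s'. s' (Suc K) = enc_list E (xs i) \<and> s' 0 = x i \<and> s' K = x i"])
         apply (rule tot_Assign) apply (simp add: K_def)
        apply (rule tot_Seq2[where R = "\<lambda>s'. s' (Suc K) = enc_list E (xs i) \<and> s' 0 = A (a0 i) \<and> s' K = x i"])
         apply (rule tot_weaken[OF c2(3)[OF i(1)] order_refl])
          apply simp
         apply (simp add: K_def)
        apply (rule tot_Seq2[where R = "\<lambda>s'. s' (Suc K) = enc_list E (xs i) \<and> s' (Suc (Suc K)) = A (a0 i) \<and> s' K = x i"])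
         apply (rule tot_Assign) apply (simp add: K_def)
        apply (rule tot_Seq2[where R = "\<lambda>s'. s' (Suc (Suc K)) = A (foldl (\<lambda>a y. g i y a) (a0 i) (drop 0 (xs i)))"])
         apply (rule tot_fold_loop[where V = "V i" and d = "x i" and T = "Tm i"])
                apply (rule body[OF i(1)], assumption+)
               apply (rule VS[OF i(1)], assumption+)
              apply (simp add: K_def)
             apply simp
            apply (rule V0[OF i(1)])
           apply simp
          apply simp
         apply simp
        apply (rule tot_Assign) apply simp
       apply (subst diff_zero, use mult_le_mono1[OF length_le_data_size[of "xs i" E], of "Tm i + 8"] in linarith)
      done
  qed
qed

text \<open>Moves a function of i into a context j from which the input of i can be computed. Inside
  loop bodies this gives access to the variables of the enclosing scope.\<close>

lemma pt_lift:
  assumes "pt I x f" "pt J x' (\<lambda>j. x (h j))" "\<And>j. j \<in> J \<Longrightarrow> h j \<in> I"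
  shows "pt J x' (\<lambda>j. f (h j))"
  by (rule pt_comp[OF assms(2,1)]) (use assms(3) in auto)

definition fold_dom :: "'i set \<Rightarrow> ('i \<Rightarrow> 'y list) \<Rightarrow> ('i \<Rightarrow> nat \<Rightarrow> 'a \<Rightarrow> bool) \<Rightarrow> ('i \<times> 'y \<times> 'a) set" where
  "fold_dom I xs V = {(i, y, a). i \<in> I \<and> (\<exists>n<length (xs i). y = xs i ! n \<and> V i n a)}"

text \<open>
  Here and below the premise for the body of a loop is stated for an arbitrary input \<open>x'\<close>
  from which the variables in scope are computable, so that bodies can be nested.
\<close>

lemma pt_foldl:
  assumes xs: "pt I x (\<lambda>i. enc_list E (xs i))" and a0: "pt I x (\<lambda>i. A (a0 i))"
    and step: "\<And>x'. pt (fold_dom I xs V) x' (\<lambda>j. x (fst j)) \<Longrightarrow>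
       pt (fold_dom I xs V) x' (\<lambda>j. E (fst (snd j))) \<Longrightarrow>
       pt (fold_dom I xs V) x' (\<lambda>j. A (snd (snd j))) \<Longrightarrow>
       pt (fold_dom I xs V) x' (\<lambda>j. A (g (fst j) (fst (snd j)) (snd (snd j))))"
    and V0: "\<And>i. i \<in> I \<Longrightarrow> V i 0 (a0 i)"
    and VS: "\<And>i n a. i \<in> I \<Longrightarrow> n < length (xs i) \<Longrightarrow> V i n a \<Longrightarrow> V i (Suc n) (g i (xs i ! n) a)"
    and B: "pbd I x B" "\<And>i n a. i \<in> I \<Longrightarrow> n \<le> length (xs i) \<Longrightarrow> V i n a \<Longrightarrow> data_size (A a) \<le> B i"
  shows "pt I x (\<lambda>i. A (foldl (\<lambda>a y. g i y a) (a0 i) (xs i)))"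
proof (rule pt_foldl_raw[OF xs a0 _ V0 VS B])
  let ?x = "\<lambda>j. Pair (x (fst j)) (Pair (E (fst (snd j))) (A (snd (snd j))))"
  show "pt (fold_dom I xs V) ?x (\<lambda>j. A (g (fst j) (fst (snd j)) (snd (snd j))))"
  proof (rule step)
    show "pt (fold_dom I xs V) ?x (\<lambda>j. x (fst j))"
      using pt_fst[OF pt_id[of "fold_dom I xs V" ?x]] by simp
    show "pt (fold_dom I xs V) ?x (\<lambda>j. E (fst (snd j)))"
      using pt_fst[OF pt_snd[OF pt_id[of "fold_dom I xs V" ?x]]] by simp
    show "pt (fold_dom I xs V) ?x (\<lambda>j. A (snd (snd j)))"
      using pt_snd[OF pt_snd[OF pt_id[of "fold_dom I xs V" ?x]]] by simp
  qed
qed (auto simp: fold_dom_def)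

section \<open>Polynomial-time list operations\<close>

lemma data_size_enc_list:
  "data_size (enc_list E xs) = Suc (\<Sum>y\<leftarrow>xs. Suc (data_size (E y)))"
  by (induction xs) auto

lemma data_size_append: "data_size (enc_list E (xs @ ys)) = data_size (enc_list E xs) + data_size (enc_list E ys) - 1"
  by (simp add: data_size_enc_list)

lemma data_size_pos: "0 < data_size d"
  by (cases d) auto

lemma data_size_take: "data_size (enc_list E (take n xs)) \<le> data_size (enc_list E xs)"
  and data_size_drop: "data_size (enc_list E (drop n xs)) \<le> data_size (enc_list E xs)"
  using data_size_append[of E "take n xs" "drop n xs"] data_size_pos[of "enc_list E (take n xs)"]
    data_size_pos[of "enc_list E (drop n xs)"] by simp_all

lemma data_size_rev: "data_size (enc_list E (rev xs)) = data_size (enc_list E xs)"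
  by (simp add: data_size_enc_list flip: rev_map)

lemma data_size_list_le:
  assumes "\<And>y. y \<in> set xs \<Longrightarrow> data_size (E y) \<le> M" "length xs \<le> L"
  shows "data_size (enc_list E xs) \<le> Suc (L * Suc M)"
proof -
  have "(\<Sum>y\<leftarrow>xs. Suc (data_size (E y))) \<le> length xs * Suc M"
    using assms(1)
  proof (induction xs)
    case (Cons a xs)
    then have "data_size (E a) \<le> M" "(\<Sum>y\<leftarrow>xs. Suc (data_size (E y))) \<le> length xs * Suc M" by auto
    then show ?case by simp
  qed simp
  also have "\<dots> \<le> L * Suc M" using assms(2) by (intro mult_le_mono1)
  finally show ?thesis by (simp add: data_size_enc_list)
qed

lemma pt_Cons:
  assumes "pt I x (\<lambda>i. E (y i))" "pt I x (\<lambda>i. enc_list E (ys i))"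
  shows "pt I x (\<lambda>i. enc_list E (y i # ys i))"
  using pt_Pair[OF assms] by simp

lemma pt_Nil: "pt I x (\<lambda>i. enc_list E [])"
  by (simp add: pt_const)

text \<open>Loops that push onto an accumulator deliver their result backwards. Reversal is itself
  such a loop, so it comes first and then repairs the order in the other list operations.\<close>

lemma pt_rev:
  assumes "pt I x (\<lambda>i. enc_list E (xs i))"
  shows "pt I x (\<lambda>i. enc_list E (rev (xs i)))"
proof -
  have "pt I x (\<lambda>i. enc_list E (foldl (\<lambda>a y. y # a) [] (xs i)))"
  proof (rule pt_foldl[where V = "\<lambda>i n a. a = rev (take n (xs i))", OF assms pt_Nil pt_Cons _ _ pt_pbd[OF assms]])
    fix i n a assume "n \<le> length (xs i)" "a = rev (take n (xs i))"
    then show "data_size (enc_list E a) \<le> data_size (enc_list E (xs i))"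
      by (simp add: data_size_rev data_size_take)
  qed (auto simp: take_Suc_conv_app_nth)
  moreover have "foldl (\<lambda>a y. y # a) b ys = rev ys @ b" for ys b :: "'b list"
    by (induction ys arbitrary: b) auto
  ultimately show ?thesis by simp
qed

lemma pt_append:
  assumes "pt I x (\<lambda>i. enc_list E (xs i))" "pt I x (\<lambda>i. enc_list E (ys i))"
  shows "pt I x (\<lambda>i. enc_list E (xs i @ ys i))"
proof -
  have "pt I x (\<lambda>i. enc_list E (foldl (\<lambda>a y. y # a) (ys i) (rev (xs i))))"
  proof (rule pt_foldl[where V = "\<lambda>i n a. a = rev (take n (rev (xs i))) @ ys i", OF pt_rev[OF assms(1)] assms(2) pt_Cons])
    show "pbd I x (\<lambda>i. data_size (enc_list E (xs i)) + data_size (enc_list E (ys i)))"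
      by (intro pbd_add pt_pbd assms)
    fix i n a assume "n \<le> length (rev (xs i))" "a = rev (take n (rev (xs i))) @ ys i"
    then show "data_size (enc_list E a) \<le> data_size (enc_list E (xs i)) + data_size (enc_list E (ys i))"
      using data_size_take[of E n "rev (xs i)"] by (simp add: data_size_rev data_size_append)
  qed (auto simp: take_Suc_conv_app_nth)
  moreover have "foldl (\<lambda>a y. y # a) b ys = rev ys @ b" for ys b :: "'b list"
    by (induction ys arbitrary: b) auto
  ultimately show ?thesis by simp
qed

lemma pt_map:
  assumes xs: "pt I x (\<lambda>i. enc_list E (xs i))"
    and g: "\<And>x'. pt (SIGMA i:I. set (xs i)) x' (\<lambda>j. x (fst j)) \<Longrightarrow>
       pt (SIGMA i:I. set (xs i)) x' (\<lambda>j. E (snd j)) \<Longrightarrow>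
       pt (SIGMA i:I. set (xs i)) x' (\<lambda>j. F (g (fst j) (snd j)))"
  shows "pt I x (\<lambda>i. enc_list F (map (g i) (xs i)))"
proof -
  let ?J = "SIGMA i:I. set (xs i)" and ?x = "\<lambda>j. Pair (x (fst j)) (E (snd j))"
  have "pbd ?J ?x (\<lambda>j. data_size (F (g (fst j) (snd j))))"
    using pt_pbd[OF g[of ?x]] pt_fst[OF pt_id[of ?J ?x]] pt_snd[OF pt_id[of ?J ?x]] by simp
  then obtain p where p: "\<And>j. j \<in> ?J \<Longrightarrow> data_size (F (g (fst j) (snd j))) \<le> poly p (data_size (?x j))"
    unfolding pbd_def by blast
  \<comment> \<open>The size bound of the body is evaluated at the input together with the whole
    list in place of one element, which gives a single bound for all entries of the result.\<close>
  define M where "M i = poly p (data_size (x i) + data_size (enc_list E (xs i)) + 1)" for i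
  have M: "data_size (F (g i y)) \<le> M i" if "i \<in> I" "y \<in> set (xs i)" for i y
    unfolding M_def
    by (rule order_trans[OF p[of "(i, y)", simplified]])
      (use that data_size_mem[of y "xs i" E] in \<open>auto intro!: poly_nat_mono\<close>)
  have "pt I x (\<lambda>i. enc_list F (foldl (\<lambda>a y. g i y # a) [] (xs i)))"
  proof (rule pt_foldl[where V = "\<lambda>i n a. a = rev (map (g i) (take n (xs i)))", OF xs pt_Nil pt_Cons])
    show "pbd I x (\<lambda>i. Suc (data_size (enc_list E (xs i)) * Suc (M i)))"
      unfolding M_def by (intro pbd_Suc pbd_mult pbd_poly pbd_add pbd_size pbd_const pt_pbd[OF xs])
    fix i n a assume i: "i \<in> I" and a: "a = rev (map (g i) (take n (xs i)))"
    then show "data_size (enc_list F a) \<le> Suc (data_size (enc_list E (xs i)) * Suc (M i))"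
      using M[OF i] length_le_data_size[of "xs i" E]
      by (intro data_size_list_le) (auto dest: in_set_takeD)
  next
    fix x' let ?D = "fold_dom I xs (\<lambda>i n a. a = rev (map (g i) (take n (xs i))))"
    assume x': "pt ?D x' (\<lambda>j. x (fst j))" "pt ?D x' (\<lambda>j. E (fst (snd j)))"
    let ?h = "\<lambda>j. (fst j, fst (snd j))"
    \<comment> \<open>The premise is instantiated with the smallest input that offers both pieces.
      The resulting program is then composed with a projection of the loop state, because its index
      set contains no accumulator.\<close>
    have pg: "pt ?J ?x (\<lambda>j. F (g (fst j) (snd j)))"
      using g[of ?x] pt_fst[OF pt_id[of ?J ?x]] pt_snd[OF pt_id[of ?J ?x]] by simp
    have "pt ?D x' (\<lambda>j. F (g (fst (?h j)) (snd (?h j))))"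
      by (rule pt_comp[OF pt_Pair[OF x'] pg]) (auto simp: fold_dom_def)
    then show "pt ?D x' (\<lambda>j. F (g (fst j) (fst (snd j))))" by simp
  qed (auto simp: take_Suc_conv_app_nth)
  moreover have "foldl (\<lambda>a y. h y # a) b ys = rev (map h ys) @ b" for ys b and h :: "'b \<Rightarrow> 'c"
    by (induction ys arbitrary: b) auto
  ultimately have "pt I x (\<lambda>i. enc_list F (rev (map (g i) (xs i))))" by simp
  from pt_rev[OF this] show ?thesis by simp
qed

lemma pt_concat:
  assumes "pt I x (\<lambda>i. enc_list (enc_list E) (xss i))"
  shows "pt I x (\<lambda>i. enc_list E (concat (xss i)))"
proof -
  have "pt I x (\<lambda>i. enc_list E (foldl (\<lambda>a y. y @ a) [] (rev (xss i))))"
  proof (rule pt_foldl[where V = "\<lambda>i n a. a = concat (rev (take n (rev (xss i))))",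
        OF pt_rev[OF assms] pt_Nil pt_append _ _ pt_pbd[OF pt_rev[OF assms]]])
    fix i n a assume a: "a = concat (rev (take n (rev (xss i))))"
    have *: "data_size (enc_list E (concat ys)) \<le> data_size (enc_list (enc_list E) ys)" for ys
      by (induction ys) (auto simp: data_size_append)
    show "data_size (enc_list E a) \<le> data_size (enc_list (enc_list E) (rev (xss i)))"
      unfolding a by (rule order_trans[OF *]) (metis data_size_rev data_size_take)
  qed (auto simp: take_Suc_conv_app_nth)
  moreover have "foldl (\<lambda>a y. y @ a) b (rev ys) = concat ys @ b" for ys and b :: "'b list"
    by (induction ys arbitrary: b rule: rev_induct) auto
  ultimately show ?thesis by simp
qed

lemma pt_if:
  assumes "pt I x (\<lambda>i. enc_bool (b i))" "pt {i\<in>I. b i} x (\<lambda>i. E (f i))" "pt {i\<in>I. \<not> b i} x (\<lambda>i. E (g i))"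
  shows "pt I x (\<lambda>i. E (if b i then f i else g i))"
proof -
  have e: "enc_bool c = Atom \<longleftrightarrow> \<not> c" for c by (cases c) auto
  show ?thesis
    by (rule pt_cong[OF pt_If[OF assms(1), of "\<lambda>i. E (f i)" "\<lambda>i. E (g i)"]])
      (use assms(2,3) e in auto)
qed

lemma pt_if':
  assumes "pt I x (\<lambda>i. enc_bool (b i))" "pt I x (\<lambda>i. E (f i))" "pt I x (\<lambda>i. E (g i))"
  shows "pt I x (\<lambda>i. E (if b i then f i else g i))"
  by (rule pt_if[OF assms(1)], rule pt_subset[OF assms(2)], simp, rule pt_subset[OF assms(3)], simp)

lemma pt_not: "pt I x (\<lambda>i. enc_bool (b i)) \<Longrightarrow> pt I x (\<lambda>i. enc_bool (\<not> b i))"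
  by (rule pt_cong[OF pt_if'[where E = enc_bool and f = "\<lambda>_. False" and g = "\<lambda>_. True"]])
    (auto intro: pt_const)

lemma pt_conj: "pt I x (\<lambda>i. enc_bool (b i)) \<Longrightarrow> pt I x (\<lambda>i. enc_bool (c i)) \<Longrightarrow> pt I x (\<lambda>i. enc_bool (b i \<and> c i))"
  by (rule pt_cong[OF pt_if'[where E = enc_bool and b = b and f = c and g = "\<lambda>_. False"]])
    (auto intro: pt_const)

lemma pt_bool_eq: "pt I x (\<lambda>i. enc_bool (b i)) \<Longrightarrow> pt I x (\<lambda>i. enc_bool (c i)) \<Longrightarrow> pt I x (\<lambda>i. enc_bool (b i = c i))"
  by (rule pt_cong[OF pt_if'[where E = enc_bool and b = b and f = c and g = "\<lambda>i. \<not> c i"]])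
    (auto intro: pt_not)

lemma pt_eq_Nil: "pt I x (\<lambda>i. enc_list E (xs i)) \<Longrightarrow> pt I x (\<lambda>i. enc_bool (xs i = []))"
  by (rule pt_cong[OF pt_If[where f = "\<lambda>_. enc_bool False" and g = "\<lambda>_. enc_bool True"]])
    (auto intro: pt_const)

lemma pt_hd:
  assumes "pt I x (\<lambda>i. enc_list E (xs i))" "\<And>i. i \<in> I \<Longrightarrow> xs i \<noteq> []"
  shows "pt I x (\<lambda>i. E (hd (xs i)))"
proof (rule pt_cong[OF pt_fst[OF assms(1)]])
  show "data_fst (enc_list E (xs i)) = E (hd (xs i))" if "i \<in> I" for i
    using assms(2)[OF that] by (cases "xs i") auto
qed

lemma pt_tl:
  assumes "pt I x (\<lambda>i. enc_list E (xs i))"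
  shows "pt I x (\<lambda>i. enc_list E (tl (xs i)))"
proof (rule pt_cong[OF pt_snd[OF assms]])
  show "data_snd (enc_list E (xs i)) = enc_list E (tl (xs i))" if "i \<in> I" for i
    by (cases "xs i") auto
qed

lemma pt_concat_map:
  assumes xs: "pt I x (\<lambda>i. enc_list E (xs i))"
    and g: "\<And>x'. pt (SIGMA i:I. set (xs i)) x' (\<lambda>j. x (fst j)) \<Longrightarrow>
       pt (SIGMA i:I. set (xs i)) x' (\<lambda>j. E (snd j)) \<Longrightarrow>
       pt (SIGMA i:I. set (xs i)) x' (\<lambda>j. enc_list F (g (fst j) (snd j)))"
  shows "pt I x (\<lambda>i. enc_list F (concat (map (g i) (xs i))))"
  by (rule pt_concat, rule pt_map[where E = E], rule xs, rule g)

lemma pt_filter: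
  assumes xs: "pt I x (\<lambda>i. enc_list E (xs i))"
    and b: "\<And>x'. pt (SIGMA i:I. set (xs i)) x' (\<lambda>j. x (fst j)) \<Longrightarrow>
       pt (SIGMA i:I. set (xs i)) x' (\<lambda>j. E (snd j)) \<Longrightarrow>
       pt (SIGMA i:I. set (xs i)) x' (\<lambda>j. enc_bool (b (fst j) (snd j)))"
  shows "pt I x (\<lambda>i. enc_list E (filter (b i) (xs i)))"
proof (rule pt_cong, rule pt_concat_map[where E = E and F = E and g = "\<lambda>i y. if b i y then [y] else []", OF xs])
  fix x' assume x': "pt (SIGMA i:I. set (xs i)) x' (\<lambda>j. x (fst j))" "pt (SIGMA i:I. set (xs i)) x' (\<lambda>j. E (snd j))"
  show "pt (SIGMA i:I. set (xs i)) x' (\<lambda>j. enc_list E (if b (fst j) (snd j) then [snd j] else []))"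
    by (rule pt_if'[where E = "enc_list E"], rule b, rule x'(1), rule x'(2), rule pt_Cons, rule x'(2), rule pt_Nil, rule pt_Nil)
next
  have "concat (map (\<lambda>y. if P y then [y] else []) ys) = filter P ys" for P and ys :: "'b list"
    by (induction ys) auto
  then show "enc_list E (concat (map (\<lambda>y. if b i y then [y] else []) (xs i))) = enc_list E (filter (b i) (xs i))" for i
    by simp
qed

lemma pt_list_all:
  assumes xs: "pt I x (\<lambda>i. enc_list E (xs i))"
    and b: "\<And>x'. pt (SIGMA i:I. set (xs i)) x' (\<lambda>j. x (fst j)) \<Longrightarrow>
       pt (SIGMA i:I. set (xs i)) x' (\<lambda>j. E (snd j)) \<Longrightarrow>
       pt (SIGMA i:I. set (xs i)) x' (\<lambda>j. enc_bool (b (fst j) (snd j)))"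
  shows "pt I x (\<lambda>i. enc_bool (\<forall>y\<in>set (xs i). b i y))"
proof (rule pt_cong)
  show "pt I x (\<lambda>i. enc_bool (filter (\<lambda>y. \<not> b i y) (xs i) = []))"
    by (rule pt_eq_Nil, rule pt_filter[where E = E], rule xs, rule pt_not, rule b)
qed (auto simp: filter_empty_conv)

lemma pt_foldr:
  assumes xs: "pt I x (\<lambda>i. enc_list E (xs i))" and a0: "pt I x (\<lambda>i. A (a0 i))"
    and step: "\<And>x'. pt (fold_dom I (\<lambda>i. rev (xs i)) V) x' (\<lambda>j. x (fst j)) \<Longrightarrow>
       pt (fold_dom I (\<lambda>i. rev (xs i)) V) x' (\<lambda>j. E (fst (snd j))) \<Longrightarrow>
       pt (fold_dom I (\<lambda>i. rev (xs i)) V) x' (\<lambda>j. A (snd (snd j))) \<Longrightarrow>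
       pt (fold_dom I (\<lambda>i. rev (xs i)) V) x' (\<lambda>j. A (g (fst j) (fst (snd j)) (snd (snd j))))"
    and V0: "\<And>i. i \<in> I \<Longrightarrow> V i 0 (a0 i)"
    and VS: "\<And>i n a. i \<in> I \<Longrightarrow> n < length (xs i) \<Longrightarrow> V i n a \<Longrightarrow> V i (Suc n) (g i (rev (xs i) ! n) a)"
    and B: "pbd I x B" "\<And>i n a. i \<in> I \<Longrightarrow> n \<le> length (xs i) \<Longrightarrow> V i n a \<Longrightarrow> data_size (A a) \<le> B i"
  shows "pt I x (\<lambda>i. A (foldr (g i) (xs i) (a0 i)))"
  unfolding foldr_conv_foldl
  by (rule pt_foldl[OF pt_rev[OF xs] a0 step V0 _ B(1)]) (use VS B(2) in auto)

definition enc_pair :: "('a \<Rightarrow> data) \<Rightarrow> ('b \<Rightarrow> data) \<Rightarrow> 'a \<times> 'b \<Rightarrow> data" where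
  "enc_pair E F p = Pair (E (fst p)) (F (snd p))"

lemma pt_pair: "pt I x (\<lambda>i. E (f i)) \<Longrightarrow> pt I x (\<lambda>i. F (g i)) \<Longrightarrow> pt I x (\<lambda>i. enc_pair E F (f i, g i))"
  by (simp add: enc_pair_def pt_Pair)

lemma pt_pair_fst: "pt I x (\<lambda>i. enc_pair E F (p i)) \<Longrightarrow> pt I x (\<lambda>i. E (fst (p i)))"
  using pt_fst[of I x "\<lambda>i. enc_pair E F (p i)"] by (simp add: enc_pair_def)

lemma pt_pair_snd: "pt I x (\<lambda>i. enc_pair E F (p i)) \<Longrightarrow> pt I x (\<lambda>i. F (snd (p i)))"
  using pt_snd[of I x "\<lambda>i. enc_pair E F (p i)"] by (simp add: enc_pair_def)

text \<open>Only one list drives the loop, so the rest of the other one is carried in the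
  accumulator; once it is used up, the state stays fixed.\<close>

lemma pt_zip:
  assumes "pt I x (\<lambda>i. enc_list E (xs i))" "pt I x (\<lambda>i. enc_list F (ys i))"
  shows "pt I x (\<lambda>i. enc_list (enc_pair E F) (zip (xs i) (ys i)))"
proof -
  let ?A = "enc_pair (enc_list F) (enc_list (enc_pair E F))"
  define g :: "'b \<Rightarrow> 'c list \<times> ('b \<times> 'c) list \<Rightarrow> 'c list \<times> ('b \<times> 'c) list" where
    "g y a = (if fst a = [] then a else (tl (fst a), (y, hd (fst a)) # snd a))" for y a
  let ?V = "\<lambda>i n a. a = (drop n (ys i), rev (take n (zip (xs i) (ys i))))"
  have "pt I x (\<lambda>i. ?A (foldl (\<lambda>a y. g y a) (ys i, []) (xs i)))"
  proof (rule pt_foldl[where V = ?V, OF assms(1)])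
    show "pt I x (\<lambda>i. ?A (ys i, []))" by (intro pt_pair assms pt_Nil)
    fix x' let ?D = "fold_dom I xs ?V"
    assume x': "pt ?D x' (\<lambda>j. x (fst j))" "pt ?D x' (\<lambda>j. E (fst (snd j)))" "pt ?D x' (\<lambda>j. ?A (snd (snd j)))"
    note 1 = pt_pair_fst[OF x'(3)] pt_pair_snd[OF x'(3)]
    show "pt ?D x' (\<lambda>j. ?A (g (fst (snd j)) (snd (snd j))))"
      unfolding g_def
    proof (rule pt_if)
      show "pt ?D x' (\<lambda>i. enc_bool (fst (snd (snd i)) = []))" by (rule pt_eq_Nil[OF 1(1)])
      show "pt {i \<in> ?D. fst (snd (snd i)) = []} x' (\<lambda>i. ?A (snd (snd i)))"
        by (rule pt_subset[OF x'(3)]) auto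
      let ?D' = "{i \<in> ?D. fst (snd (snd i)) \<noteq> []}"
      show "pt ?D' x' (\<lambda>i. ?A (tl (fst (snd (snd i))), (fst (snd i), hd (fst (snd (snd i)))) # snd (snd (snd i))))"
        by (intro pt_pair pt_tl pt_Cons pt_hd pt_subset[OF 1(1), of ?D'] pt_subset[OF 1(2), of ?D'] pt_subset[OF x'(2), of ?D']) auto
    qed
  next
    show "?V i (Suc n) (g (xs i ! n) a)" if "n < length (xs i)" "?V i n a" for i n a
      using that
      by (cases "n < length (ys i)")
        (auto simp: g_def take_Suc_conv_app_nth drop_Suc hd_drop_conv_nth tl_drop)
  next
    show "pbd I x (\<lambda>i. Suc (data_size (enc_list F (ys i)) +
       Suc (data_size (enc_list E (xs i)) * Suc (Suc (data_size (enc_list E (xs i)) + data_size (enc_list F (ys i)))))))"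
      by (intro pbd_Suc pbd_add pbd_mult pt_pbd assms)
    fix i n a assume V: "?V i n a"
    have 1: "data_size (enc_list (enc_pair E F) (rev (take n (zip (xs i) (ys i))))) \<le>
       Suc (data_size (enc_list E (xs i)) * Suc (Suc (data_size (enc_list E (xs i)) + data_size (enc_list F (ys i)))))"
    proof (rule data_size_list_le)
      fix p assume "p \<in> set (rev (take n (zip (xs i) (ys i))))"
      then have "(fst p, snd p) \<in> set (zip (xs i) (ys i))"
        by (auto dest: in_set_takeD)
      then have "fst p \<in> set (xs i)" "snd p \<in> set (ys i)"
        by (rule set_zip_leftD, rule set_zip_rightD)
      then show "data_size (enc_pair E F p) \<le> Suc (data_size (enc_list E (xs i)) + data_size (enc_list F (ys i)))"
        unfolding enc_pair_def by (simp add: add_mono data_size_mem)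
    next
      show "length (rev (take n (zip (xs i) (ys i)))) \<le> data_size (enc_list E (xs i))"
        using length_le_data_size[of "xs i" E] by simp
    qed
    have "data_size (?A a) = Suc (data_size (enc_list F (drop n (ys i))) +
        data_size (enc_list (enc_pair E F) (rev (take n (zip (xs i) (ys i))))))"
      unfolding V by (simp add: enc_pair_def)
    also have "\<dots> \<le> Suc (data_size (enc_list F (ys i)) +
       Suc (data_size (enc_list E (xs i)) * Suc (Suc (data_size (enc_list E (xs i)) + data_size (enc_list F (ys i))))))"
      by (rule Suc_le_mono[THEN iffD2], rule add_mono[OF data_size_drop 1])
    finally show "data_size (?A a) \<le> Suc (data_size (enc_list F (ys i)) +
       Suc (data_size (enc_list E (xs i)) * Suc (Suc (data_size (enc_list E (xs i)) + data_size (enc_list F (ys i))))))" .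
  qed auto
  note 2 = pt_rev[OF pt_pair_snd[OF this]]
  have "snd (foldl (\<lambda>a y. g y a) (ys, b) xs) = rev (zip xs ys) @ b" for xs ys b
  proof (induction xs arbitrary: ys b)
    case (Cons a xs)
    have "foldl (\<lambda>a y. g y a) ([], b) zs = ([], b)" for zs
      by (induction zs) (auto simp: g_def)
    then show ?case using Cons by (cases ys) (auto simp: g_def)
  qed simp
  with 2 show ?thesis by simp
qed

subsection \<open>Numbers and list indices\<close>

text \<open>Numbers are lists of \<open>True\<close>, so their arithmetic is list processing: sums
  by appending, truncated differences by dropping, comparisons by emptiness. Polynomial time
  accordingly refers to the value of a number.\<close>

lemma enc_nat_length: "enc_nat (length xs) = enc_list enc_bool (map (\<lambda>_. True) xs)"
  by (simp add: enc_nat_def map_replicate_const)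

lemma data_size_enc_nat: "data_size (enc_nat n) = Suc (4 * n)"
  by (induction n) (auto simp: enc_nat_def)

lemma pt_nat_pbd: "pt I x (\<lambda>i. enc_nat (n i)) \<Longrightarrow> pbd I x n"
  using pbd_le[OF pt_pbd[of I x "\<lambda>i. enc_nat (n i)"], of n] by (simp add: data_size_enc_nat)

lemma pt_length:
  assumes "pt I x (\<lambda>i. enc_list E (xs i))"
  shows "pt I x (\<lambda>i. enc_nat (length (xs i)))"
  unfolding enc_nat_length
  by (rule pt_map[where E = E and g = "\<lambda>_ _. True", OF assms]) (rule pt_const)

lemma pt_bits_of_nat: "pt I x (\<lambda>i. enc_nat (n i)) \<Longrightarrow> pt I x (\<lambda>i. enc_list enc_bool (replicate (n i) True))"
  by (simp add: enc_nat_def)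

lemma pt_replicate:
  assumes n: "pt I x (\<lambda>i. enc_nat (n i))" and y: "pt I x (\<lambda>i. E (y i))"
  shows "pt I x (\<lambda>i. enc_list E (replicate (n i) (y i)))"
proof -
  have "pt I x (\<lambda>i. enc_list E (map (\<lambda>_. y i) (replicate (n i) True)))"
    by (rule pt_map[where E = enc_bool and g = "\<lambda>i _. y i", OF pt_bits_of_nat[OF n]])
      (rule pt_lift[OF y], assumption, auto)
  then show ?thesis by simp
qed

lemma pt_nat_const: "pt I x (\<lambda>i. enc_nat m)"
  by (rule pt_const)

lemma pt_Suc:
  assumes "pt I x (\<lambda>i. enc_nat (n i))"
  shows "pt I x (\<lambda>i. enc_nat (Suc (n i)))"
  using pt_Cons[where E = enc_bool and y = "\<lambda>_. True", OF pt_const pt_bits_of_nat[OF assms]]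
  by (simp add: enc_nat_def)

lemma pt_plus:
  assumes "pt I x (\<lambda>i. enc_nat (m i))" "pt I x (\<lambda>i. enc_nat (n i))"
  shows "pt I x (\<lambda>i. enc_nat (m i + n i))"
  using pt_append[OF pt_bits_of_nat[OF assms(1)] pt_bits_of_nat[OF assms(2)]]
  by (simp add: enc_nat_def replicate_add)

lemma pt_times:
  assumes m: "pt I x (\<lambda>i. enc_nat (m i))" and n: "pt I x (\<lambda>i. enc_nat (n i))"
  shows "pt I x (\<lambda>i. enc_nat (m i * n i))"
proof -
  have "pt I x (\<lambda>i. enc_list enc_bool (concat (replicate (m i) (replicate (n i) True))))"
    by (rule pt_concat, rule pt_replicate[where E = enc_bits, OF m pt_bits_of_nat[OF n]])
  moreover have "concat (replicate a (replicate b True)) = replicate (a * b) True" for a b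
    by (induction a) (auto simp: replicate_add)
  ultimately show ?thesis by (simp add: enc_nat_def)
qed

lemma pt_drop:
  assumes n: "pt I x (\<lambda>i. enc_nat (n i))" and xs: "pt I x (\<lambda>i. enc_list E (xs i))"
  shows "pt I x (\<lambda>i. enc_list E (drop (n i) (xs i)))"
proof -
  have "pt I x (\<lambda>i. enc_list E (foldl (\<lambda>a _. tl a) (xs i) (replicate (n i) True)))"
  proof (rule pt_foldl[where V = "\<lambda>i k a. a = drop k (xs i)" and g = "\<lambda>_ _ a. tl a",
        OF pt_bits_of_nat[OF n] xs _ _ _ pt_pbd[OF xs]])
    fix x' assume "pt (fold_dom I (\<lambda>i. replicate (n i) True) (\<lambda>i k a. a = drop k (xs i))) x' (\<lambda>j. enc_list E (snd (snd j)))"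
    then show "pt (fold_dom I (\<lambda>i. replicate (n i) True) (\<lambda>i k a. a = drop k (xs i))) x' (\<lambda>j. enc_list E (tl (snd (snd j))))"
      by (rule pt_tl)
  qed (auto simp: drop_Suc tl_drop data_size_drop)
  moreover have "foldl (\<lambda>a _. tl a) ys (replicate k True) = drop k ys" for k and ys :: "'b list"
    by (induction k arbitrary: ys) (auto simp: drop_Suc)
  ultimately show ?thesis by simp
qed

lemma pt_minus:
  assumes "pt I x (\<lambda>i. enc_nat (m i))" "pt I x (\<lambda>i. enc_nat (n i))"
  shows "pt I x (\<lambda>i. enc_nat (m i - n i))"
  using pt_drop[OF assms(2) pt_bits_of_nat[OF assms(1)]] by (simp add: enc_nat_def)

lemma pt_map_snd:
  assumes "pt I x (\<lambda>i. enc_list (enc_pair E F) (ps i))"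
  shows "pt I x (\<lambda>i. enc_list F (map snd (ps i)))"
  by (rule pt_map[where g = "\<lambda>_. snd", OF assms]) (rule pt_pair_snd)

lemma pt_take:
  assumes n: "pt I x (\<lambda>i. enc_nat (n i))" and xs: "pt I x (\<lambda>i. enc_list E (xs i))"
  shows "pt I x (\<lambda>i. enc_list E (take (n i) (xs i)))"
proof -
  have "pt I x (\<lambda>i. enc_list E (map snd (zip (replicate (n i) True) (xs i))))"
    by (rule pt_map_snd, rule pt_zip[OF pt_bits_of_nat[OF n] xs])
  moreover have "map snd (zip (replicate k True) ys) = take k ys" for k and ys :: "'b list"
    by (induction ys arbitrary: k) (auto simp: take_Cons' gr0_conv_Suc)
  ultimately show ?thesis by simp
qed

lemma pt_nth:
  assumes n: "pt I x (\<lambda>i. enc_nat (n i))" and xs: "pt I x (\<lambda>i. enc_list E (xs i))"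
    and "\<And>i. i \<in> I \<Longrightarrow> n i < length (xs i)"
  shows "pt I x (\<lambda>i. E (xs i ! n i))"
  by (rule pt_cong[OF pt_hd[OF pt_drop[OF n xs]]]) (use assms(3) in \<open>auto simp: hd_drop_conv_nth not_le\<close>)

lemma pt_upt:
  assumes n: "pt I x (\<lambda>i. enc_nat (n i))"
  shows "pt I x (\<lambda>i. enc_list enc_nat [0..<n i])"
proof -
  \<comment> \<open>The length of the accumulator is the next number to be listed, so no separate
    counter is needed.\<close>
  define g :: "nat list \<Rightarrow> nat list" where "g a = length a # a" for a
  have "pt I x (\<lambda>i. enc_list enc_nat (foldl (\<lambda>a _. g a) [] (replicate (n i) True)))"
  proof (rule pt_foldl[where V = "\<lambda>i k a. a = rev [0..<k]" and g = "\<lambda>_ _. g" and A = "enc_list enc_nat", OF pt_bits_of_nat[OF n] pt_Nil])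
    let ?D = "fold_dom I (\<lambda>i. replicate (n i) True) (\<lambda>i k a. a = rev [0..<k])"
    fix x' assume "pt ?D x' (\<lambda>j. enc_list enc_nat (snd (snd j)))"
    then show "pt ?D x' (\<lambda>j. enc_list enc_nat (g (snd (snd j))))"
      unfolding g_def by (intro pt_Cons pt_length)
  next
    show "pbd I x (\<lambda>i. Suc (n i * Suc (Suc (4 * n i))))"
      by (intro pbd_Suc pbd_mult pt_nat_pbd n pbd_const)
    show "data_size (enc_list enc_nat a) \<le> Suc (n i * Suc (Suc (4 * n i)))"
      if "k \<le> length (replicate (n i) True)" "a = rev [0..<k]" for i k a
      by (rule data_size_list_le) (use that in \<open>auto simp: data_size_enc_nat\<close>)
  qed (auto simp: g_def)
  note 1 = pt_rev[OF this]
  have "foldl (\<lambda>a _. g a) [] (replicate k True) = rev [0..<k]" for k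
  proof (induction k)
    case (Suc k)
    have "replicate (Suc k) True = replicate k True @ [True]" by (simp add: replicate_append_same)
    then show ?case using Suc by (simp add: g_def del: replicate.simps)
  qed simp
  with 1 show ?thesis by simp
qed

lemma pt_le:
  assumes "pt I x (\<lambda>i. enc_nat (m i))" "pt I x (\<lambda>i. enc_nat (n i))"
  shows "pt I x (\<lambda>i. enc_bool (m i \<le> n i))"
  using pt_eq_Nil[OF pt_drop[OF assms(2) pt_bits_of_nat[OF assms(1)]]] by simp

lemma pt_less:
  assumes "pt I x (\<lambda>i. enc_nat (m i))" "pt I x (\<lambda>i. enc_nat (n i))"
  shows "pt I x (\<lambda>i. enc_bool (m i < n i))"
  using pt_not[OF pt_le[OF assms(2,1)]] by (simp add: not_le)

lemma pt_nat_eq: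
  assumes "pt I x (\<lambda>i. enc_nat (m i))" "pt I x (\<lambda>i. enc_nat (n i))"
  shows "pt I x (\<lambda>i. enc_bool (m i = n i))"
  by (rule pt_cong[OF pt_conj[OF pt_le[OF assms] pt_le[OF assms(2,1)]]]) (simp add: order_eq_iff)

lemma pt_bits_eq:
  assumes "pt I x (\<lambda>i. enc_bits (v i))" "pt I x (\<lambda>i. enc_bits (w i))"
  shows "pt I x (\<lambda>i. enc_bool (v i = w i))"
proof (rule pt_cong)
  have "pt I x (\<lambda>i. enc_bool (\<forall>p\<in>set (zip (v i) (w i)). fst p = snd p))"
    by (rule pt_list_all[OF pt_zip[OF assms]], rule pt_bool_eq, rule pt_pair_fst, assumption,
        rule pt_pair_snd, assumption)
  then show "pt I x (\<lambda>i. enc_bool (length (v i) = length (w i) \<and> (\<forall>p\<in>set (zip (v i) (w i)). fst p = snd p)))"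
    by (intro pt_conj pt_nat_eq pt_length[where E = enc_bool] assms)
  have "(length v = length w \<and> (\<forall>p\<in>set (zip v w). fst p = snd p)) = (v = w)" for v w :: "bool list"
    by (auto simp: list_eq_iff_zip_eq)
  then show "enc_bool (length (v i) = length (w i) \<and> (\<forall>p\<in>set (zip (v i) (w i)). fst p = snd p)) = enc_bool (v i = w i)" for i
    by simp
qed

subsection \<open>Programs with arbitrary initial stores\<close>

primrec expr_bound :: "expr \<Rightarrow> nat" where
  "expr_bound (Var i) = Suc i"
| "expr_bound (Quote a) = 0"
| "expr_bound (Fst e) = expr_bound e"
| "expr_bound (Snd e) = expr_bound e"
| "expr_bound (Mk e e') = max (expr_bound e) (expr_bound e')"

text \<open>In contrast to \<open>var_bound\<close> this also covers variables that are read. Stores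
  that agree below the bound are therefore indistinguishable for the program, and a register beyond
  it is free for other purposes.\<close>

primrec occ_bound :: "com \<Rightarrow> nat" where
  "occ_bound (Assign i e) = max (Suc i) (expr_bound e)"
| "occ_bound (Flip i) = Suc i"
| "occ_bound (Sample i) = Suc i"
| "occ_bound (Seq c c') = max (occ_bound c) (occ_bound c')"
| "occ_bound (Cond e c c') = max (expr_bound e) (max (occ_bound c) (occ_bound c'))"
| "occ_bound (While e c) = max (expr_bound e) (occ_bound c)"

lemma eval_expr_cong: "(\<And>v. v < expr_bound e \<Longrightarrow> s v = s' v) \<Longrightarrow> eval_expr e s = eval_expr e s'"
  by (induction e) auto

lemma step_cong:
  assumes "cf \<in> set_pmf (step orc (cs, s))" "\<forall>c\<in>set cs. occ_bound c \<le> b" "\<And>v. v < b \<Longrightarrow> s v = s' v"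
  shows "\<exists>cf'\<in>set_pmf (step orc (cs, s')). fst cf' = fst cf \<and> (\<forall>v<b. snd cf v = snd cf' v) \<and>
     (\<forall>c\<in>set (fst cf). occ_bound c \<le> b)"
proof (cases cs)
  case (Cons c cs')
  have e: "eval_expr e s = eval_expr e s'" if "expr_bound e \<le> b" for e
    by (rule eval_expr_cong) (use that assms(3) in auto)
  show ?thesis using assms e unfolding Cons by (cases c) auto
qed (use assms in auto)

lemma steps_cong:
  assumes "cf \<in> set_pmf (steps orc t (cs, s))" "\<forall>c\<in>set cs. occ_bound c \<le> b" "\<And>v. v < b \<Longrightarrow> s v = s' v"
  shows "\<exists>cf'\<in>set_pmf (steps orc t (cs, s')). fst cf' = fst cf \<and> (\<forall>v<b. snd cf v = snd cf' v)"
  using assms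
proof (induction t arbitrary: cs s s')
  case (Suc t)
  then obtain cf1 where 1: "cf1 \<in> set_pmf (step orc (cs, s))" "cf \<in> set_pmf (steps orc t cf1)" by auto
  obtain cf1' where 2: "cf1' \<in> set_pmf (step orc (cs, s'))" "fst cf1' = fst cf1"
    "\<forall>v<b. snd cf1 v = snd cf1' v" "\<forall>c\<in>set (fst cf1). occ_bound c \<le> b"
    using step_cong[OF 1(1) Suc.prems(2,3)] by blast
  have "cf1' = (fst cf1, snd cf1')" using 2(2) by (simp add: prod_eq_iff)
  moreover have "\<exists>cf'\<in>set_pmf (steps orc t (fst cf1, snd cf1')). fst cf' = fst cf \<and> (\<forall>v<b. snd cf v = snd cf' v)"
    by (rule Suc.IH[of "fst cf1" "snd cf1"]) (use 1(2) 2 in auto)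
  ultimately obtain cf' where "cf' \<in> set_pmf (steps orc t cf1')" "fst cf' = fst cf" "\<forall>v<b. snd cf v = snd cf' v"
    by auto
  then show ?case using 2(1) by (intro bexI[of _ cf']) auto
qed auto

lemma tot_cong:
  assumes "tot [c] s t (\<lambda>s'. s' 0 = d)" "\<And>v. v < Suc (occ_bound c) \<Longrightarrow> s' v = s v"
  shows "tot [c] s' t (\<lambda>s'. s' 0 = d)"
  unfolding tot_def
proof
  fix cf assume "cf \<in> set_pmf (steps no_oracle t ([c], s'))"
  from steps_cong[OF this, of "Suc (occ_bound c)" s] assms(2)
  obtain cf' where "cf' \<in> set_pmf (steps no_oracle t ([c], s))" "fst cf' = fst cf" "snd cf 0 = snd cf' 0"
    by auto
  then show "fst cf = [] \<and> snd cf 0 = d" using assms(1) unfolding tot_def by auto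
qed

text \<open>Recreates the empty store that \<open>start\<close> presupposes. Algorithms known only
  through \<open>halts_in\<close> and \<open>outcome\<close> can then be called in the middle of a
  larger program.\<close>

primrec resets :: "nat \<Rightarrow> com" where
  "resets 0 = Assign 0 (Var 0)"
| "resets (Suc n) = Seq (resets n) (Assign (Suc n) (Quote Atom))"

lemma tot_resets: "tot [resets n] s (Suc (2 * n)) (\<lambda>s'. s' = (\<lambda>v. if 1 \<le> v \<and> v \<le> n then Atom else s v))"
proof (induction n)
  case 0
  show ?case
    unfolding resets.simps
    by (rule tot_weaken[OF tot_Assign[where Q = "\<lambda>s'. s' = s"]]) (auto simp: fun_eq_iff)
next
  case (Suc n)
  show ?case
    unfolding resets.simps
    by (rule tot_time, rule tot_Seq2[OF Suc.IH], rule tot_Assign) (auto simp: fun_eq_iff)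
qed

section \<open>Transfer between the machine model and total correctness\<close>

lemma halts_in_iff: "halts_in orc c a t \<longleftrightarrow> halted (steps orc t (start c a))"
  by (auto simp: halts_in_def halted_def)

text \<open>Halted configurations no longer change, so the least halting time in
  \<open>outcome\<close> may be replaced by any known bound.\<close>

lemma outcome_eq:
  assumes "halts_in orc c a t"
  shows "outcome orc c a = map_pmf (\<lambda>cf. snd cf 0) (steps orc t (start c a))"
proof -
  let ?t = "LEAST t. halts_in orc c a t"
  have "halts_in orc c a ?t" "?t \<le> t" using assms by (auto intro: LeastI Least_le)
  then show ?thesis unfolding outcome_def halts_in_iff using steps_stable by metis
qed

lemma tot_of_outcome:
  assumes "halts_in no_oracle c a t" "outcome no_oracle c a = return_pmf d"
  shows "tot [c] ((\<lambda>_. Atom)(0 := a)) t (\<lambda>s'. s' 0 = d)"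
proof -
  have "map_pmf (\<lambda>cf. snd cf 0) (steps no_oracle t (start c a)) = return_pmf d"
    using outcome_eq[OF assms(1)] assms(2) by simp
  then have "(\<lambda>cf. snd cf 0) ` set_pmf (steps no_oracle t (start c a)) = {d}"
    by (metis set_map_pmf set_return_pmf)
  then show ?thesis
    using assms(1) unfolding tot_def halts_in_def start_def by auto
qed

lemma outcome_of_tot:
  assumes "tot [c] ((\<lambda>_. Atom)(0 := a)) t (\<lambda>s'. s' 0 = d)"
  shows "halts_in no_oracle c a t" "outcome no_oracle c a = return_pmf d"
proof -
  show h: "halts_in no_oracle c a t"
    using assms unfolding tot_def halts_in_def start_def by auto
  have "map_pmf (\<lambda>cf. snd cf 0) (steps no_oracle t (start c a)) =
      map_pmf (\<lambda>_. d) (steps no_oracle t (start c a))"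
    by (rule map_pmf_cong[OF refl]) (use assms in \<open>auto simp: tot_def start_def\<close>)
  then show "outcome no_oracle c a = return_pmf d"
    unfolding outcome_eq[OF h] by simp
qed

lemma pt_imp_poly_time_computable:
  assumes "pt I inp f"
  shows "poly_time_computable I inp f"
proof -
  obtain c T where T: "pbd I inp T"
    and c: "\<And>i s. i \<in> I \<Longrightarrow> s 0 = inp i \<Longrightarrow> tot [c] s (T i) (\<lambda>s'. s' 0 = f i)"
    using assms unfolding pt_def by blast
  obtain p where p: "\<And>i. i \<in> I \<Longrightarrow> T i \<le> poly p (data_size (inp i))"
    using T unfolding pbd_def by blast
  have "tot [c] ((\<lambda>_. Atom)(0 := inp i)) (poly p (data_size (inp i))) (\<lambda>s'. s' 0 = f i)" if "i \<in> I" for i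
    by (rule tot_time[OF c[OF that] p[OF that]]) simp
  from outcome_of_tot[OF this] show ?thesis
    unfolding poly_time_computable_def ppt_computable_def by blast
qed

text \<open>
  Since \<open>Mk\<close> shares subtrees, a program can build trees of exponential size, but the height of the
  values grows by a constant per step. This bounds the size of outputs that are lists of bit strings.
\<close>

primrec height :: "data \<Rightarrow> nat" where
  "height Atom = 0"
| "height (Pair a b) = Suc (max (height a) (height b))"

lemma height_le_size: "height d \<le> data_size d"
  by (induction d) auto

lemma height_eval_expr: "(\<And>v. height (s v) \<le> H) \<Longrightarrow> height (eval_expr e s) \<le> H + expr_size e"
proof (induction e)
  case (Quote a)
  then show ?case using height_le_size[of a] by simp
next
  case (Fst e)
  then show ?case by (cases "eval_expr e s") auto
next
  case (Snd e)
  then show ?case by (cases "eval_expr e s") auto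
qed (auto intro: le_SucI trans_le_add1)

lemma height_step:
  assumes "cf \<in> set_pmf (step no_oracle (cs, s))" "\<forall>c\<in>set cs. com_size c \<le> S" "\<And>v. height (s v) \<le> H"
  shows "(\<forall>c\<in>set (fst cf). com_size c \<le> S) \<and> height (snd cf v) \<le> H + S + 2"
proof (cases cs)
  case Nil
  then show ?thesis using assms(1,3) by (auto intro!: le_SucI trans_le_add1)
next
  case (Cons c cs')
  have b: "height (enc_bool x) \<le> 2" for x by (cases x) auto
  have H: "height (s v) \<le> H + S + 2" for v using assms(3)[of v] by simp
  show ?thesis
  proof (cases c)
    case (Assign i e)
    then show ?thesis
      using assms height_eval_expr[of s H e] H unfolding Cons by (auto intro: order_trans)
  next
    case (Flip i)
    have "height (enc_bool x) \<le> H + S + 2" for x using b[of x] by simp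
    then show ?thesis
      using assms H Flip unfolding Cons by auto
  qed (use assms H in \<open>auto simp: Cons no_oracle_def\<close>)
qed

lemma height_steps:
  assumes "cf \<in> set_pmf (steps no_oracle t (cs, s))" "\<forall>c\<in>set cs. com_size c \<le> S" "\<And>v. height (s v) \<le> H"
  shows "height (snd cf v) \<le> H + t * (S + 2)"
  using assms
proof (induction t arbitrary: cs s H)
  case (Suc t)
  then obtain cf1 where 1: "cf1 \<in> set_pmf (step no_oracle (cs, s))" "cf \<in> set_pmf (steps no_oracle t cf1)" by auto
  have "height (snd cf v) \<le> (H + S + 2) + t * (S + 2)"
    by (rule Suc.IH[of "fst cf1" "snd cf1"]) (use 1 height_step[OF 1(1) Suc.prems(2,3)] in auto)
  then show ?case by (simp add: algebra_simps)
qed (auto intro: order_trans)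

text \<open>The assumptions on signatures, codes and fields speak of time only. The output size that
  \<open>pt\<close> requires is recovered for output formats whose size is polynomial in their
  height.\<close>

lemma pt_of_poly_time_computable:
  assumes "poly_time_computable I inp f" and q: "\<And>i. i \<in> I \<Longrightarrow> data_size (f i) \<le> poly q (height (f i))"
  shows "pt I inp f"
proof -
  obtain c p where c: "\<And>i. i \<in> I \<Longrightarrow> halts_in no_oracle c (inp i) (poly p (data_size (inp i)))"
    "\<And>i. i \<in> I \<Longrightarrow> outcome no_oracle c (inp i) = return_pmf (f i)"
    using assms(1) unfolding poly_time_computable_def ppt_computable_def by blast
  define T where "T i = poly p (data_size (inp i))" for i
  have T: "pbd I inp T" unfolding T_def by (intro pbd_poly pbd_size)
  have run: "tot [c] ((\<lambda>_. Atom)(0 := inp i)) (T i) (\<lambda>s'. s' 0 = f i)" if "i \<in> I" for i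
    unfolding T_def by (rule tot_of_outcome) (use c that in auto)
  show ?thesis
  proof (rule ptI)
    have h: "height (f i) \<le> data_size (inp i) + T i * (com_size c + 2)" if i: "i \<in> I" for i
    proof -
      obtain cf where cf: "cf \<in> set_pmf (steps no_oracle (T i) ([c], (\<lambda>_. Atom)(0 := inp i)))"
        using set_pmf_not_empty[of "steps no_oracle (T i) ([c], (\<lambda>_. Atom)(0 := inp i))"] by blast
      then have "height (snd cf 0) \<le> data_size (inp i) + T i * (com_size c + 2)"
        by (rule height_steps) (auto simp: height_le_size)
      moreover have "snd cf 0 = f i" using run[OF i] cf by (auto simp: tot_def)
      ultimately show ?thesis by simp
    qed
    show "pbd I inp (\<lambda>i. data_size (f i))"
    proof (rule pbd_le)
      show "pbd I inp (\<lambda>i. poly q (data_size (inp i) + T i * (com_size c + 2)))"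
        by (intro pbd_poly pbd_add pbd_mult pbd_size pbd_const T)
      show "data_size (f i) \<le> poly q (data_size (inp i) + T i * (com_size c + 2))" if "i \<in> I" for i
        using q[OF that] poly_nat_mono[OF h[OF that], of q] by simp
    qed
    let ?n = "occ_bound c"
    show "pbd I inp (\<lambda>i. Suc (Suc (2 * ?n) + T i))" by (intro pbd_Suc pbd_add pbd_const T)
    fix i and s :: store assume i: "i \<in> I" "s 0 = inp i"
    show "tot [Seq (resets ?n) c] s (Suc (Suc (2 * ?n) + T i)) (\<lambda>s'. s' 0 = f i)"
      by (rule tot_Seq2[OF tot_resets], rule tot_cong[OF run[OF i(1)]]) (use i(2) in auto)
  qed
qed

lemma length_le_height: "length xs \<le> height (enc_list E xs)"
  by (induction xs) auto

lemma height_mem: "y \<in> set xs \<Longrightarrow> height (E y) \<le> height (enc_list E xs)"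
  by (induction xs) (auto intro: le_SucI max.coboundedI1 max.coboundedI2)

lemma data_size_bits: "data_size (enc_bits w) \<le> Suc (length w * 4)"
proof -
  have "data_size (enc_bool b) \<le> 3" for b by (cases b) auto
  then show ?thesis using data_size_list_le[of w enc_bool 3 "length w"] by simp
qed

lemma pt_of_computable_bits:
  assumes "poly_time_computable I inp (\<lambda>i. enc_bits (f i))"
  shows "pt I inp (\<lambda>i. enc_bits (f i))"
proof (rule pt_of_poly_time_computable[OF assms, of "[:1, 4:]"])
  show "data_size (enc_bits (f i)) \<le> poly [:1, 4:] (height (enc_bits (f i)))" for i
    using data_size_bits[of "f i"] length_le_height[of "f i" enc_bool] by simp
qed

lemma pt_of_computable_nat:
  assumes "poly_time_computable I inp (\<lambda>i. enc_nat (f i))"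
  shows "pt I inp (\<lambda>i. enc_nat (f i))"
  using pt_of_computable_bits[of I inp "\<lambda>i. replicate (f i) True"] assms by (simp add: enc_nat_def)

lemma pt_of_computable_bool:
  assumes "poly_time_computable I inp (\<lambda>i. enc_bool (f i))"
  shows "pt I inp (\<lambda>i. enc_bool (f i))"
proof (rule pt_of_poly_time_computable[OF assms, of "[:3:]"])
  show "data_size (enc_bool (f i)) \<le> poly [:3:] (height (enc_bool (f i)))" for i
    by (cases "f i") auto
qed

lemma pt_of_computable_vec:
  assumes "poly_time_computable I inp (\<lambda>i. enc_list enc_bits (f i))"
  shows "pt I inp (\<lambda>i. enc_list enc_bits (f i))"
\<comment> \<open>The polynomial is 1 + h (2 + 4 h): at most h strings, each of at most h bits and
  hence of size at most 4 h + 1, with one \<open>Pair\<close> node per entry.\<close>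
proof (rule pt_of_poly_time_computable[OF assms, of "[:1:] + [:0, 1:] * [:2, 4:]"])
  fix i let ?h = "height (enc_list enc_bits (f i))"
  have "data_size (enc_list enc_bits (f i)) \<le> Suc (?h * Suc (Suc (?h * 4)))"
  proof (rule data_size_list_le[OF _ length_le_height])
    fix w assume "w \<in> set (f i)"
    then have "length w \<le> ?h"
      using height_mem[of w "f i" enc_bits] length_le_height[of w enc_bool] by simp
    then show "data_size (enc_bits w) \<le> Suc (?h * 4)" using data_size_bits[of w] by simp
  qed
  then show "data_size (enc_list enc_bits (f i)) \<le> poly ([:1:] + [:0, 1:] * [:2, 4:]) ?h"
    by (simp add: algebra_simps)
qed

section \<open>Guruswami--Sudan decoding\<close>

subsection \<open>Interpolation\<close>

text \<open>This is Q(X + a, Y + y), where X is the variable of the coefficients and Y the outer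
  one. Its coefficients are the Hasse derivatives of Q at (a, y); they express multiplicity also in
  characteristic 2, where ordinary derivatives lose information.\<close>

definition shift :: "'a :: field \<Rightarrow> 'a \<Rightarrow> 'a poly poly \<Rightarrow> 'a poly poly" where
  "shift a y Q = pcompose (map_poly (\<lambda>c. pcompose c [:a, 1:]) Q) [:[:y:], 1:]"

lemma map_poly_add':
  assumes "f 0 = 0" "\<And>x y. f (x + y) = f x + f y"
  shows "map_poly f (p + q) = map_poly f p + map_poly f q"
  by (intro poly_eqI) (simp add: coeff_map_poly assms)

lemma shift_lin: "shift a y (smult [:c:] p + smult [:d:] q) = smult [:c:] (shift a y p) + smult [:d:] (shift a y q)"
  by (simp add: shift_def map_poly_add' map_poly_smult pcompose_add pcompose_mult pcompose_smult)

lemma shift_monom: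
  "shift a y (monom (monom 1 i) j) = smult ([:a, 1:] ^ i) ([:[:y:], 1:] ^ j)"
proof -
  have *: "pcompose (monom c n) q = smult c (q ^ n)" for c :: "'b :: comm_semiring_1" and n q
    by (induction n) (auto simp: monom_0 monom_Suc pcompose_pCons mult.commute)
  show ?thesis by (simp add: shift_def map_poly_monom *)
qed

lemma coeff_const_poly_power: "coeff ([:[:y:], 1:] ^ j) s = [:coeff ([:y, 1:] ^ j) s:]"
  for y :: "'a :: comm_ring_1"
proof (induction j arbitrary: s)
  case 0
  then show ?case by (cases s) (auto simp: one_pCons)
next
  case (Suc j)
  then show ?case by (cases s) (auto simp: coeff_pCons algebra_simps)
qed

text \<open>On a monomial the Taylor expansion factors into two binomial expansions. The decoder can
  therefore compute constraints from powers of linear polynomials without expanding a bivariate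
  shift.\<close>

lemma coeff_shift_monom:
  "coeff (coeff (shift a y (monom (monom 1 i) j)) s) r = coeff ([:a, 1:] ^ i) r * coeff ([:y, 1:] ^ j) s"
  by (simp add: shift_monom coeff_const_poly_power mult.commute)

lemma poly_shift: "poly (shift a y Q) (pcompose f [:a, 1:] - [:y:]) = pcompose (poly Q f) [:a, 1:]"
proof -
  have "poly (map_poly (\<lambda>c. pcompose c [:a, 1:]) Q) (pcompose f [:a, 1:]) = pcompose (poly Q f) [:a, 1:]"
    by (induction Q) (simp_all add: map_poly_pCons pcompose_add pcompose_mult)
  then show ?thesis by (simp add: shift_def poly_pcompose)
qed

text \<open>After the point has been moved to the origin, f becomes a polynomial g divisible by X. A
  term of Y-degree s \<le> k is then divisible by X^(k-s) through its coefficient and by X^s through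
  g^s.\<close>

lemma multiplicity_dvd:
  fixes Q :: "'a :: field poly poly"
  assumes zero: "\<And>r s. r + s < k \<Longrightarrow> coeff (coeff (shift a y Q) s) r = 0" and f: "poly f a = y"
  shows "[:- a, 1:] ^ k dvd poly Q f"
proof -
  let ?g = "pcompose f [:a, 1:] - [:y:]" and ?S = "shift a y Q" and ?X = "[:0, 1:] :: 'a poly"
  have X_dvd: "?X ^ n dvd p" if "\<And>i. i < n \<Longrightarrow> coeff p i = 0" for n and p :: "'a poly"
    using that by (simp add: monom_1_dvd_iff' flip: monom_altdef[of 1, simplified])
  have "poly ?g 0 = 0" using f by (simp add: poly_pcompose)
  then have g: "?X dvd ?g" using poly_eq_0_iff_dvd[of ?g 0] by simp
  have "?X ^ k dvd coeff ?S s * ?g ^ s" for s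
  proof (cases "s \<le> k")
    case True
    have "?X ^ (k - s) * ?X ^ s dvd coeff ?S s * ?g ^ s"
      by (intro mult_dvd_mono dvd_power_same g X_dvd zero) (use True in auto)
    then show ?thesis using True by (simp flip: power_add)
  next
    case False
    then have "?X ^ k dvd ?X ^ s" by (simp add: le_imp_power_dvd)
    also have "\<dots> dvd ?g ^ s" by (rule dvd_power_same[OF g])
    finally show ?thesis by simp
  qed
  then have "?X ^ k dvd poly ?S ?g" unfolding poly_altdef by (intro dvd_sum) auto
  then obtain u where "pcompose (poly Q f) [:a, 1:] = ?X ^ k * u"
    by (auto simp: poly_shift)
  then have "pcompose (pcompose (poly Q f) [:a, 1:]) [:- a, 1:] = pcompose (?X ^ k * u) [:- a, 1:]" by simp
  moreover have "pcompose (?X ^ k) [:- a, 1:] = [:- a, 1:] ^ k"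
  proof (induction k)
    case (Suc k)
    then show ?case
      unfolding power_Suc pcompose_mult by (simp add: pcompose_pCons)
  qed (simp add: pcompose_1)
  ultimately have "poly Q f = [:- a, 1:] ^ k * pcompose u [:- a, 1:]"
    by (simp add: pcompose_mult pcompose_pCons flip: pcompose_assoc)
  then show ?thesis by simp
qed

lemma sum_order_le_degree:
  assumes "p \<noteq> 0" "finite A"
  shows "(\<Sum>a\<in>A. order a p) \<le> degree (p :: 'a :: idom poly)"
proof -
  have "(\<Sum>a\<in>A. order a p) = (\<Sum>a\<in>A \<inter> set_mset (proots p). count (proots p) a)"
    using assms by (intro sum.mono_neutral_cong_right) (auto simp: order_root)
  also have "\<dots> \<le> size (proots p)"
    unfolding size_multiset_overloaded_eq by (intro sum_mono2) auto
  finally show ?thesis using size_proots_le[of p] by simp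
qed

text \<open>Each of the at least t agreement points is a zero of Q(X, f(X)) of multiplicity at least
  k, while the weighted degree of Q keeps the degree of Q(X, f(X)) below t k.\<close>

lemma interpolation_root:
  fixes Q :: "'a :: field poly poly"
  assumes dvd: "\<And>a. a \<in> A \<Longrightarrow> [:- a, 1:] ^ k dvd poly Q f" and A: "finite A" "card A \<ge> t"
    and supp: "\<And>i j. coeff (coeff Q j) i \<noteq> 0 \<Longrightarrow> i + (k - 1) * j < t * k" and f: "degree f \<le> k - 1"
  shows "poly Q f = 0"
proof (rule ccontr)
  assume nz: "poly Q f \<noteq> 0"
  have "t * k \<le> (\<Sum>a\<in>A. k)" using A by simp
  also have "\<dots> \<le> (\<Sum>a\<in>A. order a (poly Q f))"
    by (intro sum_mono) (use dvd nz in \<open>simp add: order_divides\<close>)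
  also have "\<dots> \<le> degree (poly Q f)" by (rule sum_order_le_degree[OF nz A(1)])
  finally have le: "t * k \<le> degree (poly Q f)" .
  \<comment> \<open>Every summand of Q(X, f(X)) has degree below t k, so the coefficient at the
    supposed degree, which is the leading one, vanishes.\<close>
  have "coeff (poly Q f) (degree (poly Q f)) = 0"
  proof -
    have "coeff (coeff Q j * f ^ j) (degree (poly Q f)) = 0" for j
    proof (cases "coeff Q j = 0")
      case False
      have "degree (coeff Q j * f ^ j) \<le> degree (coeff Q j) + (k - 1) * j"
        using degree_mult_le[of "coeff Q j" "f ^ j"] degree_power_le[of f j] mult_le_mono1[OF f, of j] by linarith
      also have "\<dots> < t * k" by (rule supp) (use False in simp)
      finally show ?thesis using le by (simp add: coeff_eq_0)
    qed simp
    then show ?thesis unfolding poly_altdef by (simp add: coeff_sum)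
  qed
  then show False using nz by simp
qed

subsection \<open>Branching of the root search\<close>

text \<open>The substitution \<open>Q(X, XY + b)\<close> turns the order of the root \<open>b\<close> of \<open>Q(0, Y)\<close> into a bound for the degree of the next level.\<close>

definition eval_X0 :: "'a :: field poly poly \<Rightarrow> 'a poly" where
  "eval_X0 Q = map_poly (\<lambda>c. coeff c 0) Q"

lemma coeff_eval_X0: "coeff (eval_X0 Q) j = coeff (coeff Q j) 0"
  by (simp add: eval_X0_def coeff_map_poly)

lemma eval_X0_pCons: "eval_X0 (pCons c Q) = pCons (coeff c 0) (eval_X0 Q)"
  by (simp add: eval_X0_def map_poly_pCons)

lemma eval_X0_add: "eval_X0 (p + q) = eval_X0 p + eval_X0 q"
  by (simp add: eval_X0_def map_poly_add')

lemma eval_X0_0 [simp]: "eval_X0 0 = 0"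
  by (simp add: eval_X0_def)

lemma eval_X0_smult: "eval_X0 (smult c p) = smult (coeff c 0) (eval_X0 p)"
  by (rule poly_eqI) (simp add: coeff_eval_X0 coeff_mult_0)

lemma eval_X0_pcompose: "eval_X0 (pcompose Q [:[:b:], 1:]) = pcompose (eval_X0 Q) [:b, 1:]"
proof (induction Q)
  case (pCons c Q)
  have "pcompose (pCons c Q) [:[:b:], 1:] = [:c:] + (smult [:b:] (pcompose Q [:[:b:], 1:]) + pCons 0 (pcompose Q [:[:b:], 1:]))"
    by (simp add: pcompose_pCons)
  then show ?case using pCons
    by (simp add: eval_X0_add eval_X0_smult eval_X0_pCons pcompose_pCons eval_X0_0)
qed (simp add: eval_X0_0)

text \<open>Let S = Q(X, Y + b) and let m be the order of b. The coefficient of Y^m in S does not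
  vanish at X = 0, and X^v divides X^i times the i-th coefficient of S for all i; at i = m this
  forces v \<le> m. For i > m a positive power of X then remains in the i-th coefficient of
  R.\<close>

lemma branch_degree:
  fixes Q R :: "'a :: field poly poly"
  assumes R: "pcompose Q [:[:b:], [:0, 1:]:] = smult ([:0, 1:] ^ v) R" and Q: "eval_X0 Q \<noteq> 0"
  shows "degree (eval_X0 R) \<le> order b (eval_X0 Q)"
proof -
  let ?X = "[:0, 1:] :: 'a poly" and ?m = "order b (eval_X0 Q)" and ?S = "pcompose Q [:[:b:], 1:]"
  obtain h where h: "eval_X0 Q = [:- b, 1:] ^ ?m * h" "\<not> [:- b, 1:] dvd h"
    using order_decomp[OF Q] by blast
  have "pcompose (eval_X0 Q) [:b, 1:] = ?X ^ ?m * pcompose h [:b, 1:]"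
  proof -
    have "pcompose ([:- b, 1:] ^ n) [:b, 1:] = ?X ^ n" for n
    proof (induction n)
      case (Suc n)
      then show ?case
        unfolding power_Suc pcompose_mult by (simp add: pcompose_pCons)
    qed (simp add: pcompose_1)
    then show ?thesis by (subst h(1)) (simp add: pcompose_mult)
  qed
  then have "coeff (coeff ?S ?m) 0 = coeff (?X ^ ?m * pcompose h [:b, 1:]) ?m"
    by (simp flip: eval_X0_pcompose coeff_eval_X0)
  also have "\<dots> = poly h b"
    by (simp add: coeff_monom_mult flip: monom_altdef[of 1, simplified])
  finally have Sm: "coeff (coeff ?S ?m) 0 \<noteq> 0"
    using h(2) by (simp add: poly_eq_0_iff_dvd)
  have "pcompose Q [:[:b:], ?X:] = pcompose ?S [:0, ?X:]"
    by (simp add: pcompose_assoc[symmetric] pcompose_pCons)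
  then have S: "?X ^ i * coeff ?S i = ?X ^ v * coeff R i" for i
    using R coeff_pcompose_linear[of ?S ?X i] by (metis coeff_smult)
  have "v \<le> ?m"
  proof (rule ccontr)
    assume "\<not> v \<le> ?m"
    then have "?X ^ ?m * coeff ?S ?m = ?X ^ ?m * (?X ^ (v - ?m) * coeff R ?m)"
      unfolding S by (simp add: mult.assoc flip: power_add)
    then have "coeff ?S ?m = ?X ^ (v - ?m) * coeff R ?m" by simp
    then show False using Sm \<open>\<not> v \<le> ?m\<close> by (simp add: coeff_mult_0 coeff_0_power)
  qed
  have "coeff (eval_X0 R) i = 0" if "i > ?m" for i
  proof -
    have "?X ^ v * (?X ^ (i - v) * coeff ?S i) = ?X ^ v * coeff R i"
      unfolding S[symmetric] using that \<open>v \<le> ?m\<close> by (simp add: mult.assoc[symmetric] flip: power_add)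
    then have "coeff R i = ?X ^ (i - v) * coeff ?S i" by simp
    then show ?thesis using that \<open>v \<le> ?m\<close> by (simp add: coeff_eval_X0 coeff_mult_0 coeff_0_power)
  qed
  then show ?thesis by (intro degree_le) auto
qed

subsection \<open>The decoder on lists of field elements\<close>

fun padd :: "('a \<Rightarrow> 'a \<Rightarrow> 'a) \<Rightarrow> 'a list \<Rightarrow> 'a list \<Rightarrow> 'a list" where
  "padd ad [] q = q"
| "padd ad p [] = p"
| "padd ad (a # p) (b # q) = ad a b # padd ad p q"

definition comb :: "('a \<Rightarrow> 'a \<Rightarrow> 'a) \<Rightarrow> ('a \<Rightarrow> 'a \<Rightarrow> 'a) \<Rightarrow> 'a \<Rightarrow> 'a list \<Rightarrow> 'a \<Rightarrow> 'a list \<Rightarrow> 'a list" where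
  "comb ad mu c h d g = padd ad (map (mu c) h) (map (mu d) g)"

definition comb2 :: "('a \<Rightarrow> 'a \<Rightarrow> 'a) \<Rightarrow> ('a \<Rightarrow> 'a \<Rightarrow> 'a) \<Rightarrow> 'a \<Rightarrow> 'a list list \<Rightarrow> 'a \<Rightarrow> 'a list list \<Rightarrow> 'a list list" where
  "comb2 ad mu c h d g = padd (padd ad) (map (map (mu c)) h) (map (map (mu d)) g)"

definition nthz :: "'a \<Rightarrow> 'a list \<Rightarrow> nat \<Rightarrow> 'a" where
  "nthz ze xs r = (if r < length xs then xs ! r else ze)"

text \<open>Coefficients of \<open>(X + a)\<close> to the power \<open>i\<close>.\<close>

definition binl :: "('a \<Rightarrow> 'a \<Rightarrow> 'a) \<Rightarrow> ('a \<Rightarrow> 'a \<Rightarrow> 'a) \<Rightarrow> 'a \<Rightarrow> 'a \<Rightarrow> 'a \<Rightarrow> nat \<Rightarrow> 'a list" where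
  "binl ad mu ze on a i = ((\<lambda>w. padd ad (ze # w) (map (mu a) w)) ^^ i) [on]"

text \<open>With multiplicity \<open>k\<close> and agreement \<open>t\<close> the monomials outnumber the constraints as soon as \<open>t\<^sup>2 \<ge> k n\<close>.\<close>

definition mons :: "nat \<Rightarrow> nat \<Rightarrow> (nat \<times> nat) list" where
  "mons t k = concat (map (\<lambda>j. map (\<lambda>i. (i, j)) [0..<t * k - (k - 1) * j]) [0..<Suc t])"

text \<open>A triple (p, r, s) demands that the coefficient of X^r Y^s vanish after p has been moved
  to the origin; all pairs with r + s < k together express multiplicity k.\<close>

definition constraints :: "nat \<Rightarrow> ('a \<times> 'a) list \<Rightarrow> (('a \<times> 'a) \<times> nat \<times> nat) list" where
  "constraints k pts = concat (map (\<lambda>p. concat (map (\<lambda>r. map (\<lambda>s. (p, r, s)) [0..<k - r]) [0..<k])) pts)"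

definition cval :: "('a \<Rightarrow> 'a \<Rightarrow> 'a) \<Rightarrow> ('a \<Rightarrow> 'a \<Rightarrow> 'a) \<Rightarrow> 'a \<Rightarrow> 'a \<Rightarrow> ('a \<times> 'a) \<times> nat \<times> nat \<Rightarrow> nat \<times> nat \<Rightarrow> 'a" where
  "cval ad mu ze on c m = mu (nthz ze (binl ad mu ze on (fst (fst c)) (fst m)) (fst (snd c)))
     (nthz ze (binl ad mu ze on (snd (fst c)) (snd m)) (snd (snd c)))"

definition mon_poly :: "'a \<Rightarrow> 'a \<Rightarrow> nat \<times> nat \<Rightarrow> 'a list list" where
  "mon_poly ze on m = replicate (snd m) [] @ [replicate (fst m) ze @ [on]]"

definition init_rows :: "('a \<Rightarrow> 'a \<Rightarrow> 'a) \<Rightarrow> ('a \<Rightarrow> 'a \<Rightarrow> 'a) \<Rightarrow> 'a \<Rightarrow> 'a \<Rightarrow> nat \<Rightarrow> nat \<Rightarrow> ('a \<times> 'a) list \<Rightarrow> ('a list \<times> 'a list list) list" where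
  "init_rows ad mu ze on t k pts =
     map (\<lambda>m. (map (\<lambda>c. cval ad mu ze on c m) (constraints k pts), mon_poly ze on m)) (mons t k)"

text \<open>
  A row consists of the values of the remaining constraints at a bivariate polynomial and the
  polynomial itself. The pivot is the last row on which the first constraint does not vanish; it is
  removed and combined with the rows before it. In characteristic 2 no subtraction is needed.
\<close>

definition elim_step :: "('a \<Rightarrow> 'a \<Rightarrow> 'a) \<Rightarrow> ('a \<Rightarrow> 'a \<Rightarrow> 'a) \<Rightarrow> 'a \<Rightarrow> 'a list \<times> 'a list list \<Rightarrow>
    ('a list \<times> 'a list list) list \<times> ('a list \<times> 'a list list) list \<Rightarrow>
    ('a list \<times> 'a list list) list \<times> ('a list \<times> 'a list list) list" where
  "elim_step ad mu ze rw st =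
     (if fst st = [] then
        (if hd (fst rw) = ze then (fst st, (tl (fst rw), snd rw) # snd st) else ([rw], snd st))
      else (fst st,
        (comb ad mu (hd (fst (hd (fst st)))) (tl (fst rw)) (hd (fst rw)) (tl (fst (hd (fst st)))),
         comb2 ad mu (hd (fst (hd (fst st)))) (snd rw) (hd (fst rw)) (snd (hd (fst st)))) # snd st))"

definition eliminate1 :: "('a \<Rightarrow> 'a \<Rightarrow> 'a) \<Rightarrow> ('a \<Rightarrow> 'a \<Rightarrow> 'a) \<Rightarrow> 'a \<Rightarrow> ('a list \<times> 'a list list) list \<Rightarrow> ('a list \<times> 'a list list) list" where
  "eliminate1 ad mu ze rws = snd (foldr (elim_step ad mu ze) rws ([], []))"

definition eliminate :: "('a \<Rightarrow> 'a \<Rightarrow> 'a) \<Rightarrow> ('a \<Rightarrow> 'a \<Rightarrow> 'a) \<Rightarrow> 'a \<Rightarrow> 'b list \<Rightarrow> ('a list \<times> 'a list list) list \<Rightarrow> ('a list \<times> 'a list list) list" where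
  "eliminate ad mu ze cs rws = foldl (\<lambda>rws _. eliminate1 ad mu ze rws) rws cs"

definition strip1 :: "'a \<Rightarrow> 'a list list \<Rightarrow> 'a list list" where
  "strip1 ze Q = (if \<forall>r\<in>set Q. nthz ze r 0 = ze then map tl Q else Q)"

definition strip :: "'a \<Rightarrow> nat \<Rightarrow> 'a list list \<Rightarrow> 'a list list" where
  "strip ze N Q = (strip1 ze ^^ N) Q"

text \<open>Horner scheme for Q(X, X Y + y). The list \<open>[] # map ((#) ze) acc\<close> is the
  accumulator times X Y: prepending to the outer list multiplies by Y, and prepending
  \<open>ze\<close> to the inner ones multiplies by X.\<close>

definition substY :: "('a \<Rightarrow> 'a \<Rightarrow> 'a) \<Rightarrow> ('a \<Rightarrow> 'a \<Rightarrow> 'a) \<Rightarrow> 'a \<Rightarrow> 'a \<Rightarrow> 'a list list \<Rightarrow> 'a list list" where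
  "substY ad mu ze y Q =
     foldr (\<lambda>q acc. padd (padd ad) [q] (padd (padd ad) (map (map (mu y)) acc) ([] # map ((#) ze) acc))) Q []"

definition eval0 :: "('a \<Rightarrow> 'a \<Rightarrow> 'a) \<Rightarrow> ('a \<Rightarrow> 'a \<Rightarrow> 'a) \<Rightarrow> 'a \<Rightarrow> 'a \<Rightarrow> 'a list list \<Rightarrow> 'a" where
  "eval0 ad mu ze y Q = foldr (\<lambda>r acc. ad (nthz ze r 0) (mu y acc)) Q ze"

text \<open>One step of the Roth-Ruckenstein search. After powers of X have been divided out, Q(0,
  y) = 0 is a nontrivial condition on the constant coefficient y of a root, and the remaining
  coefficients form a root of Q(X, X Y + y). The first component collects the coefficients found so
  far.\<close>

definition branch :: "('a \<Rightarrow> 'a \<Rightarrow> 'a) \<Rightarrow> ('a \<Rightarrow> 'a \<Rightarrow> 'a) \<Rightarrow> 'a \<Rightarrow> 'a list \<Rightarrow> nat \<Rightarrow>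
    'a list \<times> 'a list list \<Rightarrow> ('a list \<times> 'a list list) list" where
  "branch ad mu ze el N s =
     map (\<lambda>y. (fst s @ [y], substY ad mu ze y (strip ze N (snd s))))
       (filter (\<lambda>y. eval0 ad mu ze y (strip ze N (snd s)) = ze) el)"

definition level :: "('a \<Rightarrow> 'a \<Rightarrow> 'a) \<Rightarrow> ('a \<Rightarrow> 'a \<Rightarrow> 'a) \<Rightarrow> 'a \<Rightarrow> 'a list \<Rightarrow> nat \<Rightarrow>
    ('a list \<times> 'a list list) list \<Rightarrow> ('a list \<times> 'a list list) list" where
  "level ad mu ze el N st = concat (map (branch ad mu ze el N) st)"

definition roots :: "('a \<Rightarrow> 'a \<Rightarrow> 'a) \<Rightarrow> ('a \<Rightarrow> 'a \<Rightarrow> 'a) \<Rightarrow> 'a \<Rightarrow> 'a list \<Rightarrow> nat \<Rightarrow> nat \<Rightarrow> 'a list list \<Rightarrow> 'a list list" where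
  "roots ad mu ze el N k Q = map fst ((level ad mu ze el N ^^ k) [([], Q)])"

text \<open>The argument \<open>t * k + k * Suc t\<close> bounds the length of all coefficient lists during the root search.\<close>

definition decode1 :: "('a \<Rightarrow> 'a \<Rightarrow> 'a) \<Rightarrow> ('a \<Rightarrow> 'a \<Rightarrow> 'a) \<Rightarrow> 'a \<Rightarrow> 'a \<Rightarrow> 'a list \<Rightarrow> nat \<Rightarrow> ('a \<times> 'a) list \<Rightarrow> nat \<Rightarrow> 'a list list" where
  "decode1 ad mu ze on el k pts t =
     concat (map (\<lambda>rw. roots ad mu ze el (t * k + k * Suc t) k (snd rw))
       (take 1 (eliminate ad mu ze (constraints k pts) (init_rows ad mu ze on t k pts))))"

text \<open>The number of agreements is unknown. Trying every value up to the length spares the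
  computation of a square root, and the true number is one of them.\<close>

definition list_decode :: "('a \<Rightarrow> 'a \<Rightarrow> 'a) \<Rightarrow> ('a \<Rightarrow> 'a \<Rightarrow> 'a) \<Rightarrow> 'a \<Rightarrow> 'a \<Rightarrow> 'a list \<Rightarrow> nat \<Rightarrow> ('a \<times> 'a) list \<Rightarrow> 'a list list" where
  "list_decode ad mu ze on el k pts = concat (map (decode1 ad mu ze on el k pts) [0..<Suc (length pts)])"

text \<open>A certificate of linear independence: every polynomial owns a monomial that is absent
  from the later ones. Elimination only adds a multiple of a later row, the pivot, to nonzero
  multiples of earlier ones, so owned monomials survive, and no rank argument is needed to see that
  the remaining rows are nonzero.\<close>

primrec triangular :: "'f :: zero poly poly list \<Rightarrow> bool" where
  "triangular [] \<longleftrightarrow> True"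
| "triangular (q # qs) \<longleftrightarrow>
     (\<exists>i j. coeff (coeff q j) i \<noteq> 0 \<and> (\<forall>p\<in>set qs. coeff (coeff p j) i = 0)) \<and> triangular qs"

definition linear_form :: "('f :: field poly poly \<Rightarrow> 'f) \<Rightarrow> bool" where
  "linear_form \<phi> \<longleftrightarrow> (\<forall>a b p q. \<phi> (smult [:a:] p + smult [:b:] q) = a * \<phi> p + b * \<phi> q)"

text \<open>The operations are total with values in C, which makes closure unconditional. The
  embedding need not be onto: the search only tries elements of C, and messages have all their
  coefficients there. The assumption \<open>char2\<close> justifies elimination by addition
  alone.\<close>

locale field_rep =
  fixes C :: "'c set" and ad mu :: "'c \<Rightarrow> 'c \<Rightarrow> 'c" and ze on :: 'c and el :: "'c list"
    and e :: "'c \<Rightarrow> 'f :: field"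
  assumes closed [simp]: "ad x y \<in> C" "mu x y \<in> C" "ze \<in> C" "on \<in> C"
    and el: "distinct el" "set el = C"
    and inj: "inj_on e C"
    and hom: "x \<in> C \<Longrightarrow> y \<in> C \<Longrightarrow> e (ad x y) = e x + e y" "x \<in> C \<Longrightarrow> y \<in> C \<Longrightarrow> e (mu x y) = e x * e y"
      "e ze = 0" "e on = 1"
    and char2: "z + z = (0 :: 'f)"
begin

abbreviation vec :: "'c list \<Rightarrow> bool" where "vec p \<equiv> set p \<subseteq> C"
abbreviation vec2 :: "'c list list \<Rightarrow> bool" where "vec2 Q \<equiv> \<forall>r\<in>set Q. vec r"

lemma e_eq_0: "x \<in> C \<Longrightarrow> e x = 0 \<longleftrightarrow> x = ze"
  using inj closed(3) hom(3) by (metis inj_onD)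

definition P :: "'c list \<Rightarrow> 'f poly" where "P p = Poly (map e p)"
definition PP :: "'c list list \<Rightarrow> 'f poly poly" where "PP Q = Poly (map P Q)"

lemma P_simps [simp]: "P [] = 0" "P (a # p) = pCons (e a) (P p)"
  and PP_simps [simp]: "PP [] = 0" "PP (r # Q) = pCons (P r) (PP Q)"
  by (simp_all add: P_def PP_def)

lemma coeff_P: "coeff (P p) i = (if i < length p then e (p ! i) else 0)"
  by (simp add: P_def nth_default_def)

section \<open>Meaning of the list arithmetic as polynomial arithmetic\<close>

lemma vec_padd [simp]: "vec p \<Longrightarrow> vec q \<Longrightarrow> vec (padd ad p q)"
proof (induction p arbitrary: q)
  case (Cons a p)
  then show ?case by (cases q) auto
qed simp

lemma vec2_padd: "vec2 p \<Longrightarrow> vec2 q \<Longrightarrow> vec2 (padd (padd ad) p q)"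
proof (induction p arbitrary: q)
  case (Cons a p)
  then show ?case by (cases q) auto
qed simp

lemma P_padd [simp]: "vec p \<Longrightarrow> vec q \<Longrightarrow> P (padd ad p q) = P p + P q"
proof (induction p arbitrary: q)
  case (Cons a p)
  then show ?case by (cases q) (auto simp: hom)
qed simp

lemma PP_padd [simp]: "vec2 p \<Longrightarrow> vec2 q \<Longrightarrow> PP (padd (padd ad) p q) = PP p + PP q"
proof (induction p arbitrary: q)
  case (Cons a p)
  then show ?case by (cases q) auto
qed simp

lemma image_mu [simp]: "mu c ` A \<subseteq> C"
  by auto

lemma vec_smult: "vec (map (mu c) p)"
  by (induction p) auto

lemma P_smult [simp]: "c \<in> C \<Longrightarrow> vec p \<Longrightarrow> P (map (mu c) p) = smult (e c) (P p)"
  by (induction p) (auto simp: hom)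

lemma PP_smult [simp]: "c \<in> C \<Longrightarrow> vec2 Q \<Longrightarrow> PP (map (map (mu c)) Q) = smult [:e c:] (PP Q)"
  by (induction Q) simp_all

lemma vec_comb [simp]: "vec (comb ad mu c h d g)"
  unfolding comb_def by (intro vec_padd vec_smult)

lemma vec2_comb2: "vec2 (comb2 ad mu c h d g)"
  unfolding comb2_def by (rule vec2_padd) auto

lemma PP_comb2:
  "c \<in> C \<Longrightarrow> d \<in> C \<Longrightarrow> vec2 h \<Longrightarrow> vec2 g \<Longrightarrow> PP (comb2 ad mu c h d g) = smult [:e c:] (PP h) + smult [:e d:] (PP g)"
  unfolding comb2_def by (subst PP_padd) auto

lemma map_comb:
  assumes "c \<in> C" "d \<in> C" "vec us" "vec vs" "map e us = map f xs" "map e vs = map g xs"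
  shows "map e (comb ad mu c us d vs) = map (\<lambda>x. e c * f x + e d * g x) xs"
  using assms
proof (induction xs arbitrary: us vs)
  case (Cons x xs)
  then obtain u us' v vs' where "us = u # us'" "vs = v # vs'" by (cases us; cases vs) auto
  with Cons show ?case by (auto simp: comb_def hom)
qed (auto simp: comb_def)

lemma nthz_closed [simp]: "vec p \<Longrightarrow> nthz ze p r \<in> C"
  by (auto simp: nthz_def)

lemma e_nthz: "e (nthz ze p r) = coeff (P p) r"
  by (simp add: nthz_def coeff_P hom)

lemma binl: "a \<in> C \<Longrightarrow> vec (binl ad mu ze on a i) \<and> P (binl ad mu ze on a i) = [:e a, 1:] ^ i"
proof (induction i)
  case (Suc i)
  then have "vec (ze # binl ad mu ze on a i)" by simp
  then have "vec (binl ad mu ze on a (Suc i)) \<and>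
      P (binl ad mu ze on a (Suc i)) = P (ze # binl ad mu ze on a i) + smult (e a) (P (binl ad mu ze on a i))"
    using Suc unfolding binl_def funpow.simps o_apply by (intro conjI vec_padd vec_smult) (simp_all add: hom)
  then show ?case using Suc by (simp add: hom add.commute)
qed (simp add: binl_def hom one_pCons)

lemma cval_closed [simp]: "cval ad mu ze on c m \<in> C"
  by (simp add: cval_def)

definition form :: "('c \<times> 'c) \<times> nat \<times> nat \<Rightarrow> 'f poly poly \<Rightarrow> 'f" where
  "form c Q = coeff (coeff (shift (e (fst (fst c))) (e (snd (fst c))) Q) (snd (snd c))) (fst (snd c))"

lemma linear_form: "linear_form (form c)"
  by (simp add: linear_form_def form_def shift_lin)

lemma mon_poly: "vec2 (mon_poly ze on m) \<and> PP (mon_poly ze on m) = monom (monom 1 (fst m)) (snd m)"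
proof -
  have 1: "P (replicate i ze @ [on]) = monom 1 i" for i
    by (induction i) (auto simp: hom monom_0 monom_Suc)
  have "PP (replicate j [] @ [r]) = monom (P r) j" for j r
    by (induction j) (auto simp: monom_0 monom_Suc)
  then show ?thesis by (auto simp: mon_poly_def 1)
qed

lemma e_cval:
  assumes "fst (fst c) \<in> C" "snd (fst c) \<in> C"
  shows "e (cval ad mu ze on c m) = form c (PP (mon_poly ze on m))"
  using assms by (simp add: cval_def form_def hom binl e_nthz mon_poly coeff_shift_monom)

text \<open>M contains the permitted monomials, \<Psi> the constraints already enforced, and \<phi>s
  those still pending, whose values at the polynomial form the first component of the row.\<close>

definition valid :: "(nat \<times> nat) set \<Rightarrow> ('f poly poly \<Rightarrow> 'f) set \<Rightarrow> ('f poly poly \<Rightarrow> 'f) list \<Rightarrow> 'c list \<times> 'c list list \<Rightarrow> bool" where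
  "valid M \<Psi> \<phi>s rw \<longleftrightarrow> vec (fst rw) \<and> vec2 (snd rw) \<and>
     map e (fst rw) = map (\<lambda>\<phi>. \<phi> (PP (snd rw))) \<phi>s \<and> (\<forall>\<psi>\<in>\<Psi>. \<psi> (PP (snd rw)) = 0) \<and>
     (\<forall>i j. coeff (coeff (PP (snd rw)) j) i \<noteq> 0 \<longrightarrow> (i, j) \<in> M)"

lemma valid_ConsD:
  assumes "valid M \<Psi> (\<phi> # \<phi>s) rw"
  shows "hd (fst rw) \<in> C" "e (hd (fst rw)) = \<phi> (PP (snd rw))" "vec (tl (fst rw))"
    "map e (tl (fst rw)) = map (\<lambda>\<phi>. \<phi> (PP (snd rw))) \<phi>s"
  using assms by (cases "fst rw"; auto simp: valid_def)+

text \<open>The fold runs from the last row to the first, so the pivot is fixed before any row in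
  front of it is treated. The final conjunct, that no new monomials appear, is the strengthening
  that carries triangularity through the induction.\<close>

lemma elim_fold:
  assumes "\<forall>rw\<in>set rws. valid M \<Psi> (\<phi> # \<phi>s) rw" "triangular (map (PP \<circ> snd) rws)"
    and lin: "\<forall>\<psi>\<in>insert \<phi> (\<Psi> \<union> set \<phi>s). linear_form \<psi>"
    and "foldr (elim_step ad mu ze) rws ([], []) = (piv, out)"
  shows "(piv = [] \<and> length out = length rws \<or>
      (\<exists>p\<in>set rws. piv = [p] \<and> hd (fst p) \<noteq> ze \<and> length rws = Suc (length out))) \<and>
    (\<forall>rw\<in>set out. valid M (insert \<phi> \<Psi>) \<phi>s rw) \<and> triangular (map (PP \<circ> snd) out) \<and>
    (\<forall>i j. (\<forall>rw\<in>set rws. coeff (coeff (PP (snd rw)) j) i = 0) \<longrightarrow> (\<forall>rw\<in>set out. coeff (coeff (PP (snd rw)) j) i = 0))"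
  using assms(1,2,4)
proof (induction rws arbitrary: piv out)
  case (Cons rw rws)
  obtain piv' out' where 1: "foldr (elim_step ad mu ze) rws ([], []) = (piv', out')"
    by (cases "foldr (elim_step ad mu ze) rws ([], [])")
  have pre: "\<forall>rw\<in>set rws. valid M \<Psi> (\<phi> # \<phi>s) rw" "triangular (map (PP \<circ> snd) rws)"
    using Cons.prems(1,2) by (simp_all del: comp_apply)
  note IH = Cons.IH[OF pre 1]
  have ihA: "piv' = [] \<and> length out' = length rws \<or>
      (\<exists>p\<in>set rws. piv' = [p] \<and> hd (fst p) \<noteq> ze \<and> length rws = Suc (length out'))"
    and ihB: "\<forall>rw\<in>set out'. valid M (insert \<phi> \<Psi>) \<phi>s rw"
    and tri_out: "triangular (map (PP \<circ> snd) out')"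
    and ihD: "\<And>i j. \<forall>rw\<in>set rws. coeff (coeff (PP (snd rw)) j) i = 0 \<Longrightarrow> \<forall>rw\<in>set out'. coeff (coeff (PP (snd rw)) j) i = 0"
    using IH by blast+
  have rw: "valid M \<Psi> (\<phi> # \<phi>s) rw" using Cons.prems(1) by simp
  note rowD = valid_ConsD[OF rw]
  have st: "elim_step ad mu ze rw (piv', out') = (piv, out)" using Cons.prems(3) 1 by simp
  obtain i0 j0 where ij: "coeff (coeff (PP (snd rw)) j0) i0 \<noteq> 0"
    "\<forall>r\<in>set rws. coeff (coeff (PP (snd r)) j0) i0 = 0"
    using Cons.prems(2) by auto
  have out0: "\<forall>r\<in>set out'. coeff (coeff (PP (snd r)) j0) i0 = 0"
    using ihD[OF ij(2)] .
  have ex: "triangular (map (PP \<circ> snd) (r # out'))" if "coeff (coeff (PP (snd r)) j0) i0 \<noteq> 0" for r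
    using that out0 tri_out by (auto simp: comp_def)
  show ?case
  proof (cases "piv' = []")
    case True
    show ?thesis
    proof (cases "hd (fst rw) = ze")
      case z: True
      have "\<phi> (PP (snd rw)) = 0" using rowD(2) z hom by simp
      then have "valid M (insert \<phi> \<Psi>) \<phi>s (tl (fst rw), snd rw)"
        using rw rowD by (auto simp: valid_def)
      moreover have "piv = []" "out = (tl (fst rw), snd rw) # out'"
        using st True z by (auto simp: elim_step_def)
      ultimately show ?thesis
        using ihA ihB True ex[of "(tl (fst rw), snd rw)"] ij(1) ihD by (auto simp del: comp_apply triangular.simps)
    next
      case False
      then have "piv = [rw]" "out = out'" using st True by (auto simp: elim_step_def)
      then show ?thesis using ihA ihB tri_out ihD False True by (auto simp del: comp_apply)
    qed
  next
    case False
    then obtain p where p: "p \<in> set rws" "piv' = [p]" "hd (fst p) \<noteq> ze" "length rws = Suc (length out')"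
      using ihA by auto
    have pv: "valid M \<Psi> (\<phi> # \<phi>s) p" using pre(1) p(1) by blast
    note pD = valid_ConsD[OF pv]
    define rw' where "rw' = (comb ad mu (hd (fst p)) (tl (fst rw)) (hd (fst rw)) (tl (fst p)),
         comb2 ad mu (hd (fst p)) (snd rw) (hd (fst rw)) (snd p))"
    have out: "piv = [p]" "out = rw' # out'"
      using st p by (auto simp: elim_step_def rw'_def)
    have PP: "PP (snd rw') = smult [:e (hd (fst p)):] (PP (snd rw)) + smult [:e (hd (fst rw)):] (PP (snd p))"
      unfolding rw'_def snd_conv by (rule PP_comb2) (use pD rowD rw pv in \<open>auto simp: valid_def\<close>)
    \<comment> \<open>The earlier row is multiplied by the head of the pivot row, which is nonzero,
      so the monomial that it owns keeps a nonzero coefficient.\<close>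
    have nz: "e (hd (fst p)) \<noteq> 0" using pD(1) p(3) e_eq_0 by simp
    have lin': "\<psi> (PP (snd rw')) = e (hd (fst p)) * \<psi> (PP (snd rw)) + e (hd (fst rw)) * \<psi> (PP (snd p))"
      if "\<psi> \<in> insert \<phi> (\<Psi> \<union> set \<phi>s)" for \<psi>
      using lin that unfolding PP linear_form_def by blast
    have "valid M (insert \<phi> \<Psi>) \<phi>s rw'"
      unfolding valid_def
    proof (intro conjI ballI allI impI)
      show "vec (fst rw')" by (simp add: rw'_def)
      show "vec r" if "r \<in> set (snd rw')" for r
        using that unfolding rw'_def snd_conv by (rule vec2_comb2[rule_format])
      show "map e (fst rw') = map (\<lambda>\<phi>. \<phi> (PP (snd rw'))) \<phi>s"
      proof -
        have "map e (fst rw') = map (\<lambda>\<phi>. e (hd (fst p)) * \<phi> (PP (snd rw)) + e (hd (fst rw)) * \<phi> (PP (snd p))) \<phi>s"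
          unfolding rw'_def fst_conv by (rule map_comb) (use pD rowD in auto)
        also have "\<dots> = map (\<lambda>\<phi>. \<phi> (PP (snd rw'))) \<phi>s" using lin' by simp
        finally show ?thesis .
      qed
      show "\<psi> (PP (snd rw')) = 0" if "\<psi> \<in> insert \<phi> \<Psi>" for \<psi>
      proof (cases "\<psi> = \<phi>")
        case True
        \<comment> \<open>The two products are c d and d c, and their sum is zero in characteristic
          2.\<close>
        then show ?thesis using lin'[of \<phi>] pD(2) rowD(2) char2 by (simp add: mult.commute)
      next
        case False
        then show ?thesis using that lin'[of \<psi>] rw pv by (auto simp: valid_def)
      qed
      show "(i, j) \<in> M" if "coeff (coeff (PP (snd rw')) j) i \<noteq> 0" for i j
        using that rw pv unfolding PP valid_def by (auto simp: split: if_splits) (metis add_0_left mult_zero_right)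
    qed
    moreover have ij': "coeff (coeff (PP (snd rw')) j0) i0 \<noteq> 0"
      using ij p(1) nz by (simp add: PP)
    moreover have "\<forall>i j. (\<forall>r\<in>set (rw # rws). coeff (coeff (PP (snd r)) j) i = 0) \<longrightarrow> coeff (coeff (PP (snd rw')) j) i = 0"
      using p(1) by (simp add: PP)
    ultimately show ?thesis
      using p ihB ex[OF ij'] ihD unfolding out by (auto simp del: comp_apply triangular.simps)
  qed
qed auto

lemma eliminate1:
  assumes "\<forall>rw\<in>set rws. valid M \<Psi> (\<phi> # \<phi>s) rw" "triangular (map (PP \<circ> snd) rws)"
    and "\<forall>\<psi>\<in>insert \<phi> (\<Psi> \<union> set \<phi>s). linear_form \<psi>"
  shows "length rws \<le> Suc (length (eliminate1 ad mu ze rws))"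
    "\<forall>rw\<in>set (eliminate1 ad mu ze rws). valid M (insert \<phi> \<Psi>) \<phi>s rw"
    "triangular (map (PP \<circ> snd) (eliminate1 ad mu ze rws))"
  using elim_fold[OF assms, of "fst (foldr (elim_step ad mu ze) rws ([], []))" "eliminate1 ad mu ze rws"]
  by (auto simp: eliminate1_def)

text \<open>At most one row is lost per constraint. As soon as there are more rows than constraints
  a row remains, and by triangularity its polynomial is nonzero.\<close>

lemma eliminate:
  assumes "\<forall>rw\<in>set rws. valid M \<Psi> (map form cs) rw" "triangular (map (PP \<circ> snd) rws)"
    and "\<forall>\<psi>\<in>\<Psi>. linear_form \<psi>"
  shows "length rws \<le> length cs + length (eliminate ad mu ze cs rws) \<and>
    (\<forall>rw\<in>set (eliminate ad mu ze cs rws). valid M (\<Psi> \<union> form ` set cs) [] rw) \<and>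
    triangular (map (PP \<circ> snd) (eliminate ad mu ze cs rws))"
  using assms
proof (induction cs arbitrary: \<Psi> rws)
  case (Cons c cs)
  have "\<forall>\<psi>\<in>insert (form c) (\<Psi> \<union> set (map form cs)). linear_form \<psi>"
    using Cons.prems(3) linear_form by auto
  note E = eliminate1[OF Cons.prems(1)[unfolded list.map] Cons.prems(2) this]
  have "\<forall>\<psi>\<in>insert (form c) \<Psi>. linear_form \<psi>" using Cons.prems(3) linear_form by auto
  from Cons.IH[OF E(2,3) this] E(1) show ?case by (simp add: eliminate_def)
qed (auto simp: eliminate_def)

lemma triangular_monoms:
  "distinct ms \<Longrightarrow> triangular (map (\<lambda>m. monom (monom (1 :: 'f) (fst m)) (snd m)) ms)"
proof (induction ms)
  case (Cons m ms)
  then show ?case by (auto intro!: exI[of _ "fst m"] exI[of _ "snd m"] simp: prod_eq_iff)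
qed simp

end

section \<open>Counting monomials and constraints, and sizes of coefficient lists\<close>

lemma distinct_mons: "distinct (mons t k)"
proof -
  have "distinct (concat (map (\<lambda>j. map (\<lambda>i. (i, j)) [0..<f j]) [0..<n]))" for f :: "nat \<Rightarrow> nat" and n
    by (induction n) (auto simp: distinct_map inj_on_def)
  then show ?thesis unfolding mons_def .
qed

lemma set_mons: "set (mons t k) = {(i, j). j \<le> t \<and> i + (k - 1) * j < t * k}"
proof -
  have "m \<in> set (mons t k) \<longleftrightarrow> (\<exists>j\<in>{0..<Suc t}. \<exists>i\<in>{0..<t * k - (k - 1) * j}. m = (i, j))" for m
    by (simp add: mons_def image_iff del: upt_Suc)
  then show ?thesis by (auto simp: less_Suc_eq_le less_diff_conv)
qed

lemma set_constraints: "set (constraints k pts) = {(p, r, s). p \<in> set pts \<and> r + s < k}"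
proof -
  have "c \<in> set (constraints k pts) \<longleftrightarrow> (\<exists>p\<in>set pts. \<exists>r\<in>{0..<k}. \<exists>s\<in>{0..<k - r}. c = (p, r, s))" for c
    by (simp add: constraints_def image_iff)
  then show ?thesis by (auto simp: less_diff_conv add.commute)
qed

lemma length_constraints: "2 * length (constraints k pts) = length pts * (k * (k + 1))"
proof -
  have 1: "2 * (\<Sum>r\<leftarrow>[0..<m]. k - r) = m * (2 * k + 1 - m)" if "m \<le> k" for m
    using that
  proof (induction m)
    case (Suc m)
    then obtain d where "k = m + 1 + d" by (metis Suc_eq_plus1 le_Suc_ex)
    then show ?case using Suc by (simp add: algebra_simps)
  qed simp
  show ?thesis using 1[of k]
    by (simp add: constraints_def length_concat comp_def sum_list_triv algebra_simps)
qed

text \<open>The exponent j of Y admits t k - (k - 1) j exponents of X. For j \<le> t this difference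
  is not truncated, which allows the summation over the integers. The total shares the factor k + 1
  with the number of constraints; cancelling it leaves t (t + 1) against k times the number of
  points.\<close>

lemma length_mons:
  assumes "k \<ge> 1"
  shows "2 * length (mons t k) = (t + 1) * (t * (k + 1))"
proof -
  have "int (k - 1) = int k - 1" using assms by simp
  then have 1: "2 * (\<Sum>j\<leftarrow>[0..<m]. int (t * k - (k - 1) * j)) = int m * (2 * int t * int k - (int k - 1) * (int m - 1))"
    if "m \<le> t + 1" for m
    using that
  proof (induction m)
    case (Suc m)
    have "(k - 1) * m \<le> t * k" using Suc.prems by (metis Suc_le_mono Suc_eq_plus1 diff_le_self mult.commute mult_le_mono)
    then show ?case using Suc by (simp add: algebra_simps of_nat_diff)
  qed simp
  have "int (sum_list xs) = sum_list (map int xs)" for xs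
    by (induction xs) auto
  then have "2 * int (length (mons t k)) = int ((t + 1) * (t * (k + 1)))"
    using 1[of "Suc t"] assms
    by (simp add: mons_def length_concat comp_def algebra_simps del: upt_Suc)
  then show ?thesis by linarith
qed

text \<open>Lengths of lists, not degrees, determine the cost, since coefficient lists are not
  normalized.\<close>

definition shape :: "nat \<Rightarrow> nat \<Rightarrow> 'a list list \<Rightarrow> bool" where
  "shape L W Q \<longleftrightarrow> length Q \<le> L \<and> (\<forall>r\<in>set Q. length r \<le> W)"

lemma length_padd [simp]: "length (padd ad p q) = max (length p) (length q)"
  by (induction ad p q rule: padd.induct) auto

lemma shape_padd: "shape L W p \<Longrightarrow> shape L W q \<Longrightarrow> shape L W (padd (padd ad) p q)"
proof (induction p arbitrary: q L)
  case (Cons a p)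
  show ?case
  proof (cases q)
    case (Cons b q')
    then have "shape (L - 1) W (padd (padd ad) p q')" "L \<ge> 1"
      using Cons.prems Cons.IH[of "L - 1" q'] by (auto simp: shape_def)
    then show ?thesis using Cons Cons.prems by (auto simp: shape_def)
  qed (use Cons.prems in simp)
qed simp

lemma shape_map: "shape L W Q \<Longrightarrow> shape L W (map (map f) Q)"
  by (auto simp: shape_def)

lemma shape_comb2: "shape L W h \<Longrightarrow> shape L W g \<Longrightarrow> shape L W (comb2 ad mu c h d g)"
  unfolding comb2_def by (intro shape_padd shape_map)

lemma shape_mono: "shape L W Q \<Longrightarrow> L \<le> L' \<Longrightarrow> W \<le> W' \<Longrightarrow> shape L' W' Q"
  by (auto simp: shape_def)

lemma shape_strip: "shape L W Q \<Longrightarrow> shape L W (strip ze N Q)"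
proof (induction N)
  case (Suc N)
  then have "shape L W (strip1 ze (strip ze N Q))" by (auto simp: shape_def strip1_def intro: le_diff_conv[THEN iffD2])
  then show ?case by (simp add: strip_def)
qed (simp add: strip_def)

lemma length_strip [simp]: "length (strip ze N Q) = length Q"
  by (induction N) (auto simp: strip_def strip1_def)

text \<open>Each power of Y brings along at most one power of X, so one level of the search
  lengthens the inner lists by at most the outer length.\<close>

lemma shape_substY:
  assumes "\<forall>r\<in>set Q. length r \<le> W"
  shows "shape (length Q) (W + length Q) (substY ad mu ze y Q)"
  using assms
proof (induction Q)
  case (Cons q Q)
  let ?acc = "substY ad mu ze y Q" and ?L = "Suc (length Q)" and ?W = "W + Suc (length Q)"
  have acc: "shape (length Q) (W + length Q) ?acc" using Cons by simp
  have "shape ?L ?W (padd (padd ad) [q] (padd (padd ad) (map (map (mu y)) ?acc) ([] # map ((#) ze) ?acc)))"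
    by (intro shape_padd) (use acc Cons.prems in \<open>auto simp: shape_def\<close>)
  then show ?case by (simp add: substY_def)
qed (simp add: substY_def shape_def)

context field_rep
begin

definition wf_row :: "nat \<Rightarrow> nat \<Rightarrow> nat \<Rightarrow> 'c list \<times> 'c list list \<Rightarrow> bool" where
  "wf_row K L W rw \<longleftrightarrow> vec (fst rw) \<and> vec2 (snd rw) \<and> length (fst rw) = K \<and> shape L W (snd rw)"

definition wf_state :: "nat \<Rightarrow> nat \<Rightarrow> nat \<Rightarrow> nat \<Rightarrow> ('c list \<times> 'c list list) list \<times> ('c list \<times> 'c list list) list \<Rightarrow> bool" where
  "wf_state K L W n st \<longleftrightarrow> (\<forall>rw\<in>set (fst st). wf_row (Suc K) L W rw) \<and> length (fst st) \<le> 1 \<and>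
     (\<forall>rw\<in>set (snd st). wf_row K L W rw) \<and> length (snd st) \<le> n"

lemma vec_tl: "vec p \<Longrightarrow> vec (tl p)"
  by (cases p) auto

lemma wf_elim_step:
  assumes rw: "wf_row (Suc K) L W rw" and st: "wf_state K L W n st"
  shows "wf_state K L W (Suc n) (elim_step ad mu ze rw st)"
proof -
  have "wf_row K L W (comb ad mu c (tl (fst rw)) d (tl (fst p)), comb2 ad mu c (snd rw) d (snd p))"
    if "wf_row (Suc K) L W p" for p c d
    using rw that unfolding wf_row_def fst_conv snd_conv
    by (intro conjI vec_comb vec2_comb2 shape_comb2) (auto simp: comb_def)
  moreover have "wf_row K L W (tl (fst rw), snd rw)"
    using rw vec_tl by (simp add: wf_row_def)
  ultimately show ?thesis
    using rw st unfolding wf_state_def elim_step_def by (cases "fst st") simp_all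
qed

lemma wf_elim_foldr:
  assumes "\<forall>rw\<in>set rws. wf_row (Suc K) L W rw"
  shows "wf_state K L W (length rws) (foldr (elim_step ad mu ze) rws ([], []))"
  using assms
proof (induction rws)
  case (Cons rw rws)
  then show ?case using wf_elim_step[of K L W rw "length rws"] by simp
qed (simp add: wf_state_def)

lemma wf_eliminate1:
  assumes "\<forall>rw\<in>set rws. wf_row (Suc K) L W rw"
  shows "(\<forall>rw\<in>set (eliminate1 ad mu ze rws). wf_row K L W rw) \<and> length (eliminate1 ad mu ze rws) \<le> length rws"
  using wf_elim_foldr[OF assms] by (simp add: eliminate1_def wf_state_def)

lemma wf_eliminate:
  assumes "\<forall>rw\<in>set rws. wf_row (length cs) L W rw"
  shows "(\<forall>rw\<in>set (eliminate ad mu ze cs rws). wf_row 0 L W rw) \<and> length (eliminate ad mu ze cs rws) \<le> length rws"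
  using assms
proof (induction cs arbitrary: rws)
  case (Cons c cs)
  have "\<forall>rw\<in>set (eliminate1 ad mu ze rws). wf_row (length cs) L W rw" "length (eliminate1 ad mu ze rws) \<le> length rws"
    using wf_eliminate1[of rws "length cs"] Cons.prems by simp_all
  then show ?case using Cons.IH[of "eliminate1 ad mu ze rws"] by (simp add: eliminate_def)
qed (simp add: eliminate_def)

lemma init_rows_wf:
  "\<forall>rw\<in>set (init_rows ad mu ze on t k pts). wf_row (length (constraints k pts)) (Suc t) (t * k) rw"
proof
  fix rw assume "rw \<in> set (init_rows ad mu ze on t k pts)"
  then obtain i j where ij: "(i, j) \<in> set (mons t k)"
    and rw: "rw = (map (\<lambda>c. cval ad mu ze on c (i, j)) (constraints k pts), mon_poly ze on (i, j))"
    by (auto simp: init_rows_def)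
  have "shape (Suc t) (t * k) (mon_poly ze on (i, j))"
    using ij by (auto simp: shape_def mon_poly_def set_mons)
  then show "wf_row (length (constraints k pts)) (Suc t) (t * k) rw"
    using mon_poly[of "(i, j)"] by (auto simp: wf_row_def rw)
qed

lemma init_rows_valid:
  assumes "\<forall>p\<in>set pts. fst p \<in> C \<and> snd p \<in> C"
  shows "\<forall>rw\<in>set (init_rows ad mu ze on t k pts). valid (set (mons t k)) {} (map form (constraints k pts)) rw"
    "triangular (map (PP \<circ> snd) (init_rows ad mu ze on t k pts))"
proof -
  have "valid (set (mons t k)) {} (map form (constraints k pts))
      (map (\<lambda>c. cval ad mu ze on c m) (constraints k pts), mon_poly ze on m)" if "m \<in> set (mons t k)" for m
    unfolding valid_def using mon_poly[of m] that assms
    by (auto simp: set_constraints e_cval coeff_monom split: if_splits)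
  then show "\<forall>rw\<in>set (init_rows ad mu ze on t k pts). valid (set (mons t k)) {} (map form (constraints k pts)) rw"
    by (auto simp: init_rows_def)
  show "triangular (map (PP \<circ> snd) (init_rows ad mu ze on t k pts))"
    using triangular_monoms[OF distinct_mons[of t k]] by (simp add: init_rows_def comp_def mon_poly)
qed

subsection \<open>Root search\<close>

lemma PP_map_tl:
  assumes "\<forall>r\<in>set Q. nthz ze r 0 = ze"
  shows "PP Q = smult [:0, 1:] (PP (map tl Q))"
  using assms
proof (induction Q)
  case (Cons r Q)
  then show ?case by (cases r) (auto simp: nthz_def hom)
qed simp

lemma strip_Suc: "strip ze (Suc N) Q = strip ze N (strip1 ze Q)"
  by (simp add: strip_def funpow_swap1)

lemma vec2_strip: "vec2 Q \<Longrightarrow> vec2 (strip ze N Q)"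
proof (induction N arbitrary: Q)
  case (Suc N)
  have "vec2 (strip1 ze Q)" using Suc.prems vec_tl by (auto simp: strip1_def)
  then show ?case unfolding strip_Suc by (rule Suc.IH)
qed (simp add: strip_def)

lemma PP_strip: "\<exists>v. PP Q = smult ([:0, 1:] ^ v) (PP (strip ze N Q))"
proof (induction N arbitrary: Q)
  case 0
  show ?case by (rule exI[of _ 0]) (simp add: strip_def)
next
  case (Suc N)
  obtain v where v: "PP (strip1 ze Q) = smult ([:0, 1:] ^ v) (PP (strip ze N (strip1 ze Q)))"
    using Suc by blast
  show ?case
  proof (cases "\<forall>r\<in>set Q. nthz ze r 0 = ze")
    case True
    then have "PP Q = smult [:0, 1:] (PP (strip1 ze Q))" using PP_map_tl by (simp add: strip1_def)
    then have "PP Q = smult ([:0, 1:] ^ Suc v) (PP (strip ze (Suc N) Q))"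
      by (simp only: v strip_Suc smult_smult power_Suc)
    then show ?thesis ..
  next
    case False
    then have "strip1 ze Q = Q" by (auto simp: strip1_def)
    then show ?thesis using v unfolding strip_Suc by auto
  qed
qed

text \<open>Every successful division by X shortens all nonempty inner lists, so N rounds exhaust
  lists of length at most N.\<close>

lemma strip_nonzero:
  assumes "PP Q \<noteq> 0" "\<forall>r\<in>set Q. length r \<le> N"
  shows "\<exists>r\<in>set (strip ze N Q). nthz ze r 0 \<noteq> ze"
  using assms
proof (induction N arbitrary: Q)
  case 0
  have "PP Q = 0" using 0(2) by (induction Q) auto
  then show ?case using 0 by simp
next
  case (Suc N)
  show ?case
  proof (cases "\<forall>r\<in>set Q. nthz ze r 0 = ze")
    case True
    have "PP (map tl Q) \<noteq> 0" using Suc.prems(1) PP_map_tl[OF True] by auto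
    moreover have "\<forall>r\<in>set (map tl Q). length r \<le> N" using Suc.prems(2) by auto
    ultimately show ?thesis using Suc.IH[of "map tl Q"] True by (simp add: strip_Suc strip1_def)
  next
    case False
    then have "strip1 ze Q = Q" by (auto simp: strip1_def)
    then have "strip ze M Q = Q" for M by (induction M) (simp_all add: strip_def)
    then show ?thesis using False by auto
  qed
qed

lemma eval_X0_PP: "eval_X0 (PP Q) = Poly (map (\<lambda>r. e (nthz ze r 0)) Q)"
  by (induction Q) (simp_all add: eval_X0_pCons e_nthz)

lemma eval_X0_strip:
  assumes "PP Q \<noteq> 0" "\<forall>r\<in>set Q. length r \<le> N" "vec2 Q"
  shows "eval_X0 (PP (strip ze N Q)) \<noteq> 0"
proof
  assume "eval_X0 (PP (strip ze N Q)) = 0"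
  then have "Poly (map (\<lambda>r. e (nthz ze r 0)) (strip ze N Q)) = 0" by (simp add: eval_X0_PP)
  then have "\<forall>r\<in>set (strip ze N Q). e (nthz ze r 0) = 0"
    unfolding Poly_eq_0 by (metis image_eqI in_set_replicate set_map)
  then show False
    using strip_nonzero[OF assms(1,2)] vec2_strip[OF assms(3), of N] e_eq_0 nthz_closed by metis
qed

lemma substY:
  assumes y: "y \<in> C" and Q: "vec2 Q"
  shows "vec2 (substY ad mu ze y Q) \<and> PP (substY ad mu ze y Q) = pcompose (PP Q) [:[:e y:], [:0, 1:]:]"
  using Q
proof (induction Q)
  case (Cons q Q)
  let ?acc = "substY ad mu ze y Q"
  have acc: "vec2 ?acc" "PP ?acc = pcompose (PP Q) [:[:e y:], [:0, 1:]:]" using Cons by auto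
  have 1: "PP (map ((#) ze) R) = smult [:0, 1:] (PP R)" for R
    by (induction R) (simp_all add: hom)
  have v: "vec2 (map (map (mu y)) ?acc)" "vec2 ([] # map ((#) ze) ?acc)" "vec2 [q]"
    using acc(1) Cons.prems by auto
  have v': "vec2 (padd (padd ad) (map (map (mu y)) ?acc) ([] # map ((#) ze) ?acc))"
    by (rule vec2_padd[OF v(1,2)])
  have s: "substY ad mu ze y (q # Q) = padd (padd ad) [q] (padd (padd ad) (map (map (mu y)) ?acc) ([] # map ((#) ze) ?acc))"
    by (simp add: substY_def)
  have "PP (substY ad mu ze y (q # Q)) = [:P q:] + (smult [:e y:] (PP ?acc) + pCons 0 (smult [:0, 1:] (PP ?acc)))"
    unfolding s PP_padd[OF v(3) v'] PP_padd[OF v(1,2)] PP_smult[OF y acc(1)] by (simp add: 1)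
  then show ?case unfolding s using vec2_padd[OF v(3) v'] acc(2)
    by (simp only: PP_simps pcompose_pCons) simp
qed (simp add: substY_def)

lemma eval0:
  assumes "y \<in> C" "vec2 Q"
  shows "eval0 ad mu ze y Q \<in> C \<and> e (eval0 ad mu ze y Q) = poly (eval_X0 (PP Q)) (e y)"
  using assms(2)
proof (induction Q)
  case (Cons q Q)
  then show ?case using assms(1)
    by (simp add: eval0_def eval_X0_pCons hom e_nthz)
qed (simp add: eval0_def hom)

definition node :: "nat \<Rightarrow> nat \<Rightarrow> nat \<Rightarrow> 'c list \<times> 'c list list \<Rightarrow> bool" where
  "node t W m s \<longleftrightarrow> vec (fst s) \<and> length (fst s) = m \<and> vec2 (snd s) \<and> PP (snd s) \<noteq> 0 \<and>
     shape (Suc t) (W + m * Suc t) (snd s)"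

text \<open>The potential function of the search: the degree in Y that remains after dividing out X
  and setting X = 0.\<close>

definition ydeg :: "nat \<Rightarrow> 'c list \<times> 'c list list \<Rightarrow> nat" where
  "ydeg N s = degree (eval_X0 (PP (strip ze N (snd s))))"

text \<open>Children belong to distinct roots of Q(0, Y). By \<open>branch_degree\<close> the
  potential of a child is at most the multiplicity of its root, and the multiplicities add up to at
  most the degree. So the potential neither grows nor falls short of the number of children.\<close>

lemma branch:
  assumes s: "node t W m s" and N: "W + m * Suc t \<le> N"
  shows "\<forall>s'\<in>set (branch ad mu ze el N s). node t W (Suc m) s'"
    "sum_list (map (ydeg N) (branch ad mu ze el N s)) \<le> ydeg N s"
    "length (branch ad mu ze el N s) \<le> ydeg N s"
proof -
  let ?Q = "strip ze N (snd s)" and ?g = "eval_X0 (PP (strip ze N (snd s)))"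
  let ?ys = "filter (\<lambda>y. eval0 ad mu ze y ?Q = ze) el"
  have Q: "vec2 ?Q" by (rule vec2_strip) (use s in \<open>simp add: node_def\<close>)
  obtain v where v: "PP (snd s) = smult ([:0, 1:] ^ v) (PP ?Q)" using PP_strip by blast
  have nz: "PP ?Q \<noteq> 0" using v s by (auto simp: node_def)
  have g: "?g \<noteq> 0"
    by (rule eval_X0_strip) (use s N in \<open>auto simp: node_def shape_def\<close>)
  have sh: "shape (Suc t) (W + m * Suc t) ?Q" using s by (auto simp: node_def intro: shape_strip)
  have S: "vec2 (substY ad mu ze y ?Q)" "PP (substY ad mu ze y ?Q) = pcompose (PP ?Q) [:[:e y:], [:0, 1:]:]"
    if "y \<in> C" for y using substY[OF that Q] by auto
  show "\<forall>s'\<in>set (branch ad mu ze el N s). node t W (Suc m) s'"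
  proof
    fix s' assume "s' \<in> set (branch ad mu ze el N s)"
    then obtain y where y: "y \<in> C" "s' = (fst s @ [y], substY ad mu ze y ?Q)"
      using el by (auto simp: branch_def)
    have "PP (substY ad mu ze y ?Q) \<noteq> 0"
      unfolding S(2)[OF y(1)] using nz by (subst pcompose_eq_0_iff) auto
    moreover have "shape (Suc t) (W + Suc m * Suc t) (substY ad mu ze y ?Q)"
      by (rule shape_mono[OF shape_substY[of ?Q "W + m * Suc t"]]) (use sh in \<open>auto simp: shape_def\<close>)
    ultimately show "node t W (Suc m) s'" using s y S by (auto simp: node_def)
  qed
  have ord: "ydeg N (fst s @ [y], substY ad mu ze y ?Q) \<le> order (e y) ?g" if y: "y \<in> set ?ys" for y
  proof -
    have yC: "y \<in> C" using y el by auto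
    obtain w where "PP (substY ad mu ze y ?Q) = smult ([:0, 1:] ^ w) (PP (strip ze N (substY ad mu ze y ?Q)))"
      using PP_strip by blast
    then show ?thesis unfolding ydeg_def snd_conv
      by (intro branch_degree[OF _ g]) (simp add: S(2)[OF yC])
  qed
  have pos: "1 \<le> order (e y) ?g" if y: "y \<in> set ?ys" for y
  proof -
    have "y \<in> C" "eval0 ad mu ze y ?Q = ze" using y el by auto
    then have "poly ?g (e y) = 0" using eval0[OF _ Q, of y] hom(3) by simp
    then show ?thesis using g by (simp add: order_root Suc_leI)
  qed
  have "(\<Sum>y\<leftarrow>?ys. order (e y) ?g) = (\<Sum>y\<in>set ?ys. order (e y) ?g)"
    using el(1) by (intro sum_list_distinct_conv_sum_set) simp
  also have "\<dots> = (\<Sum>a\<in>e ` set ?ys. order a ?g)"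
    by (rule sum.reindex[symmetric, unfolded o_def]) (use inj el in \<open>auto simp: inj_on_def\<close>)
  also have "\<dots> \<le> ydeg N s"
    unfolding ydeg_def by (rule sum_order_le_degree[OF g]) simp
  finally have sum: "(\<Sum>y\<leftarrow>?ys. order (e y) ?g) \<le> ydeg N s" .
  have "sum_list (map (ydeg N) (branch ad mu ze el N s)) = (\<Sum>y\<leftarrow>?ys. ydeg N (fst s @ [y], substY ad mu ze y ?Q))"
    by (simp add: branch_def comp_def)
  also have "\<dots> \<le> (\<Sum>y\<leftarrow>?ys. order (e y) ?g)" by (rule sum_list_mono) (rule ord)
  finally show "sum_list (map (ydeg N) (branch ad mu ze el N s)) \<le> ydeg N s" using sum by simp
  have "length (branch ad mu ze el N s) = (\<Sum>y\<leftarrow>?ys. 1)"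
    by (simp add: branch_def sum_list_triv)
  also have "\<dots> \<le> (\<Sum>y\<leftarrow>?ys. order (e y) ?g)" by (rule sum_list_mono) (rule pos)
  finally show "length (branch ad mu ze el N s) \<le> ydeg N s" using sum by simp
qed

text \<open>The width of a level is at most the total potential of the level before, hence at most
  t; the bound is t + 1 because the initial level has one node even if t = 0.\<close>

lemma levels:
  assumes Q: "vec2 Q" "PP Q \<noteq> 0" "shape (Suc t) W Q" and N: "W + k * Suc t \<le> N" and m: "m \<le> k"
  shows "(\<forall>s\<in>set ((level ad mu ze el N ^^ m) [([], Q)]). node t W m s) \<and>
    sum_list (map (ydeg N) ((level ad mu ze el N ^^ m) [([], Q)])) \<le> t \<and>
    length ((level ad mu ze el N ^^ m) [([], Q)]) \<le> Suc t"
  using m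
proof (induction m)
  case 0
  have "degree (eval_X0 (PP (strip ze N Q))) \<le> t"
  proof (rule degree_le, intro allI impI)
    fix i assume "t < i"
    then show "coeff (eval_X0 (PP (strip ze N Q))) i = 0"
      using Q(3) by (simp add: eval_X0_PP nth_default_def shape_def)
  qed
  then show ?case using Q by (auto simp: node_def ydeg_def)
next
  case (Suc m)
  let ?st = "(level ad mu ze el N ^^ m) [([], Q)]"
  have IH: "\<forall>s\<in>set ?st. node t W m s" "sum_list (map (ydeg N) ?st) \<le> t" using Suc by auto
  have "m * Suc t \<le> k * Suc t" using Suc.prems by (intro mult_le_mono1) simp
  then have N': "W + m * Suc t \<le> N" using N by simp
  note b = branch[OF _ N']
  have "sum_list (map (ydeg N) (level ad mu ze el N st)) \<le> sum_list (map (ydeg N) st) \<and>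
      length (level ad mu ze el N st) \<le> sum_list (map (ydeg N) st)"
    if "\<forall>s\<in>set st. node t W m s" for st
    using that
  proof (induction st)
    case (Cons s st)
    then show ?case using b(2,3)[of s] by (force simp: level_def)
  qed (simp add: level_def)
  note 1 = this[OF IH(1)]
  have "node t W (Suc m) s'" if "s' \<in> set (level ad mu ze el N ?st)" for s'
    using that IH(1) b(1) unfolding level_def by fastforce
  then show ?case using 1 IH(2) by simp
qed

text \<open>The induction follows f down the tree: its first m coefficients label a node whose
  polynomial has the remaining coefficients as a root. Dividing by X keeps the root, and setting X =
  0 shows that the next coefficient passes the test.\<close>

lemma roots_complete:
  assumes Q: "vec2 Q" and f: "vec f" "length f = k" "poly (PP Q) (P f) = 0"
    and nz: "PP Q \<noteq> 0"
  shows "f \<in> set (roots ad mu ze el N k Q)"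
proof -
  have "\<exists>R. (take m f, R) \<in> set ((level ad mu ze el N ^^ m) [([], Q)]) \<and> vec2 R \<and> poly (PP R) (P (drop m f)) = 0"
    if "m \<le> k" for m
    using that
  proof (induction m)
    case 0
    then show ?case using assms by auto
  next
    case (Suc m)
    then obtain R where R: "(take m f, R) \<in> set ((level ad mu ze el N ^^ m) [([], Q)])" "vec2 R"
      "poly (PP R) (P (drop m f)) = 0" by auto
    let ?R = "strip ze N R" and ?y = "f ! m"
    have dr: "drop m f = ?y # drop (Suc m) f" using Suc.prems f(2) by (simp add: Cons_nth_drop_Suc)
    have y: "?y \<in> C" using Suc.prems f(1,2) by (auto dest: nth_mem)
    obtain v where v: "PP R = smult ([:0, 1:] ^ v) (PP ?R)" using PP_strip by blast
    then have root: "poly (PP ?R) (P (drop m f)) = 0" using R(3) by auto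
    have R': "vec2 ?R" by (rule vec2_strip[OF R(2)])
    have 0: "poly (poly S p) 0 = poly (eval_X0 S) (poly p 0)" for S p
      by (induction S) (simp_all add: eval_X0_pCons poly_0_coeff_0 coeff_mult_0)
    have "poly (eval_X0 (PP ?R)) (e ?y) = 0"
      using 0[of "PP ?R" "P (drop m f)"] root by (simp add: dr)
    then have ev: "eval0 ad mu ze ?y ?R = ze" using eval0[OF y R'] by (intro iffD1[OF e_eq_0]) auto
    have "poly (PP (substY ad mu ze ?y ?R)) (P (drop (Suc m) f)) = 0"
      using substY[OF y R'] root by (simp add: poly_pcompose dr algebra_simps)
    moreover have "(take (Suc m) f, substY ad mu ze ?y ?R) \<in> set (branch ad mu ze el N (take m f, R))"
      using ev y el Suc.prems f(2) by (auto simp: branch_def take_Suc_conv_app_nth)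
    then have "(take (Suc m) f, substY ad mu ze ?y ?R) \<in> set (level ad mu ze el N ((level ad mu ze el N ^^ m) [([], Q)]))"
      unfolding level_def[of _ _ _ _ _ "(level ad mu ze el N ^^ m) [([], Q)]"] using R(1) by auto
    ultimately show ?case using substY[OF y R']
      by (intro exI[of _ "substY ad mu ze ?y ?R"]) simp
  qed
  from this[of k] f(2) show ?thesis by (force simp: roots_def)
qed

theorem list_decode_complete:
  assumes pts: "\<forall>p\<in>set pts. fst p \<in> C \<and> snd p \<in> C" "distinct (map fst pts)"
    and f: "vec f" "length f = k" and k: "k \<ge> 1" "pts \<noteq> []"
    and A: "A \<subseteq> set pts" "\<forall>p\<in>A. e (snd p) = poly (P f) (e (fst p))" "k * length pts \<le> (card A)\<^sup>2"
  shows "f \<in> set (list_decode ad mu ze on el k pts)"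
proof -
  define t where "t = card A"
  have "t \<le> card (set pts)" unfolding t_def by (intro card_mono A) simp
  then have t: "t \<le> length pts" using card_length le_trans by blast
  let ?rws = "eliminate ad mu ze (constraints k pts) (init_rows ad mu ze on t k pts)"
  note E = eliminate[OF init_rows_valid[OF pts(1), where t = t and k = k], simplified]
  have "?rws \<noteq> []"
  proof
    assume "?rws = []"
    then have "length (mons t k) \<le> length (constraints k pts)" using E by (simp add: init_rows_def)
    then have le: "(t + 1) * (t * (k + 1)) \<le> length pts * (k * (k + 1))"
      using length_mons[OF k(1), of t] length_constraints[of k pts] by simp
    then have "((t + 1) * t) * (k + 1) \<le> (length pts * k) * (k + 1)" by (simp only: mult.assoc)
    then have "(t + 1) * t \<le> length pts * k" by (subst (asm) mult_le_cancel2) simp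
    \<comment> \<open>Counting would give t (t + 1) \<le> k n for n points, while the agreement
      hypothesis gives k n \<le> t^2. This leaves only t = 0, which is excluded because k n is
      positive.\<close>
    then have "t = 0" using A(3) by (simp add: t_def power2_eq_square algebra_simps)
    then show False using A(3) k by (simp add: t_def)
  qed
  then obtain rw rws' where rw: "?rws = rw # rws'" by (cases ?rws) auto
  let ?Q = "PP (snd rw)"
  have val: "valid (set (mons t k)) (form ` set (constraints k pts)) [] rw" using E rw by auto
  have nz: "?Q \<noteq> 0" using E rw by auto
  have "poly ?Q (P f) = 0"
  proof (rule interpolation_root[where A = "(e \<circ> fst) ` A" and t = t and k = k])
    fix a assume "a \<in> (e \<circ> fst) ` A"
    then obtain p where p: "p \<in> A" "a = e (fst p)" by auto
    show "[:- a, 1:] ^ k dvd poly ?Q (P f)"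
    proof (rule multiplicity_dvd)
      show "poly (P f) a = e (snd p)" using A(2) p by simp
      fix r s assume "r + s < k"
      then have "(p, r, s) \<in> set (constraints k pts)" using A(1) p by (auto simp: set_constraints)
      then have "form (p, r, s) ?Q = 0" using val by (auto simp: valid_def)
      then show "coeff (coeff (shift a (e (snd p)) ?Q) s) r = 0" by (simp add: form_def p)
    qed
  next
    show "finite ((e \<circ> fst) ` A)" using A(1) by (auto intro: finite_subset)
    have "inj_on fst (set pts)" using pts(2) by (simp add: distinct_map)
    then have "inj_on (e \<circ> fst) A"
      using A(1) pts(1) inj by (auto intro!: comp_inj_on intro: inj_on_subset)
    then show "t \<le> card ((e \<circ> fst) ` A)" by (simp only: card_image t_def)
  next
    fix i j assume "coeff (coeff ?Q j) i \<noteq> 0"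
    then show "i + (k - 1) * j < t * k" using val by (auto simp: valid_def set_mons)
  next
    show "degree (P f) \<le> k - 1"
      by (rule degree_le) (use f(2) in \<open>auto simp: coeff_P\<close>)
  qed
  then have "f \<in> set (roots ad mu ze el (t * k + k * Suc t) k (snd rw))"
    using val nz f by (intro roots_complete) (auto simp: valid_def)
  then show ?thesis using t rw by (force simp: list_decode_def decode1_def)
qed

end

section \<open>Embedding a finite field of characteristic 2\<close>

text \<open>
  The library theory of polynomials needs a type class, while the field of the code is a record on
  bit strings. It embeds into the algebraic closure of the type of bits: if \<open>\<theta>\<close> generates the
  multiplicative group, then the field is the quotient of the polynomials over the bits by the
  minimal polynomial of \<open>\<theta>\<close>, and \<open>\<theta>\<close> can be mapped to any root of that polynomial.
\<close>

lemma bit_alg_closure_double: "x + x = (0 :: bit alg_closure)"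
proof -
  have "(1 :: bit alg_closure) + 1 = to_ac ((1 :: bit) + 1)" by (simp only: to_ac_add to_ac_1)
  also have "(1 :: bit) + 1 = 0" by (simp add: one_add_one)
  finally have "(1 :: bit alg_closure) + 1 = 0" by simp
  then show ?thesis by (metis distrib_left mult.right_neutral mult_zero_right)
qed

lemma finite_field_embedding:
  fixes K (structure)
  assumes "Ring.field K" and fin: "finite (carrier K)" and ch: "\<one> \<oplus> \<one> = \<zero>"
  shows "\<exists>e :: 'a \<Rightarrow> bit alg_closure. inj_on e (carrier K) \<and> e \<zero> = 0 \<and> e \<one> = 1 \<and>
    (\<forall>x\<in>carrier K. \<forall>y\<in>carrier K. e (x \<oplus> y) = e x + e y \<and> e (x \<otimes> y) = e x * e y)"
proof -
  interpret K: Ring.field K by (rule assms(1))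
  obtain \<theta> where th: "\<theta> \<in> carrier (mult_of K)"
    and gen: "carrier (mult_of K) = {\<theta> [^]\<^bsub>K\<^esub> i | i :: nat. i \<in> UNIV}"
    using K.finite_field_mult_group_has_gen[OF fin] by (auto simp: nat_pow_mult_of)
  have th': "\<theta> \<in> carrier K" using th by simp
  define io :: "bit \<Rightarrow> 'a" where "io c = (if c = 1 then \<one> else \<zero>)" for c
  \<comment> \<open>Evaluation at \<theta>, by Horner's rule on the coefficient list. Its kernel is
    an ideal, generated by the element g of least degree obtained below.\<close>
  define ev where "ev p = foldr (\<lambda>c r. io c \<oplus> \<theta> \<otimes> r) (coeffs p) \<zero>" for p
  have io: "io c \<in> carrier K" "io 0 = \<zero>" "io 1 = \<one>" for c by (simp_all add: io_def)
  have io_add: "io (a + b) = io a \<oplus> io b" for a b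
    using ch by (cases a; cases b) (simp_all add: io one_add_one)
  have evl: "foldr (\<lambda>c r. io c \<oplus> \<theta> \<otimes> r) cs \<zero> \<in> carrier K" for cs
    by (induction cs) (simp_all add: io th')
  have ev_closed [simp]: "ev p \<in> carrier K" for p unfolding ev_def by (rule evl)
  have ev_0 [simp]: "ev 0 = \<zero>" by (simp add: ev_def)
  have ev_pCons: "ev (pCons c p) = io c \<oplus> \<theta> \<otimes> ev p" for c p
    by (cases "p = 0 \<and> c = 0") (auto simp: ev_def io th' cCons_def)
  have ev_add: "ev (p + q) = ev p \<oplus> ev q" for p q
  proof (induction p q rule: poly_induct2)
    case (pCons a p b q)
    have "ev (pCons a p + pCons b q) = (io a \<oplus> io b) \<oplus> \<theta> \<otimes> (ev p \<oplus> ev q)"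
      by (simp only: add_pCons ev_pCons io_add pCons.IH)
    also have "\<dots> = (io a \<oplus> \<theta> \<otimes> ev p) \<oplus> (io b \<oplus> \<theta> \<otimes> ev q)"
      using io(1) th' by (simp add: K.r_distr K.a_ac)
    finally show ?case by (simp only: ev_pCons)
  qed simp
  have ev_smult: "ev (smult c p) = io c \<otimes> ev p" for c p
    by (cases c) (simp_all add: io)
  have ev_mult: "ev (p * q) = ev p \<otimes> ev q" for p q
    by (induction p) (simp_all add: ev_pCons ev_add ev_smult io th' K.l_distr K.m_assoc)
  have ev_1 [simp]: "ev 1 = \<one>" by (simp add: one_pCons ev_pCons io th')
  have ev_monom: "ev (monom 1 i) = \<theta> [^] i" for i :: nat
    by (induction i) (simp_all add: monom_0 monom_Suc ev_pCons io th' K.m_comm)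
  have surj: "\<exists>p. ev p = x" if "x \<in> carrier K" for x
  proof (cases "x = \<zero>")
    case False
    then have "x \<in> carrier (mult_of K)" using that by simp
    then obtain i :: nat where "x = \<theta> [^] i" unfolding gen by blast
    then show ?thesis using ev_monom by blast
  qed (use ev_0 in blast)
  have minus: "p - q = p + q" for p q :: "bit poly" by (rule poly_eqI) simp
  define Z where "Z g \<longleftrightarrow> g \<noteq> 0 \<and> ev g = \<zero>" for g
  have "\<exists>g. Z g"
  proof -
    \<comment> \<open>Two powers of \<theta> coincide because the field is finite; the sum of the
      corresponding monomials is a nonzero polynomial in the kernel.\<close>
    have "\<not> inj (\<lambda>i :: nat. \<theta> [^] i)"
      using fin th' by (metis K.nat_pow_closed finite_imageD finite_subset image_subsetI infinite_UNIV_nat)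
    then obtain i j :: nat where ij: "i \<noteq> j" "\<theta> [^] i = \<theta> [^] j" by (auto simp: inj_on_def)
    have "ev (monom 1 i + monom 1 j) = \<theta> [^] i \<oplus> \<theta> [^] i" by (simp add: ev_add ev_monom ij)
    also have "\<dots> = \<theta> [^] i \<otimes> (\<one> \<oplus> \<one>)" by (simp add: K.r_distr th')
    also have "\<dots> = \<zero>" using th' by (simp add: ch)
    finally have "ev (monom 1 i + monom 1 j) = \<zero>" .
    moreover have "coeff (monom 1 i + monom 1 j :: bit poly) i = 1" using ij by simp
    then have "monom 1 i + monom 1 j \<noteq> (0 :: bit poly)" by (metis coeff_0 zero_neq_one)
    ultimately show ?thesis unfolding Z_def by blast
  qed
  then obtain g where g: "Z g" and g_min: "\<And>h. Z h \<Longrightarrow> Polynomial.degree g \<le> Polynomial.degree h"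
    using ex_has_least_nat[of Z _ Polynomial.degree] by blast
  have deg: "Polynomial.degree g > 0"
  proof (rule ccontr)
    assume "\<not> Polynomial.degree g > 0"
    then obtain c where c: "g = [:c:]" by (metis degree_eq_zeroE gr0I)
    then have "c = 1" using g by (auto simp: Z_def)
    then show False using g c by (simp add: Z_def ev_pCons io th')
  qed
  have dvd: "g dvd p" if "ev p = \<zero>" for p
  proof -
    have "ev g = \<zero>" using g by (simp add: Z_def)
    have "ev p = ev (p div g) \<otimes> ev g \<oplus> ev (p mod g)" by (simp flip: ev_mult ev_add)
    also have "\<dots> = ev (p mod g)" by (simp add: \<open>ev g = \<zero>\<close>)
    finally have "ev (p mod g) = \<zero>" using that by simp
    moreover have "p mod g = 0 \<or> Polynomial.degree (p mod g) < Polynomial.degree g"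
      using degree_mod_less[of g p] g by (auto simp: Z_def)
    ultimately have "p mod g = 0" using g_min[of "p mod g"] by (force simp: Z_def)
    then show ?thesis by (simp add: dvd_eq_mod_eq_0)
  qed
  have "Polynomial.degree (map_poly to_ac g) = Polynomial.degree g"
    by (rule degree_map_poly) simp
  then obtain \<zeta> where z: "poly (map_poly to_ac g) \<zeta> = 0"
    using alg_closed_imp_poly_has_root[of "map_poly to_ac g"] deg by auto
  define F where "F p = poly (map_poly to_ac p) \<zeta>" for p
  have F_0 [simp]: "F 0 = 0" by (simp add: F_def)
  have F_pCons: "F (pCons c p) = to_ac c + \<zeta> * F p" for c p by (simp add: F_def map_poly_pCons)
  have F_add: "F (p + q) = F p + F q" for p q
  proof (induction p q rule: poly_induct2)
    case (pCons a p b q)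
    have "F (pCons a p + pCons b q) = (to_ac a + to_ac b) + \<zeta> * (F p + F q)"
      by (simp only: add_pCons F_pCons to_ac_add pCons.IH)
    then show ?case by (simp only: F_pCons algebra_simps)
  qed simp
  have F_smult: "F (smult c p) = to_ac c * F p" for c p by (cases c) simp_all
  have F_mult: "F (p * q) = F p * F q" for p q
    by (induction p) (simp_all add: F_pCons F_add F_smult algebra_simps)
  have F_1: "F 1 = 1" by (simp add: one_pCons F_pCons)
  have F_g: "F g = 0" using z by (simp add: F_def)
  \<comment> \<open>Polynomials with the same value at \<theta> differ by a multiple of g, which
    vanishes at \<zeta>. This makes the map e below well defined on the field.\<close>
  have F_cong: "F p = F q" if "ev p = ev q" for p q
  proof -
    have "ev (p + q) = ev p \<otimes> (\<one> \<oplus> \<one>)" using that by (simp add: ev_add K.r_distr)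
    then have "g dvd p + q" by (intro dvd) (simp add: ch)
    then have "F p + F q = 0" using F_g by (auto simp: F_mult simp flip: F_add)
    then have "F p + F q = F q + F q" using bit_alg_closure_double[of "F q"] by simp
    then show ?thesis by (rule add_right_imp_eq)
  qed
  define e where "e x = F (SOME p. ev p = x)" for x
  have e: "e (ev p) = F p" for p
    unfolding e_def by (rule F_cong, rule someI[of "\<lambda>q. ev q = ev p" p]) simp
  have hom: "e (x \<oplus> y) = e x + e y" "e (x \<otimes> y) = e x * e y" if xy: "x \<in> carrier K" "y \<in> carrier K" for x y
  proof -
    obtain p q where "x = ev p" "y = ev q" using surj[OF xy(1)] surj[OF xy(2)] by blast
    then show "e (x \<oplus> y) = e x + e y" "e (x \<otimes> y) = e x * e y"
      using e[of "p + q"] e[of "p * q"] by (simp_all add: e ev_add ev_mult F_add F_mult)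
  qed
  have e0: "e \<zero> = 0" and e1: "e \<one> = 1" using e[of 0] e[of 1] F_1 by simp_all
  have "inj_on e (carrier K)"
  proof (rule inj_onI)
    fix x y assume xy: "x \<in> carrier K" "y \<in> carrier K" "e x = e y"
    define w where "w = x \<ominus> y"
    have w: "w \<in> carrier K" using xy by (simp add: w_def)
    have "x = w \<oplus> y" using xy by (simp add: w_def a_minus_def K.a_assoc K.l_neg)
    then have "e w = 0" using hom(1)[OF w xy(2)] xy(3) by simp
    then have "w = \<zero>"
    proof (rule_tac ccontr)
      assume "w \<noteq> \<zero>"
      then have "w \<otimes> inv w = \<one>" "inv w \<in> carrier K" using w K.field_Units by auto
      then show False using hom(2)[OF w, of "inv w"] \<open>e w = 0\<close> e1 by simp
    qed
    then show "x = y" using \<open>x = w \<oplus> y\<close> xy by simp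
  qed
  then show ?thesis using hom e0 e1 by blast
qed

text \<open>By Lagrange in the additive group, 2^l times the unit is zero. By distributivity this
  multiple equals the l-th power of 1 + 1, and an integral domain has no nonzero nilpotent
  elements.\<close>

lemma char_2_of_order:
  fixes K (structure)
  assumes "Ring.field K" "finite (carrier K)" "card (carrier K) = 2 ^ l"
  shows "\<one> \<oplus> \<one> = \<zero>"
proof -
  interpret K: Ring.field K by (rule assms(1))
  have grp: "group (add_monoid K)" by (rule K.add.is_group)
  have "\<one> [^]\<^bsub>add_monoid K\<^esub> (2 ^ l :: nat) = \<zero>"
    using group.pow_order_eq_1[OF grp, of \<one>] assms(3) by (simp add: Coset.order_def)
  moreover have "\<one> [^]\<^bsub>add_monoid K\<^esub> (2 ^ m :: nat) = (\<one> \<oplus> \<one>) [^] m" for m :: nat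
  proof (induction m)
    case (Suc m)
    have "\<one> [^]\<^bsub>add_monoid K\<^esub> (2 ^ Suc m :: nat) =
        \<one> [^]\<^bsub>add_monoid K\<^esub> (2 ^ m :: nat) \<oplus> \<one> [^]\<^bsub>add_monoid K\<^esub> (2 ^ m :: nat)"
      using monoid.nat_pow_mult[OF group.is_monoid[OF grp], of \<one> "2 ^ m" "2 ^ m"] by (simp add: mult_2)
    then show ?case using Suc by (simp add: K.r_distr)
  qed simp
  ultimately have "(\<one> \<oplus> \<one>) [^] l = \<zero>" by simp
  then show ?thesis
  proof (induction l)
    case (Suc l)
    then show ?case using K.integral[of "(\<one> \<oplus> \<one>) [^] l" "\<one> \<oplus> \<one>"] by auto
  qed simp
qed

section \<open>The decoder runs in polynomial time\<close>

lemma foldl_funpow: "foldl (\<lambda>a _. f a) a (replicate n y) = (f ^^ n) a"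
  by (induction n arbitrary: a) (simp_all add: funpow_swap1)

lemma pt_funpow:
  assumes n: "pt I x (\<lambda>i. enc_nat (n i))" and a0: "pt I x (\<lambda>i. A (a0 i))"
    and step: "\<And>x'. pt (fold_dom I (\<lambda>i. replicate (n i) True) V) x' (\<lambda>j. x (fst j)) \<Longrightarrow>
       pt (fold_dom I (\<lambda>i. replicate (n i) True) V) x' (\<lambda>j. A (snd (snd j))) \<Longrightarrow>
       pt (fold_dom I (\<lambda>i. replicate (n i) True) V) x' (\<lambda>j. A (g (fst j) (snd (snd j))))"
    and V0: "\<And>i. i \<in> I \<Longrightarrow> V i 0 (a0 i)"
    and VS: "\<And>i m a. i \<in> I \<Longrightarrow> m < n i \<Longrightarrow> V i m a \<Longrightarrow> V i (Suc m) (g i a)"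
    and B: "pbd I x B" "\<And>i m a. i \<in> I \<Longrightarrow> m \<le> n i \<Longrightarrow> V i m a \<Longrightarrow> data_size (A a) \<le> B i"
  shows "pt I x (\<lambda>i. A ((g i ^^ n i) (a0 i)))"
proof -
  have "pt I x (\<lambda>i. A (foldl (\<lambda>a y. g i a) (a0 i) (replicate (n i) True)))"
    by (rule pt_foldl[where V = V and E = enc_bool and g = "\<lambda>i _. g i", OF pt_bits_of_nat[OF n] a0 step V0 _ B(1)])
      (use VS B(2) in auto)
  then show ?thesis by (simp add: foldl_funpow)
qed

text \<open>At most one of the two dropped remainders is nonempty, so their concatenation is the
  tail of the longer list.\<close>

lemma padd_conv:
  "padd f p q = map (\<lambda>y. f (fst y) (snd y)) (zip p q) @ (drop (length q) p @ drop (length p) q)"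
  by (induction f p q rule: padd.induct) auto

lemma pt_padd:
  assumes p: "pt I x (\<lambda>i. enc_list E (p i))" and q: "pt I x (\<lambda>i. enc_list E (q i))"
    and f: "\<And>x'. pt (SIGMA i:I. set (zip (p i) (q i))) x' (\<lambda>j. x (fst j)) \<Longrightarrow>
       pt (SIGMA i:I. set (zip (p i) (q i))) x' (\<lambda>j. E (fst (snd j))) \<Longrightarrow>
       pt (SIGMA i:I. set (zip (p i) (q i))) x' (\<lambda>j. E (snd (snd j))) \<Longrightarrow>
       pt (SIGMA i:I. set (zip (p i) (q i))) x' (\<lambda>j. E (f (fst j) (fst (snd j)) (snd (snd j))))"
  shows "pt I x (\<lambda>i. enc_list E (padd (f i) (p i) (q i)))"
  unfolding padd_conv
proof (intro pt_append pt_drop pt_length[where E = E] p q)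
  show "pt I x (\<lambda>i. enc_list E (map (\<lambda>y. f i (fst y) (snd y)) (zip (p i) (q i))))"
  proof (rule pt_map[OF pt_zip[OF p q]])
    fix x' let ?J = "SIGMA i:I. set (zip (p i) (q i))"
    assume x': "pt ?J x' (\<lambda>j. x (fst j))" "pt ?J x' (\<lambda>j. enc_pair E E (snd j))"
    show "pt ?J x' (\<lambda>j. E (f (fst j) (fst (snd j)) (snd (snd j))))"
      by (rule f[OF x'(1) pt_pair_fst[OF x'(2)] pt_pair_snd[OF x'(2)]])
  qed
qed

abbreviation enc_vec :: "bool list list \<Rightarrow> data" where
  "enc_vec \<equiv> enc_list enc_bits"

abbreviation enc_poly2 :: "bool list list list \<Rightarrow> data" where
  "enc_poly2 \<equiv> enc_list enc_vec"

lemma data_size_vec: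
  assumes "set p \<subseteq> bitstrings l" "length p \<le> n"
  shows "data_size (enc_vec p) \<le> Suc (n * Suc (Suc (l * 4)))"
  by (rule data_size_list_le) (use assms data_size_bits in \<open>auto simp: bitstrings_def subset_iff\<close>)

lemma data_size_poly2:
  assumes "\<forall>r\<in>set Q. set r \<subseteq> bitstrings l" "shape L W Q"
  shows "data_size (enc_poly2 Q) \<le> Suc (L * Suc (Suc (W * Suc (Suc (l * 4)))))"
  by (rule data_size_list_le) (use assms data_size_vec[of _ l W] in \<open>auto simp: shape_def\<close>)

text \<open>Makes exhaustive search in the field affordable: l \<le> c ln n implies 2^l \<le> n^d
  for every d \<ge> c, as ln 2 < 1.\<close>

lemma pow2_of_log:
  assumes "(\<lambda>n. real (l n)) \<in> O(\<lambda>n. ln (real n))"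
  shows "\<exists>p :: nat poly. \<forall>n. 2 ^ l n \<le> poly p n"
proof -
  obtain c where c: "c > 0" "\<forall>\<^sub>F n in sequentially. real (l n) \<le> c * \<bar>ln (real n)\<bar>"
    using assms by (auto elim!: landau_o.bigE)
  define d where "d = nat \<lceil>c\<rceil>"
  have d: "c \<le> real d" using c(1) by (simp add: d_def)
  obtain N where N: "\<And>n. n \<ge> N \<Longrightarrow> real (l n) \<le> c * \<bar>ln (real n)\<bar>"
    using c(2) by (auto simp: eventually_sequentially)
  have big: "2 ^ l n \<le> n ^ d" if n: "n \<ge> Suc N" for n
  proof -
    have n1: "real n \<ge> 1" using n by simp
    have "real (2 ^ l n) = exp (real (l n) * ln 2)"
      by (simp add: exp_of_nat_mult)
    also have "real (l n) * ln 2 \<le> real (l n) * 1"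
      using ln_2_less_1 by (intro mult_left_mono) auto
    also have "real (l n) * 1 \<le> real d * ln (real n)"
      using N[of n] n d n1 mult_right_mono[OF d, of "ln (real n)"] by simp
    finally have "real (2 ^ l n) \<le> exp (real d * ln (real n))" by simp
    also have "\<dots> = real (n ^ d)" using n1 by (simp add: exp_of_nat_mult)
    finally show ?thesis by (simp only: of_nat_le_iff)
  qed
  \<comment> \<open>The asymptotic bound says nothing about finitely many n; the constant s covers
    these.\<close>
  define s :: nat where "s = (\<Sum>n<Suc N. 2 ^ l n)"
  have "2 ^ l n \<le> poly (monom 1 d + [:s:]) n" for n
  proof (cases "n \<ge> Suc N")
    case True
    then show ?thesis using big[of n] by (simp add: poly_monom)
  next
    case False
    then have "2 ^ l n \<le> s" unfolding s_def by (intro member_le_sum) auto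
    then show ?thesis by (simp add: poly_monom)
  qed
  then show ?thesis by blast
qed

section \<open>Field arithmetic on bit strings\<close>

locale learning_setting =
  fixes P :: setting and R :: real and lam0 :: nat
  assumes R: "0 < R" "R < 1/4"
    and valid_P: "valid_parameters P R lam0"
    and valid_F: "valid_field P lam0"
    and scheme: "signature_scheme (gen_of P) (sign_of P) (verify_of P)"
    and ecc: "error_correcting lam0 (sym_bits P) (budget P R) (ecc_of P)"
begin

abbreviation l where "l \<equiv> sym_bits P"
abbreviation C where "C lam \<equiv> bitstrings (sym_bits P lam)"

text \<open>Totalized field operations, so that their values always lie in the field.\<close>

definition ad :: "nat \<Rightarrow> bool list \<Rightarrow> bool list \<Rightarrow> bool list" where
  "ad lam a b = (if length a = l lam \<and> length b = l lam then a \<oplus>\<^bsub>fld P lam\<^esub> b else replicate (l lam) False)"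

definition mu :: "nat \<Rightarrow> bool list \<Rightarrow> bool list \<Rightarrow> bool list" where
  "mu lam a b = (if length a = l lam \<and> length b = l lam then a \<otimes>\<^bsub>fld P lam\<^esub> b else replicate (l lam) False)"

text \<open>Among the field data only addition, multiplication and the evaluation points are given
  as computable. Zero is obtained from them as w + w in characteristic 2.\<close>

definition ze :: "nat \<Rightarrow> bool list" where
  "ze lam = ad lam (replicate (l lam) False) (replicate (l lam) False)"

definition el :: "nat \<Rightarrow> bool list list" where
  "el lam = ((\<lambda>xs. map ((#) False) xs @ map ((#) True) xs) ^^ l lam) [[]]"

text \<open>The unit is the only nonzero idempotent.\<close>

definition on :: "nat \<Rightarrow> bool list" where
  "on lam = hd (filter (\<lambda>a. a \<noteq> ze lam \<and> mu lam a a = a) (el lam))"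

lemma bitlists: "distinct (((\<lambda>xs. map ((#) False) xs @ map ((#) True) xs) ^^ n) [[]]) \<and>
    set (((\<lambda>xs. map ((#) False) xs @ map ((#) True) xs) ^^ n) [[]]) = bitstrings n \<and>
    length (((\<lambda>xs. map ((#) False) xs @ map ((#) True) xs) ^^ n) [[]]) = 2 ^ n"
proof (induction n)
  case (Suc n)
  have "w \<in> bitstrings (Suc n) \<longleftrightarrow> w \<in> (#) False ` bitstrings n \<union> (#) True ` bitstrings n" for w
    by (cases w) (auto simp: bitstrings_def image_iff)
  with Suc show ?case by (auto simp: distinct_map)
qed (auto simp: bitstrings_def)

lemma el: "distinct (el lam)" "set (el lam) = C lam"
  using bitlists[of "l lam"] by (simp_all add: el_def)

context
  fixes lam assumes lam: "lam \<ge> lam0"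
begin

lemma fld: "Ring.field (fld P lam)" "carrier (fld P lam) = C lam"
  using valid_F lam by (auto simp: valid_field_def)

lemma ad_closed: "ad lam a b \<in> C lam" and mu_closed: "mu lam a b \<in> C lam"
proof -
  interpret K: Ring.field "fld P lam" by (rule fld(1))
  have c: "carrier (fld P lam) = {w. length w = l lam}" using fld(2) by (simp add: bitstrings_def)
  show "ad lam a b \<in> C lam" using K.add.m_closed[of a b] c by (simp add: ad_def bitstrings_def)
  show "mu lam a b \<in> C lam" using K.m_closed[of a b] c by (simp add: mu_def bitstrings_def)
qed

lemma finite_C: "finite (C lam)" "card (C lam) = 2 ^ l lam"
  using card_lists_length_eq[of "UNIV :: bool set" "l lam"] finite_lists_length_eq[of "UNIV :: bool set" "l lam"]
  by (simp_all add: bitstrings_def)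

lemma char2: "\<one>\<^bsub>fld P lam\<^esub> \<oplus>\<^bsub>fld P lam\<^esub> \<one>\<^bsub>fld P lam\<^esub> = \<zero>\<^bsub>fld P lam\<^esub>"
  by (rule char_2_of_order[OF fld(1), of "l lam"]) (use fld(2) finite_C in auto)

lemma ze: "ze lam = \<zero>\<^bsub>fld P lam\<^esub>"
proof -
  interpret K: Ring.field "fld P lam" by (rule fld(1))
  have w: "replicate (l lam) False \<in> carrier (fld P lam)" by (simp add: fld(2) bitstrings_def)
  have "replicate (l lam) False \<otimes>\<^bsub>fld P lam\<^esub> (\<one>\<^bsub>fld P lam\<^esub> \<oplus>\<^bsub>fld P lam\<^esub> \<one>\<^bsub>fld P lam\<^esub>) = \<zero>\<^bsub>fld P lam\<^esub>"
    using w by (simp add: char2)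
  then show ?thesis using w by (simp add: ze_def ad_def K.r_distr)
qed

lemma on: "on lam = \<one>\<^bsub>fld P lam\<^esub>"
  and filter_on: "on lam \<in> set (filter (\<lambda>a. a \<noteq> ze lam \<and> mu lam a a = a) (el lam))"
proof -
  interpret K: Ring.field "fld P lam" by (rule fld(1))
  have one: "\<one>\<^bsub>fld P lam\<^esub> \<in> C lam" using K.one_closed by (simp only: fld(2))
  let ?xs = "filter (\<lambda>a. a \<noteq> ze lam \<and> mu lam a a = a) (el lam)"
  have mem: "a \<in> set ?xs \<longleftrightarrow> a = \<one>\<^bsub>fld P lam\<^esub>" for a
  proof
    assume "a \<in> set ?xs"
    then have a: "a \<in> carrier (fld P lam)" "a \<noteq> \<zero>\<^bsub>fld P lam\<^esub>" and "mu lam a a = a"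
      by (simp_all add: el fld(2) ze)
    then have "a \<otimes>\<^bsub>fld P lam\<^esub> a = a"
      by (simp add: fld(2) mu_def bitstrings_def)
    then have "a \<otimes>\<^bsub>fld P lam\<^esub> a = a \<otimes>\<^bsub>fld P lam\<^esub> \<one>\<^bsub>fld P lam\<^esub>"
      using a(1) by simp
    then show "a = \<one>\<^bsub>fld P lam\<^esub>" using K.m_lcancel[OF a(2,1) a(1) K.one_closed] by simp
  next
    assume "a = \<one>\<^bsub>fld P lam\<^esub>"
    moreover have "mu lam \<one>\<^bsub>fld P lam\<^esub> \<one>\<^bsub>fld P lam\<^esub> = \<one>\<^bsub>fld P lam\<^esub>"
      using one by (simp add: mu_def bitstrings_def)
    ultimately show "a \<in> set ?xs" using one by (simp add: el ze)
  qed
  have s1: "set ?xs = {\<one>\<^bsub>fld P lam\<^esub>}" by (rule Set.set_eqI) (simp only: mem singleton_iff)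
  have hd: "hd ys = z" if "set ys = {z}" for ys and z :: "bool list"
    using that by (cases ys) auto
  show "on lam = \<one>\<^bsub>fld P lam\<^esub>" unfolding on_def by (rule hd[OF s1])
  show "on lam \<in> set ?xs" unfolding on_def hd[OF s1] s1 by simp
qed

lemma rep: "\<exists>e :: bool list \<Rightarrow> bit alg_closure. field_rep (C lam) (ad lam) (mu lam) (ze lam) (on lam) (el lam) e"
proof -
  interpret K: Ring.field "fld P lam" by (rule fld(1))
  have fin: "finite (carrier (fld P lam))" using finite_C(1) by (simp add: fld(2))
  obtain e :: "bool list \<Rightarrow> bit alg_closure" where e: "inj_on e (C lam)" "e \<zero>\<^bsub>fld P lam\<^esub> = 0" "e \<one>\<^bsub>fld P lam\<^esub> = 1"
    "\<forall>x\<in>C lam. \<forall>y\<in>C lam. e (x \<oplus>\<^bsub>fld P lam\<^esub> y) = e x + e y \<and> e (x \<otimes>\<^bsub>fld P lam\<^esub> y) = e x * e y"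
    using finite_field_embedding[OF fld(1) fin char2] unfolding fld(2) by blast
  have "field_rep (C lam) (ad lam) (mu lam) (ze lam) (on lam) (el lam) e"
  proof
    show "ze lam \<in> C lam" "on lam \<in> C lam" unfolding ze on
      using K.zero_closed K.one_closed by (simp_all only: fld(2))
  qed (use e el ad_closed mu_closed ze on bit_alg_closure_double in \<open>auto simp: ad_def mu_def bitstrings_def\<close>)
  then show ?thesis by blast
qed

end

text \<open>The embedding is chosen, never computed: it occurs in correctness statements and in the
  invariants behind the size bounds, but in no program.\<close>

definition em :: "nat \<Rightarrow> bool list \<Rightarrow> bit alg_closure" where
  "em lam = (SOME e. field_rep (C lam) (ad lam) (mu lam) (ze lam) (on lam) (el lam) e)"

lemma field_rep: "lam \<ge> lam0 \<Longrightarrow> field_rep (C lam) (ad lam) (mu lam) (ze lam) (on lam) (el lam) (em lam)"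
  unfolding em_def by (rule someI_ex[OF rep])

definition env :: "'i set \<Rightarrow> ('i \<Rightarrow> data) \<Rightarrow> ('i \<Rightarrow> nat) \<Rightarrow> bool" where
  "env I x lam \<longleftrightarrow> pt I x (\<lambda>i. enc_nat (lam i)) \<and> (\<forall>i\<in>I. lam0 \<le> lam i)"

lemma env_pt: "env I x lam \<Longrightarrow> pt I x (\<lambda>i. enc_nat (lam i))"
  and env_ge: "env I x lam \<Longrightarrow> i \<in> I \<Longrightarrow> lam0 \<le> lam i"
  by (auto simp: env_def)

lemma env_lift:
  assumes "env I x lam" "pt J x' (\<lambda>j. x (h j))" "\<And>j. j \<in> J \<Longrightarrow> h j \<in> I"
  shows "env J x' (\<lambda>j. lam (h j))"
  using pt_lift[OF env_pt[OF assms(1)] assms(2,3)] assms(1,3) by (auto simp: env_def)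

lemma pt_lift_Sigma: "pt I x f \<Longrightarrow> pt (Sigma I S) x' (\<lambda>j. x (fst j)) \<Longrightarrow> pt (Sigma I S) x' (\<lambda>j. f (fst j))"
  by (rule pt_lift) auto

lemma pt_lift_fold: "pt I x f \<Longrightarrow> pt (fold_dom I xs V) x' (\<lambda>j. x (fst j)) \<Longrightarrow> pt (fold_dom I xs V) x' (\<lambda>j. f (fst j))"
  by (rule pt_lift) (auto simp: fold_dom_def)

lemma env_lift_Sigma: "env I x lam \<Longrightarrow> pt (Sigma I S) x' (\<lambda>j. x (fst j)) \<Longrightarrow> env (Sigma I S) x' (\<lambda>j. lam (fst j))"
  by (rule env_lift) auto

lemma env_lift_fold: "env I x lam \<Longrightarrow> pt (fold_dom I xs V) x' (\<lambda>j. x (fst j)) \<Longrightarrow> env (fold_dom I xs V) x' (\<lambda>j. lam (fst j))"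
  by (rule env_lift) (auto simp: fold_dom_def)

lemma env_subset: "env I x lam \<Longrightarrow> J \<subseteq> I \<Longrightarrow> env J x lam"
  unfolding env_def using pt_subset by blast

lemma pt_param:
  assumes g: "g \<in> {code_len P, code_dim P, seed_len P, sym_bits P, vk_len P, sig_len P}" and e: "env I x lam"
  shows "pt I x (\<lambda>i. enc_nat (g (lam i)))"
proof -
  have "poly_time_computable UNIV enc_nat (\<lambda>lam. enc_nat (g lam))"
    using valid_P g unfolding valid_parameters_def by blast
  from pt_lift[OF pt_of_computable_nat[OF this] env_pt[OF e]] show ?thesis by simp
qed

lemmas pt_l = pt_param[of "sym_bits P", simplified]

lemma pt_in_C:
  assumes e: "env I x lam" and a: "pt I x (\<lambda>i. enc_bits (a i))"
  shows "pt I x (\<lambda>i. enc_bool (length (a i) = l (lam i)))"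
  by (intro pt_nat_eq pt_length[where E = enc_bool, OF a] pt_l[OF e])

lemma pt_field_op:
  assumes f: "f \<in> {\<lambda>K x y. x \<oplus>\<^bsub>K\<^esub> y, \<lambda>K x y. x \<otimes>\<^bsub>K\<^esub> y}"
    and e: "env I x lam" and a: "pt I x (\<lambda>i. enc_bits (a i))" and b: "pt I x (\<lambda>i. enc_bits (b i))"
  shows "pt I x (\<lambda>i. enc_bits (if length (a i) = l (lam i) \<and> length (b i) = l (lam i)
      then f (fld P (lam i)) (a i) (b i) else replicate (l (lam i)) False))"
proof (rule pt_if)
  show "pt I x (\<lambda>i. enc_bool (length (a i) = l (lam i) \<and> length (b i) = l (lam i)))"
    by (intro pt_conj pt_in_C e a b)
  show "pt {i \<in> I. \<not> (length (a i) = l (lam i) \<and> length (b i) = l (lam i))} x (\<lambda>i. enc_bits (replicate (l (lam i)) False))"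
    by (rule pt_subset[OF pt_replicate[where E = enc_bool, OF pt_l[OF e] pt_const]]) auto
  let ?I = "{i \<in> I. length (a i) = l (lam i) \<and> length (b i) = l (lam i)}"
  let ?J = "{(lam, a, b). lam \<ge> lam0 \<and> a \<in> carrier (fld P lam) \<and> b \<in> carrier (fld P lam)}"
  let ?z = "\<lambda>(lam, a, b). Pair (enc_nat lam) (Pair (enc_bits a) (enc_bits b))"
  have "poly_time_computable ?J ?z (\<lambda>(lam, a, b). enc_bits (f (fld P lam) a b))"
    using valid_F f unfolding valid_field_def by blast
  moreover have "(\<lambda>(lam, a, b). enc_bits (f (fld P lam) a b)) = (\<lambda>j. enc_bits (f (fld P (fst j)) (fst (snd j)) (snd (snd j))))"
    by (simp add: fun_eq_iff)
  ultimately have "poly_time_computable ?J ?z (\<lambda>j. enc_bits (f (fld P (fst j)) (fst (snd j)) (snd (snd j))))"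
    by simp
  from pt_of_computable_bits[OF this]
  have 1: "pt ?J ?z (\<lambda>j. enc_bits (f (fld P (fst j)) (fst (snd j)) (snd (snd j))))" .
  have s: "?I \<subseteq> I" by auto
  have "pt ?I x (\<lambda>i. Pair (enc_nat (lam i)) (Pair (enc_bits (a i)) (enc_bits (b i))))"
    by (intro pt_Pair pt_subset[OF env_pt[OF e] s] pt_subset[OF a s] pt_subset[OF b s])
  from pt_comp[OF this 1, of "\<lambda>i. (lam i, a i, b i)"]
  show "pt ?I x (\<lambda>i. enc_bits (f (fld P (lam i)) (a i) (b i)))"
    using env_ge[OF e] by (auto simp: fld bitstrings_def)
qed

lemma pt_ad:
  assumes "env I x lam" "pt I x (\<lambda>i. enc_bits (a i))" "pt I x (\<lambda>i. enc_bits (b i))"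
  shows "pt I x (\<lambda>i. enc_bits (ad (lam i) (a i) (b i)))"
  unfolding ad_def using pt_field_op[OF _ assms, of "\<lambda>K x y. x \<oplus>\<^bsub>K\<^esub> y"] by simp

lemma pt_mu:
  assumes "env I x lam" "pt I x (\<lambda>i. enc_bits (a i))" "pt I x (\<lambda>i. enc_bits (b i))"
  shows "pt I x (\<lambda>i. enc_bits (mu (lam i) (a i) (b i)))"
  unfolding mu_def using pt_field_op[OF _ assms, of "\<lambda>K x y. x \<otimes>\<^bsub>K\<^esub> y"] by simp

lemma pt_ze:
  assumes "env I x lam"
  shows "pt I x (\<lambda>i. enc_bits (ze (lam i)))"
  unfolding ze_def by (intro pt_ad assms pt_replicate[where E = enc_bool] pt_l pt_const)

lemma pbd_l: "env I x lam \<Longrightarrow> pbd I x (\<lambda>i. l (lam i))"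
  by (rule pt_nat_pbd[OF pt_l])

lemma pt_el:
  assumes e: "env I x lam"
  shows "pt I x (\<lambda>i. enc_vec (el (lam i)))"
proof -
  have "(\<lambda>lam. real (l lam)) \<in> O(\<lambda>lam. ln (real lam))"
    using valid_P unfolding valid_parameters_def by (blast dest: bigthetaD1)
  then obtain p where p: "\<And>lam. 2 ^ l lam \<le> poly p lam" using pow2_of_log by blast
  show ?thesis
  unfolding el_def
proof (rule pt_funpow[where V = "\<lambda>i m xs. xs = ((\<lambda>xs. map ((#) False) xs @ map ((#) True) xs) ^^ m) [[]]", OF pt_l[OF e]])
  show "pt I x (\<lambda>i. enc_vec [[]])" by (rule pt_const)
  show "pbd I x (\<lambda>i. Suc (poly p (lam i) * Suc (Suc (l (lam i) * 4))))"
    by (intro pbd_Suc pbd_mult pbd_poly pbd_l[OF e] pt_nat_pbd[OF env_pt[OF e]] pbd_const)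
  fix i m xs assume m: "m \<le> l (lam i)" "xs = ((\<lambda>xs. map ((#) False) xs @ map ((#) True) xs) ^^ m) [[]]"
  have "length xs = 2 ^ m" "set xs = bitstrings m" using bitlists[of m] m(2) by auto
  moreover have "(2 :: nat) ^ m \<le> poly p (lam i)"
    using p[of "lam i"] m(1) power_increasing[of m "l (lam i)" "2 :: nat"] by linarith
  ultimately show "data_size (enc_vec xs) \<le> Suc (poly p (lam i) * Suc (Suc (l (lam i) * 4)))"
    using m(1) data_size_bits by (intro data_size_list_le) (fastforce simp: bitstrings_def intro: order_trans)+
next
  fix x' let ?J = "fold_dom I (\<lambda>i. replicate (l (lam i)) True) (\<lambda>i m xs. xs = ((\<lambda>xs. map ((#) False) xs @ map ((#) True) xs) ^^ m) [[]])"
  assume x': "pt ?J x' (\<lambda>j. x (fst j))" "pt ?J x' (\<lambda>j. enc_vec (snd (snd j)))"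
  have "pt ?J x' (\<lambda>j. enc_vec (map ((#) b) (snd (snd j))))" for b
    by (rule pt_map[where E = enc_bits and F = enc_bits and g = "\<lambda>_. (#) b", OF x'(2)])
      (rule pt_Cons[where E = enc_bool, OF pt_const])
  then show "pt ?J x' (\<lambda>j. enc_vec (map ((#) False) (snd (snd j)) @ map ((#) True) (snd (snd j))))"
    by (intro pt_append)
qed simp_all
qed

lemma pt_on:
  assumes e: "env I x lam"
  shows "pt I x (\<lambda>i. enc_bits (on (lam i)))"
  unfolding on_def
proof (rule pt_hd)
  show "pt I x (\<lambda>i. enc_vec (filter (\<lambda>a. a \<noteq> ze (lam i) \<and> mu (lam i) a a = a) (el (lam i))))"
  proof (rule pt_filter[OF pt_el[OF e]])
    fix x' let ?J = "SIGMA i:I. set (el (lam i))"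
    assume x': "pt ?J x' (\<lambda>j. x (fst j))" "pt ?J x' (\<lambda>j. enc_bits (snd j))"
    note e' = env_lift_Sigma[OF e x'(1)]
    show "pt ?J x' (\<lambda>j. enc_bool (snd j \<noteq> ze (lam (fst j)) \<and> mu (lam (fst j)) (snd j) (snd j) = snd j))"
      by (intro pt_conj pt_not pt_bits_eq pt_mu e' pt_ze[OF e'] x'(2))
  qed
  show "filter (\<lambda>a. a \<noteq> ze (lam i) \<and> mu (lam i) a a = a) (el (lam i)) \<noteq> []" if "i \<in> I" for i
    unfolding filter_empty_conv using filter_on[OF env_ge[OF e that]] by auto
qed

subsection \<open>Vectors and polynomials\<close>

lemma pt_smul:
  assumes e: "env I x lam" and c: "pt I x (\<lambda>i. enc_bits (c i))" and p: "pt I x (\<lambda>i. enc_vec (p i))"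
  shows "pt I x (\<lambda>i. enc_vec (map (mu (lam i) (c i)) (p i)))"
proof (rule pt_map[where F = enc_bits, OF p])
  fix x' let ?J = "SIGMA i:I. set (p i)"
  assume x': "pt ?J x' (\<lambda>j. x (fst j))" "pt ?J x' (\<lambda>j. enc_bits (snd j))"
  show "pt ?J x' (\<lambda>j. enc_bits (mu (lam (fst j)) (c (fst j)) (snd j)))"
    by (rule pt_mu[OF env_lift_Sigma[OF e x'(1)] pt_lift_Sigma[OF c x'(1)] x'(2)])
qed

lemma pt_vadd:
  assumes e: "env I x lam" and p: "pt I x (\<lambda>i. enc_vec (p i))" and q: "pt I x (\<lambda>i. enc_vec (q i))"
  shows "pt I x (\<lambda>i. enc_vec (padd (ad (lam i)) (p i) (q i)))"
  by (rule pt_padd[OF p q]) (rule pt_ad[OF env_lift_Sigma[OF e _]])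

lemma pt_smul2:
  assumes e: "env I x lam" and c: "pt I x (\<lambda>i. enc_bits (c i))" and p: "pt I x (\<lambda>i. enc_poly2 (p i))"
  shows "pt I x (\<lambda>i. enc_poly2 (map (map (mu (lam i) (c i))) (p i)))"
proof (rule pt_map[where F = enc_vec, OF p])
  fix x' let ?J = "SIGMA i:I. set (p i)"
  assume x': "pt ?J x' (\<lambda>j. x (fst j))" "pt ?J x' (\<lambda>j. enc_vec (snd j))"
  show "pt ?J x' (\<lambda>j. enc_vec (map (mu (lam (fst j)) (c (fst j))) (snd j)))"
    by (rule pt_smul[OF env_lift_Sigma[OF e x'(1)] pt_lift_Sigma[OF c x'(1)] x'(2)])
qed

lemma pt_padd2:
  assumes e: "env I x lam" and p: "pt I x (\<lambda>i. enc_poly2 (p i))" and q: "pt I x (\<lambda>i. enc_poly2 (q i))"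
  shows "pt I x (\<lambda>i. enc_poly2 (padd (padd (ad (lam i))) (p i) (q i)))"
  by (rule pt_padd[OF p q]) (rule pt_vadd[OF env_lift_Sigma[OF e _]])

lemma pt_comb:
  assumes "env I x lam" "pt I x (\<lambda>i. enc_bits (c i))" "pt I x (\<lambda>i. enc_vec (h i))"
    "pt I x (\<lambda>i. enc_bits (d i))" "pt I x (\<lambda>i. enc_vec (g i))"
  shows "pt I x (\<lambda>i. enc_vec (comb (ad (lam i)) (mu (lam i)) (c i) (h i) (d i) (g i)))"
  unfolding comb_def by (intro pt_vadd pt_smul assms)

lemma pt_comb2:
  assumes "env I x lam" "pt I x (\<lambda>i. enc_bits (c i))" "pt I x (\<lambda>i. enc_poly2 (h i))"
    "pt I x (\<lambda>i. enc_bits (d i))" "pt I x (\<lambda>i. enc_poly2 (g i))"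
  shows "pt I x (\<lambda>i. enc_poly2 (comb2 (ad (lam i)) (mu (lam i)) (c i) (h i) (d i) (g i)))"
  unfolding comb2_def by (intro pt_padd2 pt_smul2 assms)

lemma pt_nthz:
  assumes "pt I x (\<lambda>i. E (z i))" "pt I x (\<lambda>i. enc_list E (xs i))" "pt I x (\<lambda>i. enc_nat (r i))"
  shows "pt I x (\<lambda>i. E (nthz (z i) (xs i) (r i)))"
  unfolding nthz_def
proof (rule pt_if)
  show "pt I x (\<lambda>i. enc_bool (r i < length (xs i)))" by (intro pt_less pt_length[where E = E] assms)
  show "pt {i \<in> I. r i < length (xs i)} x (\<lambda>i. E (xs i ! r i))"
    by (rule pt_nth) (use assms in \<open>auto intro: pt_subset\<close>)
  show "pt {i \<in> I. \<not> r i < length (xs i)} x (\<lambda>i. E (z i))"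
    by (rule pt_subset[OF assms(1)]) auto
qed

lemma pt_binl:
  assumes e: "env I x lam" and a: "pt I x (\<lambda>i. enc_bits (a i))" and n: "pt I x (\<lambda>i. enc_nat (n i))"
  shows "pt I x (\<lambda>i. enc_vec (binl (ad (lam i)) (mu (lam i)) (ze (lam i)) (on (lam i)) (a i) (n i)))"
  unfolding binl_def
proof (rule pt_funpow[where V = "\<lambda>i m w. set w \<subseteq> C (lam i) \<and> length w = Suc m" and A = enc_vec, OF n])
  show "pt I x (\<lambda>i. enc_vec [on (lam i)])" by (intro pt_Cons pt_Nil pt_on e)
  fix x' let ?J = "fold_dom I (\<lambda>i. replicate (n i) True) (\<lambda>i m w. set w \<subseteq> C (lam i) \<and> length w = Suc m)"
  assume x': "pt ?J x' (\<lambda>j. x (fst j))" "pt ?J x' (\<lambda>j. enc_vec (snd (snd j)))"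
  note e' = env_lift_fold[OF e x'(1)]
  show "pt ?J x' (\<lambda>j. enc_vec (padd (ad (lam (fst j))) (ze (lam (fst j)) # snd (snd j)) (map (mu (lam (fst j)) (a (fst j))) (snd (snd j)))))"
    by (intro pt_vadd pt_Cons pt_smul e' pt_ze[OF e'] pt_lift_fold[OF a x'(1)] x'(2))
next
  show "pbd I x (\<lambda>i. Suc (Suc (n i) * Suc (Suc (l (lam i) * 4))))"
    by (intro pbd_Suc pbd_mult pbd_l[OF e] pt_nat_pbd[OF n] pbd_const)
  show "data_size (enc_vec w) \<le> Suc (Suc (n i) * Suc (Suc (l (lam i) * 4)))"
    if "m \<le> n i" "set w \<subseteq> C (lam i) \<and> length w = Suc m" for i m w
    by (rule data_size_vec) (use that in auto)
next
  fix i assume "i \<in> I"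
  then interpret field_rep "C (lam i)" "ad (lam i)" "mu (lam i)" "ze (lam i)" "on (lam i)" "el (lam i)" "em (lam i)"
    by (intro field_rep env_ge[OF e])
  show "set [on (lam i)] \<subseteq> C (lam i) \<and> length [on (lam i)] = Suc 0" by simp
  show "set (padd (ad (lam i)) (ze (lam i) # w) (map (mu (lam i) (a i)) w)) \<subseteq> C (lam i) \<and>
      length (padd (ad (lam i)) (ze (lam i) # w) (map (mu (lam i) (a i)) w)) = Suc (Suc m)"
    if "set w \<subseteq> C (lam i) \<and> length w = Suc m" for m w
    using that vec_padd[of "ze (lam i) # w" "map (mu (lam i) (a i)) w"] by simp
qed

abbreviation enc_nn :: "nat \<times> nat \<Rightarrow> data" where "enc_nn \<equiv> enc_pair enc_nat enc_nat"
abbreviation enc_pt :: "bool list \<times> bool list \<Rightarrow> data" where "enc_pt \<equiv> enc_pair enc_bits enc_bits"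
abbreviation enc_con :: "(bool list \<times> bool list) \<times> nat \<times> nat \<Rightarrow> data" where "enc_con \<equiv> enc_pair enc_pt enc_nn"
abbreviation enc_row :: "bool list list \<times> bool list list list \<Rightarrow> data" where "enc_row \<equiv> enc_pair enc_vec enc_poly2"

lemma pt_mons:
  assumes t: "pt I x (\<lambda>i. enc_nat (t i))" and k: "pt I x (\<lambda>i. enc_nat (k i))"
  shows "pt I x (\<lambda>i. enc_list enc_nn (mons (t i) (k i)))"
  unfolding mons_def
proof (rule pt_concat_map[OF pt_upt[OF pt_Suc[OF t]]])
  fix x' let ?J = "SIGMA i:I. set [0..<Suc (t i)]"
  assume x': "pt ?J x' (\<lambda>j. x (fst j))" "pt ?J x' (\<lambda>j. enc_nat (snd j))"
  note t' = pt_lift_Sigma[OF t x'(1)] and k' = pt_lift_Sigma[OF k x'(1)]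
  have "pt ?J x' (\<lambda>j. enc_nat (t (fst j) * k (fst j) - (k (fst j) - 1) * snd j))"
    by (intro pt_minus pt_times t' k' x'(2) pt_nat_const)
  from pt_upt[OF this]
  show "pt ?J x' (\<lambda>j. enc_list enc_nn (map (\<lambda>i. (i, snd j)) [0..<t (fst j) * k (fst j) - (k (fst j) - 1) * snd j]))"
  proof (rule pt_map)
    fix x'' let ?K = "SIGMA j:?J. set [0..<t (fst j) * k (fst j) - (k (fst j) - 1) * snd j]"
    assume x'': "pt ?K x'' (\<lambda>j. x' (fst j))" "pt ?K x'' (\<lambda>j. enc_nat (snd j))"
    show "pt ?K x'' (\<lambda>j. enc_nn (snd j, snd (fst j)))"
      by (rule pt_pair[where E = enc_nat and F = enc_nat, OF x''(2) pt_lift_Sigma[OF x'(2) x''(1)]])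
  qed
qed

lemma pt_constraints:
  assumes k: "pt I x (\<lambda>i. enc_nat (k i))" and pts: "pt I x (\<lambda>i. enc_list enc_pt (pts i))"
  shows "pt I x (\<lambda>i. enc_list enc_con (constraints (k i) (pts i)))"
  unfolding constraints_def
proof (rule pt_concat_map[OF pts])
  fix x' let ?J = "SIGMA i:I. set (pts i)"
  assume x': "pt ?J x' (\<lambda>j. x (fst j))" "pt ?J x' (\<lambda>j. enc_pt (snd j))"
  note k' = pt_lift_Sigma[OF k x'(1)]
  show "pt ?J x' (\<lambda>j. enc_list enc_con (concat (map (\<lambda>r. map (\<lambda>s. (snd j, r, s)) [0..<k (fst j) - r]) [0..<k (fst j)])))"
  proof (rule pt_concat_map[OF pt_upt[OF k']])
    fix x'' let ?K = "SIGMA j:?J. set [0..<k (fst j)]"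
    assume x'': "pt ?K x'' (\<lambda>j. x' (fst j))" "pt ?K x'' (\<lambda>j. enc_nat (snd j))"
    have "pt ?K x'' (\<lambda>j. enc_nat (k (fst (fst j)) - snd j))"
      by (rule pt_minus[OF pt_lift_Sigma[OF k' x''(1)] x''(2)])
    from pt_upt[OF this]
    show "pt ?K x'' (\<lambda>j. enc_list enc_con (map (\<lambda>s. (snd (fst j), snd j, s)) [0..<k (fst (fst j)) - snd j]))"
    proof (rule pt_map)
      fix y let ?L = "SIGMA j:?K. set [0..<k (fst (fst j)) - snd j]"
      assume y: "pt ?L y (\<lambda>j. x'' (fst j))" "pt ?L y (\<lambda>j. enc_nat (snd j))"
      note p = pt_lift_Sigma[OF pt_lift_Sigma[OF x'(2) x''(1)] y(1)] and r = pt_lift_Sigma[OF x''(2) y(1)]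
      show "pt ?L y (\<lambda>j. enc_con (snd (fst (fst j)), snd (fst j), snd j))"
        by (rule pt_pair[where E = enc_pt and F = enc_nn, OF p pt_pair[where E = enc_nat and F = enc_nat, OF r y(2)]])
    qed
  qed
qed

lemma pt_cval:
  assumes e: "env I x lam" and c: "pt I x (\<lambda>i. enc_con (c i))" and m: "pt I x (\<lambda>i. enc_nn (m i))"
  shows "pt I x (\<lambda>i. enc_bits (cval (ad (lam i)) (mu (lam i)) (ze (lam i)) (on (lam i)) (c i) (m i)))"
  unfolding cval_def
  by (intro pt_mu e pt_nthz[where E = enc_bits] pt_ze[OF e] pt_binl
      pt_pair_fst[OF pt_pair_fst[OF c]] pt_pair_snd[OF pt_pair_fst[OF c]] pt_pair_fst[OF pt_pair_snd[OF c]]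
      pt_pair_snd[OF pt_pair_snd[OF c]] pt_pair_fst[OF m] pt_pair_snd[OF m])

lemma pt_mon_poly:
  assumes e: "env I x lam" and m: "pt I x (\<lambda>i. enc_nn (m i))"
  shows "pt I x (\<lambda>i. enc_poly2 (mon_poly (ze (lam i)) (on (lam i)) (m i)))"
  unfolding mon_poly_def
  by (intro pt_append pt_Cons[where E = enc_vec] pt_Cons[where E = enc_bits] pt_replicate[where E = enc_vec]
      pt_replicate[where E = enc_bits] pt_Nil pt_ze[OF e] pt_on[OF e] pt_pair_fst[OF m] pt_pair_snd[OF m])

lemma pt_init_rows:
  assumes e: "env I x lam" and t: "pt I x (\<lambda>i. enc_nat (t i))" and k: "pt I x (\<lambda>i. enc_nat (k i))"
    and pts: "pt I x (\<lambda>i. enc_list enc_pt (pts i))"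
  shows "pt I x (\<lambda>i. enc_list enc_row (init_rows (ad (lam i)) (mu (lam i)) (ze (lam i)) (on (lam i)) (t i) (k i) (pts i)))"
  unfolding init_rows_def
proof (rule pt_map[OF pt_mons[OF t k]])
  fix x' let ?J = "SIGMA i:I. set (mons (t i) (k i))"
  assume x': "pt ?J x' (\<lambda>j. x (fst j))" "pt ?J x' (\<lambda>j. enc_nn (snd j))"
  note e' = env_lift_Sigma[OF e x'(1)]
  have "pt ?J x' (\<lambda>j. enc_vec (map (\<lambda>c. cval (ad (lam (fst j))) (mu (lam (fst j))) (ze (lam (fst j))) (on (lam (fst j))) c (snd j))
      (constraints (k (fst j)) (pts (fst j)))))"
  proof (rule pt_map[OF pt_constraints[OF pt_lift_Sigma[OF k x'(1)] pt_lift_Sigma[OF pts x'(1)]]])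
    fix x'' let ?K = "SIGMA j:?J. set (constraints (k (fst j)) (pts (fst j)))"
    assume x'': "pt ?K x'' (\<lambda>j. x' (fst j))" "pt ?K x'' (\<lambda>j. enc_con (snd j))"
    show "pt ?K x'' (\<lambda>j. enc_bits (cval (ad (lam (fst (fst j)))) (mu (lam (fst (fst j)))) (ze (lam (fst (fst j))))
       (on (lam (fst (fst j)))) (snd j) (snd (fst j))))"
      by (rule pt_cval[OF env_lift_Sigma[OF e' x''(1)] x''(2) pt_lift_Sigma[OF x'(2) x''(1)]])
  qed
  then show "pt ?J x' (\<lambda>j. enc_row (map (\<lambda>c. cval (ad (lam (fst j))) (mu (lam (fst j))) (ze (lam (fst j))) (on (lam (fst j))) c (snd j))
      (constraints (k (fst j)) (pts (fst j))), mon_poly (ze (lam (fst j))) (on (lam (fst j))) (snd j)))"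
    by (rule pt_pair[where E = enc_vec and F = enc_poly2, OF _ pt_mon_poly[OF e' x'(2)]])
qed

end

text \<open>Needed for the running time as much as for correctness: for the zero polynomial every
  field element would pass the test at every level, and the search tree would be exponentially
  large.\<close>

lemma (in field_rep) eliminate_good:
  assumes "\<forall>p\<in>set pts. fst p \<in> C \<and> snd p \<in> C"
    and rw: "rw \<in> set (eliminate ad mu ze (constraints k pts) (init_rows ad mu ze on t k pts))"
  shows "vec2 (snd rw)" "PP (snd rw) \<noteq> 0" "shape (Suc t) (t * k) (snd rw)"
proof -
  have tri: "triangular qs \<Longrightarrow> q \<in> set qs \<Longrightarrow> q \<noteq> 0" for q :: "'z :: zero poly poly" and qs
    by (induction qs) auto
  show "PP (snd rw) \<noteq> 0"
  proof (rule tri)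
    show "triangular (map (PP \<circ> snd) (eliminate ad mu ze (constraints k pts) (init_rows ad mu ze on t k pts)))"
      using eliminate[OF init_rows_valid[OF assms(1), where t = t and k = k]] by blast
    show "PP (snd rw) \<in> set (map (PP \<circ> snd) (eliminate ad mu ze (constraints k pts) (init_rows ad mu ze on t k pts)))"
      using rw by simp
  qed
  show "vec2 (snd rw)" "shape (Suc t) (t * k) (snd rw)"
    using wf_eliminate[OF init_rows_wf] rw by (auto simp: wf_row_def)
qed

lemma data_size_row:
  assumes "set (fst rw) \<subseteq> bitstrings l" "length (fst rw) \<le> K" "\<forall>r\<in>set (snd rw). set r \<subseteq> bitstrings l" "shape L W (snd rw)"
  shows "data_size (enc_pair enc_vec enc_poly2 rw) \<le>
     Suc (Suc (K * Suc (Suc (l * 4))) + Suc (L * Suc (Suc (W * Suc (Suc (l * 4))))))"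
  unfolding enc_pair_def data_size.simps
  by (intro Suc_le_mono[THEN iffD2] add_mono data_size_vec data_size_poly2 assms)

context learning_setting
begin

abbreviation row_bound :: "nat \<Rightarrow> nat \<Rightarrow> nat \<Rightarrow> nat \<Rightarrow> nat" where
  "row_bound lam K L W \<equiv> Suc (Suc (K * Suc (Suc (l lam * 4))) + Suc (L * Suc (Suc (W * Suc (Suc (l lam * 4))))))"

lemma pbd_row_bound:
  assumes "env I x lam" "pbd I x K" "pbd I x L" "pbd I x W"
  shows "pbd I x (\<lambda>i. row_bound (lam i) (K i) (L i) (W i))"
  by (intro pbd_Suc pbd_add pbd_mult pbd_const pbd_l assms)

abbreviation wf_rowC :: "nat \<Rightarrow> nat \<Rightarrow> nat \<Rightarrow> nat \<Rightarrow> bool list list \<times> bool list list list \<Rightarrow> bool" where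
  "wf_rowC lam \<equiv> field_rep.wf_row (C lam)"
abbreviation wf_stateC where
  "wf_stateC lam \<equiv> field_rep.wf_state (C lam)"
abbreviation vec2C :: "nat \<Rightarrow> bool list list list \<Rightarrow> bool" where
  "vec2C lam Q \<equiv> \<forall>r\<in>set Q. set r \<subseteq> C lam"
abbreviation PPe :: "nat \<Rightarrow> bool list list list \<Rightarrow> bit alg_closure poly poly" where
  "PPe lam \<equiv> field_rep.PP (em lam)"

abbreviation enc_state where "enc_state \<equiv> enc_pair (enc_list enc_row) (enc_list enc_row)"

lemma pt_elim_step:
  assumes e: "env I x lam" and rw: "pt I x (\<lambda>i. enc_row (rw i))" and st: "pt I x (\<lambda>i. enc_state (st i))"
    and ne: "\<And>i. i \<in> I \<Longrightarrow> fst (rw i) \<noteq> []" "\<And>i. i \<in> I \<Longrightarrow> fst (st i) \<noteq> [] \<Longrightarrow> fst (hd (fst (st i))) \<noteq> []"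
  shows "pt I x (\<lambda>i. enc_state (elim_step (ad (lam i)) (mu (lam i)) (ze (lam i)) (rw i) (st i)))"
  unfolding elim_step_def
proof (rule pt_if)
  note hd_rw = pt_hd[OF pt_pair_fst[OF rw] ne(1)]
  note piv = pt_pair_fst[OF st] and out = pt_pair_snd[OF st]
  show "pt I x (\<lambda>i. enc_bool (fst (st i) = []))" by (rule pt_eq_Nil[OF piv])
  let ?I1 = "{i \<in> I. fst (st i) = []}" and ?I2 = "{i \<in> I. fst (st i) \<noteq> []}"
  have s1: "?I1 \<subseteq> I" and s2: "?I2 \<subseteq> I" by auto
  show "pt ?I1 x (\<lambda>i. enc_state (if hd (fst (rw i)) = ze (lam i) then (fst (st i), (tl (fst (rw i)), snd (rw i)) # snd (st i))
      else ([rw i], snd (st i))))"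
  proof (rule pt_if')
    show "pt ?I1 x (\<lambda>i. enc_bool (hd (fst (rw i)) = ze (lam i)))"
      by (rule pt_subset[OF pt_bits_eq[OF hd_rw pt_ze[OF e]] s1])
    show "pt ?I1 x (\<lambda>i. enc_state (fst (st i), (tl (fst (rw i)), snd (rw i)) # snd (st i)))"
      by (rule pt_subset[OF _ s1], rule pt_pair[where E = "enc_list enc_row" and F = "enc_list enc_row", OF piv],
          rule pt_Cons[OF _ out], rule pt_pair[where E = enc_vec and F = enc_poly2, OF pt_tl[OF pt_pair_fst[OF rw]] pt_pair_snd[OF rw]])
    show "pt ?I1 x (\<lambda>i. enc_state ([rw i], snd (st i)))"
      by (rule pt_subset[OF _ s1], rule pt_pair[where E = "enc_list enc_row" and F = "enc_list enc_row", OF pt_Cons[where E = enc_row, OF rw pt_Nil] out])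
  qed
  have p: "pt ?I2 x (\<lambda>i. enc_row (hd (fst (st i))))"
    by (rule pt_hd[OF pt_subset[OF piv s2]]) simp
  have hd_p: "pt ?I2 x (\<lambda>i. enc_bits (hd (fst (hd (fst (st i))))))"
    by (rule pt_hd[OF pt_pair_fst[OF p]]) (use ne(2) in simp)
  note e2 = env_subset[OF e s2] and rw2 = pt_subset[OF rw s2] and hd_rw2 = pt_subset[OF hd_rw s2]
  have c1: "pt ?I2 x (\<lambda>i. enc_vec (comb (ad (lam i)) (mu (lam i)) (hd (fst (hd (fst (st i))))) (tl (fst (rw i)))
       (hd (fst (rw i))) (tl (fst (hd (fst (st i)))))))"
    by (rule pt_comb[OF e2 hd_p pt_tl[OF pt_pair_fst[OF rw2]] hd_rw2 pt_tl[OF pt_pair_fst[OF p]]])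
  have c2: "pt ?I2 x (\<lambda>i. enc_poly2 (comb2 (ad (lam i)) (mu (lam i)) (hd (fst (hd (fst (st i))))) (snd (rw i))
       (hd (fst (rw i))) (snd (hd (fst (st i))))))"
    by (rule pt_comb2[OF e2 hd_p pt_pair_snd[OF rw2] hd_rw2 pt_pair_snd[OF p]])
  show "pt ?I2 x (\<lambda>i. enc_state (fst (st i),
       (comb (ad (lam i)) (mu (lam i)) (hd (fst (hd (fst (st i))))) (tl (fst (rw i))) (hd (fst (rw i))) (tl (fst (hd (fst (st i))))),
        comb2 (ad (lam i)) (mu (lam i)) (hd (fst (hd (fst (st i))))) (snd (rw i)) (hd (fst (rw i))) (snd (hd (fst (st i))))) # snd (st i)))"
    by (rule pt_pair[where E = "enc_list enc_row" and F = "enc_list enc_row", OF pt_subset[OF piv s2]],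
        rule pt_Cons[OF _ pt_subset[OF out s2]], rule pt_pair[where E = enc_vec and F = enc_poly2, OF c1 c2])
qed

text \<open>The value lists of all rows have the common length m + 1. That it is positive makes
  their heads defined, and the bound K on m enters the size of a row.\<close>

lemma pt_eliminate1:
  assumes e: "env I x lam" and rws: "pt I x (\<lambda>i. enc_list enc_row (rws i))"
    and K: "pbd I x K" and L: "pbd I x L" and W: "pbd I x W"
    and wf: "\<And>i. i \<in> I \<Longrightarrow> \<exists>m\<le>K i. \<forall>rw\<in>set (rws i). wf_rowC (lam i) (Suc m) (L i) (W i) rw"
  shows "pt I x (\<lambda>i. enc_list enc_row (eliminate1 (ad (lam i)) (mu (lam i)) (ze (lam i)) (rws i)))"
proof -
  define V where "V i n st \<longleftrightarrow> (\<exists>m\<le>K i. (\<forall>rw\<in>set (rws i). wf_rowC (lam i) (Suc m) (L i) (W i) rw) \<and>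
      wf_stateC (lam i) m (L i) (W i) n st)" for i n st
  define B where "B i = row_bound (lam i) (Suc (K i)) (L i) (W i)" for i
  have B: "pbd I x B" unfolding B_def by (intro pbd_row_bound e pbd_Suc K L W)
  have "pt I x (\<lambda>i. enc_state (foldr (\<lambda>rw st. elim_step (ad (lam i)) (mu (lam i)) (ze (lam i)) rw st) (rws i) ([], [])))"
  proof (rule pt_foldr[where V = V, OF rws])
    show "pt I x (\<lambda>i. enc_state ([], []))" by (rule pt_const)
    fix x' let ?J = "fold_dom I (\<lambda>i. rev (rws i)) V"
    assume x': "pt ?J x' (\<lambda>j. x (fst j))" "pt ?J x' (\<lambda>j. enc_row (fst (snd j)))" "pt ?J x' (\<lambda>j. enc_state (snd (snd j)))"
    show "pt ?J x' (\<lambda>j. enc_state (elim_step (ad (lam (fst j))) (mu (lam (fst j))) (ze (lam (fst j))) (fst (snd j)) (snd (snd j))))"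
    proof (rule pt_elim_step[OF env_lift_fold[OF e x'(1)] x'(2,3)])
      fix j assume "j \<in> ?J"
      then obtain i n where j: "i \<in> I" "n < length (rws i)" "j = (i, rev (rws i) ! n, snd (snd j))" "V i n (snd (snd j))"
        by (auto simp: fold_dom_def)
      interpret field_rep "C (lam i)" "ad (lam i)" "mu (lam i)" "ze (lam i)" "on (lam i)" "el (lam i)" "em (lam i)"
        by (intro field_rep env_ge[OF e] j)
      obtain m where m: "\<forall>rw\<in>set (rws i). wf_row (Suc m) (L i) (W i) rw" "wf_state m (L i) (W i) n (snd (snd j))"
        using j(4) by (auto simp: V_def)
      have "rev (rws i) ! n \<in> set (rws i)" using nth_mem[of n "rev (rws i)"] j(2) by simp
      then have "fst (snd j) \<in> set (rws i)" using j(3) by (metis fst_conv snd_conv)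
      then show "fst (fst (snd j)) \<noteq> []" using m(1) by (auto simp: wf_row_def)
      show "fst (hd (fst (snd (snd j)))) \<noteq> []" if "fst (snd (snd j)) \<noteq> []"
        using m(2) hd_in_set[OF that] by (fastforce simp: wf_state_def wf_row_def)
    qed
  next
    fix i assume i: "i \<in> I"
    interpret field_rep "C (lam i)" "ad (lam i)" "mu (lam i)" "ze (lam i)" "on (lam i)" "el (lam i)" "em (lam i)"
      by (intro field_rep env_ge[OF e] i)
    show "V i 0 ([], [])" using wf[OF i] by (auto simp: V_def wf_state_def)
    show "V i (Suc n) (elim_step (ad (lam i)) (mu (lam i)) (ze (lam i)) (rev (rws i) ! n) st)"
      if n: "n < length (rws i)" "V i n st" for n st
    proof -
      have "rev (rws i) ! n \<in> set (rws i)" using nth_mem[of n "rev (rws i)"] n(1) by simp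
      then show ?thesis using n(2) wf_elim_step unfolding V_def by blast
    qed
    show "data_size (enc_state st) \<le> Suc (Suc (1 * Suc (B i)) + Suc (data_size (enc_list enc_row (rws i)) * Suc (B i)))"
      if n: "n \<le> length (rws i)" "V i n st" for n st
    proof -
      obtain m where m: "m \<le> K i" "wf_state m (L i) (W i) n st" using n(2) by (auto simp: V_def)
      have "data_size (enc_row rw) \<le> B i" if "rw \<in> set (fst st) \<union> set (snd st)" for rw
        unfolding B_def using that m by (intro data_size_row) (auto simp: wf_state_def wf_row_def)
      then show ?thesis unfolding enc_pair_def[of "enc_list enc_row"] data_size.simps
        using m n(1) length_le_data_size[of "rws i" enc_row]
        by (intro Suc_le_mono[THEN iffD2] add_mono data_size_list_le) (auto simp: wf_state_def)
    qed
  next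
    show "pbd I x (\<lambda>i. Suc (Suc (1 * Suc (B i)) + Suc (data_size (enc_list enc_row (rws i)) * Suc (B i))))"
      by (intro pbd_Suc pbd_add pbd_mult B pbd_const pt_pbd[OF rws])
  qed
  from pt_pair_snd[OF this] show ?thesis by (simp add: eliminate1_def)
qed

lemma pt_eliminate:
  assumes e: "env I x lam" and rws: "pt I x (\<lambda>i. enc_list enc_row (rws i))" and cs: "pt I x (\<lambda>i. enc_list E (cs i))"
    and L: "pbd I x L" and W: "pbd I x W"
    and wf: "\<And>i rw. i \<in> I \<Longrightarrow> rw \<in> set (rws i) \<Longrightarrow> wf_rowC (lam i) (length (cs i)) (L i) (W i) rw"
  shows "pt I x (\<lambda>i. enc_list enc_row (eliminate (ad (lam i)) (mu (lam i)) (ze (lam i)) (cs i) (rws i)))"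
proof -
  define V where "V i n a \<longleftrightarrow> (\<forall>rw\<in>set a. wf_rowC (lam i) (length (cs i) - n) (L i) (W i) rw) \<and> length a \<le> length (rws i)" for i n a
  define B where "B i = row_bound (lam i) (length (cs i)) (L i) (W i)" for i
  have len: "pbd I x (\<lambda>i. length (cs i))" by (rule pt_nat_pbd[OF pt_length[OF cs]])
  have B: "pbd I x B" unfolding B_def by (intro pbd_row_bound e len L W)
  have "pt I x (\<lambda>i. enc_list enc_row (foldl (\<lambda>a y. eliminate1 (ad (lam i)) (mu (lam i)) (ze (lam i)) a) (rws i) (cs i)))"
  proof (rule pt_foldl[where V = V and g = "\<lambda>i y a. eliminate1 (ad (lam i)) (mu (lam i)) (ze (lam i)) a", OF cs rws])
    fix x' let ?J = "fold_dom I cs V"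
    assume x': "pt ?J x' (\<lambda>j. x (fst j))" "pt ?J x' (\<lambda>j. enc_list enc_row (snd (snd j)))"
    have pbd_lift: "pbd ?J x' (\<lambda>j. N (fst j))" if "pbd I x N" for N
      by (rule pbd_comp[OF that pt_pbd[OF x'(1)], of fst]) (auto simp: fold_dom_def)
    show "pt ?J x' (\<lambda>j. enc_list enc_row (eliminate1 (ad (lam (fst j))) (mu (lam (fst j))) (ze (lam (fst j))) (snd (snd j))))"
    proof (rule pt_eliminate1[OF env_lift_fold[OF e x'(1)] x'(2) pbd_lift[OF len] pbd_lift[OF L] pbd_lift[OF W]])
      fix j assume "j \<in> ?J"
      then obtain i n where j: "n < length (cs i)" "i = fst j" "V i n (snd (snd j))" by (auto simp: fold_dom_def)
      have "length (cs i) - n = Suc (length (cs i) - Suc n)" using j(1) by simp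
      then show "\<exists>m\<le>length (cs (fst j)). \<forall>rw\<in>set (snd (snd j)). wf_rowC (lam (fst j)) (Suc m) (L (fst j)) (W (fst j)) rw"
        using j(3) unfolding V_def j(2) by (intro exI[of _ "length (cs i) - Suc n"]) (simp add: j(2))
    qed
  next
    fix i assume i: "i \<in> I"
    interpret field_rep "C (lam i)" "ad (lam i)" "mu (lam i)" "ze (lam i)" "on (lam i)" "el (lam i)" "em (lam i)"
      by (intro field_rep env_ge[OF e] i)
    show "V i 0 (rws i)" using wf[OF i] by (simp add: V_def)
    show "V i (Suc n) (eliminate1 (ad (lam i)) (mu (lam i)) (ze (lam i)) a)" if n: "n < length (cs i)" "V i n a" for n a
    proof -
      have "length (cs i) - n = Suc (length (cs i) - Suc n)" using n(1) by simp
      then show ?thesis using n(2) wf_eliminate1[of a "length (cs i) - Suc n" "L i" "W i"] unfolding V_def by auto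
    qed
    show "data_size (enc_list enc_row a) \<le> Suc (data_size (enc_list enc_row (rws i)) * Suc (B i))" if "V i n a" for n a
    proof (rule data_size_list_le)
      show "length a \<le> data_size (enc_list enc_row (rws i))"
        using that length_le_data_size[of "rws i" enc_row] by (simp add: V_def)
      show "data_size (enc_row rw) \<le> B i" if "rw \<in> set a" for rw
        unfolding B_def using that \<open>V i n a\<close> by (intro data_size_row) (auto simp: V_def wf_row_def)
    qed
  next
    show "pbd I x (\<lambda>i. Suc (data_size (enc_list enc_row (rws i)) * Suc (B i)))"
      by (intro pbd_Suc pbd_mult B pt_pbd[OF rws])
  qed
  then show ?thesis by (simp add: eliminate_def)
qed

subsection \<open>Cost of the root search\<close>

lemma data_size_map_le:
  assumes "\<And>y. y \<in> set ys \<Longrightarrow> data_size (E (f y)) \<le> data_size (E y)"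
  shows "data_size (enc_list E (map f ys)) \<le> data_size (enc_list E ys)"
  using assms by (induction ys) (auto intro: add_mono)

lemma pt_strip:
  assumes e: "env I x lam" and N: "pt I x (\<lambda>i. enc_nat (N i))" and Q: "pt I x (\<lambda>i. enc_poly2 (Q i))"
  shows "pt I x (\<lambda>i. enc_poly2 (strip (ze (lam i)) (N i) (Q i)))"
  unfolding strip_def
proof (rule pt_funpow[where V = "\<lambda>i m R. data_size (enc_poly2 R) \<le> data_size (enc_poly2 (Q i))" and A = enc_poly2, OF N Q _ _ _ pt_pbd[OF Q]])
  fix x' let ?J = "fold_dom I (\<lambda>i. replicate (N i) True) (\<lambda>i m R. data_size (enc_poly2 R) \<le> data_size (enc_poly2 (Q i)))"
  assume x': "pt ?J x' (\<lambda>j. x (fst j))" "pt ?J x' (\<lambda>j. enc_poly2 (snd (snd j)))"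
  note e' = env_lift_fold[OF e x'(1)]
  show "pt ?J x' (\<lambda>j. enc_poly2 (strip1 (ze (lam (fst j))) (snd (snd j))))"
    unfolding strip1_def
  proof (rule pt_if')
    show "pt ?J x' (\<lambda>j. enc_bool (\<forall>r\<in>set (snd (snd j)). nthz (ze (lam (fst j))) r 0 = ze (lam (fst j))))"
    proof (rule pt_list_all[OF x'(2)])
      fix x'' let ?K = "SIGMA j:?J. set (snd (snd j))"
      assume x'': "pt ?K x'' (\<lambda>j. x' (fst j))" "pt ?K x'' (\<lambda>j. enc_vec (snd j))"
      note z = pt_ze[OF env_lift_Sigma[OF e' x''(1)]]
      show "pt ?K x'' (\<lambda>j. enc_bool (nthz (ze (lam (fst (fst j)))) (snd j) 0 = ze (lam (fst (fst j)))))"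
        by (rule pt_bits_eq[OF pt_nthz[where E = enc_bits, OF z x''(2) pt_nat_const] z])
    qed
    show "pt ?J x' (\<lambda>j. enc_poly2 (map tl (snd (snd j))))"
      by (rule pt_map[where E = enc_vec and F = enc_vec and g = "\<lambda>_. tl", OF x'(2)]) (rule pt_tl)
  qed (rule x'(2))
next
  have "data_size (enc_vec (tl r)) \<le> data_size (enc_vec r)" for r by (cases r) auto
  then have "data_size (enc_poly2 (strip1 z R)) \<le> data_size (enc_poly2 R)" for z R
    by (auto simp: strip1_def intro: data_size_map_le)
  then show "data_size (enc_poly2 (strip1 (ze (lam i)) R)) \<le> data_size (enc_poly2 (Q i))"
    if "data_size (enc_poly2 R) \<le> data_size (enc_poly2 (Q i))" for i R
    using that order_trans by blast
qed simp_all

lemma pt_substY: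
  assumes e: "env I x lam" and y: "pt I x (\<lambda>i. enc_bits (y i))" and Q: "pt I x (\<lambda>i. enc_poly2 (Q i))"
    and v: "\<And>i. i \<in> I \<Longrightarrow> vec2C (lam i) (Q i)"
  shows "pt I x (\<lambda>i. enc_poly2 (substY (ad (lam i)) (mu (lam i)) (ze (lam i)) (y i) (Q i)))"
proof -
  define W where "W i = data_size (enc_poly2 (Q i))" for i
  define g where "g i q acc = padd (padd (ad (lam i))) [q] (padd (padd (ad (lam i))) (map (map (mu (lam i) (y i))) acc)
    ([] # map ((#) (ze (lam i))) acc))" for i q acc
  define V where "V i n acc \<longleftrightarrow> vec2C (lam i) acc \<and> shape n (W i + n) acc" for i n acc
  have W: "pbd I x W" unfolding W_def by (rule pt_pbd[OF Q])
  have "pt I x (\<lambda>i. enc_poly2 (foldr (g i) (Q i) []))"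
  proof (rule pt_foldr[where V = V and A = enc_poly2, OF Q pt_Nil])
    fix x' let ?J = "fold_dom I (\<lambda>i. rev (Q i)) V"
    assume x': "pt ?J x' (\<lambda>j. x (fst j))" "pt ?J x' (\<lambda>j. enc_vec (fst (snd j)))" "pt ?J x' (\<lambda>j. enc_poly2 (snd (snd j)))"
    note e' = env_lift_fold[OF e x'(1)]
    have "pt ?J x' (\<lambda>j. enc_poly2 (map ((#) (ze (lam (fst j)))) (snd (snd j))))"
    proof (rule pt_map[OF x'(3)])
      fix x'' let ?K = "SIGMA j:?J. set (snd (snd j))"
      assume x'': "pt ?K x'' (\<lambda>j. x' (fst j))" "pt ?K x'' (\<lambda>j. enc_vec (snd j))"
      show "pt ?K x'' (\<lambda>j. enc_vec (ze (lam (fst (fst j))) # snd j))"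
        by (rule pt_Cons[OF pt_ze[OF env_lift_Sigma[OF e' x''(1)]] x''(2)])
    qed
    then show "pt ?J x' (\<lambda>j. enc_poly2 (g (fst j) (fst (snd j)) (snd (snd j))))"
      unfolding g_def
      by (intro pt_padd2 e' pt_Cons[where E = enc_vec] x'(2) pt_Nil pt_smul2 pt_lift_fold[OF y x'(1)] x'(3))
  next
    show "pbd I x (\<lambda>i. Suc (W i * Suc (Suc ((W i + W i) * Suc (Suc (l (lam i) * 4))))))"
      by (intro pbd_Suc pbd_mult pbd_add W pbd_l[OF e] pbd_const)
    fix i n acc assume i: "i \<in> I" and n: "n \<le> length (Q i)" "V i n acc"
    have nW: "n \<le> W i" using n(1) length_le_data_size[of "Q i" enc_vec] by (simp add: W_def)
    show "data_size (enc_poly2 acc) \<le> Suc (W i * Suc (Suc ((W i + W i) * Suc (Suc (l (lam i) * 4)))))"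
      using n(2) nW by (intro data_size_poly2) (auto simp: V_def intro: shape_mono)
  next
    fix i n acc assume i: "i \<in> I" and n: "n < length (Q i)" "V i n acc"
    interpret field_rep "C (lam i)" "ad (lam i)" "mu (lam i)" "ze (lam i)" "on (lam i)" "el (lam i)" "em (lam i)"
      by (intro field_rep env_ge[OF e] i)
    let ?q = "rev (Q i) ! n"
    have q: "?q \<in> set (Q i)" using nth_mem[of n "rev (Q i)"] n(1) by simp
    have "length ?q \<le> W i" unfolding W_def
      using data_size_mem[OF q, of enc_vec] length_le_data_size[of ?q enc_bits] by linarith
    then have "shape (Suc n) (W i + Suc n) (g i ?q acc)" unfolding g_def
      using n(2) by (intro shape_padd) (auto simp: V_def shape_def)
    moreover have "vec2C (lam i) (g i ?q acc)" unfolding g_def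
      using n(2) v[OF i] q by (intro vec2_padd) (auto simp: V_def)
    ultimately show "V i (Suc n) (g i ?q acc)" by (simp add: V_def)
  qed (simp add: V_def shape_def)
  moreover have "g i = (\<lambda>q acc. padd (padd (ad (lam i))) [q] (padd (padd (ad (lam i))) (map (map (mu (lam i) (y i))) acc)
    ([] # map ((#) (ze (lam i))) acc)))" for i by (intro ext) (simp add: g_def)
  ultimately show ?thesis by (simp add: substY_def)
qed

lemma pt_eval0:
  assumes e: "env I x lam" and y: "pt I x (\<lambda>i. enc_bits (y i))" and Q: "pt I x (\<lambda>i. enc_poly2 (Q i))"
  shows "pt I x (\<lambda>i. enc_bits (eval0 (ad (lam i)) (mu (lam i)) (ze (lam i)) (y i) (Q i)))"
  unfolding eval0_def
proof (rule pt_foldr[where V = "\<lambda>i n a. a \<in> C (lam i)", OF Q pt_ze[OF e]])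
  fix x' let ?J = "fold_dom I (\<lambda>i. rev (Q i)) (\<lambda>i n a. a \<in> C (lam i))"
  assume x': "pt ?J x' (\<lambda>j. x (fst j))" "pt ?J x' (\<lambda>j. enc_vec (fst (snd j)))" "pt ?J x' (\<lambda>j. enc_bits (snd (snd j)))"
  note e' = env_lift_fold[OF e x'(1)]
  show "pt ?J x' (\<lambda>j. enc_bits (ad (lam (fst j)) (nthz (ze (lam (fst j))) (fst (snd j)) 0) (mu (lam (fst j)) (y (fst j)) (snd (snd j)))))"
    by (rule pt_ad[OF e' pt_nthz[where E = enc_bits, OF pt_ze[OF e'] x'(2) pt_nat_const] pt_mu[OF e' pt_lift_fold[OF y x'(1)] x'(3)]])
next
  show "pbd I x (\<lambda>i. Suc (l (lam i) * 4))" by (intro pbd_Suc pbd_mult pbd_l[OF e] pbd_const)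
  show "data_size (enc_bits a) \<le> Suc (l (lam i) * 4)" if "a \<in> C (lam i)" for i a
    using that data_size_bits[of a] by (simp add: bitstrings_def)
next
  fix i assume "i \<in> I"
  note ge = env_ge[OF e this]
  show "ze (lam i) \<in> C (lam i)" unfolding ze_def by (rule ad_closed[OF ge])
  show "ad (lam i) a b \<in> C (lam i)" for a b by (rule ad_closed[OF ge])
qed

lemma pt_branch:
  assumes e: "env I x lam" and N: "pt I x (\<lambda>i. enc_nat (N i))" and s: "pt I x (\<lambda>i. enc_row (s i))"
    and v: "\<And>i. i \<in> I \<Longrightarrow> vec2C (lam i) (snd (s i))"
  shows "pt I x (\<lambda>i. enc_list enc_row (branch (ad (lam i)) (mu (lam i)) (ze (lam i)) (el (lam i)) (N i) (s i)))"
  unfolding branch_def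
proof (rule pt_map)
  note S = pt_strip[OF e N pt_pair_snd[OF s]]
  define ys where "ys i = filter (\<lambda>y. eval0 (ad (lam i)) (mu (lam i)) (ze (lam i)) y (strip (ze (lam i)) (N i) (snd (s i))) = ze (lam i)) (el (lam i))" for i
  show "pt I x (\<lambda>i. enc_vec (filter (\<lambda>y. eval0 (ad (lam i)) (mu (lam i)) (ze (lam i)) y (strip (ze (lam i)) (N i) (snd (s i))) = ze (lam i)) (el (lam i))))"
  proof (rule pt_filter[OF pt_el[OF e]])
    fix x' let ?J = "SIGMA i:I. set (el (lam i))"
    assume x': "pt ?J x' (\<lambda>j. x (fst j))" "pt ?J x' (\<lambda>j. enc_bits (snd j))"
    note e' = env_lift_Sigma[OF e x'(1)]
    show "pt ?J x' (\<lambda>j. enc_bool (eval0 (ad (lam (fst j))) (mu (lam (fst j))) (ze (lam (fst j))) (snd j)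
       (strip (ze (lam (fst j))) (N (fst j)) (snd (s (fst j)))) = ze (lam (fst j))))"
      by (rule pt_bits_eq[OF pt_eval0[OF e' x'(2) pt_lift_Sigma[OF S x'(1)]] pt_ze[OF e']])
  qed
  fix x'
  let ?J = "SIGMA i:I. set (filter (\<lambda>y. eval0 (ad (lam i)) (mu (lam i)) (ze (lam i)) y (strip (ze (lam i)) (N i) (snd (s i))) = ze (lam i)) (el (lam i)))"
  assume x': "pt ?J x' (\<lambda>j. x (fst j))" "pt ?J x' (\<lambda>j. enc_bits (snd j))"
  note e' = env_lift_Sigma[OF e x'(1)]
  have "pt ?J x' (\<lambda>j. enc_poly2 (substY (ad (lam (fst j))) (mu (lam (fst j))) (ze (lam (fst j))) (snd j)
      (strip (ze (lam (fst j))) (N (fst j)) (snd (s (fst j))))))"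
  proof (rule pt_substY[OF e' x'(2) pt_lift_Sigma[OF S x'(1)]])
    fix j assume "j \<in> ?J"
    then have i: "fst j \<in> I" by auto
    interpret field_rep "C (lam (fst j))" "ad (lam (fst j))" "mu (lam (fst j))" "ze (lam (fst j))" "on (lam (fst j))" "el (lam (fst j))" "em (lam (fst j))"
      by (intro field_rep env_ge[OF e] i)
    show "vec2C (lam (fst j)) (strip (ze (lam (fst j))) (N (fst j)) (snd (s (fst j))))"
      by (rule vec2_strip[OF v[OF i]])
  qed
  then show "pt ?J x' (\<lambda>j. enc_row (fst (s (fst j)) @ [snd j], substY (ad (lam (fst j))) (mu (lam (fst j))) (ze (lam (fst j))) (snd j)
      (strip (ze (lam (fst j))) (N (fst j)) (snd (s (fst j))))))"
    by (rule pt_pair[where E = enc_vec and F = enc_poly2, OF pt_append[where E = enc_bits, OF pt_lift_Sigma[OF pt_pair_fst[OF s] x'(1)] pt_Cons[where E = enc_bits, OF x'(2) pt_Nil]]])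
qed

text \<open>A mere size bound would not be preserved from one level to the next. The invariant V
  therefore records that the state is exactly the m-th level, so that \<open>levels\<close> bounds
  its width by t + 1 and the shape of its nodes.\<close>

lemma pt_roots:
  assumes e: "env I x lam" and N: "pt I x (\<lambda>i. enc_nat (N i))" and k: "pt I x (\<lambda>i. enc_nat (k i))"
    and t: "pbd I x t" and W: "pbd I x W" and Q: "pt I x (\<lambda>i. enc_poly2 (Q i))"
    and good: "\<And>i. i \<in> I \<Longrightarrow> vec2C (lam i) (Q i) \<and> PPe (lam i) (Q i) \<noteq> 0 \<and> shape (Suc (t i)) (W i) (Q i) \<and> W i + k i * Suc (t i) \<le> N i"
  shows "pt I x (\<lambda>i. enc_list enc_vec (roots (ad (lam i)) (mu (lam i)) (ze (lam i)) (el (lam i)) (N i) (k i) (Q i)))"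
proof -
  define lv where "lv i = level (ad (lam i)) (mu (lam i)) (ze (lam i)) (el (lam i)) (N i)" for i
  define V where "V i m st \<longleftrightarrow> st = (lv i ^^ m) [([], Q i)]" for i m st
  define B where "B i = row_bound (lam i) (k i) (Suc (t i)) (W i + k i * Suc (t i))" for i
  have kb: "pbd I x k" by (rule pt_nat_pbd[OF k])
  have B: "pbd I x B" unfolding B_def by (intro pbd_row_bound e kb t W pbd_add pbd_mult pbd_Suc)
  have nodes: "(\<forall>s\<in>set st. vec2C (lam i) (snd s) \<and> data_size (enc_row s) \<le> B i) \<and> length st \<le> Suc (t i)"
    if i: "i \<in> I" and m: "m \<le> k i" and V: "V i m st" for i m st
  proof -
    interpret field_rep "C (lam i)" "ad (lam i)" "mu (lam i)" "ze (lam i)" "on (lam i)" "el (lam i)" "em (lam i)"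
      by (intro field_rep env_ge[OF e] i)
    have lev: "(\<forall>s\<in>set st. node (t i) (W i) m s) \<and> length st \<le> Suc (t i)"
      using levels[of "Q i" "t i" "W i" "k i" "N i" m] good[OF i] m V by (simp add: V_def lv_def)
    have "m * Suc (t i) \<le> k i * Suc (t i)" using m by (rule mult_le_mono1)
    then have "data_size (enc_row s) \<le> B i" if "s \<in> set st" for s
      unfolding B_def using lev that m
      by (intro data_size_row) (auto simp: node_def intro: shape_mono)
    then show ?thesis using lev by (simp add: node_def)
  qed
  have "pt I x (\<lambda>i. enc_list enc_row ((lv i ^^ k i) [([], Q i)]))"
  proof (rule pt_funpow[where V = V and A = "enc_list enc_row", OF k])
    show "pt I x (\<lambda>i. enc_list enc_row [([], Q i)])"
      by (rule pt_Cons[where E = enc_row, OF pt_pair[where E = enc_vec and F = enc_poly2, OF pt_Nil Q] pt_Nil])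
    fix x' let ?J = "fold_dom I (\<lambda>i. replicate (k i) True) V"
    assume x': "pt ?J x' (\<lambda>j. x (fst j))" "pt ?J x' (\<lambda>j. enc_list enc_row (snd (snd j)))"
    note e' = env_lift_fold[OF e x'(1)] and N' = pt_lift_fold[OF N x'(1)]
    show "pt ?J x' (\<lambda>j. enc_list enc_row (lv (fst j) (snd (snd j))))"
      unfolding lv_def level_def
    proof (rule pt_concat_map[OF x'(2)])
      fix x'' let ?K = "SIGMA j:?J. set (snd (snd j))"
      assume x'': "pt ?K x'' (\<lambda>j. x' (fst j))" "pt ?K x'' (\<lambda>j. enc_row (snd j))"
      show "pt ?K x'' (\<lambda>j. enc_list enc_row (branch (ad (lam (fst (fst j)))) (mu (lam (fst (fst j)))) (ze (lam (fst (fst j))))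
         (el (lam (fst (fst j)))) (N (fst (fst j))) (snd j)))"
      proof (rule pt_branch[OF env_lift_Sigma[OF e' x''(1)] pt_lift_Sigma[OF N' x''(1)] x''(2)])
        fix j assume "j \<in> ?K"
        then obtain i m st where j: "i \<in> I" "m < k i" "V i m st" "snd j \<in> set st" "fst (fst j) = i"
          by (auto simp: fold_dom_def)
        then show "vec2C (lam (fst (fst j))) (snd (snd j))" using nodes[of i m st] by simp
      qed
    qed
  next
    show "pbd I x (\<lambda>i. Suc (Suc (t i) * Suc (B i)))" by (intro pbd_Suc pbd_mult t B)
    show "data_size (enc_list enc_row st) \<le> Suc (Suc (t i) * Suc (B i))" if "i \<in> I" "m \<le> k i" "V i m st" for i m st
      using nodes[OF that] by (intro data_size_list_le) auto
  qed (simp_all add: V_def)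
  then have "pt I x (\<lambda>i. enc_list enc_vec (map fst ((lv i ^^ k i) [([], Q i)])))"
    by (rule pt_map[where E = enc_row and F = enc_vec and g = "\<lambda>_. fst"]) (rule pt_pair_fst)
  then show ?thesis by (simp add: roots_def lv_def)
qed

lemma pt_list_decode:
  assumes e: "env I x lam" and k: "pt I x (\<lambda>i. enc_nat (k i))" and pts: "pt I x (\<lambda>i. enc_list enc_pt (pts i))"
    and pc: "\<And>i p. i \<in> I \<Longrightarrow> p \<in> set (pts i) \<Longrightarrow> fst p \<in> C (lam i) \<and> snd p \<in> C (lam i)"
  shows "pt I x (\<lambda>i. enc_list enc_vec (list_decode (ad (lam i)) (mu (lam i)) (ze (lam i)) (on (lam i)) (el (lam i)) (k i) (pts i)))"
  unfolding list_decode_def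
proof (rule pt_concat_map[OF pt_upt[OF pt_Suc[OF pt_length[OF pts]]]])
  fix x' let ?J = "SIGMA i:I. set [0..<Suc (length (pts i))]"
  assume x': "pt ?J x' (\<lambda>j. x (fst j))" and t: "pt ?J x' (\<lambda>j. enc_nat (snd j))"
  note e' = env_lift_Sigma[OF e x'] and k' = pt_lift_Sigma[OF k x'] and pts' = pt_lift_Sigma[OF pts x']
  note cs = pt_constraints[OF k' pts']
  have tk: "pt ?J x' (\<lambda>j. enc_nat (snd j * k (fst j)))" by (rule pt_times[OF t k'])
  have N: "pt ?J x' (\<lambda>j. enc_nat (snd j * k (fst j) + k (fst j) * Suc (snd j)))"
    by (intro pt_plus pt_times pt_Suc t k')
  have "pt ?J x' (\<lambda>j. enc_list enc_row (eliminate (ad (lam (fst j))) (mu (lam (fst j))) (ze (lam (fst j)))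
     (constraints (k (fst j)) (pts (fst j)))
     (init_rows (ad (lam (fst j))) (mu (lam (fst j))) (ze (lam (fst j))) (on (lam (fst j))) (snd j) (k (fst j)) (pts (fst j)))))"
  proof (rule pt_eliminate[OF e' pt_init_rows[OF e' t k' pts'] cs pbd_Suc[OF pt_nat_pbd[OF t]] pt_nat_pbd[OF tk]])
    fix j rw assume j: "j \<in> ?J"
    interpret field_rep "C (lam (fst j))" "ad (lam (fst j))" "mu (lam (fst j))" "ze (lam (fst j))" "on (lam (fst j))" "el (lam (fst j))" "em (lam (fst j))"
      by (intro field_rep env_ge[OF e' j])
    assume "rw \<in> set (init_rows (ad (lam (fst j))) (mu (lam (fst j))) (ze (lam (fst j))) (on (lam (fst j))) (snd j) (k (fst j)) (pts (fst j)))"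
    then show "wf_rowC (lam (fst j)) (length (constraints (k (fst j)) (pts (fst j)))) (Suc (snd j)) (snd j * k (fst j)) rw"
      using init_rows_wf by blast
  qed
  note 1 = pt_take[OF pt_nat_const[of _ _ 1] this]
  show "pt ?J x' (\<lambda>j. enc_list enc_vec (decode1 (ad (lam (fst j))) (mu (lam (fst j))) (ze (lam (fst j))) (on (lam (fst j))) (el (lam (fst j)))
      (k (fst j)) (pts (fst j)) (snd j)))"
    unfolding decode1_def
  proof (rule pt_concat_map[OF 1])
    fix x''
    let ?K = "SIGMA j:?J. set (take 1 (eliminate (ad (lam (fst j))) (mu (lam (fst j))) (ze (lam (fst j)))
     (constraints (k (fst j)) (pts (fst j)))
     (init_rows (ad (lam (fst j))) (mu (lam (fst j))) (ze (lam (fst j))) (on (lam (fst j))) (snd j) (k (fst j)) (pts (fst j)))))"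
    assume x'': "pt ?K x'' (\<lambda>j. x' (fst j))" and rw: "pt ?K x'' (\<lambda>j. enc_row (snd j))"
    note t'' = pt_lift_Sigma[OF t x''] and tk'' = pt_lift_Sigma[OF tk x'']
    show "pt ?K x'' (\<lambda>j. enc_list enc_vec (roots (ad (lam (fst (fst j)))) (mu (lam (fst (fst j)))) (ze (lam (fst (fst j)))) (el (lam (fst (fst j))))
       (snd (fst j) * k (fst (fst j)) + k (fst (fst j)) * Suc (snd (fst j))) (k (fst (fst j))) (snd (snd j))))"
    proof (rule pt_roots[OF env_lift_Sigma[OF e' x''] pt_lift_Sigma[OF N x''] pt_lift_Sigma[OF k' x'']
          pt_nat_pbd[OF t''] pt_nat_pbd[OF tk''] pt_pair_snd[OF rw]])
      fix j assume "j \<in> ?K"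
      then obtain i s where j: "i \<in> I" "fst j = (i, s)"
        and rw: "snd j \<in> set (eliminate (ad (lam i)) (mu (lam i)) (ze (lam i)) (constraints (k i) (pts i))
         (init_rows (ad (lam i)) (mu (lam i)) (ze (lam i)) (on (lam i)) s (k i) (pts i)))"
        by (auto dest: in_set_takeD)
      interpret field_rep "C (lam i)" "ad (lam i)" "mu (lam i)" "ze (lam i)" "on (lam i)" "el (lam i)" "em (lam i)"
        by (intro field_rep env_ge[OF e] j)
      have "\<forall>p\<in>set (pts i). fst p \<in> C (lam i) \<and> snd p \<in> C (lam i)" using pc[OF j(1)] by blast
      from eliminate_good[OF this rw]
      show "vec2C (lam (fst (fst j))) (snd (snd j)) \<and> PPe (lam (fst (fst j))) (snd (snd j)) \<noteq> 0 \<and>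
          shape (Suc (snd (fst j))) (snd (fst j) * k (fst (fst j))) (snd (snd j)) \<and>
          snd (fst j) * k (fst (fst j)) + k (fst (fst j)) * Suc (snd (fst j)) \<le> snd (fst j) * k (fst (fst j)) + k (fst (fst j)) * Suc (snd (fst j))"
        by (simp add: j(2))
    qed
  qed
qed

end

section \<open>The model\<close>

locale decoding_setting = learning_setting +
  fixes dec :: "nat \<Rightarrow> nat \<Rightarrow> bool list list \<Rightarrow> bool list" and err :: "nat \<Rightarrow> nat"
  assumes err: "\<And>lam. lam \<ge> lam0 \<Longrightarrow> real (err lam) > budget P R lam"
    and dec: "\<And>lam v y. lam \<ge> lam0 \<Longrightarrow> length y = length (ecc_of P lam v) \<Longrightarrow> set y \<subseteq> C lam \<Longrightarrow>
       hamming (ecc_of P lam v) y \<le> err lam \<Longrightarrow> dec lam (length v) y = v"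
    and dec_computable: "poly_time_computable
          {(lam, m, y). lam \<ge> lam0 \<and> length y = length (ecc_of P lam (replicate m False)) \<and> set y \<subseteq> C lam}
          (\<lambda>(lam, m, y). Pair (enc_nat lam) (Pair (enc_nat m) (enc_list enc_bits y)))
          (\<lambda>(lam, m, y). enc_bits (dec lam m y))"
begin

definition num_syms :: "nat \<Rightarrow> nat" where
  "num_syms lam = ecc_len P lam (seed_len P lam) + ecc_len P lam (code_len P lam) +
     ecc_len P lam (vk_len P lam) + code_len P lam + ecc_len P lam 1"

definition vk_of :: "nat \<Rightarrow> bool list \<Rightarrow> bool list" where
  "vk_of lam x = dec lam (vk_len P lam) (take (ecc_len P lam (vk_len P lam))
     (drop (ecc_len P lam (seed_len P lam) + ecc_len P lam (code_len P lam)) (symbols (l lam) x)))"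

definition cands :: "nat \<Rightarrow> bool list \<Rightarrow> bool list list list" where
  "cands lam x = list_decode (ad lam) (mu lam) (ze lam) (on lam) (el lam) (code_dim P lam)
     (zip (eval_pts P lam) (LEnc_part P lam x))"

definition signed :: "nat \<Rightarrow> bool list list \<Rightarrow> bool list \<times> bool list" where
  "signed lam c = (take 1 (concat c), take (sig_len P lam) (drop 1 (concat c)))"

text \<open>The whole pair is returned because the same function serves the model, which keeps the
  bit, and the forger, which outputs the pair. The pair of empty strings stands for failure.\<close>

definition find_sig :: "nat \<Rightarrow> bool list \<Rightarrow> bool list \<times> bool list" where
  "find_sig lam x =
     (let ps = filter (\<lambda>p. verify_of P (vk_of lam x) (fst p) (snd p)) (map (signed lam) (cands lam x))
      in if ps = [] then ([], []) else hd ps)"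

text \<open>Below \<open>lam0\<close> the building blocks are unconstrained, so the answer is
  constant there; this keeps the model computable by one program for all \<open>lam\<close>.\<close>

definition model :: "nat \<Rightarrow> bool list \<Rightarrow> bool" where
  "model lam x \<longleftrightarrow> lam0 \<le> lam \<and> fst (find_sig lam x) = [True]"

lemma instance_len_eq: "instance_len P lam = l lam * num_syms lam"
  by (simp add: instance_len_def num_syms_def)

lemma params:
  assumes "lam \<ge> lam0"
  shows "1 + sig_len P lam \<le> code_dim P lam * l lam" "real (code_dim P lam) = R * real (code_len P lam)"
    and "\<And>vk sk. (vk, sk) \<in> set_pmf (gen_of P lam) \<Longrightarrow> length vk = vk_len P lam"
    and "\<And>vk sk b. (vk, sk) \<in> set_pmf (gen_of P lam) \<Longrightarrow> length (sign_of P sk [b]) = sig_len P lam"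
proof -
  show "1 + sig_len P lam \<le> code_dim P lam * l lam" "real (code_dim P lam) = R * real (code_len P lam)"
    using valid_P assms unfolding valid_parameters_def by blast+
  have *: "\<forall>(vk, sk) \<in> set_pmf (gen_of P lam). length vk = vk_len P lam \<and>
        (\<forall>b. length (sign_of P sk [b]) = sig_len P lam)"
    using valid_P assms unfolding valid_parameters_def by blast
  show "length vk = vk_len P lam" "length (sign_of P sk [b]) = sig_len P lam"
    if "(vk, sk) \<in> set_pmf (gen_of P lam)" for vk sk b
    using bspec[OF * that] by simp_all
qed

lemma l_pos: "lam \<ge> lam0 \<Longrightarrow> l lam > 0" and k_pos: "lam \<ge> lam0 \<Longrightarrow> code_dim P lam > 0"
  using params(1)[of lam] by (auto intro!: gr0I)

lemma n_pos: "lam \<ge> lam0 \<Longrightarrow> code_len P lam > 0"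
  using params(2)[of lam] k_pos[of lam] by (auto intro!: gr0I)

lemma k_le_n: "lam \<ge> lam0 \<Longrightarrow> code_dim P lam \<le> code_len P lam"
  using params(2)[of lam] R mult_right_mono[of R 1 "real (code_len P lam)"] by simp

lemma eval_pts:
  assumes "lam \<ge> lam0"
  shows "distinct (eval_pts P lam) \<and> length (eval_pts P lam) = code_len P lam \<and> set (eval_pts P lam) \<subseteq> C lam"
proof -
  have "\<forall>lam\<ge>lam0. distinct (eval_pts P lam) \<and> length (eval_pts P lam) = code_len P lam \<and>
        set (eval_pts P lam) \<subseteq> carrier (fld P lam)"
    using valid_F unfolding valid_field_def by blast
  then show ?thesis using assms unfolding fld(2)[OF assms, symmetric] by blast
qed

lemma ecc_closed: "lam \<ge> lam0 \<Longrightarrow> set (ecc_of P lam v) \<subseteq> C lam"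
  using ecc unfolding error_correcting_def by blast

lemma length_ecc: "length (ecc_of P lam v) = ecc_len P lam (length v)"
proof -
  have "\<forall>lam v w. length v = length w \<longrightarrow> length (ecc_of P lam v) = length (ecc_of P lam w)"
    using ecc unfolding error_correcting_def by blast
  from this[rule_format, of v "replicate (length v) False" lam] show ?thesis by (simp add: ecc_len_def)
qed

lemma length_symbols:
  "lam \<ge> lam0 \<Longrightarrow> x \<in> bitstrings (instance_len P lam) \<Longrightarrow> length (symbols (l lam) x) = num_syms lam"
  using l_pos[of lam] by (simp add: symbols_def bitstrings_def instance_len_eq)

lemma LEnc_part_closed: "set (LEnc_part P lam x) \<subseteq> C lam"
  using set_symbols[of "l lam" x] unfolding LEnc_part_def by (meson order_trans set_drop_subset set_take_subset)

subsection \<open>The model is efficient\<close>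

lemma pt_ecc:
  assumes e: "env I x lam" and v: "pt I x (\<lambda>i. enc_bits (v i))"
  shows "pt I x (\<lambda>i. enc_vec (ecc_of P (lam i) (v i)))"
proof -
  let ?J = "{(lam, v :: bool list). lam \<ge> lam0}"
  have "poly_time_computable ?J (\<lambda>(lam, v). Pair (enc_nat lam) (enc_bits v)) (\<lambda>(lam, v). enc_vec (ecc_of P lam v))"
    using ecc unfolding error_correcting_def by blast
  moreover have "(\<lambda>(lam, v). enc_vec (ecc_of P lam v)) = (\<lambda>j. enc_vec (ecc_of P (fst j) (snd j)))"
    by (simp add: fun_eq_iff)
  ultimately have "pt ?J (\<lambda>(lam, v). Pair (enc_nat lam) (enc_bits v)) (\<lambda>j. enc_vec (ecc_of P (fst j) (snd j)))"
    using pt_of_computable_vec[of ?J _ "\<lambda>j. ecc_of P (fst j) (snd j)"] by simp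
  from pt_comp[OF pt_Pair[OF env_pt[OF e] v] this, of "\<lambda>i. (lam i, v i)"]
  show ?thesis using env_ge[OF e] by simp
qed

lemma pt_ecc_len:
  assumes e: "env I x lam" and m: "pt I x (\<lambda>i. enc_nat (m i))"
  shows "pt I x (\<lambda>i. enc_nat (ecc_len P (lam i) (m i)))"
  unfolding ecc_len_def by (rule pt_length[OF pt_ecc[OF e pt_replicate[where E = enc_bool, OF m pt_const]]])

lemma pt_dec:
  assumes e: "env I x lam" and m: "pt I x (\<lambda>i. enc_nat (m i))" and y: "pt I x (\<lambda>i. enc_vec (y i))"
    and *: "\<And>i. i \<in> I \<Longrightarrow> length (y i) = ecc_len P (lam i) (m i) \<and> set (y i) \<subseteq> C (lam i)"
  shows "pt I x (\<lambda>i. enc_bits (dec (lam i) (m i) (y i)))"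
proof -
  let ?J = "{(lam, m, y). lam \<ge> lam0 \<and> length y = length (ecc_of P lam (replicate m False)) \<and> set y \<subseteq> C lam}"
  let ?z = "\<lambda>(lam, m, y). Pair (enc_nat lam) (Pair (enc_nat m) (enc_list enc_bits y))"
  have "(\<lambda>(lam, m, y). enc_bits (dec lam m y)) = (\<lambda>j. enc_bits (dec (fst j) (fst (snd j)) (snd (snd j))))"
    by (simp add: fun_eq_iff)
  then have "pt ?J ?z (\<lambda>j. enc_bits (dec (fst j) (fst (snd j)) (snd (snd j))))"
    using pt_of_computable_bits[of ?J ?z "\<lambda>j. dec (fst j) (fst (snd j)) (snd (snd j))"] dec_computable by simp
  from pt_comp[OF pt_Pair[OF env_pt[OF e] pt_Pair[OF m y]] this, of "\<lambda>i. (lam i, m i, y i)"]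
  show ?thesis using env_ge[OF e] * by (simp add: ecc_len_def)
qed

lemma pt_eval_pts:
  assumes e: "env I x lam"
  shows "pt I x (\<lambda>i. enc_vec (eval_pts P (lam i)))"
proof -
  have "poly_time_computable {lam. lam \<ge> lam0} enc_nat (\<lambda>lam. enc_vec (eval_pts P lam))"
    using valid_F unfolding valid_field_def by blast
  from pt_comp[OF env_pt[OF e] pt_of_computable_vec[OF this], of lam]
  show ?thesis using env_ge[OF e] by simp
qed

lemma pt_verify:
  assumes "pt I x (\<lambda>i. enc_bits (vk i))" "pt I x (\<lambda>i. enc_bits (m i))" "pt I x (\<lambda>i. enc_bits (s i))"
  shows "pt I x (\<lambda>i. enc_bool (verify_of P (vk i) (m i) (s i)))"
proof -
  let ?z = "\<lambda>(vk, m, \<sigma>). Pair (enc_bits vk) (Pair (enc_bits m) (enc_bits \<sigma>))"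
  have "poly_time_computable UNIV ?z (\<lambda>(vk, m, \<sigma>). enc_bool (verify_of P vk m \<sigma>))"
    using scheme unfolding signature_scheme_def by blast
  moreover have "(\<lambda>(vk, m, \<sigma>). enc_bool (verify_of P vk m \<sigma>)) = (\<lambda>j. enc_bool (verify_of P (fst j) (fst (snd j)) (snd (snd j))))"
    by (simp add: fun_eq_iff)
  ultimately have "pt UNIV ?z (\<lambda>j. enc_bool (verify_of P (fst j) (fst (snd j)) (snd (snd j))))"
    using pt_of_computable_bool[of UNIV ?z "\<lambda>j. verify_of P (fst j) (fst (snd j)) (snd (snd j))"] by simp
  from pt_comp[OF pt_Pair[OF assms(1) pt_Pair[OF assms(2,3)]] this, of "\<lambda>i. (vk i, m i, s i)"]
  show ?thesis by simp
qed

text \<open>The number of symbols is passed along, which avoids a division by l.\<close>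

lemma pt_symbols:
  assumes e: "env I x lam" and w: "pt I x (\<lambda>i. enc_bits (w i))" and n: "pt I x (\<lambda>i. enc_nat (n i))"
    and len: "\<And>i. i \<in> I \<Longrightarrow> length (w i) = n i * l (lam i)"
  shows "pt I x (\<lambda>i. enc_vec (symbols (l (lam i)) (w i)))"
proof (rule pt_cong)
  show "pt I x (\<lambda>i. enc_vec (map (\<lambda>m. take (l (lam i)) (drop (m * l (lam i)) (w i))) [0..<n i]))"
  proof (rule pt_map[OF pt_upt[OF n]])
    fix x' let ?J = "SIGMA i:I. set [0..<n i]"
    assume x': "pt ?J x' (\<lambda>j. x (fst j))" "pt ?J x' (\<lambda>j. enc_nat (snd j))"
    note l' = pt_lift_Sigma[OF pt_l[OF e] x'(1)]
    show "pt ?J x' (\<lambda>j. enc_bits (take (l (lam (fst j))) (drop (snd j * l (lam (fst j))) (w (fst j)))))"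
      by (rule pt_take[OF l' pt_drop[OF pt_times[OF x'(2) l'] pt_lift_Sigma[OF w x'(1)]]])
  qed
  show "enc_vec (map (\<lambda>m. take (l (lam i)) (drop (m * l (lam i)) (w i))) [0..<n i]) = enc_vec (symbols (l (lam i)) (w i))"
    if "i \<in> I" for i
    using len[OF that] l_pos[OF env_ge[OF e that]] by (simp add: symbols_def)
qed

lemma pt_num_syms:
  assumes e: "env I x lam"
  shows "pt I x (\<lambda>i. enc_nat (num_syms (lam i)))"
  unfolding num_syms_def by (intro pt_plus pt_ecc_len e pt_param[OF _ e] pt_nat_const) auto

lemma pt_find_sig:
  assumes e: "env I x lam" and w: "pt I x (\<lambda>i. enc_bits (w i))"
    and len: "\<And>i. i \<in> I \<Longrightarrow> w i \<in> bitstrings (instance_len P (lam i))"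
  shows "pt I x (\<lambda>i. enc_pair enc_bits enc_bits (find_sig (lam i) (w i)))"
proof -
  note par = pt_param[OF _ e]
  have sy: "pt I x (\<lambda>i. enc_vec (symbols (l (lam i)) (w i)))"
    by (rule pt_symbols[OF e w pt_num_syms[OF e]]) (use len in \<open>auto simp: bitstrings_def instance_len_eq\<close>)
  have vk: "pt I x (\<lambda>i. enc_bits (vk_of (lam i) (w i)))"
    unfolding vk_of_def
  proof (rule pt_dec[OF e])
    show "pt I x (\<lambda>i. enc_nat (vk_len P (lam i)))" by (rule par) simp
    show "pt I x (\<lambda>i. enc_vec (take (ecc_len P (lam i) (vk_len P (lam i))) (drop (ecc_len P (lam i) (seed_len P (lam i)) +
        ecc_len P (lam i) (code_len P (lam i))) (symbols (l (lam i)) (w i)))))"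
      by (intro pt_take pt_drop pt_plus pt_ecc_len e par sy) auto
    fix i assume i: "i \<in> I"
    have "set (take (ecc_len P (lam i) (vk_len P (lam i))) (drop (ecc_len P (lam i) (seed_len P (lam i)) +
        ecc_len P (lam i) (code_len P (lam i))) (symbols (l (lam i)) (w i)))) \<subseteq> C (lam i)"
      using set_symbols[of "l (lam i)" "w i"] by (meson order_trans set_drop_subset set_take_subset)
    then show "length (take (ecc_len P (lam i) (vk_len P (lam i))) (drop (ecc_len P (lam i) (seed_len P (lam i)) +
        ecc_len P (lam i) (code_len P (lam i))) (symbols (l (lam i)) (w i)))) = ecc_len P (lam i) (vk_len P (lam i)) \<and>
        set (take (ecc_len P (lam i) (vk_len P (lam i))) (drop (ecc_len P (lam i) (seed_len P (lam i)) +
        ecc_len P (lam i) (code_len P (lam i))) (symbols (l (lam i)) (w i)))) \<subseteq> C (lam i)"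
      using length_symbols[OF env_ge[OF e i] len[OF i]] by (simp add: num_syms_def)
  qed
  have LE: "pt I x (\<lambda>i. enc_vec (LEnc_part P (lam i) (w i)))"
    unfolding LEnc_part_def by (intro pt_take pt_drop pt_plus pt_ecc_len e par sy) auto
  have cands: "pt I x (\<lambda>i. enc_list enc_vec (cands (lam i) (w i)))"
    unfolding cands_def
  proof (rule pt_list_decode[OF e par pt_zip[OF pt_eval_pts[OF e] LE]])
    fix i p assume i: "i \<in> I" and p: "p \<in> set (zip (eval_pts P (lam i)) (LEnc_part P (lam i) (w i)))"
    have "(fst p, snd p) \<in> set (zip (eval_pts P (lam i)) (LEnc_part P (lam i) (w i)))" using p by simp
    then have "fst p \<in> set (eval_pts P (lam i))" "snd p \<in> set (LEnc_part P (lam i) (w i))"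
      by (rule set_zip_leftD, rule set_zip_rightD)
    then show "fst p \<in> C (lam i) \<and> snd p \<in> C (lam i)"
      using eval_pts[OF env_ge[OF e i]] LEnc_part_closed by blast
  qed simp
  have "pt I x (\<lambda>i. enc_list enc_pt (map (signed (lam i)) (cands (lam i) (w i))))"
  proof (rule pt_map[OF cands])
    fix x' let ?J = "SIGMA i:I. set (cands (lam i) (w i))"
    assume x': "pt ?J x' (\<lambda>j. x (fst j))" "pt ?J x' (\<lambda>j. enc_vec (snd j))"
    note c = pt_concat[OF x'(2)]
    have sl: "pt I x (\<lambda>i. enc_nat (sig_len P (lam i)))" by (rule par) simp
    show "pt ?J x' (\<lambda>j. enc_pt (signed (lam (fst j)) (snd j)))"
      unfolding signed_def
      by (rule pt_pair[where E = enc_bits and F = enc_bits, OF pt_take[OF pt_nat_const c]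
          pt_take[OF pt_lift_Sigma[OF sl x'(1)] pt_drop[OF pt_nat_const c]]])
  qed
  then have ps: "pt I x (\<lambda>i. enc_list enc_pt (filter (\<lambda>p. verify_of P (vk_of (lam i) (w i)) (fst p) (snd p)) (map (signed (lam i)) (cands (lam i) (w i)))))"
  proof (rule pt_filter)
    fix x' let ?J = "SIGMA i:I. set (map (signed (lam i)) (cands (lam i) (w i)))"
    assume x': "pt ?J x' (\<lambda>j. x (fst j))" "pt ?J x' (\<lambda>j. enc_pt (snd j))"
    show "pt ?J x' (\<lambda>j. enc_bool (verify_of P (vk_of (lam (fst j)) (w (fst j))) (fst (snd j)) (snd (snd j))))"
      by (rule pt_verify[OF pt_lift_Sigma[OF vk x'(1)] pt_pair_fst[OF x'(2)] pt_pair_snd[OF x'(2)]])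
  qed
  show ?thesis
    unfolding find_sig_def Let_def
  proof (rule pt_if[OF pt_eq_Nil[OF ps]])
    show "pt {i \<in> I. filter (\<lambda>p. verify_of P (vk_of (lam i) (w i)) (fst p) (snd p)) (map (signed (lam i)) (cands (lam i) (w i))) = []} x (\<lambda>i. enc_pt ([], []))"
      by (rule pt_const)
    show "pt {i \<in> I. filter (\<lambda>p. verify_of P (vk_of (lam i) (w i)) (fst p) (snd p)) (map (signed (lam i)) (cands (lam i) (w i))) \<noteq> []} x
       (\<lambda>i. enc_pt (hd (filter (\<lambda>p. verify_of P (vk_of (lam i) (w i)) (fst p) (snd p)) (map (signed (lam i)) (cands (lam i) (w i))))))"
      by (rule pt_hd[OF pt_subset[OF ps]]) auto
  qed
qed

lemma pt_model:
  assumes lam: "pt I x (\<lambda>i. enc_nat (lam i))" and w: "pt I x (\<lambda>i. enc_bits (w i))"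
    and len: "\<And>i. i \<in> I \<Longrightarrow> w i \<in> bitstrings (instance_len P (lam i))"
  shows "pt I x (\<lambda>i. enc_bool (model (lam i) (w i)))"
proof (rule pt_cong)
  let ?I = "{i \<in> I. lam0 \<le> lam i}"
  have s: "?I \<subseteq> I" by auto
  have e: "env ?I x lam" using pt_subset[OF lam s] by (simp add: env_def)
  show "pt I x (\<lambda>i. enc_bool (if lam0 \<le> lam i then fst (find_sig (lam i) (w i)) = [True] else False))"
  proof (rule pt_if[OF pt_le[OF pt_nat_const lam]])
    show "pt ?I x (\<lambda>i. enc_bool (fst (find_sig (lam i) (w i)) = [True]))"
      by (rule pt_bits_eq[OF pt_pair_fst[OF pt_find_sig[OF e pt_subset[OF w s]]] pt_const]) (use len in auto)
  qed (rule pt_const)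
qed (simp add: model_def)

end

subsection \<open>The model finds a valid signature\<close>

lemma symbols_concat:
  assumes "set ws \<subseteq> bitstrings m" "m > 0"
  shows "symbols m (concat ws) = ws"
proof -
  have len: "length (concat ws) = length ws * m" using assms(1)
    by (induction ws) (auto simp: bitstrings_def)
  have "take m (drop (i * m) (concat ws)) = ws ! i" if "i < length ws" for i
    using assms(1) that
  proof (induction ws arbitrary: i)
    case (Cons w ws)
    then show ?case by (cases i) (auto simp: bitstrings_def)
  qed simp
  then show ?thesis unfolding symbols_def len using assms(2) by (intro nth_equalityI) simp_all
qed

lemma concat_symbols:
  assumes "length w = k * m" "m > 0"
  shows "concat (symbols m w) = w" "length (symbols m w) = k"
proof -
  show "length (symbols m w) = k" using assms by (simp add: symbols_def)
  have "concat (map (\<lambda>i. take m (drop (i * m) w)) [0..<j]) = take (j * m) w" for j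
  proof (induction j)
    case (Suc j)
    have "take (Suc j * m) w = take (j * m) w @ take m (drop (j * m) w)"
      by (metis add.commute mult_Suc take_add)
    then show ?case using Suc by simp
  qed simp
  then show "concat (symbols m w) = w" using assms by (simp add: symbols_def)
qed

lemma hamming_slice:
  assumes "length xs = length ys"
  shows "hamming (take a (drop b xs)) (take a (drop b ys)) \<le> hamming xs ys"
proof -
  have "hamming (take a (drop b xs)) (take a (drop b ys)) =
      card ((\<lambda>i. b + i) ` {i. i < length (take a (drop b xs)) \<and> take a (drop b xs) ! i \<noteq> take a (drop b ys) ! i})"
    unfolding hamming_def by (intro card_image[symmetric]) simp
  also have "\<dots> \<le> hamming xs ys"
    unfolding hamming_def by (rule card_mono) (use assms in \<open>auto simp: less_diff_conv2\<close>)
  finally show ?thesis .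
qed

context decoding_setting
begin

definition word :: "nat \<Rightarrow> bool list \<Rightarrow> bool list \<Rightarrow> bool list \<Rightarrow> bool \<Rightarrow> bool list \<Rightarrow> bool \<Rightarrow> bool list" where
  "word lam u v vk b \<sigma> c = concat (ecc_of P lam u @ ecc_of P lam v @ ecc_of P lam vk @ LEnc P lam b \<sigma> @ ecc_of P lam [c])"

abbreviation coeffs_of :: "nat \<Rightarrow> bool \<Rightarrow> bool list \<Rightarrow> bool list list" where
  "coeffs_of lam b \<sigma> \<equiv> bits_to_vec (l lam) (code_dim P lam) (b # \<sigma>)"

context
  fixes lam assumes lam: "lam \<ge> lam0"
begin

interpretation F: field_rep "C lam" "ad lam" "mu lam" "ze lam" "on lam" "el lam" "em lam"
  by (rule field_rep[OF lam])

lemma coeffs_of: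
  assumes "length \<sigma> = sig_len P lam"
  shows "set (coeffs_of lam b \<sigma>) \<subseteq> C lam" "length (coeffs_of lam b \<sigma>) = code_dim P lam"
    "signed lam (coeffs_of lam b \<sigma>) = ([b], \<sigma>)"
proof -
  let ?w = "(b # \<sigma>) @ replicate (code_dim P lam * l lam - length (b # \<sigma>)) False"
  have len: "length ?w = code_dim P lam * l lam" using params(1)[OF lam] assms by simp
  show "set (coeffs_of lam b \<sigma>) \<subseteq> C lam" unfolding bits_to_vec_def by (rule set_symbols)
  show "length (coeffs_of lam b \<sigma>) = code_dim P lam"
    unfolding bits_to_vec_def by (rule concat_symbols(2)[OF len l_pos[OF lam]])
  have "concat (coeffs_of lam b \<sigma>) = ?w"
    unfolding bits_to_vec_def by (rule concat_symbols(1)[OF len l_pos[OF lam]])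
  then show "signed lam (coeffs_of lam b \<sigma>) = ([b], \<sigma>)" using assms by (simp add: signed_def)
qed

section \<open>Codewords as values of polynomials\<close>

lemma em_sum:
  assumes "a \<in> C lam" "set cs \<subseteq> C lam" "m \<le> length cs"
  shows "(\<Oplus>\<^bsub>fld P lam\<^esub>j\<in>{..<m}. cs ! j \<otimes>\<^bsub>fld P lam\<^esub> (a [^]\<^bsub>fld P lam\<^esub> j)) \<in> C lam \<and>
    em lam (\<Oplus>\<^bsub>fld P lam\<^esub>j\<in>{..<m}. cs ! j \<otimes>\<^bsub>fld P lam\<^esub> (a [^]\<^bsub>fld P lam\<^esub> j)) = (\<Sum>j<m. em lam (cs ! j) * em lam a ^ j)"
  using assms(3)
proof (induction m)
  interpret K: Ring.field "fld P lam" by (rule fld(1)[OF lam])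
  note car = fld(2)[OF lam]
  have add: "em lam (x \<oplus>\<^bsub>fld P lam\<^esub> y) = em lam x + em lam y" and mult: "em lam (x \<otimes>\<^bsub>fld P lam\<^esub> y) = em lam x * em lam y"
    if "x \<in> C lam" "y \<in> C lam" for x y
    using F.hom(1,2)[OF that] that by (simp_all add: ad_def mu_def bitstrings_def)
  have pow: "a [^]\<^bsub>fld P lam\<^esub> j \<in> C lam \<and> em lam (a [^]\<^bsub>fld P lam\<^esub> j) = em lam a ^ j" for j :: nat
  proof (induction j)
    case 0
    show ?case using K.one_closed F.hom(4) by (simp add: on[OF lam] car)
  next
    case (Suc j)
    then show ?case using assms(1) mult[of "a [^]\<^bsub>fld P lam\<^esub> j" a] K.m_closed[of "a [^]\<^bsub>fld P lam\<^esub> j" a]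
      by (simp add: car mult.commute)
  qed
  {
    case 0
    show ?case using F.hom(3) K.zero_closed by (simp add: ze[OF lam] car)
  next
    case (Suc m)
    have c: "cs ! j \<in> C lam" if "j \<le> m" for j
    proof -
      have "cs ! j \<in> set cs" using that Suc.prems by simp
      then show ?thesis using assms(2) by blast
    qed
    have t: "cs ! j \<otimes>\<^bsub>fld P lam\<^esub> (a [^]\<^bsub>fld P lam\<^esub> j) \<in> carrier (fld P lam)" if "j \<le> m" for j
      using K.m_closed[of "cs ! j" "a [^]\<^bsub>fld P lam\<^esub> j"] c[OF that] pow by (simp add: car)
    have "(\<Oplus>\<^bsub>fld P lam\<^esub>j\<in>{..<Suc m}. cs ! j \<otimes>\<^bsub>fld P lam\<^esub> (a [^]\<^bsub>fld P lam\<^esub> j)) =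
        (cs ! m \<otimes>\<^bsub>fld P lam\<^esub> (a [^]\<^bsub>fld P lam\<^esub> m)) \<oplus>\<^bsub>fld P lam\<^esub>
        (\<Oplus>\<^bsub>fld P lam\<^esub>j\<in>{..<m}. cs ! j \<otimes>\<^bsub>fld P lam\<^esub> (a [^]\<^bsub>fld P lam\<^esub> j))"
      unfolding lessThan_Suc using t by (intro K.finsum_insert) auto
    then show ?case
      using Suc c[of m] pow[of m] t[of m] mult[of "cs ! m" "a [^]\<^bsub>fld P lam\<^esub> m"]
        add[of "cs ! m \<otimes>\<^bsub>fld P lam\<^esub> (a [^]\<^bsub>fld P lam\<^esub> m)" "\<Oplus>\<^bsub>fld P lam\<^esub>j\<in>{..<m}. cs ! j \<otimes>\<^bsub>fld P lam\<^esub> (a [^]\<^bsub>fld P lam\<^esub> j)"]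
        K.add.m_closed[of "cs ! m \<otimes>\<^bsub>fld P lam\<^esub> (a [^]\<^bsub>fld P lam\<^esub> m)" "\<Oplus>\<^bsub>fld P lam\<^esub>j\<in>{..<m}. cs ! j \<otimes>\<^bsub>fld P lam\<^esub> (a [^]\<^bsub>fld P lam\<^esub> j)"]
      by (simp add: car add.commute)
  }
qed

lemma poly_P: "poly (F.P cs) z = (\<Sum>j<length cs. em lam (cs ! j) * z ^ j)"
proof (cases cs)
  case Nil
  then show ?thesis by simp
next
  case (Cons c cs')
  have "degree (F.P cs) \<le> length cs - 1" by (rule degree_le) (auto simp: F.coeff_P)
  then have "poly (F.P cs) z = (\<Sum>j\<le>length cs - 1. coeff (F.P cs) j * z ^ j)"
    unfolding poly_altdef by (intro sum.mono_neutral_left) (auto simp: coeff_eq_0)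
  also have "{..length cs - 1} = {..<length cs}" using Cons by auto
  finally show ?thesis by (simp add: F.coeff_P)
qed

lemma LEnc:
  assumes \<sigma>: "length \<sigma> = sig_len P lam"
  shows "length (LEnc P lam b \<sigma>) = code_len P lam" "set (LEnc P lam b \<sigma>) \<subseteq> C lam"
    and "\<And>i. i < code_len P lam \<Longrightarrow> em lam (LEnc P lam b \<sigma> ! i) = poly (F.P (coeffs_of lam b \<sigma>)) (em lam (eval_pts P lam ! i))"
proof -
  note pts = eval_pts[OF lam] and cs = coeffs_of[OF \<sigma>, of b]
  show len: "length (LEnc P lam b \<sigma>) = code_len P lam" using pts by (simp add: LEnc_def rs_encode_def)
  have nth: "LEnc P lam b \<sigma> ! i \<in> C lam \<and> em lam (LEnc P lam b \<sigma> ! i) = poly (F.P (coeffs_of lam b \<sigma>)) (em lam (eval_pts P lam ! i))"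
    if i: "i < code_len P lam" for i
  proof -
    have "eval_pts P lam ! i \<in> set (eval_pts P lam)" using i pts by simp
    then have "eval_pts P lam ! i \<in> C lam" using pts by blast
    from em_sum[OF this cs(1) order_refl] show ?thesis
      using i pts by (simp add: LEnc_def rs_encode_def poly_P)
  qed
  then show "\<And>i. i < code_len P lam \<Longrightarrow> em lam (LEnc P lam b \<sigma> ! i) = poly (F.P (coeffs_of lam b \<sigma>)) (em lam (eval_pts P lam ! i))"
    by blast
  show "set (LEnc P lam b \<sigma>) \<subseteq> C lam"
    using nth len by (auto simp: in_set_conv_nth)
qed

text \<open>Two polynomials of degree below k \<le> n that agree at n points are equal, and the bit
  is the first bit of their common coefficient vector.\<close>

lemma LEnc_inj:
  assumes "length \<sigma> = sig_len P lam" "length \<sigma>' = sig_len P lam" "LEnc P lam b \<sigma> = LEnc P lam b' \<sigma>'"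
  shows "b = b'"
proof -
  let ?cs = "coeffs_of lam b \<sigma>" and ?cs' = "coeffs_of lam b' \<sigma>'"
  note cs = coeffs_of[OF assms(1), of b] and cs' = coeffs_of[OF assms(2), of b'] and pts = eval_pts[OF lam]
  have deg: "degree (F.P p) < code_len P lam" if "length p = code_dim P lam" for p
  proof -
    have "degree (F.P p) \<le> code_dim P lam - 1" by (rule degree_le) (use that in \<open>auto simp: F.coeff_P\<close>)
    then show ?thesis using k_pos[OF lam] k_le_n[OF lam] by linarith
  qed
  let ?A = "em lam ` set (eval_pts P lam)"
  have "card ?A = code_len P lam"
    using pts F.inj by (subst card_image) (auto intro: inj_on_subset simp: distinct_card)
  moreover have "poly (F.P ?cs) z = poly (F.P ?cs') z" if z: "z \<in> ?A" for z
  proof -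
    obtain i where i: "i < code_len P lam" "z = em lam (eval_pts P lam ! i)"
      using z pts by (metis imageE in_set_conv_nth)
    then show ?thesis using LEnc(3)[OF assms(1) i(1), where b = b] LEnc(3)[OF assms(2) i(1), where b = b'] assms(3) by simp
  qed
  ultimately have "F.P ?cs = F.P ?cs'"
    using deg[OF cs(2)] deg[OF cs'(2)] by (intro poly_eqI_degree[of ?A]) auto
  then have "em lam (?cs ! i) = em lam (?cs' ! i)" if "i < code_dim P lam" for i
    using F.coeff_P[of ?cs i] F.coeff_P[of ?cs' i] that cs(2) cs'(2) by simp
  then have "map (em lam) ?cs = map (em lam) ?cs'"
    using cs(2) cs'(2) by (simp add: list_eq_iff_nth_eq)
  then have "?cs = ?cs'"
    by (rule map_inj_on) (rule inj_on_subset[OF F.inj Un_least[OF cs(1) cs'(1)]])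
  from arg_cong[OF this, of "signed lam"] show ?thesis unfolding cs(3) cs'(3) by simp
qed

lemma symbols_word:
  assumes \<sigma>: "length \<sigma> = sig_len P lam"
  shows "symbols (l lam) (word lam u v vk b \<sigma> c) =
    ecc_of P lam u @ ecc_of P lam v @ ecc_of P lam vk @ LEnc P lam b \<sigma> @ ecc_of P lam [c]"
  unfolding word_def
  by (rule symbols_concat) (use ecc_closed[OF lam] LEnc(2)[OF \<sigma>] l_pos[OF lam] in auto)

lemma word_label:
  assumes "length \<sigma> = sig_len P lam" "length u = seed_len P lam" "length v = code_len P lam" "length vk = vk_len P lam"
  shows "true_label P lam (word lam u v vk b \<sigma> c) = b"
proof -
  have part: "LEnc_part P lam (word lam u v vk b \<sigma> c) = LEnc P lam b \<sigma>"
    unfolding LEnc_part_def symbols_word[OF assms(1)]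
    using assms LEnc(1)[OF assms(1), where b = b] by (simp add: length_ecc)
  show ?thesis
    unfolding true_label_def part
    by (rule some_equality) (use assms(1) LEnc_inj in auto)
qed

text \<open>It is left open which pair is found. The original bit and signature lie in the list of
  candidates, so the filtered list is nonempty, and its head verifies by the choice of the
  filter.\<close>

lemma find_sig_verifies:
  assumes lens: "length \<sigma> = sig_len P lam" "length u = seed_len P lam" "length v = code_len P lam" "length vk = vk_len P lam"
    and x': "x' \<in> bitstrings (instance_len P lam)"
    and dist: "symbol_distance P lam (word lam u v vk b \<sigma> c) x' \<le> budget P R lam"
    and ver: "verify_of P vk [b] \<sigma>"
  shows "verify_of P vk (fst (find_sig lam x')) (snd (find_sig lam x'))"
proof -
  let ?s = "symbols (l lam) (word lam u v vk b \<sigma> c)" and ?s' = "symbols (l lam) x'"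
  note s = symbols_word[OF lens(1), of u v vk b c] and L = LEnc[OF lens(1), where b = b]
  have len: "length ?s = length ?s'"
    using length_symbols[OF lam x'] lens L by (simp add: s length_ecc num_syms_def)
  have d: "real (hamming ?s ?s') \<le> budget P R lam" using dist by (simp add: symbol_distance_def)
  let ?o = "ecc_len P lam (seed_len P lam) + ecc_len P lam (code_len P lam)" and ?v = "ecc_len P lam (vk_len P lam)"
  have "take ?v (drop ?o ?s) = ecc_of P lam vk" using lens by (simp add: s length_ecc)
  with hamming_slice[OF len, of ?v ?o] d
  have "real (hamming (ecc_of P lam vk) (take ?v (drop ?o ?s'))) \<le> budget P R lam" by simp
  then have "hamming (ecc_of P lam vk) (take ?v (drop ?o ?s')) \<le> err lam" using err[OF lam] by simp
  moreover have "length (take ?v (drop ?o ?s')) = length (ecc_of P lam vk)"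
    using length_symbols[OF lam x'] lens by (simp add: length_ecc num_syms_def)
  moreover have "set (take ?v (drop ?o ?s')) \<subseteq> C lam"
    using set_symbols[of "l lam" x'] by (meson order_trans set_drop_subset set_take_subset)
  ultimately have vk: "vk_of lam x' = vk"
    unfolding vk_of_def using dec[OF lam, of "take ?v (drop ?o ?s')" vk] lens(4) by simp
  define ys where "ys = LEnc_part P lam x'"
  let ?n = "code_len P lam" and ?y = "LEnc P lam b \<sigma>" and ?as = "eval_pts P lam"
  have "take ?n (drop (?o + ?v) ?s) = ?y" using lens L(1) by (simp add: s length_ecc)
  with hamming_slice[OF len, of ?n "?o + ?v"] d
  have dy: "real (hamming ?y ys) \<le> budget P R lam" by (simp add: ys_def LEnc_part_def)
  have ys: "length ys = ?n" "set ys \<subseteq> C lam"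
    using length_symbols[OF lam x'] LEnc_part_closed by (simp_all add: ys_def LEnc_part_def num_syms_def)
  note pts = eval_pts[OF lam]
  define G where "G = {i. i < ?n \<and> ?y ! i = ys ! i}"
  have "G \<union> {i. i < ?n \<and> ?y ! i \<noteq> ys ! i} = {..<?n}" "G \<inter> {i. i < ?n \<and> ?y ! i \<noteq> ys ! i} = {}"
    by (auto simp: G_def)
  then have "card G + hamming ?y ys = ?n"
    unfolding hamming_def L(1) by (metis (no_types, lifting) card_Un_disjoint card_lessThan finite_Un finite_lessThan)
  \<comment> \<open>At least sqrt R times n positions survive. The square of this number is R n^2 =
    k n, which is the agreement that list decoding asks for.\<close>
  then have "real ?n - (1 - sqrt R) * real ?n \<le> real (card G)" using dy by (simp add: budget_def)
  then have "sqrt R * real ?n \<le> real (card G)" by (simp add: algebra_simps)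
  then have "(sqrt R * real ?n)\<^sup>2 \<le> (real (card G))\<^sup>2" using R by (intro power_mono) auto
  moreover have "(sqrt R * real ?n)\<^sup>2 = R * real ?n * real ?n"
    using R by (simp add: power_mult_distrib power2_eq_square)
  ultimately have "real (code_dim P lam * ?n) \<le> real ((card G)\<^sup>2)" using params(2)[OF lam] by simp
  then have agree: "code_dim P lam * ?n \<le> (card G)\<^sup>2" by (simp only: of_nat_le_iff)
  let ?pts = "zip ?as ys" and ?A = "(\<lambda>i. (?as ! i, ys ! i)) ` G"
  have lp: "length ?pts = ?n" using pts ys by simp
  have inj: "inj_on (\<lambda>i. (?as ! i, ys ! i)) G"
    using pts by (auto simp: inj_on_def G_def nth_eq_iff_index_eq)
  have "coeffs_of lam b \<sigma> \<in> set (cands lam x')"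
    unfolding cands_def ys_def[symmetric]
  proof (rule F.list_decode_complete)
    show "\<forall>p\<in>set ?pts. fst p \<in> C lam \<and> snd p \<in> C lam"
    proof
      fix p assume "p \<in> set ?pts"
      then have "(fst p, snd p) \<in> set ?pts" by simp
      then have "fst p \<in> set ?as" "snd p \<in> set ys" by (rule set_zip_leftD, rule set_zip_rightD)
      then show "fst p \<in> C lam \<and> snd p \<in> C lam" using pts ys by blast
    qed
    show "distinct (map fst ?pts)" using pts ys by simp
    show "set (coeffs_of lam b \<sigma>) \<subseteq> C lam" "length (coeffs_of lam b \<sigma>) = code_dim P lam"
      using coeffs_of[OF lens(1)] by auto
    show "1 \<le> code_dim P lam" "?pts \<noteq> []" using k_pos[OF lam] n_pos[OF lam] lp by auto
    show "?A \<subseteq> set ?pts" using pts ys by (auto simp: set_zip G_def)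
    show "\<forall>p\<in>?A. em lam (snd p) = poly (F.P (coeffs_of lam b \<sigma>)) (em lam (fst p))"
    proof
      fix p assume "p \<in> ?A"
      then obtain i where i: "i < ?n" "?y ! i = ys ! i" "p = (?as ! i, ys ! i)" by (auto simp: G_def)
      then show "em lam (snd p) = poly (F.P (coeffs_of lam b \<sigma>)) (em lam (fst p))" using L(3)[OF i(1)] by simp
    qed
    show "code_dim P lam * length ?pts \<le> (card ?A)\<^sup>2" using agree lp card_image[OF inj] by simp
  qed
  then have "([b], \<sigma>) \<in> set (map (signed lam) (cands lam x'))"
    using coeffs_of(3)[OF lens(1), of b] by (metis image_eqI set_map)
  then have "([b], \<sigma>) \<in> set (filter (\<lambda>p. verify_of P vk (fst p) (snd p)) (map (signed lam) (cands lam x')))"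
    using ver by simp
  then have ne: "filter (\<lambda>p. verify_of P vk (fst p) (snd p)) (map (signed lam) (cands lam x')) \<noteq> []"
    by (metis list.set(1) empty_iff)
  from hd_in_set[OF this] show ?thesis
    using ne unfolding find_sig_def vk Let_def by simp
qed

end

end

section \<open>Forgers from adversaries\<close>

subsection \<open>Hard-coding the answers of the oracle\<close>

text \<open>Register q holds a queue of answers drawn in advance, and a query removes its
  head.\<close>

primrec hardcode :: "nat \<Rightarrow> com \<Rightarrow> com" where
  "hardcode q (Assign i e) = Assign i e"
| "hardcode q (Flip i) = Flip i"
| "hardcode q (Sample i) = Seq (Assign i (Fst (Var q))) (Assign q (Snd (Var q)))"
| "hardcode q (Seq c c') = Seq (hardcode q c) (hardcode q c')"
| "hardcode q (Cond e c c') = Cond e (hardcode q c) (hardcode q c')"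
| "hardcode q (While e c) = While e (hardcode q c)"

abbreviation enc_data :: "data list \<Rightarrow> data" where
  "enc_data \<equiv> enc_list (\<lambda>d. d)"

lemma step_hardcode:
  assumes "\<forall>c\<in>set cs. occ_bound c \<le> q" "\<forall>i. cs \<noteq> [] \<longrightarrow> hd cs \<noteq> Sample i"
  shows "step no_oracle (map (hardcode q) cs, s(q := w)) =
    map_pmf (\<lambda>cf. (map (hardcode q) (fst cf), (snd cf)(q := w))) (step orc (cs, s))"
proof (cases cs)
  case (Cons c cs')
  have e: "eval_expr e (s(q := w)) = eval_expr e s" if "expr_bound e \<le> q" for e
    by (rule eval_expr_cong) (use that in auto)
  show ?thesis using assms e unfolding Cons
    by (cases c) (auto simp: pmf.map_comp o_def fun_upd_twist intro!: map_pmf_cong)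
qed simp

text \<open>Lazy and eager sampling agree. A run of t steps asks at most t times, so n \<ge> t
  answers suffice, and those left over are averaged out. The factor 3 pays for the three steps that
  replace one query.\<close>

lemma steps_hardcode:
  assumes "halted (steps orc t (cs, s))" "\<forall>c\<in>set cs. occ_bound c \<le> q" "t \<le> n" "q > 0"
  shows "(\<forall>ws\<in>set_pmf (replicate_pmf n orc). halted (steps no_oracle (3 * t) (map (hardcode q) cs, s(q := enc_data ws)))) \<and>
    map_pmf (\<lambda>cf. snd cf 0) (steps orc t (cs, s)) =
      bind_pmf (replicate_pmf n orc) (\<lambda>ws. map_pmf (\<lambda>cf. snd cf 0) (steps no_oracle (3 * t) (map (hardcode q) cs, s(q := enc_data ws))))"
  using assms(1-3)
proof (induction t arbitrary: cs s n)
  case 0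
  then show ?case using assms(4) by (simp add: halted_def)
next
  case (Suc t)
  have IH: "(\<forall>ws\<in>set_pmf (replicate_pmf m orc). halted (steps no_oracle (3 * t) (map (hardcode q) (fst cf), (snd cf)(q := enc_data ws)))) \<and>
    map_pmf (\<lambda>cf. snd cf 0) (steps orc t cf) =
      bind_pmf (replicate_pmf m orc) (\<lambda>ws. map_pmf (\<lambda>cf. snd cf 0) (steps no_oracle (3 * t) (map (hardcode q) (fst cf), (snd cf)(q := enc_data ws))))"
    if "cf \<in> set_pmf (step orc (cs, s))" "t \<le> m" for cf m
  proof -
    have "halted (steps orc t cf)" using Suc.prems(1) that(1) by (simp add: halted_bind)
    moreover have "\<forall>c\<in>set (fst cf). occ_bound c \<le> q"
    proof (cases cs)
      case Nil
      then show ?thesis using that(1) by simp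
    next
      case (Cons c cs')
      then show ?thesis using that(1) Suc.prems(2) by (cases c) (auto split: if_splits)
    qed
    ultimately show ?thesis using Suc.IH[of "fst cf" "snd cf" m] that(2) unfolding prod.collapse by blast
  qed
  show ?case
  proof (cases "\<exists>i cs'. cs = Sample i # cs'")
    case True
    then obtain i cs' where cs: "cs = Sample i # cs'" by blast
    obtain m where n: "n = Suc m" "t \<le> m" using Suc.prems(3) by (cases n) auto
    have i: "i < q" using Suc.prems(2) cs by simp
    have run: "steps no_oracle (3 * Suc t) (map (hardcode q) cs, s(q := enc_data (a # ws))) =
        steps no_oracle (3 * t) (map (hardcode q) cs', (s(i := a))(q := enc_data ws))" for a ws
    proof -
      have 3: "3 * Suc t = Suc (Suc (Suc (3 * t)))" by simp
      have "s(q := Pair a (enc_data ws), i := a, q := enc_data ws) = (s(i := a))(q := enc_data ws)"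
        using i by (auto simp: fun_eq_iff)
      then show ?thesis unfolding 3 using i by (simp add: cs bind_return_pmf)
    qed
    have IH': "(\<forall>ws\<in>set_pmf (replicate_pmf m orc). halted (steps no_oracle (3 * t) (map (hardcode q) cs', (s(i := a))(q := enc_data ws)))) \<and>
      map_pmf (\<lambda>cf. snd cf 0) (steps orc t (cs', s(i := a))) =
      bind_pmf (replicate_pmf m orc) (\<lambda>ws. map_pmf (\<lambda>cf. snd cf 0) (steps no_oracle (3 * t) (map (hardcode q) cs', (s(i := a))(q := enc_data ws))))"
      if "a \<in> set_pmf orc" for a
      using IH[of "(cs', s(i := a))" m] that n(2) by (simp add: cs)
    have "map_pmf (\<lambda>cf. snd cf 0) (steps orc (Suc t) (cs, s)) =
        bind_pmf orc (\<lambda>a. map_pmf (\<lambda>cf. snd cf 0) (steps orc t (cs', s(i := a))))"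
      by (simp add: cs map_bind_pmf bind_map_pmf)
    also have "\<dots> = bind_pmf orc (\<lambda>a. bind_pmf (replicate_pmf m orc)
        (\<lambda>ws. map_pmf (\<lambda>cf. snd cf 0) (steps no_oracle (3 * Suc t) (map (hardcode q) cs, s(q := enc_data (a # ws))))))"
      using IH' unfolding run by (intro bind_pmf_cong) auto
    also have "\<dots> = bind_pmf (replicate_pmf n orc)
        (\<lambda>ws. map_pmf (\<lambda>cf. snd cf 0) (steps no_oracle (3 * Suc t) (map (hardcode q) cs, s(q := enc_data ws))))"
      by (simp only: n(1) replicate_pmf.simps bind_assoc_pmf bind_return_pmf)
    finally have eq: "map_pmf (\<lambda>cf. snd cf 0) (steps orc (Suc t) (cs, s)) = \<dots>" .
    have "halted (steps no_oracle (3 * Suc t) (map (hardcode q) cs, s(q := enc_data ws)))"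
      if ws: "ws \<in> set_pmf (replicate_pmf n orc)" for ws
    proof -
      obtain a ws' where "ws = a # ws'" "a \<in> set_pmf orc" "ws' \<in> set_pmf (replicate_pmf m orc)"
        using ws n(1) by auto
      then show ?thesis using IH' unfolding \<open>ws = a # ws'\<close> run by blast
    qed
    then show ?thesis using eq by blast
  next
    case False
    then have ns: "\<forall>i. cs \<noteq> [] \<longrightarrow> hd cs \<noteq> Sample i" by (metis list.collapse)
    let ?f = "\<lambda>cf ws. (map (hardcode q) (fst cf), (snd cf)(q := enc_data ws))"
    note IHn = IH[OF _ Suc_leD[OF Suc.prems(3)]]
    \<comment> \<open>A command other than a query takes one step in both programs; the two spare
      steps are spent in the halted state.\<close>
    have 3: "3 * Suc t = Suc (3 * t + 2)" by simp
    have run: "steps no_oracle (3 * Suc t) (map (hardcode q) cs, s(q := enc_data ws)) =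
        bind_pmf (step orc (cs, s)) (\<lambda>cf. steps no_oracle (3 * t) (?f cf ws))"
      if ws: "ws \<in> set_pmf (replicate_pmf n orc)" for ws
    proof -
      have "steps no_oracle (3 * t + 2) (?f cf ws) = steps no_oracle (3 * t) (?f cf ws)"
        if "cf \<in> set_pmf (step orc (cs, s))" for cf
        by (rule steps_stable) (use IHn[OF that] ws in auto)
      then show ?thesis
        unfolding 3 steps.simps step_hardcode[OF Suc.prems(2) ns, of _ _ orc] bind_map_pmf
        by (intro bind_pmf_cong) auto
    qed
    have "map_pmf (\<lambda>cf. snd cf 0) (steps orc (Suc t) (cs, s)) =
        bind_pmf (step orc (cs, s)) (\<lambda>cf. map_pmf (\<lambda>cf. snd cf 0) (steps orc t cf))"
      by (simp add: map_bind_pmf)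
    also have "\<dots> = bind_pmf (step orc (cs, s)) (\<lambda>cf. bind_pmf (replicate_pmf n orc)
        (\<lambda>ws. map_pmf (\<lambda>cf. snd cf 0) (steps no_oracle (3 * t) (?f cf ws))))"
      using IHn by (intro bind_pmf_cong) auto
    \<comment> \<open>The coins of this step are independent of the list of answers, so the order of
      drawing may be exchanged.\<close>
    also have "\<dots> = bind_pmf (replicate_pmf n orc) (\<lambda>ws. bind_pmf (step orc (cs, s))
        (\<lambda>cf. map_pmf (\<lambda>cf. snd cf 0) (steps no_oracle (3 * t) (?f cf ws))))"
      by (rule bind_commute_pmf)
    also have "\<dots> = bind_pmf (replicate_pmf n orc)
        (\<lambda>ws. map_pmf (\<lambda>cf. snd cf 0) (steps no_oracle (3 * Suc t) (map (hardcode q) cs, s(q := enc_data ws))))"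
      using run by (intro bind_pmf_cong) (auto simp: map_bind_pmf)
    finally have eq: "map_pmf (\<lambda>cf. snd cf 0) (steps orc (Suc t) (cs, s)) = \<dots>" .
    have "halted (steps no_oracle (3 * Suc t) (map (hardcode q) cs, s(q := enc_data ws)))"
      if "ws \<in> set_pmf (replicate_pmf n orc)" for ws
      unfolding run[OF that] halted_bind using IHn that by auto
    then show ?thesis using eq by blast
  qed
qed

lemma com_size_hardcode: "com_size (hardcode q c) \<le> 8 * com_size c"
  by (induction c) auto

subsection \<open>Sequencing random programs\<close>

lemma tot_exact: "tot cs s t (\<lambda>s'. s' = s1) \<Longrightarrow> steps no_oracle t (cs, s) = return_pmf ([], s1)"
  unfolding tot_def by (auto simp: set_pmf_subset_singleton[symmetric] prod_eq_iff)

text \<open>Only the middle program may be random. The first one must produce an exact store,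
  because the run of the adversary depends on every register that it reads, while the last one
  depends on register 0 alone.\<close>

lemma run_sandwich:
  assumes c1: "tot [c1] s t1 (\<lambda>s'. s' = s1)" and c2: "halted (steps no_oracle t2 ([c2], s1))"
    and c3: "\<And>s'. tot [c3] s' t3 (\<lambda>s''. s'' 0 = g (s' 0))"
  shows "halted (steps no_oracle (t1 + (t2 + t3) + 2) ([Seq c1 (Seq c2 c3)], s)) \<and>
    map_pmf (\<lambda>cf. snd cf 0) (steps no_oracle (t1 + (t2 + t3) + 2) ([Seq c1 (Seq c2 c3)], s)) =
      map_pmf (\<lambda>cf. g (snd cf 0)) (steps no_oracle t2 ([c2], s1))"
proof -
  have h3: "halted (steps no_oracle t3 ([c3], s'))" for s' by (rule tot_halted[OF c3])
  have s23: "steps no_oracle (t2 + t3) ([c2] @ [c3], s1) =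
      bind_pmf (steps no_oracle t2 ([c2], s1)) (\<lambda>cf. steps no_oracle t3 ([c3], snd cf))"
    by (rule steps_append[OF c2 h3])
  have h23: "halted (steps no_oracle (t2 + t3) ([c2] @ [c3], s1))"
    unfolding s23 halted_bind using h3 by blast
  have S: "steps no_oracle (Suc (t2 + t3)) ([Seq c2 c3], s1) = steps no_oracle (t2 + t3) ([c2] @ [c3], s1)"
    by (simp add: bind_return_pmf)
  have "steps no_oracle (t1 + Suc (t2 + t3)) ([c1] @ [Seq c2 c3], s) =
      bind_pmf (steps no_oracle t1 ([c1], s)) (\<lambda>cf. steps no_oracle (Suc (t2 + t3)) ([Seq c2 c3], snd cf))"
    by (rule steps_append[OF tot_halted[OF c1]]) (use h23 S tot_exact[OF c1] in auto)
  also have "\<dots> = steps no_oracle (t2 + t3) ([c2] @ [c3], s1)"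
    using tot_exact[OF c1] S by (simp add: bind_return_pmf)
  finally have run: "steps no_oracle (t1 + (t2 + t3) + 2) ([Seq c1 (Seq c2 c3)], s) = steps no_oracle (t2 + t3) ([c2] @ [c3], s1)"
    by (simp add: bind_return_pmf)
  have "map_pmf (\<lambda>cf. snd cf 0) (steps no_oracle t3 ([c3], s')) = return_pmf (g (s' 0))" for s'
  proof -
    have "map_pmf (\<lambda>cf. snd cf 0) (steps no_oracle t3 ([c3], s')) = map_pmf (\<lambda>_. g (s' 0)) (steps no_oracle t3 ([c3], s'))"
      by (rule map_pmf_cong[OF refl]) (use c3[of s'] in \<open>auto simp: tot_def\<close>)
    then show ?thesis by simp
  qed
  then have "map_pmf (\<lambda>cf. snd cf 0) (steps no_oracle (t2 + t3) ([c2] @ [c3], s1)) =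
      bind_pmf (steps no_oracle t2 ([c2], s1)) (\<lambda>cf. return_pmf (g (snd cf 0)))"
    unfolding s23 map_bind_pmf by simp
  then show ?thesis unfolding run using h23 by (simp add: map_pmf_def)
qed

subsection \<open>Reading a bit string of bounded length\<close>

text \<open>Register 0 holds the unread rest of the tree, register 1 the unary counter, and register
  2 the bits read so far.\<close>

definition read_body :: com where
  "read_body = Seq (Cond (Var 0)
       (Seq (Cond (Fst (Var 0)) (Assign 2 (Mk (Quote (Pair Atom Atom)) (Var 2))) (Assign 2 (Mk (Quote Atom) (Var 2))))
            (Assign 0 (Snd (Var 0))))
       (Assign 0 (Var 0)))
     (Assign 1 (Snd (Var 1)))"

text \<open>
  The tree computed by the adversary may have exponential size. Only \<open>n\<close> bits of the string that it
  stands for are read; they end up in reverse order, and longer strings are discarded.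
\<close>

definition read_bits :: "nat \<Rightarrow> com" where
  "read_bits n = Seq (Assign 1 (Quote (enc_nat n))) (Seq (Assign 2 (Quote Atom))
     (Seq (While (Var 1) read_body)
     (Seq (Cond (Var 0) (Assign 2 (Quote Atom)) (Assign 0 (Var 0))) (Assign 0 (Var 2)))))"

lemma tot_Cond1:
  assumes "eval_expr e s \<noteq> Atom \<Longrightarrow> tot [c] s t Q" "eval_expr e s = Atom \<Longrightarrow> tot [c'] s t Q"
  shows "tot [Cond e c c'] s (Suc t) Q"
  by (rule tot_Cond) (use assms in auto)

lemma tot_read_body:
  assumes "s 1 = Pair a (enc_nat m)" "s 2 = enc_bits w"
  shows "tot [read_body] s 8 (\<lambda>s'. s' 1 = enc_nat m \<and> s' 2 = enc_bits (rev (take 1 (dec_bits (s 0))) @ w) \<and>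
     dec_bits (s' 0) = drop 1 (dec_bits (s 0)))"
proof -
  let ?Q = "\<lambda>s'. s' 1 = Pair a (enc_nat m) \<and> s' 2 = enc_bits (rev (take 1 (dec_bits (s 0))) @ w) \<and>
     dec_bits (s' 0) = drop 1 (dec_bits (s 0))"
  have 1: "tot [Cond (Var 0)
       (Seq (Cond (Fst (Var 0)) (Assign 2 (Mk (Quote (Pair Atom Atom)) (Var 2))) (Assign 2 (Mk (Quote Atom) (Var 2))))
            (Assign 0 (Snd (Var 0))))
       (Assign 0 (Var 0))] s 5 ?Q"
  proof (cases "s 0")
    case Atom
    then have "tot [Assign 0 (Var 0)] s 1 ?Q" by (intro tot_Assign) (use assms in simp)
    then have "tot [Assign 0 (Var 0)] s 4 ?Q" by (rule tot_time) simp
    then have "tot [Cond (Var 0)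
       (Seq (Cond (Fst (Var 0)) (Assign 2 (Mk (Quote (Pair Atom Atom)) (Var 2))) (Assign 2 (Mk (Quote Atom) (Var 2))))
            (Assign 0 (Snd (Var 0))))
       (Assign 0 (Var 0))] s (Suc 4) ?Q" by (intro tot_Cond1) (use Atom in simp_all)
    then show ?thesis by simp
  next
    case (Pair u v)
    let ?R = "\<lambda>s'. s' 0 = Pair u v \<and> s' 1 = Pair a (enc_nat m) \<and> s' 2 = enc_bits ((u \<noteq> Atom) # w)"
    have "tot [Cond (Fst (Var 0)) (Assign 2 (Mk (Quote (Pair Atom Atom)) (Var 2))) (Assign 2 (Mk (Quote Atom) (Var 2)))] s (Suc 1) ?R"
      by (intro tot_Cond1; rule tot_Assign) (use assms Pair in auto)
    then have "tot [Seq (Cond (Fst (Var 0)) (Assign 2 (Mk (Quote (Pair Atom Atom)) (Var 2))) (Assign 2 (Mk (Quote Atom) (Var 2))))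
            (Assign 0 (Snd (Var 0)))] s (Suc (Suc 1 + 1)) ?Q"
      by (rule tot_Seq2) (rule tot_Assign, use Pair in auto)
    then have "tot [Cond (Var 0)
       (Seq (Cond (Fst (Var 0)) (Assign 2 (Mk (Quote (Pair Atom Atom)) (Var 2))) (Assign 2 (Mk (Quote Atom) (Var 2))))
            (Assign 0 (Snd (Var 0))))
       (Assign 0 (Var 0))] s (Suc (Suc (Suc 1 + 1))) ?Q" by (intro tot_Cond1) (use Pair in simp_all)
    then show ?thesis by (rule tot_time) simp
  qed
  have "tot [read_body] s (Suc (5 + 1)) (\<lambda>s'. s' 1 = enc_nat m \<and> s' 2 = enc_bits (rev (take 1 (dec_bits (s 0))) @ w) \<and>
     dec_bits (s' 0) = drop 1 (dec_bits (s 0)))"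
    unfolding read_body_def by (rule tot_Seq2[OF 1]) (rule tot_Assign, simp)
  then show ?thesis by (rule tot_time) simp
qed

lemma enc_nat_simps [simp]: "enc_nat 0 = Atom" "enc_nat (Suc n) = Pair (Pair Atom Atom) (enc_nat n)"
  by (simp_all add: enc_nat_def)

lemma tot_read_loop:
  assumes "s 1 = enc_nat m" "s 2 = enc_bits w"
  shows "tot [While (Var 1) read_body] s (Suc (m * 9)) (\<lambda>s'. s' 2 = enc_bits (rev (take m (dec_bits (s 0))) @ w) \<and>
     dec_bits (s' 0) = drop m (dec_bits (s 0)))"
  using assms
proof (induction m arbitrary: s w)
  case 0
  show ?case by (rule tot_time[OF tot_While_done]) (use 0 in auto)
next
  case (Suc m)
  have "tot [While (Var 1) read_body] s (Suc (8 + Suc (m * 9))) (\<lambda>s'. s' 2 = enc_bits (rev (take (Suc m) (dec_bits (s 0))) @ w) \<and>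
     dec_bits (s' 0) = drop (Suc m) (dec_bits (s 0)))"
  proof (rule tot_While_step)
    show "eval_expr (Var 1) s \<noteq> Atom" using Suc.prems by simp
    show "tot [read_body, While (Var 1) read_body] s (8 + Suc (m * 9)) (\<lambda>s'. s' 2 = enc_bits (rev (take (Suc m) (dec_bits (s 0))) @ w) \<and>
     dec_bits (s' 0) = drop (Suc m) (dec_bits (s 0)))"
    proof (rule tot_Cons[OF tot_read_body])
      show "s 1 = Pair (Pair Atom Atom) (enc_nat m)" "s 2 = enc_bits w" using Suc.prems by simp_all
      fix s1 :: store assume s1: "s1 1 = enc_nat m \<and> s1 2 = enc_bits (rev (take 1 (dec_bits (s 0))) @ w) \<and> dec_bits (s1 0) = drop 1 (dec_bits (s 0))"
      have t: "rev (take (Suc m) xs) = rev (take m (tl xs)) @ rev (take (Suc 0) xs)" for xs :: "bool list"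
        by (cases xs) auto
      show "tot [While (Var 1) read_body] s1 (Suc (m * 9)) (\<lambda>s'. s' 2 = enc_bits (rev (take (Suc m) (dec_bits (s 0))) @ w) \<and>
          dec_bits (s' 0) = drop (Suc m) (dec_bits (s 0)))"
        by (rule tot_weaken[OF Suc.IH[of s1 "rev (take 1 (dec_bits (s 0))) @ w"] order_refl])
          (use s1 in \<open>simp_all add: drop_Suc t\<close>)
    qed
  qed
  then show ?case by (rule tot_time) simp
qed

lemma tot_read_bits:
  "tot [read_bits n] s (n * 9 + 12)
     (\<lambda>s'. s' 0 = enc_bits (if length (dec_bits (s 0)) \<le> n then rev (dec_bits (s 0)) else []))"
proof -
  let ?w = "dec_bits (s 0)"
  have atom: "d = Atom \<longleftrightarrow> dec_bits d = []" for d by (cases d) auto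
  have "tot [read_bits n] s (Suc (1 + Suc (1 + Suc (Suc (n * 9) + Suc (Suc 1 + 1)))))
     (\<lambda>s'. s' 0 = enc_bits (if length ?w \<le> n then rev ?w else []))"
    unfolding read_bits_def
  proof (rule tot_Seq2[where R = "\<lambda>s1. s1 0 = s 0 \<and> s1 1 = enc_nat n"])
    show "tot [Assign 1 (Quote (enc_nat n))] s 1 (\<lambda>s1. s1 0 = s 0 \<and> s1 1 = enc_nat n)"
      by (rule tot_Assign) simp
    fix s1 :: store assume s1: "s1 0 = s 0 \<and> s1 1 = enc_nat n"
    show "tot [Seq (Assign 2 (Quote Atom)) (Seq (While (Var 1) read_body)
        (Seq (Cond (Var 0) (Assign 2 (Quote Atom)) (Assign 0 (Var 0))) (Assign 0 (Var 2))))] s1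
        (Suc (1 + Suc (Suc (n * 9) + Suc (Suc 1 + 1)))) (\<lambda>s'. s' 0 = enc_bits (if length ?w \<le> n then rev ?w else []))"
    proof (rule tot_Seq2[where R = "\<lambda>s2. s2 0 = s 0 \<and> s2 1 = enc_nat n \<and> s2 2 = enc_bits []"])
      show "tot [Assign 2 (Quote Atom)] s1 1 (\<lambda>s2. s2 0 = s 0 \<and> s2 1 = enc_nat n \<and> s2 2 = enc_bits [])"
        by (rule tot_Assign) (use s1 in simp)
      fix s2 :: store assume s2: "s2 0 = s 0 \<and> s2 1 = enc_nat n \<and> s2 2 = enc_bits []"
      show "tot [Seq (While (Var 1) read_body) (Seq (Cond (Var 0) (Assign 2 (Quote Atom)) (Assign 0 (Var 0))) (Assign 0 (Var 2)))] s2
          (Suc (Suc (n * 9) + Suc (Suc 1 + 1))) (\<lambda>s'. s' 0 = enc_bits (if length ?w \<le> n then rev ?w else []))"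
      proof (rule tot_Seq2[OF tot_read_loop[of s2 n "[]"]])
        show "s2 1 = enc_nat n" "s2 2 = enc_bits []" using s2 by auto
        fix s3 :: store assume "s3 2 = enc_bits (rev (take n (dec_bits (s2 0))) @ []) \<and> dec_bits (s3 0) = drop n (dec_bits (s2 0))"
        then have s3: "s3 2 = enc_bits (rev (take n ?w))" "dec_bits (s3 0) = drop n ?w" using s2 by simp_all
        show "tot [Seq (Cond (Var 0) (Assign 2 (Quote Atom)) (Assign 0 (Var 0))) (Assign 0 (Var 2))] s3
            (Suc (Suc 1 + 1)) (\<lambda>s'. s' 0 = enc_bits (if length ?w \<le> n then rev ?w else []))"
        proof (rule tot_Seq2[where R = "\<lambda>s4. s4 2 = enc_bits (if length ?w \<le> n then rev ?w else [])"])
          show "tot [Cond (Var 0) (Assign 2 (Quote Atom)) (Assign 0 (Var 0))] s3 (Suc 1)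
              (\<lambda>s4. s4 2 = enc_bits (if length ?w \<le> n then rev ?w else []))"
            by (rule tot_Cond1; rule tot_Assign) (use s3 atom[of "s3 0"] in auto)
          show "tot [Assign 0 (Var 2)] s4 1 (\<lambda>s'. s' 0 = enc_bits (if length ?w \<le> n then rev ?w else []))"
            if "s4 2 = enc_bits (if length ?w \<le> n then rev ?w else [])" for s4
            by (rule tot_Assign) (use that in simp)
        qed
      qed
    qed
  qed
  then show ?thesis by (rule tot_time) simp
qed

context decoding_setting
begin

subsection \<open>Building the challenge for the adversary\<close>

text \<open>Replaces the sum in the field record by a scheme built from the computable operations:
  each coefficient c becomes the constant polynomial \<open>[c]\<close>, and evaluation at X = 0
  leaves the Horner rule in Y.\<close>

lemma LEnc_horner:
  assumes lam: "lam \<ge> lam0" and \<sigma>: "length \<sigma> = sig_len P lam"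
  shows "LEnc P lam b \<sigma> = map (\<lambda>a. eval0 (ad lam) (mu lam) (ze lam) a (map (\<lambda>c. [c]) (coeffs_of lam b \<sigma>))) (eval_pts P lam)"
proof (rule nth_equalityI)
  interpret F: field_rep "C lam" "ad lam" "mu lam" "ze lam" "on lam" "el lam" "em lam"
    by (rule field_rep[OF lam])
  note L = LEnc[OF lam \<sigma>, where b = b] and pts = eval_pts[OF lam] and cs = coeffs_of[OF lam \<sigma>, of b]
  show "length (LEnc P lam b \<sigma>) = length (map (\<lambda>a. eval0 (ad lam) (mu lam) (ze lam) a (map (\<lambda>c. [c]) (coeffs_of lam b \<sigma>))) (eval_pts P lam))"
    using L(1) pts by simp
  fix i assume "i < length (LEnc P lam b \<sigma>)"
  then have i: "i < code_len P lam" using L(1) by simp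
  have "eval_pts P lam ! i \<in> set (eval_pts P lam)" using i pts by simp
  then have a: "eval_pts P lam ! i \<in> C lam" using pts by blast
  have v: "\<forall>r\<in>set (map (\<lambda>c. [c]) (coeffs_of lam b \<sigma>)). set r \<subseteq> C lam" using cs(1) by auto
  have "eval_X0 (F.PP (map (\<lambda>c. [c]) p)) = F.P p" for p
    by (simp add: F.eval_X0_PP F.P_def nthz_def comp_def)
  then have "em lam (eval0 (ad lam) (mu lam) (ze lam) (eval_pts P lam ! i) (map (\<lambda>c. [c]) (coeffs_of lam b \<sigma>))) = em lam (LEnc P lam b \<sigma> ! i)"
    using F.eval0[OF a v] L(3)[OF i] by simp
  moreover have "LEnc P lam b \<sigma> ! i \<in> C lam"
    using L(1,2) i by (metis nth_mem subsetD)
  ultimately show "LEnc P lam b \<sigma> ! i = map (\<lambda>a. eval0 (ad lam) (mu lam) (ze lam) a (map (\<lambda>c. [c]) (coeffs_of lam b \<sigma>))) (eval_pts P lam) ! i"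
    using F.eval0[OF a v] F.inj i pts by (simp add: inj_on_def)
qed

lemma pt_LEnc:
  assumes e: "env I x lam" and b: "pt I x (\<lambda>i. enc_bool (b i))" and \<sigma>: "pt I x (\<lambda>i. enc_bits (\<sigma> i))"
    and len: "\<And>i. i \<in> I \<Longrightarrow> length (\<sigma> i) = sig_len P (lam i)"
  shows "pt I x (\<lambda>i. enc_vec (LEnc P (lam i) (b i) (\<sigma> i)))"
proof (rule pt_cong)
  have k: "pt I x (\<lambda>i. enc_nat (code_dim P (lam i)))" by (rule pt_param[OF _ e]) simp
  note w = pt_Cons[OF b \<sigma>]
  have cs: "pt I x (\<lambda>i. enc_vec (coeffs_of (lam i) (b i) (\<sigma> i)))"
    unfolding bits_to_vec_def
  proof (rule pt_symbols[OF e _ k])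
    show "pt I x (\<lambda>i. enc_bits ((b i # \<sigma> i) @ replicate (code_dim P (lam i) * l (lam i) - length (b i # \<sigma> i)) False))"
      by (intro pt_append pt_replicate[where E = enc_bool] pt_minus pt_times k pt_l[OF e] pt_length[OF w] w pt_const)
    fix i assume i: "i \<in> I"
    show "length ((b i # \<sigma> i) @ replicate (code_dim P (lam i) * l (lam i) - length (b i # \<sigma> i)) False) = code_dim P (lam i) * l (lam i)"
      using params(1)[OF env_ge[OF e i]] len[OF i] by simp
  qed
  have "pt I x (\<lambda>i. enc_poly2 (map (\<lambda>c. [c]) (coeffs_of (lam i) (b i) (\<sigma> i))))"
    by (rule pt_map[where E = enc_bits and F = enc_vec and g = "\<lambda>_ c. [c]", OF cs])
      (rule pt_Cons[where E = enc_bits, OF _ pt_Nil])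
  note cs' = this
  show "pt I x (\<lambda>i. enc_vec (map (\<lambda>a. eval0 (ad (lam i)) (mu (lam i)) (ze (lam i)) a (map (\<lambda>c. [c]) (coeffs_of (lam i) (b i) (\<sigma> i)))) (eval_pts P (lam i))))"
  proof (rule pt_map[OF pt_eval_pts[OF e]])
    fix x' let ?J = "SIGMA i:I. set (eval_pts P (lam i))"
    assume x': "pt ?J x' (\<lambda>j. x (fst j))" "pt ?J x' (\<lambda>j. enc_bits (snd j))"
    show "pt ?J x' (\<lambda>j. enc_bits (eval0 (ad (lam (fst j))) (mu (lam (fst j))) (ze (lam (fst j))) (snd j)
        (map (\<lambda>c. [c]) (coeffs_of (lam (fst j)) (b (fst j)) (\<sigma> (fst j))))))"
      by (rule pt_eval0[OF env_lift_Sigma[OF e x'(1)] x'(2) pt_lift_Sigma[OF cs' x'(1)]])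
  qed
  show "enc_vec (map (\<lambda>a. eval0 (ad (lam i)) (mu (lam i)) (ze (lam i)) a (map (\<lambda>c. [c]) (coeffs_of (lam i) (b i) (\<sigma> i)))) (eval_pts P (lam i))) =
      enc_vec (LEnc P (lam i) (b i) (\<sigma> i))" if "i \<in> I" for i
    using LEnc_horner[OF env_ge[OF e that] len[OF that]] by simp
qed

text \<open>The strings p1 and p2 are the blocks of the instance before the key and after the
  codeword. The masked bit in p2 depends on the secret and on the sampler, so these blocks are
  written into the program, while the two in between are computed from the input of the
  forger.\<close>

definition advice :: "nat \<Rightarrow> bool list \<Rightarrow> bool list \<Rightarrow> data" where
  "advice lam p1 p2 = Pair (enc_nat lam) (Pair (enc_bits p1) (enc_bits p2))"

definition challenge :: "nat \<Rightarrow> bool list \<Rightarrow> bool list \<Rightarrow> bool list \<Rightarrow> bool \<Rightarrow> bool list \<Rightarrow> bool list" where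
  "challenge lam p1 p2 vk b \<sigma> = p1 @ concat (ecc_of P lam vk) @ concat (LEnc P lam b \<sigma>) @ p2"

definition dom1 :: "(nat \<times> bool list \<times> bool list \<times> bool list \<times> bool \<times> bool list) set" where
  "dom1 = {(lam, p1, p2, vk, b, \<sigma>). lam0 \<le> lam \<and> length \<sigma> = sig_len P lam}"

definition in1 :: "nat \<times> bool list \<times> bool list \<times> bool list \<times> bool \<times> bool list \<Rightarrow> data" where
  "in1 = (\<lambda>(lam, p1, p2, vk, b, \<sigma>). Pair (advice lam p1 p2) (forger_input vk [b] \<sigma>))"

definition out1 :: "nat \<times> bool list \<times> bool list \<times> bool list \<times> bool \<times> bool list \<Rightarrow> data" where
  "out1 = (\<lambda>(lam, p1, p2, vk, b, \<sigma>). adversary_input (challenge lam p1 p2 vk b \<sigma>) b Atom)"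

lemma pt_stage1: "pt dom1 in1 out1"
proof -
  have i: "in1 j = Pair (Pair (enc_nat (fst j)) (Pair (enc_bits (fst (snd j))) (enc_bits (fst (snd (snd j))))))
      (Pair (enc_bits (fst (snd (snd (snd j))))) (Pair (Pair (enc_bool (fst (snd (snd (snd (snd j)))))) Atom) (enc_bits (snd (snd (snd (snd (snd j))))))))" for j
    by (simp add: in1_def advice_def forger_input_def split_beta)
  note id = pt_id[of dom1 in1]
  have lam: "pt dom1 in1 (\<lambda>j. enc_nat (fst j))" using pt_fst[OF pt_fst[OF id]] by (simp add: i)
  have p1: "pt dom1 in1 (\<lambda>j. enc_bits (fst (snd j)))" using pt_fst[OF pt_snd[OF pt_fst[OF id]]] by (simp add: i)
  have p2: "pt dom1 in1 (\<lambda>j. enc_bits (fst (snd (snd j))))" using pt_snd[OF pt_snd[OF pt_fst[OF id]]] by (simp add: i)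
  have vk: "pt dom1 in1 (\<lambda>j. enc_bits (fst (snd (snd (snd j)))))" using pt_fst[OF pt_snd[OF id]] by (simp add: i)
  have b: "pt dom1 in1 (\<lambda>j. enc_bool (fst (snd (snd (snd (snd j))))))"
    using pt_fst[OF pt_fst[OF pt_snd[OF pt_snd[OF id]]]] by (simp add: i)
  have \<sigma>: "pt dom1 in1 (\<lambda>j. enc_bits (snd (snd (snd (snd (snd j))))))"
    using pt_snd[OF pt_snd[OF pt_snd[OF id]]] by (simp add: i)
  have e: "env dom1 in1 fst" using lam by (auto simp: env_def dom1_def)
  have L: "pt dom1 in1 (\<lambda>j. enc_vec (LEnc P (fst j) (fst (snd (snd (snd (snd j))))) (snd (snd (snd (snd (snd j)))))))"
    by (rule pt_LEnc[OF e b \<sigma>]) (auto simp: dom1_def)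
  have "pt dom1 in1 (\<lambda>j. enc_bits (fst (snd j) @ (concat (ecc_of P (fst j) (fst (snd (snd (snd j)))))
      @ (concat (LEnc P (fst j) (fst (snd (snd (snd (snd j))))) (snd (snd (snd (snd (snd j)))))) @ fst (snd (snd j))))))"
    by (intro pt_append p1 p2 pt_concat pt_ecc[OF e vk] L)
  note 1 = pt_Pair[OF this pt_Pair[OF b pt_const[where d = Atom]]]
  show ?thesis by (rule pt_cong[OF 1]) (simp add: out1_def adversary_input_def challenge_def split_beta)
qed

text \<open>The length test keeps the decoder on the domain where it is known to be
  efficient.\<close>

definition forgery :: "nat \<Rightarrow> bool list \<Rightarrow> bool list \<times> bool list" where
  "forgery lam w = (if length w = instance_len P lam then find_sig lam w else ([], []))"

definition in2 :: "nat \<times> bool list \<Rightarrow> data" where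
  "in2 j = Pair (enc_nat (fst j)) (enc_bits (snd j))"

text \<open>The reversal undoes the order in which \<open>read_bits\<close> leaves the
  string.\<close>

lemma pt_stage2: "pt {j. lam0 \<le> fst j} in2 (\<lambda>j. enc_pt (forgery (fst j) (rev (snd j))))"
proof -
  let ?I = "{j :: nat \<times> bool list. lam0 \<le> fst j}"
  have lam: "pt ?I in2 (\<lambda>j. enc_nat (fst j))" using pt_fst[OF pt_id[of ?I in2]] by (simp add: in2_def)
  have w: "pt ?I in2 (\<lambda>j. enc_bits (snd j))" using pt_snd[OF pt_id[of ?I in2]] by (simp add: in2_def)
  have e: "env ?I in2 fst" using lam by (simp add: env_def)
  note r = pt_rev[OF w]
  show ?thesis
    unfolding forgery_def
  proof (rule pt_if[where E = enc_pt])
    show "pt ?I in2 (\<lambda>j. enc_bool (length (rev (snd j)) = instance_len P (fst j)))"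
      unfolding instance_len_eq by (intro pt_nat_eq pt_length[OF r] pt_times pt_l[OF e] pt_num_syms[OF e])
    let ?J = "{j \<in> ?I. length (rev (snd j)) = instance_len P (fst j)}"
    have s: "?J \<subseteq> ?I" by auto
    show "pt ?J in2 (\<lambda>j. enc_pt (find_sig (fst j) (rev (snd j))))"
      by (rule pt_find_sig[OF env_subset[OF e s] pt_subset[OF r s]]) (auto simp: bitstrings_def)
  qed (rule pt_const)
qed

text \<open>Strings that are too long are replaced by the empty one; positivity ensures that this is
  not mistaken for an instance.\<close>

lemma instance_len_pos: "lam \<ge> lam0 \<Longrightarrow> instance_len P lam > 0"
  using l_pos[of lam] n_pos[of lam] by (simp add: instance_len_def)

text \<open>One pair of polynomials and one constant serve all adversaries, parameters and advice.
  The stages before and after the adversary are fixed programs, and whatever else varies is the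
  adversary itself or quoted data, which the size bound accounts for.\<close>

lemma forge_program:
  obtains B :: "com \<Rightarrow> nat \<Rightarrow> data list \<Rightarrow> bool list \<Rightarrow> bool list \<Rightarrow> com" and p q :: "nat poly" and K :: nat where
    "\<And>c lam ws p1 p2. com_size (B c lam ws p1 p2) \<le> 8 * com_size c + data_size (advice lam p1 p2) +
       data_size (enc_data ws) + data_size (enc_nat (instance_len P lam)) + data_size (enc_nat lam) + K"
    "\<And>c lam ws p1 p2 vk b \<sigma> t M. lam \<ge> lam0 \<Longrightarrow> length \<sigma> = sig_len P lam \<Longrightarrow>
       M = steps no_oracle t ([hardcode (Suc (occ_bound c)) c],
         ((\<lambda>_. Atom)(0 := out1 (lam, p1, p2, vk, b, \<sigma>)))(Suc (occ_bound c) := enc_data ws)) \<Longrightarrow>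
       halted M \<Longrightarrow>
       halts_in no_oracle (B c lam ws p1 p2) (forger_input vk [b] \<sigma>)
         (poly p (data_size (in1 (lam, p1, p2, vk, b, \<sigma>))) + poly q (data_size (enc_nat lam) + instance_len P lam) + t) \<and>
       outcome no_oracle (B c lam ws p1 p2) (forger_input vk [b] \<sigma>) =
         map_pmf (\<lambda>cf. enc_pt (forgery lam (dec_bits (snd cf 0)))) M"
proof -
  obtain pre T1 where T1: "pbd dom1 in1 T1" and "\<forall>i\<in>dom1. \<forall>s. s 0 = in1 i \<longrightarrow> tot [pre] s (T1 i) (\<lambda>s'. s' 0 = out1 i)"
    using pt_stage1 unfolding pt_def by blast
  then have pre: "tot [pre] s (T1 i) (\<lambda>s'. s' 0 = out1 i \<and> (\<forall>v\<ge>var_bound pre. s' v = s v))" if "i \<in> dom1" "s 0 = in1 i" for i s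
    using that by (intro tot_frame) simp
  obtain p1' where p1': "\<And>i. i \<in> dom1 \<Longrightarrow> T1 i \<le> poly p1' (data_size (in1 i))"
    using T1 unfolding pbd_def by blast
  let ?I = "{j :: nat \<times> bool list. lam0 \<le> fst j}"
  obtain post T2 where T2: "pbd ?I in2 T2" and
    post: "\<forall>i\<in>?I. \<forall>s. s 0 = in2 i \<longrightarrow> tot [post] s (T2 i) (\<lambda>s'. s' 0 = enc_pt (forgery (fst i) (rev (snd i))))"
    using pt_stage2 unfolding pt_def by blast
  obtain p2' where p2': "\<And>i. i \<in> ?I \<Longrightarrow> T2 i \<le> poly p2' (data_size (in2 i))"
    using T2 unfolding pbd_def by blast
  \<comment> \<open>The first stage writes no register from k on; clearing registers 1 to k leaves
    exactly the store on which the adversary is supposed to start.\<close>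
  define k where "k = var_bound pre"
  define c1 where "c1 = (\<lambda>c lam ws p1 p2. Seq (Assign 0 (Mk (Quote (advice lam p1 p2)) (Var 0)))
    (Seq pre (Seq (resets k) (Assign (Suc (occ_bound c)) (Quote (enc_data ws))))))"
  define c3 where "c3 = (\<lambda>lam. Seq (read_bits (instance_len P lam)) (Seq (Assign 0 (Mk (Quote (enc_nat lam)) (Var 0))) post))"
  define B where "B = (\<lambda>c lam ws p1 p2. Seq (c1 c lam ws p1 p2) (Seq (hardcode (Suc (occ_bound c)) c) (c3 lam)))"
  define p where "p = p1' + [:2 * k + 8:]"
  \<comment> \<open>There are 9 steps for each bit read, a constant for overhead, and the second
    stage on an input of size at most 2 + 4 m. The constant 20 has enough slack for the 2 steps
    added by \<open>run_sandwich\<close>.\<close>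
  define q where "q = [:0, 9:] + [:20:] + pcompose p2' [:2, 4:]"
  have C1: "tot [c1 c lam ws p1 p2] ((\<lambda>_. Atom)(0 := forger_input vk [b] \<sigma>)) (poly p (data_size (in1 (lam, p1, p2, vk, b, \<sigma>))))
      (\<lambda>s'. s' = ((\<lambda>_. Atom)(0 := out1 (lam, p1, p2, vk, b, \<sigma>)))(Suc (occ_bound c) := enc_data ws))"
    if j: "(lam, p1, p2, vk, b, \<sigma>) \<in> dom1" for c lam ws p1 p2 vk b \<sigma>
  proof -
    let ?j = "(lam, p1, p2, vk, b, \<sigma>)"
    let ?s0 = "(\<lambda>_. Atom)(0 := forger_input vk [b] \<sigma>)"
    have "tot [c1 c lam ws p1 p2] ?s0 (Suc (1 + Suc (T1 ?j + Suc (Suc (2 * k) + 1))))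
        (\<lambda>s'. s' = ((\<lambda>_. Atom)(0 := out1 ?j))(Suc (occ_bound c) := enc_data ws))"
      unfolding c1_def
    proof (rule tot_Seq2[where R = "\<lambda>s. s = (\<lambda>_. Atom)(0 := in1 ?j)"])
      show "tot [Assign 0 (Mk (Quote (advice lam p1 p2)) (Var 0))] ?s0 1 (\<lambda>s. s = (\<lambda>_. Atom)(0 := in1 ?j))"
        by (rule tot_Assign) (simp add: in1_def)
      fix s1 :: store assume s1: "s1 = (\<lambda>_. Atom)(0 := in1 ?j)"
      show "tot [Seq pre (Seq (resets k) (Assign (Suc (occ_bound c)) (Quote (enc_data ws))))] s1
          (Suc (T1 ?j + Suc (Suc (2 * k) + 1))) (\<lambda>s'. s' = ((\<lambda>_. Atom)(0 := out1 ?j))(Suc (occ_bound c) := enc_data ws))"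
      proof (rule tot_Seq2[OF pre[of ?j s1, OF j]])
        show "s1 0 = in1 ?j" using s1 by simp
        fix s2 :: store assume s2: "s2 0 = out1 ?j \<and> (\<forall>v\<ge>var_bound pre. s2 v = s1 v)"
        show "tot [Seq (resets k) (Assign (Suc (occ_bound c)) (Quote (enc_data ws)))] s2
            (Suc (Suc (2 * k) + 1)) (\<lambda>s'. s' = ((\<lambda>_. Atom)(0 := out1 ?j))(Suc (occ_bound c) := enc_data ws))"
        proof (rule tot_Seq2[OF tot_resets])
          fix s3 :: store assume s3: "s3 = (\<lambda>v. if 1 \<le> v \<and> v \<le> k then Atom else s2 v)"
          have "s3 = (\<lambda>_. Atom)(0 := out1 ?j)" using s1 s2 by (auto simp: s3 k_def fun_eq_iff)
          then show "tot [Assign (Suc (occ_bound c)) (Quote (enc_data ws))] s3 1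
              (\<lambda>s'. s' = ((\<lambda>_. Atom)(0 := out1 ?j))(Suc (occ_bound c) := enc_data ws))"
            by (intro tot_Assign) simp
        qed
      qed
    qed
    then show ?thesis by (rule tot_time) (use p1'[OF j] in \<open>simp add: p_def\<close>)
  qed
  have C3: "tot [c3 lam] s (poly q (data_size (enc_nat lam) + instance_len P lam) - 2)
      (\<lambda>s'. s' 0 = enc_pt (forgery lam (dec_bits (s 0))))" if lam: "lam \<ge> lam0" for lam s
  proof -
    let ?N = "instance_len P lam"
    let ?w = "if length (dec_bits (s 0)) \<le> ?N then rev (dec_bits (s 0)) else []"
    have j: "(lam, ?w) \<in> ?I" using lam by simp
    have f: "forgery lam (rev ?w) = forgery lam (dec_bits (s 0))"
      using instance_len_pos[OF lam] by (auto simp: forgery_def)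
    have "tot [c3 lam] s (Suc ((?N * 9 + 12) + Suc (1 + T2 (lam, ?w)))) (\<lambda>s'. s' 0 = enc_pt (forgery lam (dec_bits (s 0))))"
      unfolding c3_def
    proof (rule tot_Seq2[OF tot_read_bits])
      fix s1 :: store assume s1: "s1 0 = enc_bits ?w"
      show "tot [Seq (Assign 0 (Mk (Quote (enc_nat lam)) (Var 0))) post] s1 (Suc (1 + T2 (lam, ?w)))
          (\<lambda>s'. s' 0 = enc_pt (forgery lam (dec_bits (s 0))))"
      proof (rule tot_Seq2[where R = "\<lambda>s2. s2 0 = in2 (lam, ?w)"])
        show "tot [Assign 0 (Mk (Quote (enc_nat lam)) (Var 0))] s1 1 (\<lambda>s2. s2 0 = in2 (lam, ?w))"
          by (rule tot_Assign) (simp add: in2_def s1)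
        show "tot [post] s2 (T2 (lam, ?w)) (\<lambda>s'. s' 0 = enc_pt (forgery lam (dec_bits (s 0))))" if "s2 0 = in2 (lam, ?w)" for s2
          by (rule tot_weaken[OF post[rule_format, of "(lam, ?w)" s2, OF j that] order_refl]) (use f in simp)
      qed
    qed
    then show ?thesis
    proof (rule tot_time)
      have "data_size (in2 (lam, ?w)) \<le> 2 + (data_size (enc_nat lam) + ?N) * 4"
        using data_size_bits[of ?w] by (auto simp: in2_def split: if_splits)
      then have "poly p2' (data_size (in2 (lam, ?w))) \<le> poly p2' (2 + (data_size (enc_nat lam) + ?N) * 4)"
        by (rule poly_nat_mono)
      with p2'[OF j] show "Suc ((?N * 9 + 12) + Suc (1 + T2 (lam, ?w))) \<le> poly q (data_size (enc_nat lam) + ?N) - 2"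
        by (simp add: q_def poly_pcompose algebra_simps del: if_split)
    qed
  qed
  show thesis
  proof (rule that)
    have rb: "com_size (read_bits n) \<le> 60 + data_size (enc_nat n)" for n
      by (simp add: read_bits_def read_body_def)
    show "com_size (B c lam ws p1 p2) \<le> 8 * com_size c + data_size (advice lam p1 p2) +
       data_size (enc_data ws) + data_size (enc_nat (instance_len P lam)) + data_size (enc_nat lam) +
       (com_size pre + com_size (resets k) + com_size post + 100)" for c lam ws p1 p2
      using rb[of "instance_len P lam"] com_size_hardcode[of "Suc (occ_bound c)" c]
      by (simp add: B_def c1_def c3_def)
    fix c lam ws p1 p2 vk b \<sigma> t M
    assume lam: "lam \<ge> lam0" and \<sigma>: "length \<sigma> = sig_len P lam"
      and M: "M = steps no_oracle t ([hardcode (Suc (occ_bound c)) c],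
         ((\<lambda>_. Atom)(0 := out1 (lam, p1, p2, vk, b, \<sigma>)))(Suc (occ_bound c) := enc_data ws))" and h: "halted M"
    have j: "(lam, p1, p2, vk, b, \<sigma>) \<in> dom1" using lam \<sigma> by (simp add: dom1_def)
    let ?p = "poly p (data_size (in1 (lam, p1, p2, vk, b, \<sigma>)))" and ?q = "poly q (data_size (enc_nat lam) + instance_len P lam)"
    note run = run_sandwich[OF C1[OF j] h[unfolded M] C3[OF lam], folded M]
    have time: "?p + (t + (?q - 2)) + 2 = ?p + ?q + t" by (simp add: q_def)
    have H: "halts_in no_oracle (B c lam ws p1 p2) (forger_input vk [b] \<sigma>) (?p + ?q + t)"
      and O: "map_pmf (\<lambda>cf. snd cf 0) (steps no_oracle (?p + ?q + t) (start (B c lam ws p1 p2) (forger_input vk [b] \<sigma>))) =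
        map_pmf (\<lambda>cf. enc_pt (forgery lam (dec_bits (snd cf 0)))) M"
      using run unfolding time halts_in_iff start_def B_def by blast+
    show "halts_in no_oracle (B c lam ws p1 p2) (forger_input vk [b] \<sigma>) (?p + ?q + t) \<and>
       outcome no_oracle (B c lam ws p1 p2) (forger_input vk [b] \<sigma>) =
         map_pmf (\<lambda>cf. enc_pt (forgery lam (dec_bits (snd cf 0)))) M"
      using H outcome_eq[OF H] O by simp
  qed
qed

end

subsection \<open>The reduction\<close>

lemma halts_in_mono: "halts_in orc c a t \<Longrightarrow> t \<le> t' \<Longrightarrow> halts_in orc c a t'"
  unfolding halts_in_iff using steps_stable[of orc t "start c a" t'] by metis

lemma prob_bind_mono:
  assumes "\<And>x. x \<in> set_pmf M \<Longrightarrow> measure_pmf.prob (f x) E \<le> measure_pmf.prob (g x) E'"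
  shows "measure_pmf.prob (bind_pmf M f) E \<le> measure_pmf.prob (bind_pmf M g) E'"
proof -
  have "emeasure (bind_pmf M f) E \<le> emeasure (bind_pmf M g) E'"
    unfolding emeasure_bind_pmf
    by (rule nn_integral_mono_AE) (use assms in \<open>auto simp: AE_measure_pmf_iff measure_pmf.emeasure_eq_measure\<close>)
  then show ?thesis by (simp add: measure_pmf.emeasure_eq_measure del: emeasure_bind_pmf)
qed

lemma prob_bind_le:
  assumes "\<And>x. x \<in> set_pmf M \<Longrightarrow> measure_pmf.prob (f x) E \<le> c"
  shows "measure_pmf.prob (bind_pmf M f) E \<le> c"
proof -
  have "emeasure (bind_pmf M f) E \<le> (\<integral>\<^sup>+ x. ennreal c \<partial>M)"
    unfolding emeasure_bind_pmf
    by (rule nn_integral_mono_AE) (use assms in \<open>auto simp: AE_measure_pmf_iff measure_pmf.emeasure_eq_measure intro: ennreal_leI\<close>)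
  then have "emeasure (bind_pmf M f) E \<le> ennreal c" by simp
  moreover obtain x where "x \<in> set_pmf M" using set_pmf_not_empty by fastforce
  then have "0 \<le> c" using assms measure_nonneg order_trans by blast
  ultimately show ?thesis by (simp add: measure_pmf.emeasure_eq_measure del: emeasure_bind_pmf)
qed

lemma negligible_add:
  assumes "negligible f" "negligible g"
  shows "negligible (\<lambda>lam. f lam + g lam)"
  unfolding negligible_def
proof (intro allI impI)
  fix p :: "real poly" assume "\<forall>\<^sub>F lam in sequentially. 0 < poly p (real lam)"
  then have "\<forall>\<^sub>F lam in sequentially. 0 < poly (smult 2 p) (real lam)" by simp
  then have "\<forall>\<^sub>F lam in sequentially. f lam < 1 / poly (smult 2 p) (real lam)"
    "\<forall>\<^sub>F lam in sequentially. g lam < 1 / poly (smult 2 p) (real lam)"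
    using assms unfolding negligible_def by blast+
  then show "\<forall>\<^sub>F lam in sequentially. f lam + g lam < 1 / poly p (real lam)"
    by eventually_elim (simp add: field_simps)
qed

context decoding_setting
begin

lemma finite_bitstrings: "finite (bitstrings m)" and bitstrings_nonempty: "bitstrings m \<noteq> {}"
  using finite_lists_length_eq[of "UNIV :: bool set" m] Ex_list_of_length[of m] by (auto simp: bitstrings_def)

lemma set_uniform_bits: "set_pmf (uniform_bits m) = bitstrings m"
  unfolding uniform_bits_def by (rule set_pmf_of_set[OF bitstrings_nonempty finite_bitstrings])

lemma length_concat_ecc: "lam \<ge> lam0 \<Longrightarrow> length (concat (ecc_of P lam v)) = ecc_len P lam (length v) * l lam"
proof -
  have "length (concat ws) = length ws * m" if "set ws \<subseteq> bitstrings m" for ws :: "bool list list" and m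
    using that by (induction ws) (auto simp: bitstrings_def)
  then show "lam \<ge> lam0 \<Longrightarrow> length (concat (ecc_of P lam v)) = ecc_len P lam (length v) * l lam"
    using ecc_closed[of lam v] by (simp add: length_ecc)
qed

lemma word_instance:
  assumes lam: "lam \<ge> lam0"
    and lens: "length \<sigma> = sig_len P lam" "length u = seed_len P lam" "length v = code_len P lam" "length vk = vk_len P lam"
  shows "word lam u v vk b \<sigma> c \<in> bitstrings (instance_len P lam)"
proof -
  have "length (concat ws) = length ws * m" if "set ws \<subseteq> bitstrings m" for ws :: "bool list list" and m
    using that by (induction ws) (auto simp: bitstrings_def)
  from this[OF LEnc(2)[OF lam lens(1)]] show ?thesis
    using LEnc(1)[OF lam lens(1)] length_concat_ecc[OF lam] lens
    by (simp add: word_def bitstrings_def instance_len_eq num_syms_def algebra_simps)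
qed

lemma challenge_word: "challenge lam (concat (ecc_of P lam u @ ecc_of P lam v)) (concat (ecc_of P lam [c])) vk b \<sigma> = word lam u v vk b \<sigma> c"
  by (simp add: challenge_def word_def)

lemma verifies:
  assumes "(vk, sk) \<in> set_pmf (gen_of P lam)"
  shows "verify_of P vk m (sign_of P sk m)"
proof -
  have "measure_pmf.prob (gen_of P lam) {(vk, sk). verify_of P vk m (sign_of P sk m)} = 1"
    using scheme unfolding signature_scheme_def by blast
  then have "AE p in gen_of P lam. p \<in> {(vk, sk). verify_of P vk m (sign_of P sk m)}"
    by (subst measure_pmf.AE_iff_emeasure_eq_1) (auto simp: measure_pmf.emeasure_eq_measure)
  then show ?thesis using assms by (auto simp: AE_measure_pmf_iff)
qed

lemma instance_dist_eq:
  "instance_dist P lam s = bind_pmf (uniform_bits (seed_len P lam)) (\<lambda>u. bind_pmf (uniform_bits (code_len P lam)) (\<lambda>v.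
     bind_pmf (pmf_of_set UNIV) (\<lambda>b. bind_pmf (gen_of P lam) (\<lambda>ks. return_pmf
       (word lam u v (fst ks) b (sign_of P (snd ks) [b]) (b \<noteq> inner_F2 v (restrict_bits s (samp_of P lam u))))))))"
  by (simp only: instance_dist_def word_def case_prod_unfold)

lemma pbd_instance_len: "pbd {lam. lam0 \<le> lam} enc_nat (instance_len P)"
  and pbd_lam: "pbd {lam. lam0 \<le> lam} enc_nat (\<lambda>lam. lam)"
  and pbd_vk_len: "pbd {lam. lam0 \<le> lam} enc_nat (vk_len P)"
  and pbd_sig_len: "pbd {lam. lam0 \<le> lam} enc_nat (sig_len P)"
proof -
  let ?I = "{lam. lam0 \<le> lam}"
  have id: "pt ?I enc_nat (\<lambda>lam. enc_nat lam)" by (rule pt_id)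
  have e: "env ?I enc_nat (\<lambda>lam. lam)" using id by (simp add: env_def)
  show "pbd ?I enc_nat (\<lambda>lam. lam)" by (rule pt_nat_pbd[OF id])
  have "pt ?I enc_nat (\<lambda>lam. enc_nat (instance_len P lam))"
    unfolding instance_len_eq by (rule pt_times[OF pt_l[OF e] pt_num_syms[OF e]])
  from pt_nat_pbd[OF this] show "pbd ?I enc_nat (instance_len P)" .
  have "pt ?I enc_nat (\<lambda>lam. enc_nat (vk_len P lam))" by (rule pt_param[OF _ e]) simp
  from pt_nat_pbd[OF this] show "pbd ?I enc_nat (vk_len P)" .
  have "pt ?I enc_nat (\<lambda>lam. enc_nat (sig_len P lam))" by (rule pt_param[OF _ e]) simp
  from pt_nat_pbd[OF this] show "pbd ?I enc_nat (sig_len P)" .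
qed

text \<open>Everything except the coins of the run is fixed. The planted signature verifies, so
  every perturbation within the budget still yields a verifying pair, and if the model answers
  incorrectly, the message of this pair differs from \<open>[b]\<close>. The event for the adversary
  is thus contained in the one for the forger.\<close>

lemma event_le_forgery:
  assumes lam: "lam \<ge> lam0" and lens: "length u = seed_len P lam" "length v = code_len P lam"
    and ks: "(vk, sk) \<in> set_pmf (gen_of P lam)"
    and x: "x = word lam u v vk b (sign_of P sk [b]) c"
    and O: "outcome no_oracle B i = map_pmf (\<lambda>cf. enc_pt (forgery lam (dec_bits (snd cf 0)))) M"
  shows "measure_pmf.prob (map_pmf (\<lambda>cf. (x, dec_bits (snd cf 0))) M)
      {(x, x'). x' \<in> bitstrings (instance_len P lam) \<and> model lam x' \<noteq> true_label P lam x \<and> symbol_distance P lam x x' \<le> budget P R lam}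
    \<le> measure_pmf.prob (bind_pmf (outcome no_oracle B i) (\<lambda>out. return_pmf (vk, dec_bits (data_fst out), dec_bits (data_snd out))))
      {(vk, m', \<sigma>'). m' \<noteq> [b] \<and> verify_of P vk m' \<sigma>'}"
proof -
  let ?\<sigma> = "sign_of P sk [b]"
  note p = params(3,4)[OF lam ks]
  have h: "true_label P lam x = b" unfolding x by (rule word_label[OF lam p(2) lens p(1)])
  have *: "m' \<noteq> [b] \<and> verify_of P vk m' \<sigma>'"
    if "forgery lam x' = (m', \<sigma>')" and x': "x' \<in> bitstrings (instance_len P lam)" "model lam x' \<noteq> b" "symbol_distance P lam x x' \<le> budget P R lam" for x' m' \<sigma>'
  proof -
    have "forgery lam x' = find_sig lam x'" using x'(1) by (simp add: forgery_def bitstrings_def)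
    moreover have "fst (find_sig lam x') \<noteq> [b]" using x'(2) lam by (auto simp: model_def)
    ultimately show ?thesis
      using find_sig_verifies[OF lam p(2) lens p(1) x'(1) x'(3)[unfolded x] verifies[OF ks]] that(1) by (metis fst_conv snd_conv)
  qed
  show ?thesis
    unfolding O bind_return_pmf' map_pmf_def[symmetric] measure_map_pmf pmf.map_comp
    by (rule measure_pmf.finite_measure_mono) (use * in \<open>auto simp: h enc_pair_def dec_enc_bits\<close>)
qed

context
  fixes A :: "nat \<Rightarrow> com" and pA :: "nat poly"
  assumes A_halts: "\<And>lam s x y. s \<in> bitstrings (secret_len P lam) \<Longrightarrow> x \<in> bitstrings (instance_len P lam) \<Longrightarrow>
      halts_in (sampling_oracle (instance_dist P lam s)) (A lam) (adversary_input x y Atom) (poly pA lam)"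
    and A_size: "\<And>lam. com_size (A lam) \<le> poly pA lam"
    and unforgeable: "weakly_unforgeable (gen_of P) (sign_of P) (verify_of P)"
begin

definition answers :: "nat \<Rightarrow> bool list \<Rightarrow> data list pmf" where
  "answers lam s = replicate_pmf (poly pA lam) (sampling_oracle (instance_dist P lam s))"

definition run :: "nat \<Rightarrow> data list \<Rightarrow> bool list \<Rightarrow> bool \<Rightarrow> (com list \<times> store) pmf" where
  "run lam ws x b = steps no_oracle (3 * poly pA lam) ([hardcode (Suc (occ_bound (A lam))) (A lam)],
     ((\<lambda>_. Atom)(0 := adversary_input x b Atom))(Suc (occ_bound (A lam)) := enc_data ws))"

lemma run:
  assumes "s \<in> bitstrings (secret_len P lam)" "x \<in> bitstrings (instance_len P lam)"
  shows "ws \<in> set_pmf (answers lam s) \<Longrightarrow> halted (run lam ws x b)"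
    and "outcome (sampling_oracle (instance_dist P lam s)) (A lam) (adversary_input x b Atom) =
      bind_pmf (answers lam s) (\<lambda>ws. map_pmf (\<lambda>cf. snd cf 0) (run lam ws x b))"
proof -
  note h = A_halts[OF assms, of b]
  have "halted (steps (sampling_oracle (instance_dist P lam s)) (poly pA lam) ([A lam], (\<lambda>_. Atom)(0 := adversary_input x b Atom)))"
    using h by (simp add: halts_in_iff start_def)
  note * = steps_hardcode[OF this, of "Suc (occ_bound (A lam))" "poly pA lam", simplified, folded answers_def]
  show "halted (run lam ws x b)" if "ws \<in> set_pmf (answers lam s)"
    using * that by (simp add: run_def)
  show "outcome (sampling_oracle (instance_dist P lam s)) (A lam) (adversary_input x b Atom) =
      bind_pmf (answers lam s) (\<lambda>ws. map_pmf (\<lambda>cf. snd cf 0) (run lam ws x b))"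
    unfolding outcome_eq[OF h] using * by (simp add: run_def start_def)
qed

lemma answers_mem:
  assumes lam: "lam \<ge> lam0" and ws: "ws \<in> set_pmf (answers lam s)"
  shows "set ws \<subseteq> enc_bits ` bitstrings (instance_len P lam)" "length ws = poly pA lam"
proof -
  have "set_pmf (instance_dist P lam s) \<subseteq> bitstrings (instance_len P lam)"
    using instance_dist_supported[OF valid_P valid_F ecc lam] by (simp add: the_problem_def)
  moreover have "set ws \<subseteq> enc_bits ` set_pmf (instance_dist P lam s)"
    using ws by (auto simp: answers_def set_replicate_pmf sampling_oracle_def)
  ultimately show "set ws \<subseteq> enc_bits ` bitstrings (instance_len P lam)" by blast
  show "length ws = poly pA lam" using ws by (simp add: answers_def set_replicate_pmf)
qed

text \<open>The choices to be fixed: answers of the oracle for any secret, the seed, the vector, and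
  the masked bit, which ranges freely although the secret, the seed, the vector and the label
  determine it. The set is finite for large \<open>lam\<close>, so a best choice exists.\<close>

definition advices :: "nat \<Rightarrow> (data list \<times> bool list \<times> bool list \<times> bool) set" where
  "advices lam = (\<Union>s\<in>bitstrings (secret_len P lam). set_pmf (answers lam s)) \<times>
     bitstrings (seed_len P lam) \<times> bitstrings (code_len P lam) \<times> UNIV"

lemma advices_nonempty: "advices lam \<noteq> {}"
  by (simp add: advices_def bitstrings_nonempty set_pmf_not_empty ex_in_conv)

lemma finite_advices: "lam \<ge> lam0 \<Longrightarrow> finite (advices lam)"
proof -
  assume lam: "lam \<ge> lam0"
  have "(\<Union>s\<in>bitstrings (secret_len P lam). set_pmf (answers lam s)) \<subseteq>
      {ws. set ws \<subseteq> enc_bits ` bitstrings (instance_len P lam) \<and> length ws = poly pA lam}"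
    using answers_mem[OF lam] by blast
  then have "finite (\<Union>s\<in>bitstrings (secret_len P lam). set_pmf (answers lam s))"
    by (rule finite_subset) (intro finite_lists_length_eq finite_imageI finite_bitstrings)
  then show "finite (advices lam)" by (simp add: advices_def finite_bitstrings)
qed

definition front_part :: "nat \<Rightarrow> data list \<times> bool list \<times> bool list \<times> bool \<Rightarrow> bool list" where
  "front_part lam = (\<lambda>(ws, u, v, c). concat (ecc_of P lam u @ ecc_of P lam v))"

definition back_part :: "nat \<Rightarrow> data list \<times> bool list \<times> bool list \<times> bool \<Rightarrow> bool list" where
  "back_part lam = (\<lambda>(ws, u, v, c). concat (ecc_of P lam [c]))"

lemma advice_sizes:
  assumes lam: "lam \<ge> lam0" and a: "a \<in> advices lam"
  shows "data_size (advice lam (front_part lam a) (back_part lam a)) \<le> 4 * lam + 8 * instance_len P lam + 10"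
    and "data_size (enc_data (fst a)) \<le> Suc (poly pA lam * Suc (Suc (instance_len P lam * 4)))"
proof -
  obtain ws u v c where a': "a = (ws, u, v, c)" "length u = seed_len P lam" "length v = code_len P lam"
    and ws: "set ws \<subseteq> enc_bits ` bitstrings (instance_len P lam)" "length ws = poly pA lam"
    using a answers_mem[OF lam] by (auto simp: advices_def bitstrings_def)
  have "length (front_part lam a) \<le> instance_len P lam" "length (back_part lam a) \<le> instance_len P lam"
    using length_concat_ecc[OF lam] a' by (simp_all add: front_part_def back_part_def instance_len_eq num_syms_def algebra_simps)
  then show "data_size (advice lam (front_part lam a) (back_part lam a)) \<le> 4 * lam + 8 * instance_len P lam + 10"
    using data_size_bits[of "front_part lam a"] data_size_bits[of "back_part lam a"] by (simp add: advice_def data_size_enc_nat)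
  have "data_size y \<le> Suc (instance_len P lam * 4)" if y: "y \<in> set ws" for y
  proof -
    obtain w where "y = enc_bits w" "length w = instance_len P lam" using ws(1) y by (auto simp: bitstrings_def)
    then show ?thesis using data_size_bits[of w] by simp
  qed
  then show "data_size (enc_data (fst a)) \<le> Suc (poly pA lam * Suc (Suc (instance_len P lam * 4)))"
    using data_size_list_le[of ws "\<lambda>d. d" "Suc (instance_len P lam * 4)" "poly pA lam"] ws(2) a' by simp
qed

text \<open>An average over the advice is at most its maximum, and the maximizing advice depends
  only on \<open>lam\<close> and on the bit. One bound thus covers all secrets, and it is admissible
  because forgers are nonuniform families.\<close>

theorem reduction:
  "\<exists>\<nu>. negligible \<nu> \<and> (\<forall>lam\<ge>lam0. \<forall>s\<in>bitstrings (secret_len P lam).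
     measure_pmf.prob (bind_pmf (instance_dist P lam s) (\<lambda>x.
       bind_pmf (outcome (sampling_oracle (instance_dist P lam s)) (A lam) (adversary_input x (true_label P lam x) Atom))
         (\<lambda>out. return_pmf (x, dec_bits out))))
     {(x, x'). x' \<in> bitstrings (instance_len P lam) \<and> model lam x' \<noteq> true_label P lam x \<and> symbol_distance P lam x x' \<le> budget P R lam}
     \<le> \<nu> lam)"
proof (rule forge_program)
  fix B :: "com \<Rightarrow> nat \<Rightarrow> data list \<Rightarrow> bool list \<Rightarrow> bool list \<Rightarrow> com" and p q :: "nat poly" and K :: nat
  assume size: "\<And>c lam ws p1 p2. com_size (B c lam ws p1 p2) \<le> 8 * com_size c + data_size (advice lam p1 p2) +
       data_size (enc_data ws) + data_size (enc_nat (instance_len P lam)) + data_size (enc_nat lam) + K"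
    and B: "\<And>c lam ws p1 p2 vk b \<sigma> t M. lam \<ge> lam0 \<Longrightarrow> length \<sigma> = sig_len P lam \<Longrightarrow>
       M = steps no_oracle t ([hardcode (Suc (occ_bound c)) c],
         ((\<lambda>_. Atom)(0 := out1 (lam, p1, p2, vk, b, \<sigma>)))(Suc (occ_bound c) := enc_data ws)) \<Longrightarrow>
       halted M \<Longrightarrow>
       halts_in no_oracle (B c lam ws p1 p2) (forger_input vk [b] \<sigma>)
         (poly p (data_size (in1 (lam, p1, p2, vk, b, \<sigma>))) + poly q (data_size (enc_nat lam) + instance_len P lam) + t) \<and>
       outcome no_oracle (B c lam ws p1 p2) (forger_input vk [b] \<sigma>) =
         map_pmf (\<lambda>cf. enc_pt (forgery lam (dec_bits (snd cf 0)))) M"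
  define prog where "prog lam a = B (A lam) lam (fst a) (front_part lam a) (back_part lam a)" for lam a
  define success where "success b lam c = measure_pmf.prob
      (do {
         (vk, sk) \<leftarrow> gen_of P lam;
         out \<leftarrow> outcome no_oracle c (forger_input vk [b] (sign_of P sk [b]));
         return_pmf (vk, dec_bits (data_fst out), dec_bits (data_snd out))
       }) {(vk, m', \<sigma>'). m' \<noteq> [b] \<and> verify_of P vk m' \<sigma>'}" for b lam c
  define best where "best b lam = (SOME a. a \<in> advices lam \<and> (\<forall>a'\<in>advices lam. success b lam (prog lam a') \<le> success b lam (prog lam a)))" for b lam
  have best: "best b lam \<in> advices lam \<and> (\<forall>a'\<in>advices lam. success b lam (prog lam a') \<le> success b lam (prog lam (best b lam)))"
    if lam: "lam \<ge> lam0" for b lam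
    unfolding best_def
  proof (rule someI_ex)
    let ?S = "(\<lambda>a. success b lam (prog lam a)) ` advices lam"
    have S: "finite ?S" "?S \<noteq> {}" using finite_advices[OF lam] advices_nonempty by auto
    obtain a where a: "a \<in> advices lam" "Max ?S = success b lam (prog lam a)" using Max_in[OF S] by blast
    have "success b lam (prog lam a') \<le> success b lam (prog lam a)" if "a' \<in> advices lam" for a'
      unfolding a(2)[symmetric] by (rule Max_ge[OF S(1)]) (use that in blast)
    then show "\<exists>a. a \<in> advices lam \<and> (\<forall>a'\<in>advices lam. success b lam (prog lam a') \<le> success b lam (prog lam a))"
      using a(1) by blast
  qed
  \<comment> \<open>Below \<open>lam0\<close> the family still needs members of polynomial size; a
    program that stops at once takes their place.\<close>
  define forger where "forger b lam = (if lam \<ge> lam0 then prog lam (best b lam) else Assign 0 (Quote Atom))" for b lam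
  define time where "time lam = poly p (4 * lam + 8 * instance_len P lam + 4 * vk_len P lam + 4 * sig_len P lam + 30) +
      poly q (Suc (4 * lam) + instance_len P lam) + 3 * poly pA lam" for lam
  have prog: "halts_in no_oracle (prog lam a) (forger_input vk [b] (sign_of P sk [b])) (time lam) \<and>
      outcome no_oracle (prog lam a) (forger_input vk [b] (sign_of P sk [b])) =
        map_pmf (\<lambda>cf. enc_pt (forgery lam (dec_bits (snd cf 0)))) (run lam ws (word lam u v vk b (sign_of P sk [b]) c) b)"
    if lam: "lam \<ge> lam0" and ks: "(vk, sk) \<in> set_pmf (gen_of P lam)" and a: "a \<in> advices lam" and a_eq: "a = (ws, u, v, c)"
    for lam vk sk a ws u v c b
  proof -
    let ?\<sigma> = "sign_of P sk [b]"
    let ?x = "word lam u v vk b ?\<sigma> c"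
    note len = params(3,4)[OF lam ks]
    obtain s where s: "s \<in> bitstrings (secret_len P lam)" "ws \<in> set_pmf (answers lam s)"
      and uv: "length u = seed_len P lam" "length v = code_len P lam"
      using a a_eq by (auto simp: advices_def bitstrings_def)
    have h: "halted (run lam ws ?x b)" by (rule run(1)[OF s(1) word_instance[OF lam len(2) uv len(1)] s(2)])
    have out: "out1 (lam, front_part lam a, back_part lam a, vk, b, ?\<sigma>) = adversary_input ?x b Atom"
      unfolding challenge_word[symmetric] by (simp add: out1_def front_part_def back_part_def a_eq)
    let ?i = "data_size (in1 (lam, front_part lam a, back_part lam a, vk, b, ?\<sigma>))"
    have H: "halts_in no_oracle (prog lam a) (forger_input vk [b] ?\<sigma>)
         (poly p ?i + poly q (data_size (enc_nat lam) + instance_len P lam) + 3 * poly pA lam) \<and>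
       outcome no_oracle (prog lam a) (forger_input vk [b] ?\<sigma>) =
         map_pmf (\<lambda>cf. enc_pt (forgery lam (dec_bits (snd cf 0)))) (run lam ws ?x b)"
      unfolding prog_def by (rule B[OF lam len(2) _ h]) (simp add: run_def out[unfolded a_eq] a_eq)
    have "data_size (enc_bits [b]) \<le> 5" using data_size_bits[of "[b]"] by simp
    then have "?i \<le> 4 * lam + 8 * instance_len P lam + 4 * vk_len P lam + 4 * sig_len P lam + 30"
      using advice_sizes(1)[OF lam a] data_size_bits[of vk] data_size_bits[of ?\<sigma>] len(1) len(2)[of b]
      by (simp add: in1_def forger_input_def)
    then have "poly p ?i \<le> poly p (4 * lam + 8 * instance_len P lam + 4 * vk_len P lam + 4 * sig_len P lam + 30)"
      by (rule poly_nat_mono)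
    then have "poly p ?i + poly q (data_size (enc_nat lam) + instance_len P lam) + 3 * poly pA lam \<le> time lam"
      by (simp add: time_def data_size_enc_nat)
    then show ?thesis using H halts_in_mono by blast
  qed
  \<comment> \<open>Dominates both the size of the program and its running time, so that one
    polynomial can serve in \<open>poly_time_family\<close>.\<close>
  define total where "total lam = 8 * poly pA lam + (4 * lam + 8 * instance_len P lam + 10) +
      Suc (poly pA lam * Suc (Suc (instance_len P lam * 4))) + Suc (4 * instance_len P lam) + Suc (4 * lam) + K + time lam" for lam
  have "pbd {lam. lam0 \<le> lam} enc_nat total"
    unfolding total_def time_def
    by (intro pbd_add pbd_Suc pbd_mult pbd_const pbd_poly pbd_instance_len pbd_lam pbd_vk_len pbd_sig_len)
  then obtain r where r: "\<And>lam. lam \<ge> lam0 \<Longrightarrow> total lam \<le> poly r (Suc (4 * lam))"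
    unfolding pbd_def by (auto simp: data_size_enc_nat)
  have family: "poly_time_family (\<lambda>lam. {(no_oracle, forger_input vk [b] (sign_of P sk [b])) | vk sk. (vk, sk) \<in> set_pmf (gen_of P lam)}) (forger b)" for b
    unfolding poly_time_family_def
  \<comment> \<open>The unary input has size 4 \<open>lam\<close> + 1, which explains the
    substitution; the 3 is the size of the program used below \<open>lam0\<close>.\<close>
  proof (intro exI[of _ "pcompose r [:1, 4:] + [:3:]"] allI conjI ballI)
    fix lam
    have pr: "poly (pcompose r [:1, 4:] + [:3:]) lam = poly r (Suc (4 * lam)) + 3"
      by (simp add: poly_pcompose mult.commute)
    show "com_size (forger b lam) \<le> poly (pcompose r [:1, 4:] + [:3:]) lam"
    proof (cases "lam \<ge> lam0")
      case True
      have "com_size (forger b lam) \<le> total lam"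
        using size[of "A lam" lam "fst (best b lam)" "front_part lam (best b lam)" "back_part lam (best b lam)"]
          advice_sizes[OF True best[OF True, of b, THEN conjunct1]] A_size[of lam] True
        by (simp add: forger_def prog_def total_def data_size_enc_nat)
      then show ?thesis using r[OF True] pr by simp
    qed (use pr in \<open>simp add: forger_def\<close>)
    fix oa assume "oa \<in> {(no_oracle, forger_input vk [b] (sign_of P sk [b])) | vk sk. (vk, sk) \<in> set_pmf (gen_of P lam)}"
    then obtain vk sk where ks: "(vk, sk) \<in> set_pmf (gen_of P lam)" "oa = (no_oracle, forger_input vk [b] (sign_of P sk [b]))" by blast
    have "halts_in no_oracle (forger b lam) (forger_input vk [b] (sign_of P sk [b])) (poly r (Suc (4 * lam)) + 3)"
    proof (cases "lam \<ge> lam0")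
      case True
      obtain ws u v c where "best b lam = (ws, u, v, c)" by (rule prod_cases4)
      with prog[OF True ks(1) best[OF True, THEN conjunct1]] have "halts_in no_oracle (prog lam (best b lam)) (forger_input vk [b] (sign_of P sk [b])) (time lam)"
        by blast
      moreover have "time lam \<le> poly r (Suc (4 * lam)) + 3" using r[OF True] by (simp add: total_def)
      ultimately show ?thesis using True halts_in_mono by (simp add: forger_def)
    next
      case False
      have "halts_in no_oracle (Assign 0 (Quote Atom)) (forger_input vk [b] (sign_of P sk [b])) (Suc 0)"
        by (simp add: halts_in_iff start_def bind_return_pmf)
      then show ?thesis using False halts_in_mono by (simp add: forger_def)
    qed
    then show "case oa of (orc, a) \<Rightarrow> halts_in orc (forger b lam) a (poly (pcompose r [:1, 4:] + [:3:]) lam)"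
      unfolding ks(2) pr by simp
  qed
  have negl: "negligible (\<lambda>lam. success b lam (forger b lam))" for b
    using unforgeable family[of b] unfolding weakly_unforgeable_def success_def by blast
  have "measure_pmf.prob (bind_pmf (instance_dist P lam s) (\<lambda>x.
       bind_pmf (outcome (sampling_oracle (instance_dist P lam s)) (A lam) (adversary_input x (true_label P lam x) Atom))
         (\<lambda>out. return_pmf (x, dec_bits out))))
     {(x, x'). x' \<in> bitstrings (instance_len P lam) \<and> model lam x' \<noteq> true_label P lam x \<and> symbol_distance P lam x x' \<le> budget P R lam}
     \<le> success False lam (forger False lam) + success True lam (forger True lam)" (is "measure_pmf.prob _ ?E \<le> _")
    if lam: "lam \<ge> lam0" and s: "s \<in> bitstrings (secret_len P lam)" for lam s
    unfolding instance_dist_eq[of lam s] bind_assoc_pmf bind_return_pmf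
    unfolding instance_dist_eq[of lam s, symmetric]
  \<comment> \<open>The seed, the vector and the bit are fixed one after the other; the key, the
    answers of the oracle and the coins of the run remain random.\<close>
  proof (rule prob_bind_le, rule prob_bind_le, rule prob_bind_le)
    fix u v b assume "u \<in> set_pmf (uniform_bits (seed_len P lam))" "v \<in> set_pmf (uniform_bits (code_len P lam))"
    then have uv: "length u = seed_len P lam" "length v = code_len P lam" by (simp_all add: set_uniform_bits bitstrings_def)
    define c where "c \<longleftrightarrow> (b \<noteq> inner_F2 v (restrict_bits s (samp_of P lam u)))"
    define x where "x ks = word lam u v (fst ks) b (sign_of P (snd ks) [b]) c" for ks
    have x: "x ks \<in> bitstrings (instance_len P lam)" "true_label P lam (x ks) = b" if "ks \<in> set_pmf (gen_of P lam)" for ks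
    proof -
      note len = params(3,4)[OF lam, of "fst ks" "snd ks", unfolded prod.collapse, OF that]
      show "x ks \<in> bitstrings (instance_len P lam)" unfolding x_def by (rule word_instance[OF lam len(2) uv len(1)])
      show "true_label P lam (x ks) = b" unfolding x_def by (rule word_label[OF lam len(2) uv len(1)])
    qed
    have "bind_pmf (gen_of P lam) (\<lambda>ks. bind_pmf (outcome (sampling_oracle (instance_dist P lam s)) (A lam)
          (adversary_input (x ks) (true_label P lam (x ks)) Atom)) (\<lambda>out. return_pmf (x ks, dec_bits out))) =
        bind_pmf (gen_of P lam) (\<lambda>ks. bind_pmf (answers lam s) (\<lambda>ws. map_pmf (\<lambda>cf. (x ks, dec_bits (snd cf 0))) (run lam ws (x ks) b)))"
      by (rule bind_pmf_cong[OF refl]) (simp add: x run(2)[OF s x(1)] bind_assoc_pmf map_pmf_def bind_return_pmf)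
    \<comment> \<open>The answers are fresh samples with keys of their own, hence independent of the
      key in the challenge, and may be drawn first.\<close>
    also have "\<dots> = bind_pmf (answers lam s) (\<lambda>ws. bind_pmf (gen_of P lam) (\<lambda>ks. map_pmf (\<lambda>cf. (x ks, dec_bits (snd cf 0))) (run lam ws (x ks) b)))"
      by (rule bind_commute_pmf)
    finally have eq: "bind_pmf (gen_of P lam) (\<lambda>ks. bind_pmf (outcome (sampling_oracle (instance_dist P lam s)) (A lam)
          (adversary_input (x ks) (true_label P lam (x ks)) Atom)) (\<lambda>out. return_pmf (x ks, dec_bits out))) = \<dots>" .
    have "measure_pmf.prob \<dots> ?E \<le> success b lam (forger b lam)"
    proof (rule prob_bind_le)
      fix ws assume ws: "ws \<in> set_pmf (answers lam s)"
      let ?a = "(ws, u, v, c)"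
      have a: "?a \<in> advices lam" using ws s uv by (auto simp: advices_def bitstrings_def)
      have "measure_pmf.prob (bind_pmf (gen_of P lam) (\<lambda>ks. map_pmf (\<lambda>cf. (x ks, dec_bits (snd cf 0))) (run lam ws (x ks) b))) ?E
          \<le> success b lam (prog lam ?a)"
        unfolding success_def
      proof (rule prob_bind_mono)
        fix ks assume ks: "ks \<in> set_pmf (gen_of P lam)"
        obtain vk sk where e: "ks = (vk, sk)" by (cases ks)
        have xe: "x (vk, sk) = word lam u v vk b (sign_of P sk [b]) c" by (simp add: x_def)
        note pr = prog[OF lam ks[unfolded e] a refl, of b, THEN conjunct2]
        show "measure_pmf.prob (map_pmf (\<lambda>cf. (x ks, dec_bits (snd cf 0))) (run lam ws (x ks) b)) ?E
          \<le> measure_pmf.prob (case ks of (vk, sk) \<Rightarrow> bind_pmf (outcome no_oracle (prog lam ?a) (forger_input vk [b] (sign_of P sk [b])))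
               (\<lambda>out. return_pmf (vk, dec_bits (data_fst out), dec_bits (data_snd out))))
            {(vk, m', \<sigma>'). m' \<noteq> [b] \<and> verify_of P vk m' \<sigma>'}"
          unfolding e prod.case by (rule event_le_forgery[OF lam uv ks[unfolded e] xe pr[folded xe]])
      qed
      also have "\<dots> \<le> success b lam (forger b lam)" using best[OF lam] a lam by (simp add: forger_def)
      finally show "measure_pmf.prob (bind_pmf (gen_of P lam) (\<lambda>ks. map_pmf (\<lambda>cf. (x ks, dec_bits (snd cf 0))) (run lam ws (x ks) b))) ?E
          \<le> success b lam (forger b lam)" .
    qed
    also have "\<dots> \<le> success False lam (forger False lam) + success True lam (forger True lam)"
      by (cases b) (simp_all add: success_def)
    finally show "measure_pmf.prob (bind_pmf (gen_of P lam) (\<lambda>ks.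
        bind_pmf (outcome (sampling_oracle (instance_dist P lam s)) (A lam) (adversary_input (word lam u v (fst ks) b (sign_of P (snd ks) [b])
            (b \<noteq> inner_F2 v (restrict_bits s (samp_of P lam u))))
          (true_label P lam (word lam u v (fst ks) b (sign_of P (snd ks) [b]) (b \<noteq> inner_F2 v (restrict_bits s (samp_of P lam u))))) Atom))
         (\<lambda>out. return_pmf (word lam u v (fst ks) b (sign_of P (snd ks) [b]) (b \<noteq> inner_F2 v (restrict_bits s (samp_of P lam u))), dec_bits out)))) ?E
      \<le> success False lam (forger False lam) + success True lam (forger True lam)"
      unfolding eq[symmetric] unfolding x_def c_def .
  qed
  with negligible_add[OF negl negl] show ?thesis by blast
qed

end

subsection \<open>The learner\<close>

text \<open>All knowledge sits in the evaluation of the model. Training has a single possible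
  output, which is what zero bits of parameters mean.\<close>

definition robust_learner :: learner where
  "robust_learner = \<lparr>train = Assign 0 (Quote Atom), model_fun = (\<lambda>lam \<theta> x. model lam x)\<rparr>"

lemma train: "halts_in no_oracle (train robust_learner) a 1"
  and train_out: "train_out robust_learner S lam = return_pmf Atom"
proof -
  have "tot [train robust_learner] ((\<lambda>_. Atom)(0 := a)) 1 (\<lambda>s'. s' 0 = Atom)" for a
    unfolding robust_learner_def learner.simps by (rule tot_Assign) simp
  from outcome_of_tot[OF this]
  show "halts_in no_oracle (train robust_learner) a 1" "train_out robust_learner S lam = return_pmf Atom"
    by (simp_all add: train_out_def)
qed

lemma possible_outputs: "possible_outputs F robust_learner lam = {Atom}"
proof -
  have "[] \<in> labeled_sets F lam" by (simp add: labeled_sets_def)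
  then show ?thesis by (auto simp: possible_outputs_def train_out)
qed

lemma robust_learner_efficient: "efficient_learner (the_problem P) robust_learner"
  unfolding efficient_learner_def
proof
  show "\<exists>p :: nat poly. \<forall>lam. \<forall>S\<in>labeled_sets (the_problem P) lam.
      halts_in no_oracle (train robust_learner) (train_input S lam) (poly p (length S * lam))"
    by (rule exI[of _ "[:1:]"]) (simp add: train[simplified])
  let ?I = "{(lam, \<theta>, x). \<theta> \<in> possible_outputs (the_problem P) robust_learner lam \<and> x \<in> instances (the_problem P) lam}"
  let ?x = "\<lambda>(lam, \<theta>, x). Pair (enc_nat lam) (Pair \<theta> (enc_bits x))"
  have i: "?x j = Pair (enc_nat (fst j)) (Pair (fst (snd j)) (enc_bits (snd (snd j))))" for j by (simp add: split_beta)
  have lam: "pt ?I ?x (\<lambda>j. enc_nat (fst j))" using pt_fst[OF pt_id[of ?I ?x]] by (simp add: i)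
  have w: "pt ?I ?x (\<lambda>j. enc_bits (snd (snd j)))" using pt_snd[OF pt_snd[OF pt_id[of ?I ?x]]] by (simp add: i)
  have "pt ?I ?x (\<lambda>j. enc_bool (model (fst j) (snd (snd j))))"
    by (rule pt_model[OF lam w]) (auto simp: the_problem_def)
  then have "pt ?I ?x (\<lambda>(lam, \<theta>, x). enc_bool (model_fun robust_learner lam \<theta> x))"
    by (rule pt_cong) (auto simp: robust_learner_def)
  then show "poly_time_computable ?I ?x (\<lambda>(lam, \<theta>, x). enc_bool (model_fun robust_learner lam \<theta> x))"
    by (rule pt_imp_poly_time_computable)
qed

lemma negligible_mono_eventually:
  assumes "negligible f" "\<forall>\<^sub>F lam in sequentially. g lam \<le> f lam"
  shows "negligible g"
  unfolding negligible_def
proof (intro allI impI)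
  fix p :: "real poly" assume "\<forall>\<^sub>F lam in sequentially. 0 < poly p (real lam)"
  then have "\<forall>\<^sub>F lam in sequentially. f lam < 1 / poly p (real lam)" using assms(1) unfolding negligible_def by blast
  with assms(2) show "\<forall>\<^sub>F lam in sequentially. g lam < 1 / poly p (real lam)" by eventually_elim simp
qed

lemma robust_learner_robust:
  assumes "weakly_unforgeable (gen_of P) (sign_of P) (verify_of P)"
  shows "negl_robustly_learns_without_samples (the_problem P) robust_learner (symbol_distance P) (budget P R)"
  unfolding negl_robustly_learns_without_samples_def
proof (intro allI impI)
  fix A assume "adversary_family (the_problem P) robust_learner A"
  then obtain p :: "nat poly" where size: "\<And>lam. com_size (A lam) \<le> poly p lam"
    and halts: "\<And>lam s x y. s \<in> bitstrings (secret_len P lam) \<Longrightarrow> x \<in> bitstrings (instance_len P lam) \<Longrightarrow>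
      halts_in (sampling_oracle (instance_dist P lam s)) (A lam) (adversary_input x y Atom) (poly p lam)"
    unfolding adversary_family_def poly_time_family_def possible_outputs
    by (fastforce simp: the_problem_def)
  obtain \<nu> where \<nu>: "negligible \<nu>" and le: "\<And>lam s. lam \<ge> lam0 \<Longrightarrow> s \<in> bitstrings (secret_len P lam) \<Longrightarrow>
     measure_pmf.prob (bind_pmf (instance_dist P lam s) (\<lambda>x.
       bind_pmf (outcome (sampling_oracle (instance_dist P lam s)) (A lam) (adversary_input x (true_label P lam x) Atom))
         (\<lambda>out. return_pmf (x, dec_bits out))))
     {(x, x'). x' \<in> bitstrings (instance_len P lam) \<and> model lam x' \<noteq> true_label P lam x \<and> symbol_distance P lam x x' \<le> budget P R lam}
     \<le> \<nu> lam"
    using reduction[of A p, OF halts size assms] by blast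
  \<comment> \<open>Finitely many values do not affect negligibility, and 1 bounds every
    risk.\<close>
  let ?\<nu> = "\<lambda>lam. if lam \<ge> lam0 then \<nu> lam else 1"
  have "negligible ?\<nu>"
    by (rule negligible_mono_eventually[OF \<nu>]) (use eventually_ge_at_top[of lam0] in eventually_elim, simp)
  moreover have "robust_against (the_problem P) robust_learner (symbol_distance P) (budget P R) A (\<lambda>lam N. ?\<nu> lam)"
    unfolding robust_against_def
  proof (intro allI ballI)
    fix lam D h and N :: nat
    assume "D \<in> dists (the_problem P) lam" "h \<in> concepts (the_problem P) lam"
    then obtain s where s: "s \<in> bitstrings (secret_len P lam)" and D: "D = instance_dist P lam s" and h: "h = true_label P lam"
      by (auto simp: the_problem_def)
    have "risk (the_problem P) robust_learner (symbol_distance P) (budget P R) A lam h D Atom \<le> ?\<nu> lam"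
    proof (cases "lam \<ge> lam0")
      case True
      then show ?thesis using le[OF True s]
        by (simp add: risk_def D h robust_learner_def the_problem_def)
    qed (simp add: risk_def)
    then show "measure_pmf.expectation (bind_pmf (replicate_pmf N D) (\<lambda>xs. train_out robust_learner (labeled h xs) lam))
        (risk (the_problem P) robust_learner (symbol_distance P) (budget P R) A lam h D) \<le> ?\<nu> lam"
      by (simp add: train_out)
  qed
  ultimately show "\<exists>\<nu>. negligible \<nu> \<and> robust_against (the_problem P) robust_learner (symbol_distance P) (budget P R) A (\<lambda>lam N. \<nu> lam)"
    by blast
qed

end

theorem theorem28:
  fixes P :: setting and R \<kappa>2 :: real and \<kappa>1 :: "nat \<Rightarrow> real" and lam0 :: nat
  assumes "0 < R" and "R < 1/4"
    and "valid_parameters P R lam0"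
    and "valid_field P lam0"
    and "signature_scheme (gen_of P) (sign_of P) (verify_of P)"
    and "weakly_unforgeable (gen_of P) (sign_of P) (verify_of P)"
    and "\<And>lam. 0 < \<kappa>1 lam \<and> \<kappa>1 lam < 1" and "0 < \<kappa>2" and "\<kappa>2 < 1"
    and "sampler_family lam0 (secret_len P) (code_len P) (seed_len P) \<kappa>1 \<kappa>2 (samp_of P)"
    and "error_correcting lam0 (sym_bits P) (budget P R) (ecc_of P)"
  shows "\<exists>L. efficient_learner (the_problem P) L \<and>
             outputs_models_with_params (the_problem P) L (\<lambda>_. 0) \<and>
             negl_robustly_learns_without_samples (the_problem P) L
               (symbol_distance P) (budget P R)"
proof -
  \<comment> \<open>The assumption on the code only asserts that a decoder exists; one is fixed here
    because the model has to run it.\<close>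
  obtain dec err where "\<forall>lam\<ge>lam0. real (err lam) > budget P R lam"
    "\<forall>lam\<ge>lam0. \<forall>v y. length y = length (ecc_of P lam v) \<and> set y \<subseteq> bitstrings (sym_bits P lam) \<and>
           hamming (ecc_of P lam v) y \<le> err lam \<longrightarrow> dec lam (length v) y = v"
    "poly_time_computable
          {(lam, m, y). lam \<ge> lam0 \<and> length y = length (ecc_of P lam (replicate m False)) \<and>
             set y \<subseteq> bitstrings (sym_bits P lam)}
          (\<lambda>(lam, m, y). Pair (enc_nat lam) (Pair (enc_nat m) (enc_list enc_bits y)))
          (\<lambda>(lam, m, y). enc_bits (dec lam m y))"
    using assms(11) unfolding error_correcting_def by blast
  then interpret decoding_setting P R lam0 dec err
    using assms(1-5,11) by unfold_locales auto
  show ?thesis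
    using robust_learner_efficient robust_learner_robust[OF assms(6)]
    by (intro exI[of _ robust_learner]) (simp add: outputs_models_with_params_def possible_outputs)
qed

end
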